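(* Let $(C,Q)\to(B,N)$ be a homomorphism of prelog rings such that $C\to B$ and $Q\to N$ are surjective, and let $D^1_{(B,N)|(C,Q)}$ be the simplicial module defined in the context. Then there is a first quadrant convergent spectral sequence $$E^2_{p,q}\;\Rightarrow\;H_{p+q}\big(D^1_{(B,N)|(C,Q)}\big)$$ where $E^2_{p,q}=0$ for $q=0$ and $E^2_{p,1}=H_{p+1}\big(\mathbb{L}_{(B,N)|(C,Q)}\big)$, with $\mathbb{L}_{(B,N)|(C,Q)}$ the logarithmic cotangent complex of Gabber.
   Context: All rings and monoids are commutative. A prelog ring $(C,Q,\alpha)$, written $(C,Q)$, is a ring $C$, a monoid $Q$ and a monoid homomorphism $\alpha\colon Q\to C$ to the multiplicative monoid of $C$. A homomorphism of prelog rings is a pair of a ring homomorphism and a monoid homomorphism compatible with the structure maps. $Q^{\mathrm{gp}}$ is the group completion and $\mathbb{Z}[Q]$ the monoid ring. Homology of a simplicial module means homology of its associated chain complex. For $Q\to P$, $P^{\mathrm{gp}}/Q^{\mathrm{gp}}$ denotes the quotient by the image of $Q^{\mathrm{gp}}$. **Resolution.** Let $(C,Q)\to(R,P)\to(B,N)$ be a factorization in simplicial prelog rings as a free cofibration followed by a trivial fibration, with $R_0=C$ and $P_0=Q$ in simplicial degree $0$. Free cofibration: in each simplicial degree $n$, $P_n=Q\oplus\mathbb{N}^{Y_n}$ and $R_n=\mathbb{Z}[P_n]\otimes_{\mathbb{Z}[Q]}C[X_n]=C[X_n\cup Y_n]$ for sets $X_n,Y_n$ of generators stable under degeneracies. Trivial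 fibration: $R\to B$ and $P\to N$ are trivial Kan fibrations of underlying simplicial sets. **The simplicial module $D^1$.** Put $I=\ker(\pi\colon R\otimes_CB\to B)$, $J=\ker(\mathbb{Z}[P]\otimes_{\mathbb{Z}[Q]}\mathbb{Z}[N]\to\mathbb{Z}[N])$, $T=\ker((P\oplus_QN)^{\mathrm{gp}}\to N^{\mathrm{gp}})$, and $$U=(R\otimes_CB)\otimes_{\mathbb{Z}[P]\otimes_{\mathbb{Z}[Q]}\mathbb{Z}[N]}J .$$ Note $\mathbb{Z}[P]\otimes_{\mathbb{Z}[Q]}\mathbb{Z}[N]=\mathbb{Z}[P\oplus_QN]$; let $h\colon P\oplus_QN\to N$ be the canonical map. $D^1_{(B,N)|(C,Q)}$ is the simplicial $R\otimes_CB$-module defined as the pushout of $$I\xleftarrow{\ \alpha\ }U\xrightarrow{\ \beta\ }B\otimes_{\mathbb{Z}}T,$$ where $\alpha$ is the obvious map (induced by $\mathbb{Z}[P]\otimes_{\mathbb{Z}[Q]}\mathbb{Z}[N]\to R\otimes_CB$ and multiplication), $R\otimes_CB$ acts on $B\otimes_{\mathbb{Z}}T$ through $\pi$, and $\beta$ is induced by $\pi$ and the map $J\to B\otimes_{\mathbb{Z}}T$ sending $p-p'$ (with $p,p'\in P\oplus_QN$, $h(p)=h(p')$) to $h(p')\otimes p(p')^{-1}$, $h(p')$ being viewed in $B$ via $N\to B$. **Gabber's logarithmic cotangent complex.** With $(R,P)$ a free cofibration–trivial fibration resolution, $\mathbb{L}_{(B,N)|(C,Q)}$ is the simplicial $B$-module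 (equivalently its chain complex) given by the degreewise pushout of $$B\otimes_R\Omega_{R|C}\longleftarrow B\otimes_{\mathbb{Z}[P]}\Omega_{\mathbb{Z}[P]|\mathbb{Z}[Q]}\longrightarrow B\otimes_{\mathbb{Z}}P^{\mathrm{gp}}/Q^{\mathrm{gp}},$$ where the left map is canonical and the right map sends $b\otimes dp$ to $b\,\bar h(p)\otimes\bar p$, with $\bar h(p)$ the image of $p$ under $P\to N\to B$. Its homology is independent of the resolution. *)

theory Defs
  imports
    "HOL-Algebra.IntRing"
    "HOL-Algebra.Module"
    "HOL-Algebra.Free_Abelian_Groups"
    "HOL-Algebra.Indexed_Polynomials"
begin

section \<open>Modules\<close>

text \<open>
  The record \<^typ>\<open>('a, 'm) module\<close> extends the ring record; its fields \<open>mult\<close> and \<open>one\<close>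
  play no role for modules and are filled arbitrarily.  The scalar ring is not part of the record.
\<close>

definition mk_module :: "('m, 'z) monoid_scheme \<Rightarrow> ('a \<Rightarrow> 'm \<Rightarrow> 'm) \<Rightarrow> ('a, 'm) module" where
  "mk_module G act =
    \<lparr>carrier = carrier G, monoid.mult = mult G, monoid.one = \<one>\<^bsub>G\<^esub>, ring.zero = \<one>\<^bsub>G\<^esub>, ring.add = mult G, smult = act\<rparr>"

definition int_module :: "('m, 'z) monoid_scheme \<Rightarrow> (int, 'm) module" where
  "int_module G = mk_module G (\<lambda>k x. x [^]\<^bsub>G\<^esub> k)"

definition restrict_scalars :: "('a \<Rightarrow> 'b) \<Rightarrow> ('b, 'm) module \<Rightarrow> ('a, 'm) module" where
  "restrict_scalars f M = mk_module (add_monoid M) (\<lambda>a x. f a \<odot>\<^bsub>M\<^esub> x)"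

definition ring_as_module :: "('r, 'z) ring_scheme \<Rightarrow> ('r, 'r) module" where
  "ring_as_module R = mk_module (add_monoid R) (\<lambda>r x. r \<otimes>\<^bsub>R\<^esub> x)"

definition lin_maps ::
  "('a, 'z) ring_scheme \<Rightarrow> ('a, 'm) module \<Rightarrow> ('a, 'k) module \<Rightarrow> ('m \<Rightarrow> 'k) set" where
  "lin_maps A M N = {f \<in> hom (add_monoid M) (add_monoid N).
     \<forall>a\<in>carrier A. \<forall>x\<in>carrier M. f (a \<odot>\<^bsub>M\<^esub> x) = a \<odot>\<^bsub>N\<^esub> f x}"

definition module_iso ::
  "('a, 'z) ring_scheme \<Rightarrow> ('a, 'm) module \<Rightarrow> ('a, 'k) module \<Rightarrow> bool" where
  "module_iso A M N \<longleftrightarrow> (\<exists>f\<in>lin_maps A M N. bij_betw f (carrier M) (carrier N))"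

definition zero_module :: "('a, 'm) module \<Rightarrow> bool" where
  "zero_module M \<longleftrightarrow> carrier M = {\<zero>\<^bsub>M\<^esub>}"

definition quot_module :: "('a, 'm) module \<Rightarrow> 'm set \<Rightarrow> ('a, 'm set) module" where
  "quot_module M K = mk_module (add_monoid M Mod K) (\<lambda>a V. \<Union>x\<in>V. K +>\<^bsub>M\<^esub> (a \<odot>\<^bsub>M\<^esub> x))"

definition subquot_module :: "('a, 'm) module \<Rightarrow> 'm set \<Rightarrow> 'm set \<Rightarrow> ('a, 'm set) module" where
  "subquot_module M Z K = quot_module (M\<lparr>carrier := Z\<rparr>) K"

definition direct_sum :: "('a, 'm) module \<Rightarrow> ('a, 'k) module \<Rightarrow> ('a, 'm \<times> 'k) module" where
  "direct_sum M N = mk_module (add_monoid M \<times>\<times> add_monoid N) (\<lambda>a (x, y). (a \<odot>\<^bsub>M\<^esub> x, a \<odot>\<^bsub>N\<^esub> y))"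

definition pushout_rel ::
  "('a, 'u) module \<Rightarrow> ('a, 'm) module \<Rightarrow> ('a, 'k) module \<Rightarrow> ('u \<Rightarrow> 'm) \<Rightarrow> ('u \<Rightarrow> 'k) \<Rightarrow> ('m \<times> 'k) set" where
  "pushout_rel U M N f g = (\<lambda>u. (f u, \<ominus>\<^bsub>N\<^esub> g u)) ` carrier U"

definition pushout_module ::
  "('a, 'u) module \<Rightarrow> ('a, 'm) module \<Rightarrow> ('a, 'k) module \<Rightarrow> ('u \<Rightarrow> 'm) \<Rightarrow> ('u \<Rightarrow> 'k)
    \<Rightarrow> ('a, ('m \<times> 'k) set) module" where
  "pushout_module U M N f g = quot_module (direct_sum M N) (pushout_rel U M N f g)"

definition pushout_class ::
  "('a, 'u) module \<Rightarrow> ('a, 'm) module \<Rightarrow> ('a, 'k) module \<Rightarrow> ('u \<Rightarrow> 'm) \<Rightarrow> ('u \<Rightarrow> 'k)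
    \<Rightarrow> 'm \<times> 'k \<Rightarrow> ('m \<times> 'k) set" where
  "pushout_class U M N f g x = pushout_rel U M N f g +>\<^bsub>direct_sum M N\<^esub> x"

subsection \<open>Modules given by symbols and relations\<close>

text \<open>The homomorphism out of a free abelian group that is \<open>\<phi>\<close> on the basis.\<close>

definition frag_lift :: "('g, 'z) monoid_scheme \<Rightarrow> ('x \<Rightarrow> 'g) \<Rightarrow> ('x \<Rightarrow>\<^sub>0 int) \<Rightarrow> 'g" where
  "frag_lift G \<phi> c = finprod G (\<lambda>x. \<phi> x [^]\<^bsub>G\<^esub> Poly_Mapping.lookup c x) (Poly_Mapping.keys c)"

text \<open>
  \<open>symbol_module S V K\<close> is the abelian group generated by symbols \<open>(s, x)\<close> with
  \<open>s \<in> S\<close> and \<open>x \<in> V\<close>, additive in \<open>s\<close> and subject to the relations \<open>K\<close>, with \<open>S\<close> acting on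
  the first component (all relation sets \<open>K\<close> used below are stable under this action).  The
  symbol \<open>(s, x)\<close> stands for \<open>s \<otimes> x\<close> in a tensor product and for \<open>s dx\<close> in a module of
  differentials.
\<close>

definition symbol_relations ::
  "('s, 'z) ring_scheme \<Rightarrow> 'x set \<Rightarrow> ('s \<times> 'x \<Rightarrow>\<^sub>0 int) set \<Rightarrow> ('s \<times> 'x \<Rightarrow>\<^sub>0 int) set" where
  "symbol_relations S V K = generate (free_Abelian_group (carrier S \<times> V))
     ({frag_of (s \<oplus>\<^bsub>S\<^esub> s', x) - frag_of (s, x) - frag_of (s', x) | s s' x.
         s \<in> carrier S \<and> s' \<in> carrier S \<and> x \<in> V} \<union> K)"

definition symbol_class ::
  "('s, 'z) ring_scheme \<Rightarrow> 'x set \<Rightarrow> ('s \<times> 'x \<Rightarrow>\<^sub>0 int) set \<Rightarrow> ('s \<times> 'x \<Rightarrow>\<^sub>0 int)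
    \<Rightarrow> ('s \<times> 'x \<Rightarrow>\<^sub>0 int) set" where
  "symbol_class S V K c = symbol_relations S V K #>\<^bsub>free_Abelian_group (carrier S \<times> V)\<^esub> c"

definition symbol_module ::
  "('s, 'z) ring_scheme \<Rightarrow> 'x set \<Rightarrow> ('s \<times> 'x \<Rightarrow>\<^sub>0 int) set
    \<Rightarrow> ('s, ('s \<times> 'x \<Rightarrow>\<^sub>0 int) set) module" where
  "symbol_module S V K =
     mk_module (free_Abelian_group (carrier S \<times> V) Mod symbol_relations S V K)
       (\<lambda>s Z. \<Union>c\<in>Z. symbol_class S V K (frag_extend (\<lambda>(s', x). frag_of (s \<otimes>\<^bsub>S\<^esub> s', x)) c))"

text \<open>
  The additive map from a symbol module to \<open>M\<close> given by \<open>\<phi>\<close> on symbols.  It is meaningful only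
  if \<open>\<phi>\<close> respects the relations, and then the image of a class is a singleton.
\<close>

definition symbol_lift ::
  "('m, 'z) ring_scheme \<Rightarrow> ('s \<Rightarrow> 'x \<Rightarrow> 'm) \<Rightarrow> ('s \<times> 'x \<Rightarrow>\<^sub>0 int) set \<Rightarrow> 'm" where
  "symbol_lift M \<phi> Z = the_elem (frag_lift (add_monoid M) (case_prod \<phi>) ` Z)"

subsection \<open>Tensor products\<close>

text \<open>The \<open>S\<close>-module \<open>S \<otimes>\<^sub>A M\<close> for a ring homomorphism \<open>f : A \<rightarrow> S\<close> and an \<open>A\<close>-module \<open>M\<close>.\<close>

definition tensor_relations ::
  "('a, 'y) ring_scheme \<Rightarrow> ('s, 'z) ring_scheme \<Rightarrow> ('a \<Rightarrow> 's) \<Rightarrow> ('a, 'm) module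
    \<Rightarrow> ('s \<times> 'm \<Rightarrow>\<^sub>0 int) set" where
  "tensor_relations A S f M =
     {frag_of (s, x \<oplus>\<^bsub>M\<^esub> x') - frag_of (s, x) - frag_of (s, x') | s x x'.
        s \<in> carrier S \<and> x \<in> carrier M \<and> x' \<in> carrier M} \<union>
     {frag_of (s \<otimes>\<^bsub>S\<^esub> f a, x) - frag_of (s, a \<odot>\<^bsub>M\<^esub> x) | s a x.
        s \<in> carrier S \<and> a \<in> carrier A \<and> x \<in> carrier M}"

definition base_change ::
  "('a, 'y) ring_scheme \<Rightarrow> ('s, 'z) ring_scheme \<Rightarrow> ('a \<Rightarrow> 's) \<Rightarrow> ('a, 'm) module
    \<Rightarrow> ('s, ('s \<times> 'm \<Rightarrow>\<^sub>0 int) set) module" where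
  "base_change A S f M = symbol_module S (carrier M) (tensor_relations A S f M)"

definition pure_tensor ::
  "('a, 'y) ring_scheme \<Rightarrow> ('s, 'z) ring_scheme \<Rightarrow> ('a \<Rightarrow> 's) \<Rightarrow> ('a, 'm) module
    \<Rightarrow> 's \<Rightarrow> 'm \<Rightarrow> ('s \<times> 'm \<Rightarrow>\<^sub>0 int) set" where
  "pure_tensor A S f M s x = symbol_class S (carrier M) (tensor_relations A S f M) (frag_of (s, x))"

text \<open>The ring \<open>R \<otimes>\<^sub>C B\<close> for ring homomorphisms \<open>e : C \<rightarrow> R\<close> and \<open>f : C \<rightarrow> B\<close>.\<close>

definition ring_tensor ::
  "('c, 'x) ring_scheme \<Rightarrow> ('r, 'y) ring_scheme \<Rightarrow> ('b, 'z) ring_scheme \<Rightarrow> ('c \<Rightarrow> 'r) \<Rightarrow> ('c \<Rightarrow> 'b)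
    \<Rightarrow> ('r \<times> 'b \<Rightarrow>\<^sub>0 int) set ring" where
  "ring_tensor C R B e f =
    (let B\<^sub>C = restrict_scalars f (ring_as_module B); M = base_change C R e B\<^sub>C in
     \<lparr>carrier = carrier M,
      monoid.mult = (\<lambda>V Y. \<Union>c\<in>V. \<Union>d\<in>Y. symbol_class R (carrier B) (tensor_relations C R e B\<^sub>C)
        (frag_extend (\<lambda>(r, b). frag_extend (\<lambda>(r', b'). frag_of (r \<otimes>\<^bsub>R\<^esub> r', b \<otimes>\<^bsub>B\<^esub> b')) d) c)),
      monoid.one = pure_tensor C R e B\<^sub>C \<one>\<^bsub>R\<^esub> \<one>\<^bsub>B\<^esub>,
      ring.zero = \<zero>\<^bsub>M\<^esub>, ring.add = add M\<rparr>)"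

subsection \<open>Kaehler differentials\<close>

definition differential_relations ::
  "('c, 'y) ring_scheme \<Rightarrow> ('r, 'z) ring_scheme \<Rightarrow> ('c \<Rightarrow> 'r) \<Rightarrow> ('r \<times> 'r \<Rightarrow>\<^sub>0 int) set" where
  "differential_relations C R e =
     {frag_of (r, x \<oplus>\<^bsub>R\<^esub> y) - frag_of (r, x) - frag_of (r, y) | r x y.
        r \<in> carrier R \<and> x \<in> carrier R \<and> y \<in> carrier R} \<union>
     {frag_of (r, x \<otimes>\<^bsub>R\<^esub> y) - frag_of (r \<otimes>\<^bsub>R\<^esub> x, y) - frag_of (r \<otimes>\<^bsub>R\<^esub> y, x) | r x y.
        r \<in> carrier R \<and> x \<in> carrier R \<and> y \<in> carrier R} \<union>
     {frag_of (r, e c) | r c. r \<in> carrier R \<and> c \<in> carrier C}"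

definition differentials ::
  "('c, 'y) ring_scheme \<Rightarrow> ('r, 'z) ring_scheme \<Rightarrow> ('c \<Rightarrow> 'r)
    \<Rightarrow> ('r, ('r \<times> 'r \<Rightarrow>\<^sub>0 int) set) module" where
  "differentials C R e = symbol_module R (carrier R) (differential_relations C R e)"

definition differential ::
  "('c, 'y) ring_scheme \<Rightarrow> ('r, 'z) ring_scheme \<Rightarrow> ('c \<Rightarrow> 'r) \<Rightarrow> 'r \<Rightarrow> ('r \<times> 'r \<Rightarrow>\<^sub>0 int) set" where
  "differential C R e x = symbol_class R (carrier R) (differential_relations C R e) (frag_of (\<one>\<^bsub>R\<^esub>, x))"

section \<open>Commutative monoids\<close>

text \<open>Unlike \<^const>\<open>hom\<close>, a homomorphism of monoids is required to preserve the unit.\<close>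

definition monoid_hom :: "('p, 'y) monoid_scheme \<Rightarrow> ('n, 'z) monoid_scheme \<Rightarrow> ('p \<Rightarrow> 'n) set" where
  "monoid_hom P N = {h \<in> hom P N. h \<one>\<^bsub>P\<^esub> = \<one>\<^bsub>N\<^esub>}"

subsection \<open>Group completion\<close>

definition gp_rel :: "('p, 'z) monoid_scheme \<Rightarrow> (('p \<times> 'p) \<times> ('p \<times> 'p)) set" where
  "gp_rel P = {((a, b), (c, d)). a \<in> carrier P \<and> b \<in> carrier P \<and> c \<in> carrier P \<and> d \<in> carrier P \<and>
     (\<exists>s\<in>carrier P. s \<otimes>\<^bsub>P\<^esub> (a \<otimes>\<^bsub>P\<^esub> d) = s \<otimes>\<^bsub>P\<^esub> (c \<otimes>\<^bsub>P\<^esub> b))}"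

text \<open>The element \<open>a b\<^sup>-\<^sup>1\<close> of the group completion.\<close>

definition gp_frac :: "('p, 'z) monoid_scheme \<Rightarrow> 'p \<Rightarrow> 'p \<Rightarrow> ('p \<times> 'p) set" where
  "gp_frac P a b = gp_rel P `` {(a, b)}"

definition gp :: "('p, 'z) monoid_scheme \<Rightarrow> ('p \<times> 'p) set monoid" where
  "gp P = \<lparr>carrier = (carrier P \<times> carrier P) // gp_rel P,
     monoid.mult = (\<lambda>V Y. \<Union>(a, b)\<in>V. \<Union>(c, d)\<in>Y. gp_frac P (a \<otimes>\<^bsub>P\<^esub> c) (b \<otimes>\<^bsub>P\<^esub> d)),
     monoid.one = gp_frac P \<one>\<^bsub>P\<^esub> \<one>\<^bsub>P\<^esub>\<rparr>"

definition gp_map :: "('n, 'z) monoid_scheme \<Rightarrow> ('p \<Rightarrow> 'n) \<Rightarrow> ('p \<times> 'p) set \<Rightarrow> ('n \<times> 'n) set" where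
  "gp_map N h V = (\<Union>(a, b)\<in>V. gp_frac N (h a) (h b))"

subsection \<open>Amalgamated sums\<close>

text \<open>
  The equivalence relation on \<open>P \<times> N\<close> that defines \<open>P \<oplus>\<^sub>Q N\<close> for \<open>f : Q \<rightarrow> P\<close> and \<open>g : Q \<rightarrow> N\<close>.
  The generating pairs are stable under multiplication, so it is a congruence.
\<close>

inductive_set amalg_rel ::
  "('q, 'x) monoid_scheme \<Rightarrow> ('p, 'y) monoid_scheme \<Rightarrow> ('n, 'z) monoid_scheme
    \<Rightarrow> ('q \<Rightarrow> 'p) \<Rightarrow> ('q \<Rightarrow> 'n) \<Rightarrow> (('p \<times> 'n) \<times> ('p \<times> 'n)) set"
  for Q P N f g where
  refl: "p \<in> carrier P \<Longrightarrow> n \<in> carrier N \<Longrightarrow> ((p, n), (p, n)) \<in> amalg_rel Q P N f g"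
| sym: "(x, y) \<in> amalg_rel Q P N f g \<Longrightarrow> (y, x) \<in> amalg_rel Q P N f g"
| trans: "(x, y) \<in> amalg_rel Q P N f g \<Longrightarrow> (y, z) \<in> amalg_rel Q P N f g
    \<Longrightarrow> (x, z) \<in> amalg_rel Q P N f g"
| glue: "q \<in> carrier Q \<Longrightarrow> p \<in> carrier P \<Longrightarrow> n \<in> carrier N
    \<Longrightarrow> ((p \<otimes>\<^bsub>P\<^esub> f q, n), (p, g q \<otimes>\<^bsub>N\<^esub> n)) \<in> amalg_rel Q P N f g"

definition amalg_class ::
  "('q, 'x) monoid_scheme \<Rightarrow> ('p, 'y) monoid_scheme \<Rightarrow> ('n, 'z) monoid_scheme
    \<Rightarrow> ('q \<Rightarrow> 'p) \<Rightarrow> ('q \<Rightarrow> 'n) \<Rightarrow> 'p \<Rightarrow> 'n \<Rightarrow> ('p \<times> 'n) set" where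
  "amalg_class Q P N f g p n = amalg_rel Q P N f g `` {(p, n)}"

definition amalg ::
  "('q, 'x) monoid_scheme \<Rightarrow> ('p, 'y) monoid_scheme \<Rightarrow> ('n, 'z) monoid_scheme
    \<Rightarrow> ('q \<Rightarrow> 'p) \<Rightarrow> ('q \<Rightarrow> 'n) \<Rightarrow> ('p \<times> 'n) set monoid" where
  "amalg Q P N f g = \<lparr>carrier = (carrier P \<times> carrier N) // amalg_rel Q P N f g,
     monoid.mult = (\<lambda>V Y. \<Union>(p, n)\<in>V. \<Union>(p', n')\<in>Y. amalg_class Q P N f g (p \<otimes>\<^bsub>P\<^esub> p') (n \<otimes>\<^bsub>N\<^esub> n')),
     monoid.one = amalg_class Q P N f g \<one>\<^bsub>P\<^esub> \<one>\<^bsub>N\<^esub>\<rparr>"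

subsection \<open>Monoid rings\<close>

definition monoid_ring :: "('p, 'z) monoid_scheme \<Rightarrow> ('p \<Rightarrow>\<^sub>0 int) ring" where
  "monoid_ring P = \<lparr>carrier = {c. Poly_Mapping.keys c \<subseteq> carrier P},
     monoid.mult = (\<lambda>c d. frag_extend (\<lambda>x. frag_extend (\<lambda>y. frag_of (x \<otimes>\<^bsub>P\<^esub> y)) d) c),
     monoid.one = frag_of \<one>\<^bsub>P\<^esub>, ring.zero = 0, ring.add = (+)\<rparr>"

definition monoid_ring_map :: "('p \<Rightarrow> 'n) \<Rightarrow> ('p \<Rightarrow>\<^sub>0 int) \<Rightarrow> ('n \<Rightarrow>\<^sub>0 int)" where
  "monoid_ring_map h = frag_extend (\<lambda>x. frag_of (h x))"

section \<open>Prelog rings\<close>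

record ('c, 'q) prelog =
  ring_of :: "'c ring"
  monoid_of :: "'q monoid"
  chart :: "'q \<Rightarrow> 'c"

definition prelog_ring :: "('c, 'q) prelog \<Rightarrow> bool" where
  "prelog_ring A \<longleftrightarrow> cring (ring_of A) \<and> comm_monoid (monoid_of A) \<and>
     chart A \<in> monoid_hom (monoid_of A) (ring_of A)"

type_synonym ('c, 'q, 'b, 'n) prelog_map = "('c \<Rightarrow> 'b) \<times> ('q \<Rightarrow> 'n)"

definition prelog_hom ::
  "('c, 'q) prelog \<Rightarrow> ('b, 'n) prelog \<Rightarrow> ('c, 'q, 'b, 'n) prelog_map set" where
  "prelog_hom A B = {(f, g). f \<in> ring_hom (ring_of A) (ring_of B) \<and>
     g \<in> monoid_hom (monoid_of A) (monoid_of B) \<and>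
     (\<forall>q\<in>carrier (monoid_of A). chart B (g q) = f (chart A q))}"

section \<open>Simplicial objects\<close>

text \<open>
  \<open>face V n i : V\<^sub>n \<rightarrow> V\<^sub>n\<^sub>-\<^sub>1\<close> is meaningful for \<open>1 \<le> n\<close> and \<open>i \<le> n\<close>, and
  \<open>degen V n i : V\<^sub>n \<rightarrow> V\<^sub>n\<^sub>+\<^sub>1\<close> for \<open>i \<le> n\<close>.
\<close>

record ('o, 'f) simplicial =
  obj :: "nat \<Rightarrow> 'o"
  face :: "nat \<Rightarrow> nat \<Rightarrow> 'f"
  degen :: "nat \<Rightarrow> nat \<Rightarrow> 'f"

type_synonym 'x sset = "('x set, 'x \<Rightarrow> 'x) simplicial"
type_synonym ('r, 'p) sprelog = "(('r, 'p) prelog, ('r, 'p, 'r, 'p) prelog_map) simplicial"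
type_synonym ('a, 'm) smodule = "(('a, 'm) module, 'm \<Rightarrow> 'm) simplicial"

definition simplicial_set :: "'x sset \<Rightarrow> bool" where
  "simplicial_set V \<longleftrightarrow>
     (\<forall>n\<ge>1. \<forall>i\<le>n. face V n i \<in> obj V n \<rightarrow> obj V (n - 1)) \<and>
     (\<forall>n. \<forall>i\<le>n. degen V n i \<in> obj V n \<rightarrow> obj V (n + 1)) \<and>
     (\<forall>n\<ge>2. \<forall>j\<le>n. \<forall>i<j. \<forall>x\<in>obj V n.
        face V (n - 1) i (face V n j x) = face V (n - 1) (j - 1) (face V n i x)) \<and>
     (\<forall>n. \<forall>j\<le>n. \<forall>i\<le>j. \<forall>x\<in>obj V n.
        degen V (n + 1) i (degen V n j x) = degen V (n + 1) (j + 1) (degen V n i x)) \<and>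
     (\<forall>n. \<forall>j\<le>n. \<forall>i\<le>n + 1. \<forall>x\<in>obj V n.
        face V (n + 1) i (degen V n j x) =
          (if i < j then degen V (n - 1) (j - 1) (face V n i x)
           else if i \<le> j + 1 then x
           else degen V (n - 1) j (face V n (i - 1) x)))"

definition simplicial_map :: "'x sset \<Rightarrow> 'y sset \<Rightarrow> (nat \<Rightarrow> 'x \<Rightarrow> 'y) \<Rightarrow> bool" where
  "simplicial_map V Y f \<longleftrightarrow>
     (\<forall>n. f n \<in> obj V n \<rightarrow> obj Y n) \<and>
     (\<forall>n\<ge>1. \<forall>i\<le>n. \<forall>x\<in>obj V n. f (n - 1) (face V n i x) = face Y n i (f n x)) \<and>
     (\<forall>n. \<forall>i\<le>n. \<forall>x\<in>obj V n. f (n + 1) (degen V n i x) = degen Y n i (f n x))"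

text \<open>
  Trivial Kan fibrations: the right lifting property against all inclusions \<open>\<partial>\<Delta>\<^sup>n \<rightarrow> \<Delta>\<^sup>n\<close>.
  A map \<open>\<partial>\<Delta>\<^sup>n \<rightarrow> V\<close> is a tuple \<open>u 0, \<dots>, u n\<close> of \<open>(n-1)\<close>-simplices with \<open>d\<^sub>i (u j) = d\<^sub>j\<^sub>-\<^sub>1 (u i)\<close>
  for \<open>i < j\<close>; there is no condition for \<open>n = 1\<close>, and no data at all for \<open>n = 0\<close>.
\<close>

definition trivial_fibration :: "'x sset \<Rightarrow> 'y sset \<Rightarrow> (nat \<Rightarrow> 'x \<Rightarrow> 'y) \<Rightarrow> bool" where
  "trivial_fibration V Y f \<longleftrightarrow> simplicial_map V Y f \<and>
     (\<forall>n. \<forall>u. \<forall>y\<in>obj Y n.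
        (1 \<le> n \<longrightarrow> (\<forall>i\<le>n. u i \<in> obj V (n - 1) \<and> f (n - 1) (u i) = face Y n i y)) \<longrightarrow>
        (2 \<le> n \<longrightarrow> (\<forall>j\<le>n. \<forall>i<j. face V (n - 1) i (u j) = face V (n - 1) (j - 1) (u i))) \<longrightarrow>
        (\<exists>x\<in>obj V n. f n x = y \<and> (1 \<le> n \<longrightarrow> (\<forall>i\<le>n. face V n i x = u i))))"

definition ring_sset :: "('r, 'p) sprelog \<Rightarrow> 'r sset" where
  "ring_sset S = \<lparr>obj = (\<lambda>n. carrier (ring_of (obj S n))),
     face = (\<lambda>n i. fst (face S n i)), degen = (\<lambda>n i. fst (degen S n i))\<rparr>"

definition monoid_sset :: "('r, 'p) sprelog \<Rightarrow> 'p sset" where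
  "monoid_sset S = \<lparr>obj = (\<lambda>n. carrier (monoid_of (obj S n))),
     face = (\<lambda>n i. snd (face S n i)), degen = (\<lambda>n i. snd (degen S n i))\<rparr>"

definition simplicial_prelog_ring :: "('r, 'p) sprelog \<Rightarrow> bool" where
  "simplicial_prelog_ring S \<longleftrightarrow>
     (\<forall>n. prelog_ring (obj S n)) \<and>
     (\<forall>n\<ge>1. \<forall>i\<le>n. face S n i \<in> prelog_hom (obj S n) (obj S (n - 1))) \<and>
     (\<forall>n. \<forall>i\<le>n. degen S n i \<in> prelog_hom (obj S n) (obj S (n + 1))) \<and>
     simplicial_set (ring_sset S) \<and> simplicial_set (monoid_sset S)"

definition simplicial_prelog_hom ::
  "('r, 'p) sprelog \<Rightarrow> ('b, 'n) sprelog \<Rightarrow> (nat \<Rightarrow> ('r, 'p, 'b, 'n) prelog_map) \<Rightarrow> bool" where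
  "simplicial_prelog_hom S S' h \<longleftrightarrow>
     (\<forall>n. h n \<in> prelog_hom (obj S n) (obj S' n)) \<and>
     simplicial_map (ring_sset S) (ring_sset S') (\<lambda>n. fst (h n)) \<and>
     simplicial_map (monoid_sset S) (monoid_sset S') (\<lambda>n. snd (h n))"

definition const_sprelog :: "('c, 'q) prelog \<Rightarrow> ('c, 'q) sprelog" where
  "const_sprelog A = \<lparr>obj = (\<lambda>n. A), face = (\<lambda>n i. (\<lambda>x. x, \<lambda>x. x)), degen = (\<lambda>n i. (\<lambda>x. x, \<lambda>x. x))\<rparr>"

section \<open>Resolutions\<close>

definition monomial :: "('r, 'z) monoid_scheme \<Rightarrow> ('i \<Rightarrow> 'r) \<Rightarrow> 'i multiset \<Rightarrow> 'r" where
  "monomial R v m = finprod R (\<lambda>i. v i [^]\<^bsub>R\<^esub> count m i) (set_mset m)"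

text \<open>\<open>P = Q \<oplus> \<nat>\<^sup>Y\<close>, where \<open>\<nat>\<^sup>Y\<close> is the free commutative monoid on \<open>Y\<close>.\<close>

definition free_monoid_on ::
  "('q, 'y) monoid_scheme \<Rightarrow> ('p, 'z) monoid_scheme \<Rightarrow> ('q \<Rightarrow> 'p) \<Rightarrow> 'p set \<Rightarrow> bool" where
  "free_monoid_on Q P e Y \<longleftrightarrow> Y \<subseteq> carrier P \<and>
     bij_betw (\<lambda>(q, m). e q \<otimes>\<^bsub>P\<^esub> monomial P (\<lambda>y. y) m) (carrier Q \<times> {m. set_mset m \<subseteq> Y}) (carrier P)"

text \<open>
  \<open>R\<close> is the polynomial ring over \<open>C\<close> in the variables \<open>v i\<close> for \<open>i \<in> I\<close>: evaluation of
  polynomials is bijective.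
\<close>

definition free_algebra_on ::
  "('c, 'y) ring_scheme \<Rightarrow> ('r, 'z) ring_scheme \<Rightarrow> ('c \<Rightarrow> 'r) \<Rightarrow> 'i set \<Rightarrow> ('i \<Rightarrow> 'r) \<Rightarrow> bool" where
  "free_algebra_on C R e I v \<longleftrightarrow> v \<in> I \<rightarrow> carrier R \<and>
     bij_betw (\<lambda>F. finsum R (\<lambda>m. e (F m) \<otimes>\<^bsub>R\<^esub> monomial R v m) {m. F m \<noteq> \<zero>\<^bsub>C\<^esub>})
       (ring.indexed_pset C I (carrier C)) (carrier R)"

definition free_cofibration ::
  "('c, 'q) prelog \<Rightarrow> ('r, 'p) sprelog \<Rightarrow> (nat \<Rightarrow> ('c, 'q, 'r, 'p) prelog_map) \<Rightarrow> bool" where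
  "free_cofibration A S \<eta> \<longleftrightarrow> (\<exists>(Xs :: nat \<Rightarrow> 'r set) (Ys :: nat \<Rightarrow> 'p set). \<forall>n.
     free_monoid_on (monoid_of A) (monoid_of (obj S n)) (snd (\<eta> n)) (Ys n) \<and>
     free_algebra_on (ring_of A) (ring_of (obj S n)) (fst (\<eta> n)) (Sum_Type.Plus (Xs n) (Ys n))
       (case_sum (\<lambda>x. x) (chart (obj S n))) \<and>
     (\<forall>i\<le>n. fst (degen S n i) ` Xs n \<subseteq> Xs (n + 1) \<and> snd (degen S n i) ` Ys n \<subseteq> Ys (n + 1)))"

text \<open>
  A resolution \<open>(C,Q) \<rightarrow> (R,P) \<rightarrow> (B,N)\<close> of \<open>\<phi>\<close> with simplicial middle term \<open>S = (R,P)\<close>.  The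
  identifications \<open>R\<^sub>0 = C\<close> and \<open>P\<^sub>0 = Q\<close> are expressed by bijectivity of the structure maps in
  degree \<open>0\<close>.
\<close>

definition log_resolution ::
  "('c, 'q) prelog \<Rightarrow> ('b, 'n) prelog \<Rightarrow> ('c, 'q, 'b, 'n) prelog_map \<Rightarrow> ('r, 'p) sprelog
    \<Rightarrow> (nat \<Rightarrow> ('c, 'q, 'r, 'p) prelog_map) \<Rightarrow> (nat \<Rightarrow> ('r, 'p, 'b, 'n) prelog_map) \<Rightarrow> bool" where
  "log_resolution A B \<phi> S \<eta> \<epsilon> \<longleftrightarrow>
     simplicial_prelog_ring S \<and>
     simplicial_prelog_hom (const_sprelog A) S \<eta> \<and>
     simplicial_prelog_hom S (const_sprelog B) \<epsilon> \<and>
     (\<forall>n. \<forall>c\<in>carrier (ring_of A). fst (\<epsilon> n) (fst (\<eta> n) c) = fst \<phi> c) \<and>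
     (\<forall>n. \<forall>q\<in>carrier (monoid_of A). snd (\<epsilon> n) (snd (\<eta> n) q) = snd \<phi> q) \<and>
     free_cofibration A S \<eta> \<and>
     trivial_fibration (ring_sset S) (ring_sset (const_sprelog B)) (\<lambda>n. fst (\<epsilon> n)) \<and>
     trivial_fibration (monoid_sset S) (monoid_sset (const_sprelog B)) (\<lambda>n. snd (\<epsilon> n)) \<and>
     bij_betw (fst (\<eta> 0)) (carrier (ring_of A)) (carrier (ring_of (obj S 0))) \<and>
     bij_betw (snd (\<eta> 0)) (carrier (monoid_of A)) (carrier (monoid_of (obj S 0)))"

record ('c, 'q, 'r, 'p, 'b, 'n) factorization =
  source :: "('c, 'q) prelog"
  middle :: "('r, 'p) prelog"
  target :: "('b, 'n) prelog"
  incl :: "('c, 'q, 'r, 'p) prelog_map"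
  proj :: "('r, 'p, 'b, 'n) prelog_map"

abbreviation "Cr F \<equiv> ring_of (source F)"
abbreviation "Qm F \<equiv> monoid_of (source F)"
abbreviation "Rr F \<equiv> ring_of (middle F)"
abbreviation "Pm F \<equiv> monoid_of (middle F)"
abbreviation "Br F \<equiv> ring_of (target F)"
abbreviation "Nm F \<equiv> monoid_of (target F)"

definition degreewise ::
  "('c, 'q) prelog \<Rightarrow> ('b, 'n) prelog \<Rightarrow> ('r, 'p) sprelog
    \<Rightarrow> (nat \<Rightarrow> ('c, 'q, 'r, 'p) prelog_map) \<Rightarrow> (nat \<Rightarrow> ('r, 'p, 'b, 'n) prelog_map)
    \<Rightarrow> nat \<Rightarrow> ('c, 'q, 'r, 'p, 'b, 'n) factorization" where
  "degreewise A B S \<eta> \<epsilon> n =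
    \<lparr>source = A, middle = obj S n, target = B, incl = \<eta> n, proj = \<epsilon> n\<rparr>"

definition int_to_target :: "('c, 'q, 'r, 'p, 'b, 'n) factorization \<Rightarrow> int \<Rightarrow> 'b" where
  "int_to_target F k = add_pow (Br F) k \<one>\<^bsub>Br F\<^esub>"

section \<open>The simplicial module \<open>D\<^sup>1\<close>\<close>

type_synonym ('r, 'b) RB_elem = "('r \<times> 'b \<Rightarrow>\<^sub>0 int) set"
type_synonym ('p, 'n) PN_elem = "('p \<times> 'n) set"
type_synonym ('p, 'n) T_elem = "(('p, 'n) PN_elem \<times> ('p, 'n) PN_elem) set"
type_synonym ('p, 'b, 'n) BT_elem = "('b \<times> ('p, 'n) T_elem \<Rightarrow>\<^sub>0 int) set"
type_synonym ('r, 'p, 'b, 'n) U_elem = "(('r, 'b) RB_elem \<times> (('p, 'n) PN_elem \<Rightarrow>\<^sub>0 int) \<Rightarrow>\<^sub>0 int) set"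
type_synonym ('r, 'p, 'b, 'n) D1_elem = "(('r, 'b) RB_elem \<times> ('p, 'b, 'n) BT_elem) set"

subsection \<open>\<open>R \<otimes>\<^sub>C B\<close> and \<open>I\<close>\<close>

definition RB :: "('c, 'q, 'r, 'p, 'b, 'n) factorization \<Rightarrow> ('r, 'b) RB_elem ring" where
  "RB F = ring_tensor (Cr F) (Rr F) (Br F) (fst (incl F)) (fst (proj F) \<circ> fst (incl F))"

definition RB_tensor :: "('c, 'q, 'r, 'p, 'b, 'n) factorization \<Rightarrow> 'r \<Rightarrow> 'b \<Rightarrow> ('r, 'b) RB_elem" where
  "RB_tensor F = pure_tensor (Cr F) (Rr F) (fst (incl F))
     (restrict_scalars (fst (proj F) \<circ> fst (incl F)) (ring_as_module (Br F)))"

definition RB_proj :: "('c, 'q, 'r, 'p, 'b, 'n) factorization \<Rightarrow> ('r, 'b) RB_elem \<Rightarrow> 'b" where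
  "RB_proj F = symbol_lift (Br F) (\<lambda>r b. fst (proj F) r \<otimes>\<^bsub>Br F\<^esub> b)"

definition I_mod ::
  "('c, 'q, 'r, 'p, 'b, 'n) factorization \<Rightarrow> (('r, 'b) RB_elem, ('r, 'b) RB_elem) module" where
  "I_mod F = (ring_as_module (RB F))\<lparr>carrier := a_kernel (RB F) (Br F) (RB_proj F)\<rparr>"

subsection \<open>\<open>P \<oplus>\<^sub>Q N\<close>, \<open>J\<close> and \<open>T\<close>\<close>

definition PN :: "('c, 'q, 'r, 'p, 'b, 'n) factorization \<Rightarrow> ('p, 'n) PN_elem monoid" where
  "PN F = amalg (Qm F) (Pm F) (Nm F) (snd (incl F)) (snd (proj F) \<circ> snd (incl F))"

definition PN_class :: "('c, 'q, 'r, 'p, 'b, 'n) factorization \<Rightarrow> 'p \<Rightarrow> 'n \<Rightarrow> ('p, 'n) PN_elem" where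
  "PN_class F = amalg_class (Qm F) (Pm F) (Nm F) (snd (incl F)) (snd (proj F) \<circ> snd (incl F))"

definition PN_proj :: "('c, 'q, 'r, 'p, 'b, 'n) factorization \<Rightarrow> ('p, 'n) PN_elem \<Rightarrow> 'n" where
  "PN_proj F V = the_elem ((\<lambda>(p, n). snd (proj F) p \<otimes>\<^bsub>Nm F\<^esub> n) ` V)"

text \<open>The tensor product \<open>\<int>[P] \<otimes> \<int>[N]\<close> over \<open>\<int>[Q]\<close> is taken in the form \<open>\<int>[P \<oplus>\<^sub>Q N]\<close>.\<close>

definition ZPN :: "('c, 'q, 'r, 'p, 'b, 'n) factorization \<Rightarrow> (('p, 'n) PN_elem \<Rightarrow>\<^sub>0 int) ring" where
  "ZPN F = monoid_ring (PN F)"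

definition ZPN_to_RB ::
  "('c, 'q, 'r, 'p, 'b, 'n) factorization \<Rightarrow> (('p, 'n) PN_elem \<Rightarrow>\<^sub>0 int) \<Rightarrow> ('r, 'b) RB_elem" where
  "ZPN_to_RB F = frag_lift (add_monoid (RB F))
     (\<lambda>V. the_elem ((\<lambda>(p, n). RB_tensor F (chart (middle F) p) (chart (target F) n)) ` V))"

definition J_set :: "('c, 'q, 'r, 'p, 'b, 'n) factorization \<Rightarrow> (('p, 'n) PN_elem \<Rightarrow>\<^sub>0 int) set" where
  "J_set F = a_kernel (ZPN F) (monoid_ring (Nm F)) (monoid_ring_map (PN_proj F))"

definition J_mod ::
  "('c, 'q, 'r, 'p, 'b, 'n) factorization
    \<Rightarrow> (('p, 'n) PN_elem \<Rightarrow>\<^sub>0 int, ('p, 'n) PN_elem \<Rightarrow>\<^sub>0 int) module" where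
  "J_mod F = (ring_as_module (ZPN F))\<lparr>carrier := J_set F\<rparr>"

definition T_grp :: "('c, 'q, 'r, 'p, 'b, 'n) factorization \<Rightarrow> ('p, 'n) T_elem monoid" where
  "T_grp F = (gp (PN F))\<lparr>carrier := kernel (gp (PN F)) (gp (Nm F)) (gp_map (Nm F) (PN_proj F))\<rparr>"

definition BT_mod :: "('c, 'q, 'r, 'p, 'b, 'n) factorization \<Rightarrow> ('b, ('p, 'b, 'n) BT_elem) module" where
  "BT_mod F = base_change \<Z> (Br F) (int_to_target F) (int_module (T_grp F))"

definition BT_tensor ::
  "('c, 'q, 'r, 'p, 'b, 'n) factorization \<Rightarrow> 'b \<Rightarrow> ('p, 'n) T_elem \<Rightarrow> ('p, 'b, 'n) BT_elem" where
  "BT_tensor F = pure_tensor \<Z> (Br F) (int_to_target F) (int_module (T_grp F))"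

subsection \<open>\<open>U\<close>, the two maps out of it, and the pushout\<close>

definition U_mod ::
  "('c, 'q, 'r, 'p, 'b, 'n) factorization
    \<Rightarrow> (('r, 'b) RB_elem, ('r, 'p, 'b, 'n) U_elem) module" where
  "U_mod F = base_change (ZPN F) (RB F) (ZPN_to_RB F) (J_mod F)"

definition U_to_I ::
  "('c, 'q, 'r, 'p, 'b, 'n) factorization \<Rightarrow> ('r, 'p, 'b, 'n) U_elem \<Rightarrow> ('r, 'b) RB_elem" where
  "U_to_I F = symbol_lift (I_mod F) (\<lambda>z j. z \<otimes>\<^bsub>RB F\<^esub> ZPN_to_RB F j)"

text \<open>
  The differences \<open>x - y\<close> below generate \<open>J\<close> as an abelian group, so the additive map is
  determined by its values on them.
\<close>

definition J_to_BT ::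
  "('c, 'q, 'r, 'p, 'b, 'n) factorization \<Rightarrow> (('p, 'n) PN_elem \<Rightarrow>\<^sub>0 int) \<Rightarrow> ('p, 'b, 'n) BT_elem" where
  "J_to_BT F = (THE f. f \<in> hom (add_monoid (J_mod F)) (add_monoid (BT_mod F)) \<and>
     f \<in> extensional (J_set F) \<and>
     (\<forall>x\<in>carrier (PN F). \<forall>y\<in>carrier (PN F). PN_proj F x = PN_proj F y \<longrightarrow>
        f (frag_of x - frag_of y) =
          BT_tensor F (chart (target F) (PN_proj F y)) (gp_frac (PN F) x y)))"

definition U_to_BT ::
  "('c, 'q, 'r, 'p, 'b, 'n) factorization \<Rightarrow> ('r, 'p, 'b, 'n) U_elem \<Rightarrow> ('p, 'b, 'n) BT_elem" where
  "U_to_BT F = symbol_lift (BT_mod F) (\<lambda>z j. RB_proj F z \<odot>\<^bsub>BT_mod F\<^esub> J_to_BT F j)"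

definition D1_mod ::
  "('c, 'q, 'r, 'p, 'b, 'n) factorization
    \<Rightarrow> (('r, 'b) RB_elem, ('r, 'p, 'b, 'n) D1_elem) module" where
  "D1_mod F = pushout_module (U_mod F) (I_mod F) (restrict_scalars (RB_proj F) (BT_mod F))
     (U_to_I F) (U_to_BT F)"

definition D1_class ::
  "('c, 'q, 'r, 'p, 'b, 'n) factorization
    \<Rightarrow> ('r, 'b) RB_elem \<Rightarrow> ('p, 'b, 'n) BT_elem \<Rightarrow> ('r, 'p, 'b, 'n) D1_elem" where
  "D1_class F i t = pushout_class (U_mod F) (I_mod F) (restrict_scalars (RB_proj F) (BT_mod F))
     (U_to_I F) (U_to_BT F) (i, t)"

text \<open>Functoriality in the middle term, for a map \<open>k\<close> from the middle term of \<open>F\<close> to that of \<open>F'\<close>.\<close>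

definition RB_map ::
  "('c, 'q, 'r, 'p, 'b, 'n) factorization \<Rightarrow> ('r, 'p, 'r, 'p) prelog_map
    \<Rightarrow> ('r, 'b) RB_elem \<Rightarrow> ('r, 'b) RB_elem" where
  "RB_map F' k = symbol_lift (RB F') (\<lambda>r b. RB_tensor F' (fst k r) b)"

definition PN_map ::
  "('c, 'q, 'r, 'p, 'b, 'n) factorization \<Rightarrow> ('r, 'p, 'r, 'p) prelog_map
    \<Rightarrow> ('p, 'n) PN_elem \<Rightarrow> ('p, 'n) PN_elem" where
  "PN_map F' k V = (\<Union>(p, n)\<in>V. PN_class F' (snd k p) n)"

definition BT_map ::
  "('c, 'q, 'r, 'p, 'b, 'n) factorization \<Rightarrow> ('r, 'p, 'r, 'p) prelog_map
    \<Rightarrow> ('p, 'b, 'n) BT_elem \<Rightarrow> ('p, 'b, 'n) BT_elem" where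
  "BT_map F' k = symbol_lift (BT_mod F') (\<lambda>b t. BT_tensor F' b (gp_map (PN F') (PN_map F' k) t))"

definition D1_map ::
  "('c, 'q, 'r, 'p, 'b, 'n) factorization \<Rightarrow> ('r, 'p, 'r, 'p) prelog_map
    \<Rightarrow> ('r, 'p, 'b, 'n) D1_elem \<Rightarrow> ('r, 'p, 'b, 'n) D1_elem" where
  "D1_map F' k Z = (\<Union>(i, t)\<in>Z. D1_class F' (RB_map F' k i) (BT_map F' k t))"

text \<open>In degree \<open>n\<close> this is a module over \<open>R\<^sub>n \<otimes>\<^sub>C B\<close>.\<close>

definition D1 ::
  "('c, 'q) prelog \<Rightarrow> ('b, 'n) prelog \<Rightarrow> ('r, 'p) sprelog
    \<Rightarrow> (nat \<Rightarrow> ('c, 'q, 'r, 'p) prelog_map) \<Rightarrow> (nat \<Rightarrow> ('r, 'p, 'b, 'n) prelog_map)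
    \<Rightarrow> (('r, 'b) RB_elem, ('r, 'p, 'b, 'n) D1_elem) smodule" where
  "D1 A B S \<eta> \<epsilon> = \<lparr>obj = (\<lambda>n. D1_mod (degreewise A B S \<eta> \<epsilon> n)),
     face = (\<lambda>n i. D1_map (degreewise A B S \<eta> \<epsilon> (n - 1)) (face S n i)),
     degen = (\<lambda>n i. D1_map (degreewise A B S \<eta> \<epsilon> (n + 1)) (degen S n i))\<rparr>"

text \<open>The underlying simplicial \<open>B\<close>-module, along \<open>B \<rightarrow> R\<^sub>n \<otimes>\<^sub>C B\<close>, \<open>b \<mapsto> 1 \<otimes> b\<close>.\<close>

definition D1_over_B ::
  "('c, 'q) prelog \<Rightarrow> ('b, 'n) prelog \<Rightarrow> ('r, 'p) sprelog
    \<Rightarrow> (nat \<Rightarrow> ('c, 'q, 'r, 'p) prelog_map) \<Rightarrow> (nat \<Rightarrow> ('r, 'p, 'b, 'n) prelog_map)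
    \<Rightarrow> ('b, ('r, 'p, 'b, 'n) D1_elem) smodule" where
  "D1_over_B A B S \<eta> \<epsilon> = \<lparr>obj = (\<lambda>n. restrict_scalars
       (RB_tensor (degreewise A B S \<eta> \<epsilon> n) \<one>\<^bsub>ring_of (obj S n)\<^esub>) (obj (D1 A B S \<eta> \<epsilon>) n)),
     face = face (D1 A B S \<eta> \<epsilon>), degen = degen (D1 A B S \<eta> \<epsilon>)\<rparr>"

section \<open>Gabber's logarithmic cotangent complex\<close>

type_synonym ('r, 'b) BOm_elem = "('b \<times> ('r \<times> 'r \<Rightarrow>\<^sub>0 int) set \<Rightarrow>\<^sub>0 int) set"
type_synonym ('p, 'b) BG_elem = "('b \<times> ('p \<times> 'p) set set \<Rightarrow>\<^sub>0 int) set"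
type_synonym ('r, 'p, 'b) L_elem = "(('r, 'b) BOm_elem \<times> ('p, 'b) BG_elem) set"

definition ZP_to_R :: "('c, 'q, 'r, 'p, 'b, 'n) factorization \<Rightarrow> ('p \<Rightarrow>\<^sub>0 int) \<Rightarrow> 'r" where
  "ZP_to_R F = frag_lift (add_monoid (Rr F)) (chart (middle F))"

definition bar_h :: "('c, 'q, 'r, 'p, 'b, 'n) factorization \<Rightarrow> 'p \<Rightarrow> 'b" where
  "bar_h F p = chart (target F) (snd (proj F) p)"

definition ZP_to_B :: "('c, 'q, 'r, 'p, 'b, 'n) factorization \<Rightarrow> ('p \<Rightarrow>\<^sub>0 int) \<Rightarrow> 'b" where
  "ZP_to_B F = frag_lift (add_monoid (Br F)) (bar_h F)"

definition BOmR_mod :: "('c, 'q, 'r, 'p, 'b, 'n) factorization \<Rightarrow> ('b, ('r, 'b) BOm_elem) module" where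
  "BOmR_mod F = base_change (Rr F) (Br F) (fst (proj F)) (differentials (Cr F) (Rr F) (fst (incl F)))"

definition BOmR_tensor ::
  "('c, 'q, 'r, 'p, 'b, 'n) factorization \<Rightarrow> 'b \<Rightarrow> ('r \<times> 'r \<Rightarrow>\<^sub>0 int) set \<Rightarrow> ('r, 'b) BOm_elem" where
  "BOmR_tensor F =
     pure_tensor (Rr F) (Br F) (fst (proj F)) (differentials (Cr F) (Rr F) (fst (incl F)))"

definition BOmP_mod ::
  "('c, 'q, 'r, 'p, 'b, 'n) factorization \<Rightarrow> ('b, ('p \<Rightarrow>\<^sub>0 int, 'b) BOm_elem) module" where
  "BOmP_mod F = base_change (monoid_ring (Pm F)) (Br F) (ZP_to_B F)
     (differentials (monoid_ring (Qm F)) (monoid_ring (Pm F)) (monoid_ring_map (snd (incl F))))"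

definition Pgp_mod_Qgp :: "('c, 'q, 'r, 'p, 'b, 'n) factorization \<Rightarrow> ('p \<times> 'p) set set monoid" where
  "Pgp_mod_Qgp F = gp (Pm F) Mod (gp_map (Pm F) (snd (incl F)) ` carrier (gp (Qm F)))"

definition bar_p :: "('c, 'q, 'r, 'p, 'b, 'n) factorization \<Rightarrow> 'p \<Rightarrow> ('p \<times> 'p) set set" where
  "bar_p F p = (gp_map (Pm F) (snd (incl F)) ` carrier (gp (Qm F)))
     #>\<^bsub>gp (Pm F)\<^esub> gp_frac (Pm F) p \<one>\<^bsub>Pm F\<^esub>"

definition BG_mod :: "('c, 'q, 'r, 'p, 'b, 'n) factorization \<Rightarrow> ('b, ('p, 'b) BG_elem) module" where
  "BG_mod F = base_change \<Z> (Br F) (int_to_target F) (int_module (Pgp_mod_Qgp F))"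

definition BG_tensor ::
  "('c, 'q, 'r, 'p, 'b, 'n) factorization \<Rightarrow> 'b \<Rightarrow> ('p \<times> 'p) set set \<Rightarrow> ('p, 'b) BG_elem" where
  "BG_tensor F = pure_tensor \<Z> (Br F) (int_to_target F) (int_module (Pgp_mod_Qgp F))"

text \<open>\<open>b \<otimes> z dx \<mapsto> b \<otimes> \<alpha>(z) d\<alpha>(x)\<close>, with \<open>\<alpha> : \<int>[P] \<rightarrow> R\<close>.\<close>

definition BOmP_to_BOmR ::
  "('c, 'q, 'r, 'p, 'b, 'n) factorization \<Rightarrow> ('p \<Rightarrow>\<^sub>0 int, 'b) BOm_elem \<Rightarrow> ('r, 'b) BOm_elem" where
  "BOmP_to_BOmR F =
    (let \<Omega> = differentials (Cr F) (Rr F) (fst (incl F));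
         \<kappa> = symbol_lift \<Omega> (\<lambda>z x. ZP_to_R F z \<odot>\<^bsub>\<Omega>\<^esub>
               differential (Cr F) (Rr F) (fst (incl F)) (ZP_to_R F x))
     in symbol_lift (BOmR_mod F) (\<lambda>b w. BOmR_tensor F b (\<kappa> w)))"

text \<open>
  \<open>b \<otimes> dp \<mapsto> b \<cdot> bar_h p \<otimes> bar_p p\<close>: the additive map \<open>D\<close> on \<open>\<int>[P]\<close> with
  \<open>D p = bar_h p \<otimes> bar_p p\<close> is a derivation, and \<open>b \<otimes> z dx\<close> goes to \<open>b \<cdot> z \<cdot> D x\<close>.
\<close>

definition BOmP_to_BG ::
  "('c, 'q, 'r, 'p, 'b, 'n) factorization \<Rightarrow> ('p \<Rightarrow>\<^sub>0 int, 'b) BOm_elem \<Rightarrow> ('p, 'b) BG_elem" where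
  "BOmP_to_BG F =
    (let D = frag_lift (add_monoid (BG_mod F)) (\<lambda>p. BG_tensor F (bar_h F p) (bar_p F p));
         \<gamma> = symbol_lift (BG_mod F) (\<lambda>z x. ZP_to_B F z \<odot>\<^bsub>BG_mod F\<^esub> D x)
     in symbol_lift (BG_mod F) (\<lambda>b w. b \<odot>\<^bsub>BG_mod F\<^esub> \<gamma> w))"

definition L_mod :: "('c, 'q, 'r, 'p, 'b, 'n) factorization \<Rightarrow> ('b, ('r, 'p, 'b) L_elem) module" where
  "L_mod F = pushout_module (BOmP_mod F) (BOmR_mod F) (BG_mod F) (BOmP_to_BOmR F) (BOmP_to_BG F)"

definition L_class ::
  "('c, 'q, 'r, 'p, 'b, 'n) factorization \<Rightarrow> ('r, 'b) BOm_elem \<Rightarrow> ('p, 'b) BG_elem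
    \<Rightarrow> ('r, 'p, 'b) L_elem" where
  "L_class F w t = pushout_class (BOmP_mod F) (BOmR_mod F) (BG_mod F)
     (BOmP_to_BOmR F) (BOmP_to_BG F) (w, t)"

definition BOmR_map ::
  "('c, 'q, 'r, 'p, 'b, 'n) factorization \<Rightarrow> ('r, 'p, 'r, 'p) prelog_map
    \<Rightarrow> ('r, 'b) BOm_elem \<Rightarrow> ('r, 'b) BOm_elem" where
  "BOmR_map F' k =
    (let \<Omega>' = differentials (Cr F') (Rr F') (fst (incl F'));
         \<kappa> = symbol_lift \<Omega>' (\<lambda>r x. fst k r \<odot>\<^bsub>\<Omega>'\<^esub>
               differential (Cr F') (Rr F') (fst (incl F')) (fst k x))
     in symbol_lift (BOmR_mod F') (\<lambda>b w. BOmR_tensor F' b (\<kappa> w)))"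

definition Pgp_mod_Qgp_map ::
  "('c, 'q, 'r, 'p, 'b, 'n) factorization \<Rightarrow> ('r, 'p, 'r, 'p) prelog_map
    \<Rightarrow> ('p \<times> 'p) set set \<Rightarrow> ('p \<times> 'p) set set" where
  "Pgp_mod_Qgp_map F' k Z = (\<Union>V\<in>Z. (gp_map (Pm F') (snd (incl F')) ` carrier (gp (Qm F')))
     #>\<^bsub>gp (Pm F')\<^esub> gp_map (Pm F') (snd k) V)"

definition BG_map ::
  "('c, 'q, 'r, 'p, 'b, 'n) factorization \<Rightarrow> ('r, 'p, 'r, 'p) prelog_map
    \<Rightarrow> ('p, 'b) BG_elem \<Rightarrow> ('p, 'b) BG_elem" where
  "BG_map F' k = symbol_lift (BG_mod F') (\<lambda>b t. BG_tensor F' b (Pgp_mod_Qgp_map F' k t))"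

definition L_map ::
  "('c, 'q, 'r, 'p, 'b, 'n) factorization \<Rightarrow> ('r, 'p, 'r, 'p) prelog_map
    \<Rightarrow> ('r, 'p, 'b) L_elem \<Rightarrow> ('r, 'p, 'b) L_elem" where
  "L_map F' k Z = (\<Union>(w, t)\<in>Z. L_class F' (BOmR_map F' k w) (BG_map F' k t))"

definition log_cotangent ::
  "('c, 'q) prelog \<Rightarrow> ('b, 'n) prelog \<Rightarrow> ('r, 'p) sprelog
    \<Rightarrow> (nat \<Rightarrow> ('c, 'q, 'r, 'p) prelog_map) \<Rightarrow> (nat \<Rightarrow> ('r, 'p, 'b, 'n) prelog_map)
    \<Rightarrow> ('b, ('r, 'p, 'b) L_elem) smodule" where
  "log_cotangent A B S \<eta> \<epsilon> = \<lparr>obj = (\<lambda>n. L_mod (degreewise A B S \<eta> \<epsilon> n)),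
     face = (\<lambda>n i. L_map (degreewise A B S \<eta> \<epsilon> (n - 1)) (face S n i)),
     degen = (\<lambda>n i. L_map (degreewise A B S \<eta> \<epsilon> (n + 1)) (degen S n i))\<rparr>"

section \<open>Homology\<close>

definition boundary :: "('a, 'm) smodule \<Rightarrow> nat \<Rightarrow> 'm \<Rightarrow> 'm" where
  "boundary M n x = finsum (obj M (n - 1))
     (\<lambda>i. if even i then face M n i x else \<ominus>\<^bsub>obj M (n - 1)\<^esub> face M n i x) {..n}"

definition cycles :: "('a, 'm) smodule \<Rightarrow> nat \<Rightarrow> 'm set" where
  "cycles M n = (if n = 0 then carrier (obj M 0)
     else {x \<in> carrier (obj M n). boundary M n x = \<zero>\<^bsub>obj M (n - 1)\<^esub>})"

definition homology :: "('a, 'm) smodule \<Rightarrow> nat \<Rightarrow> ('a, 'm set) module" where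
  "homology M n = subquot_module (obj M n) (cycles M n) (boundary M (n + 1) ` carrier (obj M (n + 1)))"

section \<open>First quadrant spectral sequences\<close>

text \<open>
  Pages start at \<open>r = 2\<close>, and \<open>d r p q : E r p q \<rightarrow> E r (p - r) (q + r - 1)\<close>.
\<close>

definition first_quadrant_spectral_sequence ::
  "('a, 'z) ring_scheme \<Rightarrow> (nat \<Rightarrow> int \<Rightarrow> int \<Rightarrow> ('a, 'e) module)
    \<Rightarrow> (nat \<Rightarrow> int \<Rightarrow> int \<Rightarrow> 'e \<Rightarrow> 'e) \<Rightarrow> bool" where
  "first_quadrant_spectral_sequence A E d \<longleftrightarrow> (\<forall>r\<ge>2. \<forall>p q.
     module A (E r p q) \<and>
     (p < 0 \<or> q < 0 \<longrightarrow> zero_module (E r p q)) \<and>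
     d r p q \<in> lin_maps A (E r p q) (E r (p - int r) (q + int r - 1)) \<and>
     (\<forall>x\<in>carrier (E r (p + int r) (q - int r + 1)).
        d r p q (d r (p + int r) (q - int r + 1) x) = \<zero>\<^bsub>E r (p - int r) (q + int r - 1)\<^esub>) \<and>
     module_iso A (E (r + 1) p q)
       (subquot_module (E r p q)
          {x \<in> carrier (E r p q). d r p q x = \<zero>\<^bsub>E r (p - int r) (q + int r - 1)\<^esub>}
          (d r (p + int r) (q - int r + 1) ` carrier (E r (p + int r) (q - int r + 1)))))"

text \<open>
  Convergence: \<open>H n\<close> has a finite filtration by submodules whose graded pieces are the
  \<open>E\<^sup>\<infinity>\<close>-terms.  In the first quadrant all differentials from and to \<open>E r p q\<close> vanish for
  \<open>r > p\<close> and \<open>r > q + 1\<close>, so \<open>E\<^sup>\<infinity>\<close> at \<open>(p, q)\<close> is \<open>E r p q\<close> for such \<open>r\<close>.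
\<close>

definition converges_to ::
  "('a, 'z) ring_scheme \<Rightarrow> (nat \<Rightarrow> int \<Rightarrow> int \<Rightarrow> ('a, 'e) module) \<Rightarrow> (nat \<Rightarrow> ('a, 'h) module) \<Rightarrow> bool" where
  "converges_to A E H \<longleftrightarrow> (\<forall>n. \<exists>\<Phi> :: int \<Rightarrow> 'h set.
     (\<forall>p. submodule (\<Phi> p) A (H n)) \<and>
     (\<forall>p. \<Phi> (p - 1) \<subseteq> \<Phi> p) \<and>
     (\<forall>p<0. \<Phi> p = {\<zero>\<^bsub>H n\<^esub>}) \<and>
     (\<forall>p\<ge>int n. \<Phi> p = carrier (H n)) \<and>
     (\<forall>p q r. 0 \<le> p \<longrightarrow> 0 \<le> q \<longrightarrow> p + q = int n \<longrightarrow> 2 \<le> r \<longrightarrow> p < int r \<longrightarrow> q + 1 < int r \<longrightarrow>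
        module_iso A (E r p q) (subquot_module (H n) (\<Phi> p) (\<Phi> (p - 1)))))"

end

theory Submission
  imports Defs
begin

text \<open>
  The proof compares \<open>D\<^sup>1\<close> with the cotangent complex \<open>\<bbbL>\<close> by a \<open>B\<close>-linear map \<open>g : D\<^sup>1 \<rightarrow> \<bbbL>\<close> that
  commutes with the faces, and reads off the spectral sequence from the kernel of \<open>g\<close>.

  In one simplicial degree, the map \<open>R \<otimes>\<^sub>C B \<rightarrow> B \<otimes>\<^sub>R \<Omega>\<close>, \<open>r \<otimes> b \<mapsto> b \<otimes> dr\<close>, is a derivation.  On the
  augmentation ideal \<open>I\<close> it is therefore linear and vanishes on \<open>I\<^sup>2\<close>.  Together with the map
  \<open>T \<rightarrow> P\<^sup>g\<^sup>p / Q\<^sup>g\<^sup>p\<close>, \<open>(p, n) \<mapsto> p\<close>, it respects the relations of the two pushouts and defines \<open>g\<close>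
  (\<open>D1_to_L\<close>).  This map hits the generators of \<open>\<bbbL>\<close> (\<open>D1_to_L_surj\<close>).  Conversely \<open>r \<mapsto> r \<otimes> 1 - 1 \<otimes> \<epsilon>(r)\<close>
  is a derivation modulo \<open>I\<^sup>2\<close>, which gives an inverse of \<open>g\<close> modulo \<open>I\<^sup>2\<close>: the kernel of \<open>g\<close> is the image
  of \<open>I\<^sup>2\<close> in \<open>D\<^sup>1\<close> (\<open>D1_to_L_kernel\<close>, \<open>D1_to_L_product\<close>).

  Let \<open>K\<close> be the kernel of \<open>g\<close>, a subcomplex of \<open>D\<^sup>1\<close>.  In degree \<open>0\<close> already \<open>D\<^sup>1\<close> is zero, because \<open>R\<^sub>0 = C\<close>
  and \<open>P\<^sub>0 = Q\<close> (\<open>D_zero\<close>).  In degree \<open>1\<close>, for \<open>a\<close> and \<open>b\<close> in \<open>I\<close> the product \<open>a b\<close> is up to sign the boundary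
  of \<open>s\<^sub>0 a \<cdot> s\<^sub>1 b\<close>, since the other two faces of this element have a factor that comes from degree \<open>0\<close>
  (\<open>product_boundary\<close>).  Hence \<open>H\<^sub>0(K) = H\<^sub>1(K) = 0\<close> (\<open>kernel_1\<close>).

  The spectral sequence is that of the filtration of \<open>D\<^sup>1\<close> with the two steps \<open>K\<close> and \<open>D\<^sup>1\<close>, that is, the long
  exact sequence of \<open>K \<rightarrow> D\<^sup>1 \<rightarrow> \<bbbL>\<close>, indexed as follows: \<open>E\<^sup>2\<close> is \<open>H\<^sub>p\<^sub>+\<^sub>1(\<bbbL>)\<close> at \<open>(p, 1)\<close>, it is \<open>H\<^sub>q(K)\<close> at \<open>(0, q)\<close>
  with \<open>q \<ge> 2\<close>, and it is zero elsewhere.  Nothing is lost with \<open>H\<^sub>0(K)\<close> and \<open>H\<^sub>1(K)\<close>, and \<open>H\<^sub>0(\<bbbL>)\<close> is zero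
  like \<open>D\<^sup>1\<close> in degree \<open>0\<close>.  The connecting homomorphism \<open>H\<^sub>r\<^sub>+\<^sub>1(\<bbbL>) \<rightarrow> H\<^sub>r(K)\<close> then goes from \<open>(r, 1)\<close> to
  \<open>(0, r)\<close> and is the only differential on page \<open>r\<close>.  What survives in total degree \<open>n\<close> is the kernel of the
  connecting homomorphism on \<open>H\<^sub>n(\<bbbL>)\<close> and the cokernel of the one into \<open>H\<^sub>n(K)\<close>, which are a quotient and
  a submodule of \<open>H\<^sub>n(D\<^sup>1)\<close> (\<open>chain_surjection.spectral_sequence\<close>).

  The tensor products, differentials, group completions and amalgamated sums are given by symbols
  and relations or by classes of pairs.  The first sections provide their universal properties;
  after that, identities between additive maps are only checked on generators.
\<close>


section \<open>Additive maps, quotients and pushouts\<close>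

abbreviation addhom :: "('a, 'y) ring_scheme \<Rightarrow> ('b, 'z) ring_scheme \<Rightarrow> ('a \<Rightarrow> 'b) set" where
  "addhom M N \<equiv> hom (add_monoid M) (add_monoid N)"

lemma addhomI:
  assumes "\<And>x. x \<in> carrier M \<Longrightarrow> f x \<in> carrier N"
    and "\<And>x y. x \<in> carrier M \<Longrightarrow> y \<in> carrier M \<Longrightarrow> f (x \<oplus>\<^bsub>M\<^esub> y) = f x \<oplus>\<^bsub>N\<^esub> f y"
  shows "f \<in> addhom M N"
  using assms by (auto simp: hom_def)

lemma addhom_closed: "f \<in> addhom M N \<Longrightarrow> x \<in> carrier M \<Longrightarrow> f x \<in> carrier N"
  by (auto simp: hom_def)

lemma addhom_add:
  "f \<in> addhom M N \<Longrightarrow> x \<in> carrier M \<Longrightarrow> y \<in> carrier M \<Longrightarrow> f (x \<oplus>\<^bsub>M\<^esub> y) = f x \<oplus>\<^bsub>N\<^esub> f y"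
  by (auto simp: hom_def)

lemma addhom_group_hom:
  "f \<in> addhom M N \<Longrightarrow> abelian_group M \<Longrightarrow> abelian_group N \<Longrightarrow> group_hom (add_monoid M) (add_monoid N) f"
  by (simp add: group_hom_def group_hom_axioms_def abelian_group.a_group)

lemma addhom_zero:
  "f \<in> addhom M N \<Longrightarrow> abelian_group M \<Longrightarrow> abelian_group N \<Longrightarrow> f \<zero>\<^bsub>M\<^esub> = \<zero>\<^bsub>N\<^esub>"
  using group_hom.hom_one[OF addhom_group_hom, of f M N] by simp

lemma addhom_neg:
  "f \<in> addhom M N \<Longrightarrow> abelian_group M \<Longrightarrow> abelian_group N \<Longrightarrow> x \<in> carrier M
    \<Longrightarrow> f (\<ominus>\<^bsub>M\<^esub> x) = \<ominus>\<^bsub>N\<^esub> f x"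
  using group_hom.hom_inv[OF addhom_group_hom, of f M N x] by (simp add: a_inv_def)

lemma addhom_diff:
  "f \<in> addhom M N \<Longrightarrow> abelian_group M \<Longrightarrow> abelian_group N \<Longrightarrow> x \<in> carrier M \<Longrightarrow> y \<in> carrier M
    \<Longrightarrow> f (x \<ominus>\<^bsub>M\<^esub> y) = f x \<ominus>\<^bsub>N\<^esub> f y"
  by (simp add: a_minus_def addhom_add addhom_neg addhom_closed abelian_group.a_inv_closed)

lemma addhom_comp:
  "f \<in> addhom M N \<Longrightarrow> g \<in> addhom N P \<Longrightarrow> (\<lambda>x. g (f x)) \<in> addhom M P"
  by (intro addhomI) (simp_all add: addhom_closed addhom_add)

lemma addhom_plus:
  assumes "abelian_group N" "f \<in> addhom M N" "g \<in> addhom M N"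
  shows "(\<lambda>x. f x \<oplus>\<^bsub>N\<^esub> g x) \<in> addhom M N"
proof -
  interpret N: abelian_group N by fact
  show ?thesis
    using assms by (intro addhomI) (auto simp: addhom_closed addhom_add N.a_ac)
qed

lemma addhom_uminus:
  assumes "abelian_group N" "f \<in> addhom M N"
  shows "(\<lambda>x. \<ominus>\<^bsub>N\<^esub> f x) \<in> addhom M N"
proof -
  interpret N: abelian_group N by fact
  show ?thesis
    using assms by (intro addhomI) (auto simp: addhom_closed addhom_add N.minus_add)
qed

lemma addhom_const_zero: "abelian_group N \<Longrightarrow> (\<lambda>x. \<zero>\<^bsub>N\<^esub>) \<in> addhom M N"
  by (intro addhomI) (simp_all add: abelian_group.axioms(1) abelian_monoid.zero_closed abelian_monoid.l_zero)

lemma (in abelian_group) four_diff: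
  assumes "a \<in> carrier G" "b \<in> carrier G" "c \<in> carrier G" "d \<in> carrier G"
  shows "(a \<oplus> b) \<ominus> (c \<oplus> d) = (a \<ominus> c) \<oplus> (b \<ominus> d)"
  using assms by (simp add: a_minus_def minus_add a_ac)

lemma (in abelian_group) diff_zero_iff:
  assumes "a \<in> carrier G" "b \<in> carrier G"
  shows "a \<ominus> b = \<zero> \<longleftrightarrow> a = b"
  using assms minus_equality[of a "\<ominus> b"] by (auto simp: a_minus_def r_neg)

subsection \<open>Groups viewed as modules\<close>

lemma mk_module_simps [simp]:
  "carrier (mk_module G act) = carrier G"
  "\<zero>\<^bsub>mk_module G act\<^esub> = \<one>\<^bsub>G\<^esub>"
  "(\<oplus>\<^bsub>mk_module G act\<^esub>) = (\<otimes>\<^bsub>G\<^esub>)"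
  "a \<odot>\<^bsub>mk_module G act\<^esub> x = act a x"
  by (simp_all add: mk_module_def)

lemma mk_module_a_inv [simp]: "\<ominus>\<^bsub>mk_module G act\<^esub> x = inv\<^bsub>G\<^esub> x"
  by (simp add: a_inv_def m_inv_def mk_module_def)

lemma hom_from_mk_module [simp]: "hom (add_monoid (mk_module G act)) E = hom G E"
  by (simp add: hom_def mk_module_def)

lemma hom_to_mk_module [simp]: "hom E (add_monoid (mk_module G act)) = hom E G"
  by (simp add: hom_def mk_module_def)

lemma abelian_group_mk_module: "comm_group G \<Longrightarrow> abelian_group (mk_module G act)"
proof -
  assume "comm_group G"
  then interpret comm_group G .
  show ?thesis
    by (rule abelian_groupI) (auto simp: m_ac intro: bexI[of _ "inv\<^bsub>G\<^esub> _"])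
qed

lemma restrict_scalars_simps [simp]:
  "carrier (restrict_scalars f M) = carrier M"
  "\<zero>\<^bsub>restrict_scalars f M\<^esub> = \<zero>\<^bsub>M\<^esub>"
  "(\<oplus>\<^bsub>restrict_scalars f M\<^esub>) = (\<oplus>\<^bsub>M\<^esub>)"
  "a \<odot>\<^bsub>restrict_scalars f M\<^esub> x = f a \<odot>\<^bsub>M\<^esub> x"
  "\<ominus>\<^bsub>restrict_scalars f M\<^esub> x = \<ominus>\<^bsub>M\<^esub> x"
  by (simp_all add: restrict_scalars_def) (simp_all add: a_inv_def)

lemma restrict_scalars_minus [simp]: "x \<ominus>\<^bsub>restrict_scalars f M\<^esub> y = x \<ominus>\<^bsub>M\<^esub> y"
  by (simp add: a_minus_def)

lemma restrict_scalars_hom [simp]: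
  "hom (add_monoid (restrict_scalars f M)) E = hom (add_monoid M) E"
  "hom E (add_monoid (restrict_scalars f M)) = hom E (add_monoid M)"
  by (simp_all only: restrict_scalars_def hom_from_mk_module hom_to_mk_module)

lemma restrict_scalars_abelian: "abelian_group M \<Longrightarrow> abelian_group (restrict_scalars f M)"
  unfolding restrict_scalars_def by (intro abelian_group_mk_module abelian_group.a_comm_group)

lemma module_restrict_scalars:
  assumes "module B M" "cring A" "f \<in> ring_hom A B"
  shows "module A (restrict_scalars f M)"
proof -
  interpret M: module B M by fact
  interpret A: cring A by fact
  show ?thesis
    using assms(3)
    by (intro moduleI restrict_scalars_abelian M.abelian_group_axioms A.is_cring)
       (auto simp: ring_hom_def M.smult_l_distr M.smult_r_distr M.smult_assoc1 Pi_iff)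
qed

lemma ring_as_module_simps [simp]:
  "carrier (ring_as_module R) = carrier R"
  "\<zero>\<^bsub>ring_as_module R\<^esub> = \<zero>\<^bsub>R\<^esub>"
  "(\<oplus>\<^bsub>ring_as_module R\<^esub>) = (\<oplus>\<^bsub>R\<^esub>)"
  "a \<odot>\<^bsub>ring_as_module R\<^esub> x = a \<otimes>\<^bsub>R\<^esub> x"
  "\<ominus>\<^bsub>ring_as_module R\<^esub> x = \<ominus>\<^bsub>R\<^esub> x"
  by (simp_all add: ring_as_module_def) (simp_all add: a_inv_def)

lemma module_ring_as_module: "cring R \<Longrightarrow> module R (ring_as_module R)"
proof -
  assume "cring R"
  then interpret cring R .
  have ab: "abelian_group (ring_as_module R)"
    unfolding ring_as_module_def by (intro abelian_group_mk_module a_comm_group)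
  show ?thesis
    by (intro moduleI ab is_cring) (auto simp: l_distr r_distr m_assoc)
qed

lemma int_module_simps [simp]:
  "carrier (int_module G) = carrier G"
  "\<zero>\<^bsub>int_module G\<^esub> = \<one>\<^bsub>G\<^esub>"
  "(\<oplus>\<^bsub>int_module G\<^esub>) = (\<otimes>\<^bsub>G\<^esub>)"
  "a \<odot>\<^bsub>int_module G\<^esub> x = x [^]\<^bsub>G\<^esub> a"
  "\<ominus>\<^bsub>int_module G\<^esub> x = inv\<^bsub>G\<^esub> x"
  by (simp_all add: int_module_def)

lemma int_module_hom [simp]:
  "hom (add_monoid (int_module G)) E = hom G E"
  "hom E (add_monoid (int_module G)) = hom E G"
  by (simp_all only: int_module_def hom_from_mk_module hom_to_mk_module)

lemma module_int_module: "comm_group G \<Longrightarrow> module \<Z> (int_module G)"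
proof -
  assume "comm_group G"
  then interpret comm_group G .
  have ab: "abelian_group (int_module G)"
    unfolding int_module_def by (intro abelian_group_mk_module comm_group_axioms)
  show ?thesis
  proof (rule moduleI[OF int_is_cring ab])
    fix a b :: int and x assume "x \<in> carrier (int_module G)"
    then have "x [^]\<^bsub>G\<^esub> (a * b) = (x [^]\<^bsub>G\<^esub> b) [^]\<^bsub>G\<^esub> a"
      using int_pow_pow[of x b a] by (simp add: mult.commute[of a b])
    then show "(a \<otimes>\<^bsub>\<Z>\<^esub> b) \<odot>\<^bsub>int_module G\<^esub> x = a \<odot>\<^bsub>int_module G\<^esub> (b \<odot>\<^bsub>int_module G\<^esub> x)"
      by simp
  qed (simp_all add: int_pow_mult int_pow_distrib)
qed

subsection \<open>Quotients\<close>

text \<open>Maps out of a quotient are written as unions over a coset; the union is over a single value.\<close>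

lemma UN_coset_const:
  assumes "x \<in> V" "\<And>y. y \<in> V \<Longrightarrow> F y = F x"
  shows "(\<Union>y\<in>V. F y) = F x"
proof -
  have "F ` V = {F x}" using assms by blast
  then show ?thesis by simp
qed

lemma FactGroup_mult_rcos:
  assumes "comm_group G" "subgroup K G" "x \<in> carrier G" "y \<in> carrier G"
  shows "(K #>\<^bsub>G\<^esub> x) \<otimes>\<^bsub>G Mod K\<^esub> (K #>\<^bsub>G\<^esub> y) = K #>\<^bsub>G\<^esub> (x \<otimes>\<^bsub>G\<^esub> y)"
proof -
  interpret normal K G using comm_group.subgroup_imp_normal[OF assms(1,2)] .
  show ?thesis using assms by (simp add: FactGroup_def rcos_sum)
qed

lemma FactGroup_carrier_rcos: "carrier (G Mod K) = (\<lambda>x. K #>\<^bsub>G\<^esub> x) ` carrier G"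
  by (auto simp: FactGroup_def RCOSETS_def)

lemma FactGroup_eq_iff:
  assumes "comm_group G" "subgroup K G" "x \<in> carrier G" "y \<in> carrier G"
  shows "K #>\<^bsub>G\<^esub> x = K #>\<^bsub>G\<^esub> y \<longleftrightarrow> x \<otimes>\<^bsub>G\<^esub> inv\<^bsub>G\<^esub> y \<in> K"
proof -
  interpret comm_group G by fact
  interpret K: subgroup K G by fact
  have "x \<in> K #>\<^bsub>G\<^esub> y \<longleftrightarrow> x \<otimes>\<^bsub>G\<^esub> inv\<^bsub>G\<^esub> y \<in> K"
    using K.rcos_module assms by auto
  moreover have "x \<in> K #>\<^bsub>G\<^esub> y \<longleftrightarrow> K #>\<^bsub>G\<^esub> x = K #>\<^bsub>G\<^esub> y"
    using assms by (metis rcos_self repr_independence)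
  ultimately show ?thesis by simp
qed

lemma FactGroup_one_iff:
  assumes "comm_group G" "subgroup K G" "x \<in> carrier G"
  shows "K #>\<^bsub>G\<^esub> x = \<one>\<^bsub>G Mod K\<^esub> \<longleftrightarrow> x \<in> K"
proof -
  interpret comm_group G by fact
  interpret K: subgroup K G by fact
  show ?thesis
    using FactGroup_eq_iff[OF assms(1-3), of "\<one>\<^bsub>G\<^esub>"] assms(3) by (simp add: coset_join3 K.subset coset_join2 K.subgroup_axioms one_FactGroup)
qed

lemma FactGroup_hom: "comm_group G \<Longrightarrow> subgroup K G \<Longrightarrow> (\<lambda>x. K #>\<^bsub>G\<^esub> x) \<in> hom G (G Mod K)"
  by (rule homI) (simp_all only: FactGroup_mult_rcos FactGroup_carrier_rcos imageI)

lemma FactGroup_comm_group: "comm_group G \<Longrightarrow> subgroup K G \<Longrightarrow> comm_group (G Mod K)"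
  by (rule comm_group.abelian_FactGroup)

lemma FactGroup_UN:
  assumes "comm_group G" "subgroup K G" "x \<in> carrier G"
    and "\<And>y. y \<in> carrier G \<Longrightarrow> y \<otimes>\<^bsub>G\<^esub> inv\<^bsub>G\<^esub> x \<in> K \<Longrightarrow> F y = F x"
  shows "(\<Union>y\<in>K #>\<^bsub>G\<^esub> x. F y) = F x"
proof (rule UN_coset_const)
  interpret comm_group G by fact
  interpret K: subgroup K G by fact
  show "x \<in> K #>\<^bsub>G\<^esub> x" using assms by (simp add: rcos_self)
  fix y assume y: "y \<in> K #>\<^bsub>G\<^esub> x"
  have yc: "y \<in> carrier G" using y assms r_coset_subset_G K.subset by blast
  moreover have "y \<otimes>\<^bsub>G\<^esub> inv\<^bsub>G\<^esub> x \<in> K" using y yc assms K.rcos_module by auto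
  ultimately show "F y = F x" using assms(4) by blast
qed

lemma a_r_coset_add_monoid: "K +>\<^bsub>M\<^esub> x = K #>\<^bsub>add_monoid M\<^esub> x"
  by (simp add: a_r_coset_def)

text \<open>
  The additive part of the theory of \<^const>\<open>quot_module\<close>.  It is kept apart from the scalar action
  because the maps below are first shown to be additive, and linear only afterwards, on generators.
\<close>

locale module_quotient = abelian_group M for M :: "('a, 'm) module" (structure) +
  fixes K
  assumes K: "subgroup K (add_monoid M)"
begin

lemma K_closed: "x \<in> K \<Longrightarrow> x \<in> carrier M"
  using subgroup.mem_carrier[OF K] by simp
lemma K_zero: "\<zero> \<in> K"
  using subgroup.one_closed[OF K] by simp
lemma K_add: "x \<in> K \<Longrightarrow> y \<in> K \<Longrightarrow> x \<oplus> y \<in> K"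
  using subgroup.m_closed[OF K] by simp
lemma K_neg: "x \<in> K \<Longrightarrow> \<ominus> x \<in> K"
  using subgroup.m_inv_closed[OF K] by (simp add: a_inv_def)
lemma K_diff: "x \<in> K \<Longrightarrow> y \<in> K \<Longrightarrow> x \<ominus> y \<in> K"
  by (simp add: a_minus_def K_add K_neg)

lemma quot_carrier: "carrier (quot_module M K) = (\<lambda>x. K +> x) ` carrier M"
  by (simp add: quot_module_def FactGroup_carrier_rcos a_r_coset_add_monoid)

lemma quot_closed: "x \<in> carrier M \<Longrightarrow> K +> x \<in> carrier (quot_module M K)"
  by (simp add: quot_carrier)

lemma quot_add: "x \<in> carrier M \<Longrightarrow> y \<in> carrier M \<Longrightarrow>
    (K +> x) \<oplus>\<^bsub>quot_module M K\<^esub> (K +> y) = K +> (x \<oplus> y)"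
  using FactGroup_mult_rcos[OF a_comm_group K, of x y]
  by (simp add: quot_module_def a_r_coset_add_monoid)

lemma quot_hom: "(\<lambda>x. K +> x) \<in> addhom M (quot_module M K)"
  by (intro addhomI) (auto simp: quot_closed quot_add)

lemma quot_abelian: "abelian_group (quot_module M K)"
  unfolding quot_module_def
  by (intro abelian_group_mk_module FactGroup_comm_group a_comm_group K)

lemma quot_eq_iff: "x \<in> carrier M \<Longrightarrow> y \<in> carrier M \<Longrightarrow> K +> x = K +> y \<longleftrightarrow> x \<ominus> y \<in> K"
  using FactGroup_eq_iff[OF a_comm_group K, of x y]
  by (simp add: a_r_coset_add_monoid a_minus_def a_inv_def)

lemma quot_zero_iff: "x \<in> carrier M \<Longrightarrow> K +> x = \<zero>\<^bsub>quot_module M K\<^esub> \<longleftrightarrow> x \<in> K"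
  using FactGroup_one_iff[OF a_comm_group K, of x]
  by (simp add: a_r_coset_add_monoid quot_module_def)

lemma quot_UN:
  assumes "x \<in> carrier M" "\<And>y. y \<in> carrier M \<Longrightarrow> y \<ominus> x \<in> K \<Longrightarrow> F y = F x"
  shows "(\<Union>y\<in>K +> x. F y) = F x"
  unfolding a_r_coset_add_monoid using assms
  by (intro FactGroup_UN[OF a_comm_group K]) (auto simp: a_minus_def a_inv_def)

lemma quot_smult:
  assumes "x \<in> carrier M" "(\<lambda>x. a \<odot> x) \<in> addhom M M" "\<And>x. x \<in> K \<Longrightarrow> a \<odot> x \<in> K"
  shows "a \<odot>\<^bsub>quot_module M K\<^esub> (K +> x) = K +> (a \<odot> x)"
proof -
  have "(\<Union>y\<in>K +> x. K +> (a \<odot> y)) = K +> (a \<odot> x)"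
  proof (rule quot_UN)
    fix y assume y: "y \<in> carrier M" "y \<ominus> x \<in> K"
    have "a \<odot> y \<ominus> a \<odot> x = a \<odot> (y \<ominus> x)"
      using addhom_diff[OF assms(2) abelian_group_axioms abelian_group_axioms] y assms(1) by simp
    then show "K +> a \<odot> y = K +> a \<odot> x"
      using addhom_closed[OF assms(2)] y assms by (simp add: quot_eq_iff)
  qed fact
  then show ?thesis by (simp add: quot_module_def)
qed

text \<open>
  Functoriality of quotients, in the shape in which the maps between pushouts are given: a union
  over the coset of the classes of the images.
\<close>

lemma quot_map:
  assumes "module_quotient N K'" "F \<in> addhom M N" "\<And>x. x \<in> K \<Longrightarrow> F x \<in> K'" "x \<in> carrier M"
  shows "(\<Union>y\<in>K +> x. K' +>\<^bsub>N\<^esub> F y) = K' +>\<^bsub>N\<^esub> F x"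
proof (rule quot_UN)
  interpret N: module_quotient N K' by fact
  fix y assume y: "y \<in> carrier M" "y \<ominus> x \<in> K"
  have "F y \<ominus>\<^bsub>N\<^esub> F x = F (y \<ominus> x)"
    using addhom_diff[OF assms(2) abelian_group_axioms N.abelian_group_axioms] y assms(4) by simp
  then show "K' +>\<^bsub>N\<^esub> F y = K' +>\<^bsub>N\<^esub> F x"
    using addhom_closed[OF assms(2)] y assms by (simp add: N.quot_eq_iff)
qed fact

lemma quot_map_hom:
  assumes "module_quotient N K'" "F \<in> addhom M N" "\<And>x. x \<in> K \<Longrightarrow> F x \<in> K'"
  shows "(\<lambda>V. \<Union>y\<in>V. K' +>\<^bsub>N\<^esub> F y) \<in> addhom (quot_module M K) (quot_module N K')"
proof -
  interpret N: module_quotient N K' by fact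
  show ?thesis
  proof (rule addhomI)
    fix V W assume "V \<in> carrier (quot_module M K)" "W \<in> carrier (quot_module M K)"
    then obtain x y where "x \<in> carrier M" "V = K +> x" "y \<in> carrier M" "W = K +> y"
      by (auto simp: quot_carrier)
    then show "(\<Union>y\<in>V \<oplus>\<^bsub>quot_module M K\<^esub> W. K' +>\<^bsub>N\<^esub> F y) =
      (\<Union>y\<in>V. K' +>\<^bsub>N\<^esub> F y) \<oplus>\<^bsub>quot_module N K'\<^esub> (\<Union>y\<in>W. K' +>\<^bsub>N\<^esub> F y)"
      by (simp only: quot_add quot_map[OF assms] a_closed N.quot_add addhom_closed[OF assms(2)]
        addhom_add[OF assms(2)])
  next
    fix V assume "V \<in> carrier (quot_module M K)"
    then obtain x where "x \<in> carrier M" "V = K +> x"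
      by (auto simp: quot_carrier)
    then show "(\<Union>y\<in>V. K' +>\<^bsub>N\<^esub> F y) \<in> carrier (quot_module N K')"
      by (simp only: quot_map[OF assms] N.quot_closed addhom_closed[OF assms(2)])
  qed
qed

text \<open>For maps out of a quotient that arise from a universal property instead of a formula on cosets.\<close>

lemma quot_universal:
  assumes "abelian_group E" "F \<in> addhom M E" "\<And>x. x \<in> K \<Longrightarrow> F x = \<zero>\<^bsub>E\<^esub>"
  obtains G where "G \<in> addhom (quot_module M K) E" "\<And>x. x \<in> carrier M \<Longrightarrow> G (K +> x) = F x"
proof -
  interpret F: group_hom "add_monoid M" "add_monoid E" F
    by (rule addhom_group_hom[OF assms(2) abelian_group_axioms assms(1)])
  have "K \<subseteq> kernel (add_monoid M) (add_monoid E) F"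
    using K_closed assms(3) by (auto simp: kernel_def)
  then obtain G where "G \<in> hom (add_monoid M Mod K) (add_monoid E)"
    "\<And>x. x \<in> carrier M \<Longrightarrow> G (K #>\<^bsub>add_monoid M\<^esub> x) = F x"
    using F.FactGroup_universal_kernel[OF comm_group.subgroup_imp_normal[OF a_comm_group K]] by auto
  then show ?thesis
    by (intro that[of G]) (simp_all only: quot_module_def hom_from_mk_module a_r_coset_add_monoid)
qed

end

lemma submodule_subgroup: "submodule K A M \<Longrightarrow> subgroup K (add_monoid M)"
  by (auto simp: submodule_def)

lemma submodule_smult: "submodule K A M \<Longrightarrow> a \<in> carrier A \<Longrightarrow> x \<in> K \<Longrightarrow> a \<odot>\<^bsub>M\<^esub> x \<in> K"
  by (auto simp: submodule_def submodule_axioms_def)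

lemma submoduleI':
  assumes "subgroup K (add_monoid M)" "\<And>a x. a \<in> carrier A \<Longrightarrow> x \<in> K \<Longrightarrow> a \<odot>\<^bsub>M\<^esub> x \<in> K"
  shows "submodule K A M"
  using assms by (auto simp: submodule_def submodule_axioms_def)

lemma module_smult_hom: "module A M \<Longrightarrow> a \<in> carrier A \<Longrightarrow> (\<lambda>x. a \<odot>\<^bsub>M\<^esub> x) \<in> addhom M M"
  by (intro addhomI) (auto simp: module.smult_r_distr module.smult_closed)

lemma module_abelian: "module A M \<Longrightarrow> abelian_group M"
  by (simp add: module_def)

lemma submodule_quotient: "module A M \<Longrightarrow> submodule K A M \<Longrightarrow> module_quotient M K"
  by (simp add: module_quotient_def module_quotient_axioms_def module_abelian submodule_subgroup)

lemma quot_module_smult: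
  assumes "module A M" "submodule K A M" "a \<in> carrier A" "x \<in> carrier M"
  shows "a \<odot>\<^bsub>quot_module M K\<^esub> (K +>\<^bsub>M\<^esub> x) = K +>\<^bsub>M\<^esub> (a \<odot>\<^bsub>M\<^esub> x)"
  using assms by (intro module_quotient.quot_smult submodule_quotient[OF assms(1,2)] module_smult_hom submodule_smult)

lemma module_quot_module:
  assumes "module A M" "submodule K A M"
  shows "module A (quot_module M K)"
proof -
  interpret M: module A M by fact
  interpret Q: module_quotient M K by (rule submodule_quotient) fact+
  note qs = quot_module_smult[OF assms]
  show ?thesis
    by (intro moduleI Q.quot_abelian M.is_cring)
       (auto simp: Q.quot_carrier Q.quot_add qs M.smult_l_distr M.smult_r_distr M.smult_assoc1)
qed

lemma lin_mapsI:
  assumes "f \<in> addhom M N" "\<And>a x. a \<in> carrier A \<Longrightarrow> x \<in> carrier M \<Longrightarrow> f (a \<odot>\<^bsub>M\<^esub> x) = a \<odot>\<^bsub>N\<^esub> f x"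
  shows "f \<in> lin_maps A M N"
  using assms by (simp add: lin_maps_def)

lemma lin_maps_addhom: "f \<in> lin_maps A M N \<Longrightarrow> f \<in> addhom M N"
  by (simp add: lin_maps_def)

lemma lin_maps_smult:
  "f \<in> lin_maps A M N \<Longrightarrow> a \<in> carrier A \<Longrightarrow> x \<in> carrier M \<Longrightarrow> f (a \<odot>\<^bsub>M\<^esub> x) = a \<odot>\<^bsub>N\<^esub> f x"
  by (simp add: lin_maps_def)

subsection \<open>Direct sums and pushouts\<close>

lemma direct_sum_simps [simp]:
  "carrier (direct_sum M N) = carrier M \<times> carrier N"
  "\<zero>\<^bsub>direct_sum M N\<^esub> = (\<zero>\<^bsub>M\<^esub>, \<zero>\<^bsub>N\<^esub>)"
  "(x, y) \<oplus>\<^bsub>direct_sum M N\<^esub> (x', y') = (x \<oplus>\<^bsub>M\<^esub> x', y \<oplus>\<^bsub>N\<^esub> y')"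
  "a \<odot>\<^bsub>direct_sum M N\<^esub> (x, y) = (a \<odot>\<^bsub>M\<^esub> x, a \<odot>\<^bsub>N\<^esub> y)"
  by (simp_all add: direct_sum_def DirProd_def)

lemma comm_group_DirProd: "comm_group G \<Longrightarrow> comm_group H \<Longrightarrow> comm_group (G \<times>\<times> H)"
  by (intro group.group_comm_groupI DirProd_group)
     (auto simp: comm_group_def comm_monoid.m_comm)

lemma abelian_group_direct_sum:
  "abelian_group M \<Longrightarrow> abelian_group N \<Longrightarrow> abelian_group (direct_sum M N)"
  unfolding direct_sum_def
  by (intro abelian_group_mk_module comm_group_DirProd abelian_group.a_comm_group)

lemma direct_sum_neg:
  assumes "abelian_group M" "abelian_group N" "x \<in> carrier M" "y \<in> carrier N"
  shows "\<ominus>\<^bsub>direct_sum M N\<^esub> (x, y) = (\<ominus>\<^bsub>M\<^esub> x, \<ominus>\<^bsub>N\<^esub> y)"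
  using assms unfolding direct_sum_def mk_module_a_inv
  by (simp add: inv_DirProd abelian_group.a_group) (simp add: a_inv_def)

lemma direct_sum_diff:
  assumes "abelian_group M" "abelian_group N" "x \<in> carrier M" "y \<in> carrier N" "x' \<in> carrier M" "y' \<in> carrier N"
  shows "(x, y) \<ominus>\<^bsub>direct_sum M N\<^esub> (x', y') = (x \<ominus>\<^bsub>M\<^esub> x', y \<ominus>\<^bsub>N\<^esub> y')"
  using assms by (simp add: a_minus_def direct_sum_neg)

lemma module_direct_sum:
  assumes "module A M" "module A N"
  shows "module A (direct_sum M N)"
proof -
  interpret M: module A M by fact
  interpret N: module A N by fact
  show ?thesis
    by (intro moduleI abelian_group_direct_sum M.is_cring M.abelian_group_axioms N.abelian_group_axioms)
       (auto simp: M.smult_l_distr M.smult_r_distr M.smult_assoc1 N.smult_l_distr N.smult_r_distr N.smult_assoc1)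
qed

lemma addhom_pair:
  assumes "f \<in> addhom U M" "g \<in> addhom U N"
  shows "(\<lambda>u. (f u, g u)) \<in> addhom U (direct_sum M N)"
  using assms by (intro addhomI) (auto simp: addhom_closed addhom_add)

lemma addhom_on_pair:
  assumes "abelian_group E" "f \<in> addhom M E" "g \<in> addhom N E"
  shows "(\<lambda>(x, y). f x \<oplus>\<^bsub>E\<^esub> g y) \<in> addhom (direct_sum M N) E"
proof -
  interpret abelian_group E by fact
  show ?thesis
    using assms by (intro addhomI) (auto simp: addhom_closed addhom_add a_ac)
qed

lemma addhom_map_prod:
  assumes "f \<in> addhom M M'" "g \<in> addhom N N'"
  shows "(\<lambda>(x, y). (f x, g y)) \<in> addhom (direct_sum M N) (direct_sum M' N')"
  using assms by (intro addhomI) (auto simp: addhom_closed addhom_add)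

lemma pushout_rel_subgroup:
  assumes "abelian_group U" "abelian_group M" "abelian_group N" "f \<in> addhom U M" "g \<in> addhom U N"
  shows "subgroup (pushout_rel U M N f g) (add_monoid (direct_sum M N))"
proof -
  have h: "(\<lambda>u. (f u, \<ominus>\<^bsub>N\<^esub> g u)) \<in> addhom U (direct_sum M N)"
    by (intro addhom_pair addhom_uminus assms)
  interpret group_hom "add_monoid U" "add_monoid (direct_sum M N)" "\<lambda>u. (f u, \<ominus>\<^bsub>N\<^esub> g u)"
    by (intro addhom_group_hom h assms abelian_group_direct_sum)
  show ?thesis using img_is_subgroup by (simp add: pushout_rel_def)
qed

section \<open>Modules given by symbols and relations\<close>

text \<open>Enlarging the index set allows two elements of the free group to be added over a common support.\<close>

lemma frag_lift_superset:
  assumes "comm_group G" "finite T" "Poly_Mapping.keys c \<subseteq> T" "\<And>x. x \<in> T \<Longrightarrow> \<phi> x \<in> carrier G"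
  shows "frag_lift G \<phi> c = finprod G (\<lambda>x. \<phi> x [^]\<^bsub>G\<^esub> Poly_Mapping.lookup c x) T"
proof -
  interpret comm_group G by fact
  show ?thesis
    unfolding frag_lift_def using assms
    by (intro finprod_mono_neutral_cong_left) (auto simp: in_keys_iff)
qed

lemma frag_lift_hom:
  assumes "comm_group G" "\<And>x. x \<in> V \<Longrightarrow> \<phi> x \<in> carrier G"
  shows "frag_lift G \<phi> \<in> hom (free_Abelian_group V) G"
proof (rule homI)
  interpret comm_group G by fact
  fix c assume c: "c \<in> carrier (free_Abelian_group V)"
  then show "frag_lift G \<phi> c \<in> carrier G"
    unfolding frag_lift_def using assms(2) by (intro finprod_closed) auto
next
  interpret comm_group G by fact
  fix c d assume c: "c \<in> carrier (free_Abelian_group V)" "d \<in> carrier (free_Abelian_group V)"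
  let ?T = "Poly_Mapping.keys c \<union> Poly_Mapping.keys d"
  have T: "finite ?T" "?T \<subseteq> V" and \<phi>: "\<And>x. x \<in> ?T \<Longrightarrow> \<phi> x \<in> carrier G" using c assms(2) by auto
  have "frag_lift G \<phi> (c + d) =
      finprod G (\<lambda>x. \<phi> x [^]\<^bsub>G\<^esub> Poly_Mapping.lookup c x \<otimes>\<^bsub>G\<^esub> \<phi> x [^]\<^bsub>G\<^esub> Poly_Mapping.lookup d x) ?T"
    using frag_lift_superset[OF assms(1) T(1) Poly_Mapping.keys_add \<phi>]
    by (simp add: lookup_add)  (intro finprod_cong, auto simp: int_pow_mult \<phi> simp_implies_def)
  also have "\<dots> = finprod G (\<lambda>x. \<phi> x [^]\<^bsub>G\<^esub> Poly_Mapping.lookup c x) ?T \<otimes>\<^bsub>G\<^esub>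
      finprod G (\<lambda>x. \<phi> x [^]\<^bsub>G\<^esub> Poly_Mapping.lookup d x) ?T"
    using \<phi> by (intro finprod_multf) auto
  also have "\<dots> = frag_lift G \<phi> c \<otimes>\<^bsub>G\<^esub> frag_lift G \<phi> d"
    using frag_lift_superset[OF assms(1) T(1) _ \<phi>, of c] frag_lift_superset[OF assms(1) T(1) _ \<phi>, of d]
    by simp
  finally show "frag_lift G \<phi> (c \<otimes>\<^bsub>free_Abelian_group V\<^esub> d) = frag_lift G \<phi> c \<otimes>\<^bsub>G\<^esub> frag_lift G \<phi> d"
    by simp
qed

lemma frag_lift_of:
  assumes "comm_group G" "\<phi> x \<in> carrier G"
  shows "frag_lift G \<phi> (frag_of x) = \<phi> x"
proof -
  interpret comm_group G by fact
  show ?thesis using assms by (simp add: frag_lift_def)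
qed

text \<open>
  The group \<^const>\<open>free_Abelian_group\<close> is written multiplicatively although its elements are finitely
  supported functions; this locale restates what it means to be a homomorphism out of it in terms of
  \<open>+\<close>, \<open>-\<close> and supports.
\<close>

locale free_hom = N: abelian_group N for N :: "('n, 'z) ring_scheme" +
  fixes V :: "'x set" and F
  assumes F: "F \<in> hom (free_Abelian_group V) (add_monoid N)"
begin

sublocale gh: group_hom "free_Abelian_group V" "add_monoid N" F
  by (simp add: group_hom_def group_hom_axioms_def F N.a_group)

lemma closed: "Poly_Mapping.keys c \<subseteq> V \<Longrightarrow> F c \<in> carrier N"
  using gh.hom_closed[of c] by simp
lemma zero: "F 0 = \<zero>\<^bsub>N\<^esub>"
  using gh.hom_one by simp
lemma add: "Poly_Mapping.keys c \<subseteq> V \<Longrightarrow> Poly_Mapping.keys d \<subseteq> V \<Longrightarrow> F (c + d) = F c \<oplus>\<^bsub>N\<^esub> F d"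
  using gh.hom_mult[of c d] by simp
lemma neg: "Poly_Mapping.keys c \<subseteq> V \<Longrightarrow> F (- c) = \<ominus>\<^bsub>N\<^esub> F c"
  using gh.hom_inv[of c] by (simp add: a_inv_def)
lemma diff: "Poly_Mapping.keys c \<subseteq> V \<Longrightarrow> Poly_Mapping.keys d \<subseteq> V \<Longrightarrow> F (c - d) = F c \<ominus>\<^bsub>N\<^esub> F d"
  using add[of c "- d"] neg[of d] by (simp add: a_minus_def)

end

lemma free_hom_frag_lift:
  assumes "abelian_group N" "\<And>x. x \<in> V \<Longrightarrow> \<phi> x \<in> carrier N"
  shows "free_hom N V (frag_lift (add_monoid N) \<phi>)"
  using assms
  by (simp add: free_hom_def free_hom_axioms_def frag_lift_hom abelian_group.a_comm_group)

lemma keys_diff_subset: "Poly_Mapping.keys c \<subseteq> V \<Longrightarrow> Poly_Mapping.keys d \<subseteq> V \<Longrightarrow> Poly_Mapping.keys (c - d) \<subseteq> V"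
  using keys_diff[of c d] by auto

lemma keys_add_subset: "Poly_Mapping.keys c \<subseteq> V \<Longrightarrow> Poly_Mapping.keys d \<subseteq> V \<Longrightarrow> Poly_Mapping.keys (c + d) \<subseteq> V"
  using Poly_Mapping.keys_add[of c d] by auto

lemma keys_frag_extend_subset:
  "Poly_Mapping.keys c \<subseteq> V \<Longrightarrow> (\<And>x. x \<in> V \<Longrightarrow> Poly_Mapping.keys (f x) \<subseteq> W) \<Longrightarrow> Poly_Mapping.keys (frag_extend f c) \<subseteq> W"
  using keys_frag_extend[of f c] by blast

text \<open>The formula for the scalar action in \<^const>\<open>symbol_module\<close>, on representatives.\<close>

definition symbol_act :: "('s, 'z) ring_scheme \<Rightarrow> 's \<Rightarrow> ('s \<times> 'x \<Rightarrow>\<^sub>0 int) \<Rightarrow> ('s \<times> 'x \<Rightarrow>\<^sub>0 int)" where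
  "symbol_act S s = frag_extend (\<lambda>(s', x). frag_of (s \<otimes>\<^bsub>S\<^esub> s', x))"

lemma symbol_act_simps [simp]:
  "symbol_act S s 0 = 0"
  "symbol_act S s (frag_of (s', x)) = frag_of (s \<otimes>\<^bsub>S\<^esub> s', x)"
  "symbol_act S s (c - d) = symbol_act S s c - symbol_act S s d"
  "symbol_act S s (c + d) = symbol_act S s c + symbol_act S s d"
  "symbol_act S s (- c) = - symbol_act S s c"
  by (simp_all add: symbol_act_def frag_extend_diff frag_extend_add frag_extend_minus)

text \<open>Stability of \<open>K\<close> under the action is what makes the action on classes well defined.\<close>

locale symbols = S: cring S for S :: "('s, 'z) ring_scheme" +
  fixes V :: "'x set" and K :: "('s \<times> 'x \<Rightarrow>\<^sub>0 int) set"
  assumes K_keys: "c \<in> K \<Longrightarrow> Poly_Mapping.keys c \<subseteq> carrier S \<times> V"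
    and K_stable: "s \<in> carrier S \<Longrightarrow> c \<in> K \<Longrightarrow> symbol_act S s c \<in> K"
begin

abbreviation "FS \<equiv> free_Abelian_group (carrier S \<times> V)"
abbreviation "Rel \<equiv> symbol_relations S V K"
abbreviation "SM \<equiv> symbol_module S V K"
abbreviation "cls \<equiv> symbol_class S V K"

lemma comm_FS: "comm_group FS"
  by (rule abelian_free_Abelian_group)

lemma Rel_subgroup: "subgroup Rel FS"
  unfolding symbol_relations_def
proof (rule group.generate_is_subgroup[OF group_free_Abelian_group], safe)
  fix s s' x assume *: "s \<in> carrier S" "s' \<in> carrier S" "x \<in> V"
  show "frag_of (s \<oplus>\<^bsub>S\<^esub> s', x) - frag_of (s, x) - frag_of (s', x) \<in> carrier FS"
    using * by (simp add: keys_diff_subset)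
qed (use K_keys in auto)

lemma cls_add:
  "Poly_Mapping.keys c \<subseteq> carrier S \<times> V \<Longrightarrow> Poly_Mapping.keys d \<subseteq> carrier S \<times> V \<Longrightarrow>
    cls (c + d) = cls c \<oplus>\<^bsub>SM\<^esub> cls d"
  using FactGroup_mult_rcos[OF comm_FS Rel_subgroup, of c d]
  by (simp add: symbol_class_def symbol_module_def)

lemma SM_abelian: "abelian_group SM"
  unfolding symbol_module_def
  by (intro abelian_group_mk_module FactGroup_comm_group comm_FS Rel_subgroup)

lemma SM_carrier: "carrier SM = cls ` {c. Poly_Mapping.keys c \<subseteq> carrier S \<times> V}"
  by (simp add: symbol_module_def FactGroup_carrier_rcos symbol_class_def) (simp add: free_Abelian_group_def)

lemma cls_closed: "Poly_Mapping.keys c \<subseteq> carrier S \<times> V \<Longrightarrow> cls c \<in> carrier SM"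
  by (auto simp: SM_carrier)

sublocale cls: free_hom SM "carrier S \<times> V" cls
  by (intro free_hom.intro SM_abelian free_hom_axioms.intro homI) (auto simp: cls_closed cls_add)

lemma cls_eq_iff:
  "Poly_Mapping.keys c \<subseteq> carrier S \<times> V \<Longrightarrow> Poly_Mapping.keys d \<subseteq> carrier S \<times> V \<Longrightarrow>
    cls c = cls d \<longleftrightarrow> c - d \<in> Rel"
  using FactGroup_eq_iff[OF comm_FS Rel_subgroup, of c d] by (simp add: symbol_class_def)

lemma cls_zero_iff: "Poly_Mapping.keys c \<subseteq> carrier S \<times> V \<Longrightarrow> cls c = \<zero>\<^bsub>SM\<^esub> \<longleftrightarrow> c \<in> Rel"
  using FactGroup_one_iff[OF comm_FS Rel_subgroup, of c] by (simp add: symbol_class_def symbol_module_def)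

lemma cls_relation: "c \<in> K \<Longrightarrow> cls c = \<zero>\<^bsub>SM\<^esub>"
  by (subst cls_zero_iff) (auto simp: symbol_relations_def K_keys intro: generate.incl)

lemma SM_induct [consumes 1, case_names zero sym diff]:
  assumes "z \<in> carrier SM" "P \<zero>\<^bsub>SM\<^esub>"
    and "\<And>s x. s \<in> carrier S \<Longrightarrow> x \<in> V \<Longrightarrow> P (cls (frag_of (s, x)))"
    and "\<And>y z. y \<in> carrier SM \<Longrightarrow> z \<in> carrier SM \<Longrightarrow> P y \<Longrightarrow> P z \<Longrightarrow> P (y \<ominus>\<^bsub>SM\<^esub> z)"
  shows "P z"
proof -
  obtain c where c: "Poly_Mapping.keys c \<subseteq> carrier S \<times> V" "z = cls c"
    using assms(1) by (auto simp: SM_carrier)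
  have "P (cls c)"
    using c(1)
    by (rule free_Abelian_group_induct)
      (use assms(2-) in \<open>auto simp: cls.zero cls.diff cls.closed simp del: mem_Times_iff\<close>)
  then show ?thesis using c by simp
qed

lemma cls_sym_add:
  assumes "s \<in> carrier S" "s' \<in> carrier S" "x \<in> V"
  shows "cls (frag_of (s \<oplus>\<^bsub>S\<^esub> s', x)) = cls (frag_of (s, x)) \<oplus>\<^bsub>SM\<^esub> cls (frag_of (s', x))"
proof -
  have "frag_of (s \<oplus>\<^bsub>S\<^esub> s', x) - (frag_of (s, x) + frag_of (s', x)) =
      frag_of (s \<oplus>\<^bsub>S\<^esub> s', x) - frag_of (s, x) - frag_of (s', x)"
    by simp
  also have "\<dots> \<in> Rel"
    unfolding symbol_relations_def using assms by (intro generate.incl) auto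
  finally show ?thesis
    using assms cls_eq_iff[of "frag_of (s \<oplus>\<^bsub>S\<^esub> s', x)" "frag_of (s, x) + frag_of (s', x)"]
    by (simp add: cls_add keys_add_subset)
qed

lemma act_keys:
  "s \<in> carrier S \<Longrightarrow> Poly_Mapping.keys c \<subseteq> carrier S \<times> V \<Longrightarrow> Poly_Mapping.keys (symbol_act S s c) \<subseteq> carrier S \<times> V"
  unfolding symbol_act_def by (erule keys_frag_extend_subset) auto

lemma Rel_keys: "c \<in> Rel \<Longrightarrow> Poly_Mapping.keys c \<subseteq> carrier S \<times> V"
  using subgroup.mem_carrier[OF Rel_subgroup] by auto

text \<open>The relations form the subgroup generated by the listed elements, and the kernel of \<open>F\<close> is a subgroup.\<close>

lemma Rel_vanish:
  assumes "free_hom N (carrier S \<times> V) F"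
    and ad: "\<And>s s' x. s \<in> carrier S \<Longrightarrow> s' \<in> carrier S \<Longrightarrow> x \<in> V \<Longrightarrow>
      F (frag_of (s \<oplus>\<^bsub>S\<^esub> s', x)) = F (frag_of (s, x)) \<oplus>\<^bsub>N\<^esub> F (frag_of (s', x))"
    and van: "\<And>c. c \<in> K \<Longrightarrow> F c = \<zero>\<^bsub>N\<^esub>" and c: "c \<in> Rel"
  shows "F c = \<zero>\<^bsub>N\<^esub>"
proof -
  interpret F: free_hom N "carrier S \<times> V" F by fact
  have "Rel \<subseteq> kernel FS (add_monoid N) F"
    unfolding symbol_relations_def
  proof (rule group.generate_subgroup_incl[OF group_free_Abelian_group _ F.gh.subgroup_kernel], safe)
    fix s s' x assume *: "s \<in> carrier S" "s' \<in> carrier S" "x \<in> V"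
    have "F (frag_of (s \<oplus>\<^bsub>S\<^esub> s', x) - (frag_of (s, x) + frag_of (s', x))) = \<zero>\<^bsub>N\<^esub>"
      using * by (simp add: F.diff F.add keys_add_subset ad F.closed F.N.diff_zero_iff)
    then show "frag_of (s \<oplus>\<^bsub>S\<^esub> s', x) - frag_of (s, x) - frag_of (s', x) \<in> kernel FS (add_monoid N) F"
      using * by (simp add: kernel_def keys_diff_subset diff_diff_eq keys_add_subset)
  next
    fix c assume "c \<in> K"
    then show "c \<in> kernel FS (add_monoid N) F"
      using K_keys[of c] by (auto simp: kernel_def van)
  qed
  then show ?thesis using c by (auto simp: kernel_def)
qed

text \<open>
  Acting by \<open>s\<close> and taking the class afterwards is a homomorphism that kills the generating
  relations, hence all of them.
\<close>

lemma act_Rel: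
  assumes s: "s \<in> carrier S" and c: "c \<in> Rel"
  shows "symbol_act S s c \<in> Rel"
proof -
  have "free_hom SM (carrier S \<times> V) (\<lambda>c. cls (symbol_act S s c))"
    by (intro free_hom.intro SM_abelian free_hom_axioms.intro homI)
       (use s act_keys in \<open>auto simp: cls_closed cls_add\<close>)
  then have "cls (symbol_act S s c) = \<zero>\<^bsub>SM\<^esub>"
    by (rule Rel_vanish[OF _ _ _ c]) (use s in \<open>auto simp: S.r_distr cls_sym_add cls_relation K_stable\<close>)
  then show ?thesis using cls_zero_iff act_keys s c Rel_keys by blast
qed

lemma smult_cls:
  assumes "s \<in> carrier S" "Poly_Mapping.keys c \<subseteq> carrier S \<times> V"
  shows "s \<odot>\<^bsub>SM\<^esub> cls c = cls (symbol_act S s c)"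
proof -
  have "(\<Union>d\<in>Rel #>\<^bsub>FS\<^esub> c. cls (symbol_act S s d)) = cls (symbol_act S s c)"
  proof (rule FactGroup_UN[OF comm_FS Rel_subgroup])
    fix d assume d: "d \<in> carrier FS" "d \<otimes>\<^bsub>FS\<^esub> inv\<^bsub>FS\<^esub> c \<in> Rel"
    then have "symbol_act S s (d - c) \<in> Rel" using assms by (intro act_Rel) auto
    then show "cls (symbol_act S s d) = cls (symbol_act S s c)"
      using cls_eq_iff act_keys d assms by simp
  qed (use assms in auto)
  then show ?thesis
    by (simp add: symbol_module_def symbol_act_def symbol_class_def)
qed

lemma smult_sym:
  "s \<in> carrier S \<Longrightarrow> s' \<in> carrier S \<Longrightarrow> x \<in> V \<Longrightarrow> s \<odot>\<^bsub>SM\<^esub> cls (frag_of (s', x)) = cls (frag_of (s \<otimes>\<^bsub>S\<^esub> s', x))"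
  by (simp add: smult_cls)

lemma smult_addhom: "s \<in> carrier S \<Longrightarrow> (\<lambda>z. s \<odot>\<^bsub>SM\<^esub> z) \<in> addhom SM SM"
proof (rule addhomI)
  fix z w assume s: "s \<in> carrier S" and "z \<in> carrier SM" "w \<in> carrier SM"
  then obtain c d where cd: "Poly_Mapping.keys c \<subseteq> carrier S \<times> V" "z = cls c"
    "Poly_Mapping.keys d \<subseteq> carrier S \<times> V" "w = cls d" by (auto simp: SM_carrier)
  have "s \<odot>\<^bsub>SM\<^esub> cls (c + d) = cls (symbol_act S s c) \<oplus>\<^bsub>SM\<^esub> cls (symbol_act S s d)"
    using smult_cls[OF s keys_add_subset[OF cd(1,3)]] cls_add[OF act_keys[OF s cd(1)] act_keys[OF s cd(3)]]
    by simp
  then show "s \<odot>\<^bsub>SM\<^esub> (z \<oplus>\<^bsub>SM\<^esub> w) = s \<odot>\<^bsub>SM\<^esub> z \<oplus>\<^bsub>SM\<^esub> s \<odot>\<^bsub>SM\<^esub> w"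
    unfolding cd(2,4) cls_add[OF cd(1,3)] smult_cls[OF s cd(1)] smult_cls[OF s cd(3)] .
qed (auto simp: SM_carrier smult_cls act_keys cls_closed)

lemma SM_hom_eq:
  assumes "f \<in> addhom SM N" "g \<in> addhom SM N" "abelian_group N"
    "\<And>s x. s \<in> carrier S \<Longrightarrow> x \<in> V \<Longrightarrow> f (cls (frag_of (s, x))) = g (cls (frag_of (s, x)))" "z \<in> carrier SM"
  shows "f z = g z"
  using assms(5)
proof (induction rule: SM_induct)
  case zero
  then show ?case using addhom_zero SM_abelian assms(1-3) by metis
next
  case (diff y z)
  then show ?case using addhom_diff SM_abelian assms(1-3) by metis
qed (fact assms(4))

lemma module_SM: "module S SM"
proof (rule moduleI[OF S.is_cring SM_abelian])
  show cl: "a \<odot>\<^bsub>SM\<^esub> x \<in> carrier SM" if "a \<in> carrier S" "x \<in> carrier SM" for a x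
    using that by (auto simp: SM_carrier smult_cls act_keys)
  show "a \<odot>\<^bsub>SM\<^esub> (x \<oplus>\<^bsub>SM\<^esub> y) = a \<odot>\<^bsub>SM\<^esub> x \<oplus>\<^bsub>SM\<^esub> a \<odot>\<^bsub>SM\<^esub> y"
    if "a \<in> carrier S" "x \<in> carrier SM" "y \<in> carrier SM" for a x y
    using addhom_add smult_addhom that by metis
  show "(a \<oplus>\<^bsub>S\<^esub> b) \<odot>\<^bsub>SM\<^esub> x = a \<odot>\<^bsub>SM\<^esub> x \<oplus>\<^bsub>SM\<^esub> b \<odot>\<^bsub>SM\<^esub> x"
    if "a \<in> carrier S" "b \<in> carrier S" "x \<in> carrier SM" for a b x
    by (rule SM_hom_eq[where N = SM and f = "\<lambda>x. (a \<oplus>\<^bsub>S\<^esub> b) \<odot>\<^bsub>SM\<^esub> x"])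
       (use that in \<open>auto intro!: addhom_plus smult_addhom SM_abelian simp: smult_sym S.l_distr cls_sym_add\<close>)
  show "(a \<otimes>\<^bsub>S\<^esub> b) \<odot>\<^bsub>SM\<^esub> x = a \<odot>\<^bsub>SM\<^esub> (b \<odot>\<^bsub>SM\<^esub> x)"
    if "a \<in> carrier S" "b \<in> carrier S" "x \<in> carrier SM" for a b x
    by (rule SM_hom_eq[where N = SM and f = "\<lambda>x. (a \<otimes>\<^bsub>S\<^esub> b) \<odot>\<^bsub>SM\<^esub> x"])
       (use that addhom_comp[OF smult_addhom smult_addhom, of b a] in
        \<open>auto intro!: smult_addhom SM_abelian simp: smult_sym S.m_assoc\<close>)
  show "\<one>\<^bsub>S\<^esub> \<odot>\<^bsub>SM\<^esub> x = x" if "x \<in> carrier SM" for x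
    by (rule SM_hom_eq[where N = SM and f = "\<lambda>x. \<one>\<^bsub>S\<^esub> \<odot>\<^bsub>SM\<^esub> x"])
       (use that in \<open>auto intro!: smult_addhom SM_abelian addhomI simp: smult_sym\<close>)
qed

text \<open>
  By \<open>Rel_vanish\<close> the additive extension of \<open>\<phi>\<close> is constant on classes, so the image of a class is
  a singleton, as the definition of \<^const>\<open>symbol_lift\<close> requires.
\<close>

lemma lift:
  assumes "abelian_group N"
    and cl: "\<And>s x. s \<in> carrier S \<Longrightarrow> x \<in> V \<Longrightarrow> \<phi> s x \<in> carrier N"
    and ad: "\<And>s s' x. s \<in> carrier S \<Longrightarrow> s' \<in> carrier S \<Longrightarrow> x \<in> V \<Longrightarrow> \<phi> (s \<oplus>\<^bsub>S\<^esub> s') x = \<phi> s x \<oplus>\<^bsub>N\<^esub> \<phi> s' x"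
    and van: "\<And>c. c \<in> K \<Longrightarrow> frag_lift (add_monoid N) (case_prod \<phi>) c = \<zero>\<^bsub>N\<^esub>"
  shows lift_hom: "symbol_lift N \<phi> \<in> addhom SM N"
    and lift_sym: "s \<in> carrier S \<Longrightarrow> x \<in> V \<Longrightarrow> symbol_lift N \<phi> (cls (frag_of (s, x))) = \<phi> s x"
proof -
  interpret N: abelian_group N by fact
  let ?F = "frag_lift (add_monoid N) (case_prod \<phi>)"
  interpret F: free_hom N "carrier S \<times> V" ?F
    by (rule free_hom_frag_lift) (use assms in auto)
  have Fof: "?F (frag_of (s, x)) = \<phi> s x" if "s \<in> carrier S" "x \<in> V" for s x
    using that cl by (subst frag_lift_of) (auto simp: N.a_comm_group)
  have F0: "?F c = \<zero>\<^bsub>N\<^esub>" if "c \<in> Rel" for c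
    by (rule Rel_vanish[OF F.free_hom_axioms _ van that]) (auto simp: Fof ad)
  have L: "symbol_lift N \<phi> (cls c) = ?F c" if c: "Poly_Mapping.keys c \<subseteq> carrier S \<times> V" for c
  proof -
    have "?F ` cls c = {?F c}"
    proof
      show "?F ` cls c \<subseteq> {?F c}"
        using Rel_keys c F0
        by (auto simp: symbol_class_def r_coset_def F.add F.closed)
      have "0 + c \<in> cls c"
        using subgroup.one_closed[OF Rel_subgroup] unfolding symbol_class_def r_coset_def by force
      then show "{?F c} \<subseteq> ?F ` cls c" by simp
    qed
    then show ?thesis by (simp add: symbol_lift_def)
  qed
  show "symbol_lift N \<phi> \<in> addhom SM N"
  proof (rule addhomI)
    fix z w assume "z \<in> carrier SM" "w \<in> carrier SM"
    then obtain c d where cd: "Poly_Mapping.keys c \<subseteq> carrier S \<times> V" "z = cls c"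
      "Poly_Mapping.keys d \<subseteq> carrier S \<times> V" "w = cls d" by (auto simp: SM_carrier)
    have "symbol_lift N \<phi> (z \<oplus>\<^bsub>SM\<^esub> w) = symbol_lift N \<phi> (cls (c + d))"
      using cd by (simp only: cls_add)
    then show "symbol_lift N \<phi> (z \<oplus>\<^bsub>SM\<^esub> w) = symbol_lift N \<phi> z \<oplus>\<^bsub>N\<^esub> symbol_lift N \<phi> w"
      using cd by (simp only: L keys_add_subset F.add)
  qed (auto simp: SM_carrier L F.closed)
  show "s \<in> carrier S \<Longrightarrow> x \<in> V \<Longrightarrow> symbol_lift N \<phi> (cls (frag_of (s, x))) = \<phi> s x"
    by (simp add: L Fof)
qed

end

subsection \<open>Tensor products\<close>

locale tensor = A: cring A + S: cring S + M: module A M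
  for A :: "('a, 'y) ring_scheme" and S :: "('s, 'z) ring_scheme" and M :: "('a, 'm) module" +
  fixes f
  assumes f: "f \<in> ring_hom A S"
begin

abbreviation "BC \<equiv> base_change A S f M"
abbreviation "pt \<equiv> pure_tensor A S f M"

lemma f_closed [simp]: "a \<in> carrier A \<Longrightarrow> f a \<in> carrier S"
  using f by (auto simp: ring_hom_def)

sublocale sy: symbols S "carrier M" "tensor_relations A S f M"
proof (rule symbols.intro[OF S.is_cring], unfold_locales)
  fix c assume "c \<in> tensor_relations A S f M"
  then show "Poly_Mapping.keys c \<subseteq> carrier S \<times> carrier M"
    by (auto simp: tensor_relations_def simp del: mem_Times_iff dest!: subsetD[OF keys_diff] split: if_splits)
next
  fix s c assume s: "s \<in> carrier S" and "c \<in> tensor_relations A S f M"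
  then consider t x x' where "c = frag_of (t, x \<oplus>\<^bsub>M\<^esub> x') - frag_of (t, x) - frag_of (t, x')"
      "t \<in> carrier S" "x \<in> carrier M" "x' \<in> carrier M"
    | t a x where "c = frag_of (t \<otimes>\<^bsub>S\<^esub> f a, x) - frag_of (t, a \<odot>\<^bsub>M\<^esub> x)"
      "t \<in> carrier S" "a \<in> carrier A" "x \<in> carrier M"
    by (auto simp: tensor_relations_def)
  then show "symbol_act S s c \<in> tensor_relations A S f M"
  proof cases
    case 1
    then show ?thesis
      unfolding tensor_relations_def using s
      by (intro UnI1 CollectI exI[of _ "s \<otimes>\<^bsub>S\<^esub> t"] exI[of _ x] exI[of _ x']) simp
  next
    case 2
    then show ?thesis
      unfolding tensor_relations_def using s
      by (intro UnI2 CollectI exI[of _ "s \<otimes>\<^bsub>S\<^esub> t"] exI[of _ a] exI[of _ x]) (simp add: S.m_assoc)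
  qed
qed

lemma BC_module: "module S BC"
  unfolding base_change_def by (rule sy.module_SM)

lemma BC_abelian: "abelian_group BC"
  unfolding base_change_def by (rule sy.SM_abelian)

lemma pt_closed [simp]: "s \<in> carrier S \<Longrightarrow> x \<in> carrier M \<Longrightarrow> pt s x \<in> carrier BC"
  by (simp add: base_change_def pure_tensor_def sy.cls_closed)

lemma pt_add_left:
  "s \<in> carrier S \<Longrightarrow> s' \<in> carrier S \<Longrightarrow> x \<in> carrier M \<Longrightarrow> pt (s \<oplus>\<^bsub>S\<^esub> s') x = pt s x \<oplus>\<^bsub>BC\<^esub> pt s' x"
  by (simp add: base_change_def pure_tensor_def sy.cls_sym_add)

lemma pt_add_right:
  assumes "s \<in> carrier S" "x \<in> carrier M" "x' \<in> carrier M"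
  shows "pt s (x \<oplus>\<^bsub>M\<^esub> x') = pt s x \<oplus>\<^bsub>BC\<^esub> pt s x'"
proof -
  have "frag_of (s, x \<oplus>\<^bsub>M\<^esub> x') - frag_of (s, x) - frag_of (s, x') \<in> tensor_relations A S f M"
    using assms unfolding tensor_relations_def by blast
  from sy.cls_relation[OF this]
  have "sy.cls (frag_of (s, x \<oplus>\<^bsub>M\<^esub> x') - (frag_of (s, x) + frag_of (s, x'))) = \<zero>\<^bsub>sy.SM\<^esub>"
    by (simp add: diff_diff_eq)
  then show ?thesis
    using assms by (simp add: base_change_def pure_tensor_def sy.cls.diff keys_add_subset
        sy.cls.N.diff_zero_iff sy.cls_closed sy.cls_add)
qed

lemma pt_balance:
  assumes "s \<in> carrier S" "a \<in> carrier A" "x \<in> carrier M"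
  shows "pt (s \<otimes>\<^bsub>S\<^esub> f a) x = pt s (a \<odot>\<^bsub>M\<^esub> x)"
proof -
  have "frag_of (s \<otimes>\<^bsub>S\<^esub> f a, x) - frag_of (s, a \<odot>\<^bsub>M\<^esub> x) \<in> tensor_relations A S f M"
    using assms unfolding tensor_relations_def by blast
  from sy.cls_relation[OF this] show ?thesis
    using assms by (simp add: pure_tensor_def sy.cls.diff sy.cls.N.diff_zero_iff sy.cls_closed)
qed

lemma pt_smult: "s \<in> carrier S \<Longrightarrow> t \<in> carrier S \<Longrightarrow> x \<in> carrier M \<Longrightarrow> s \<odot>\<^bsub>BC\<^esub> pt t x = pt (s \<otimes>\<^bsub>S\<^esub> t) x"
  by (simp add: base_change_def pure_tensor_def sy.smult_sym)

lemma pt_right_hom: "s \<in> carrier S \<Longrightarrow> (\<lambda>x. pt s x) \<in> addhom M BC"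
  by (intro addhomI) (auto simp: pt_add_right)

lemma BC_induct [consumes 1, case_names zero pure diff]:
  assumes "z \<in> carrier BC" "P \<zero>\<^bsub>BC\<^esub>"
    and "\<And>s x. s \<in> carrier S \<Longrightarrow> x \<in> carrier M \<Longrightarrow> P (pt s x)"
    and "\<And>y z. y \<in> carrier BC \<Longrightarrow> z \<in> carrier BC \<Longrightarrow> P y \<Longrightarrow> P z \<Longrightarrow> P (y \<ominus>\<^bsub>BC\<^esub> z)"
  shows "P z"
  using sy.SM_induct[of z P] assms by (simp add: base_change_def pure_tensor_def)

lemma BC_hom_eq:
  assumes "g \<in> addhom BC N" "h \<in> addhom BC N" "abelian_group N"
    "\<And>s x. s \<in> carrier S \<Longrightarrow> x \<in> carrier M \<Longrightarrow> g (pt s x) = h (pt s x)" "z \<in> carrier BC"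
  shows "g z = h z"
  using sy.SM_hom_eq[of g N h z] assms by (simp add: base_change_def pure_tensor_def)

text \<open>
  The universal property of the tensor product: \<open>adr\<close> and \<open>bal\<close> say that the two families of tensor
  relations are killed, while additivity in the scalars is built into symbol modules.
\<close>

lemma BC_lift:
  assumes N: "abelian_group N"
    and cl: "\<And>s x. s \<in> carrier S \<Longrightarrow> x \<in> carrier M \<Longrightarrow> \<phi> s x \<in> carrier N"
    and adl: "\<And>s s' x. s \<in> carrier S \<Longrightarrow> s' \<in> carrier S \<Longrightarrow> x \<in> carrier M \<Longrightarrow> \<phi> (s \<oplus>\<^bsub>S\<^esub> s') x = \<phi> s x \<oplus>\<^bsub>N\<^esub> \<phi> s' x"
    and adr: "\<And>s x x'. s \<in> carrier S \<Longrightarrow> x \<in> carrier M \<Longrightarrow> x' \<in> carrier M \<Longrightarrow> \<phi> s (x \<oplus>\<^bsub>M\<^esub> x') = \<phi> s x \<oplus>\<^bsub>N\<^esub> \<phi> s x'"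
    and bal: "\<And>s a x. s \<in> carrier S \<Longrightarrow> a \<in> carrier A \<Longrightarrow> x \<in> carrier M \<Longrightarrow> \<phi> (s \<otimes>\<^bsub>S\<^esub> f a) x = \<phi> s (a \<odot>\<^bsub>M\<^esub> x)"
  shows BC_lift_hom: "symbol_lift N \<phi> \<in> addhom BC N"
    and BC_lift_pt: "s \<in> carrier S \<Longrightarrow> x \<in> carrier M \<Longrightarrow> symbol_lift N \<phi> (pt s x) = \<phi> s x"
proof -
  interpret N: abelian_group N by fact
  let ?F = "frag_lift (add_monoid N) (case_prod \<phi>)"
  interpret F: free_hom N "carrier S \<times> carrier M" ?F
    by (rule free_hom_frag_lift) (use assms in auto)
  have Fof: "?F (frag_of (s, x)) = \<phi> s x" if "s \<in> carrier S" "x \<in> carrier M" for s x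
    using that cl by (subst frag_lift_of) (auto simp: N.a_comm_group)
  have van: "?F c = \<zero>\<^bsub>N\<^esub>" if "c \<in> tensor_relations A S f M" for c
    using that unfolding tensor_relations_def
  proof (safe, goal_cases)
    case (1 s x x')
    then show ?case
      by (simp add: diff_diff_eq F.diff F.add keys_add_subset Fof adr cl N.diff_zero_iff)
  next
    case (2 s a x)
    then show ?case
      by (simp add: F.diff Fof bal cl N.diff_zero_iff)
  qed
  show "symbol_lift N \<phi> \<in> addhom BC N"
    unfolding base_change_def by (rule sy.lift_hom[OF N cl adl van])
  show "s \<in> carrier S \<Longrightarrow> x \<in> carrier M \<Longrightarrow> symbol_lift N \<phi> (pt s x) = \<phi> s x"
    unfolding pure_tensor_def by (rule sy.lift_sym[OF N cl adl van])
qed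

end

text \<open>
  The ring \<open>R \<otimes>\<^sub>C B\<close> and the module underlying it are different records with the same additive group;
  the next three lemmas carry additive facts from one to the other.
\<close>

lemma abelian_group_transfer:
  fixes N :: "('m, 'y) ring_scheme" and M :: "('m, 'z) ring_scheme"
  assumes "abelian_group M" "carrier N = carrier M" "ring.add N = ring.add M" "ring.zero N = ring.zero M"
  shows "abelian_group N"
proof -
  interpret M: abelian_group M by fact
  show ?thesis
    by (rule abelian_groupI) (use assms(2-) M.l_neg in \<open>auto simp: M.a_ac intro!: bexI[of _ "\<ominus>\<^bsub>M\<^esub> _"]\<close>)
qed

lemma addhom_transfer:
  fixes N :: "('m, 'y) ring_scheme" and M :: "('m, 'z) ring_scheme"
  assumes "carrier N = carrier M" "ring.add N = ring.add M"
  shows "addhom N L = addhom M L" "addhom L N = addhom L M"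
  using assms by (simp_all add: hom_def)

lemma a_inv_transfer:
  fixes N :: "('m, 'y) ring_scheme" and M :: "('m, 'z) ring_scheme"
  assumes "carrier N = carrier M" "ring.add N = ring.add M" "ring.zero N = ring.zero M"
  shows "a_inv N = a_inv M"
  using assms by (intro ext) (simp add: a_inv_def m_inv_def)

lemma free_hom_eq:
  assumes "free_hom N V F" "free_hom N V G" "\<And>x. x \<in> V \<Longrightarrow> F (frag_of x) = G (frag_of x)"
    "Poly_Mapping.keys c \<subseteq> V"
  shows "F c = G c"
proof -
  interpret F: free_hom N V F by fact
  interpret G: free_hom N V G by fact
  show ?thesis
    using assms(4) by (rule free_Abelian_group_induct) (simp_all add: F.zero G.zero F.diff G.diff assms(3))
qed

lemma free_hom_comp:
  assumes "free_hom M V F" "g \<in> addhom M N" "abelian_group N"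
  shows "free_hom N V (\<lambda>c. g (F c))"
proof -
  interpret F: free_hom M V F by fact
  show ?thesis
    using assms by (auto intro!: free_hom.intro free_hom_axioms.intro homI simp: F.closed F.add addhom_closed addhom_add)
qed

lemma (in symbols) free_hom_cls_extend:
  assumes "\<And>c. Poly_Mapping.keys c \<subseteq> W \<Longrightarrow> Poly_Mapping.keys (frag_extend h c) \<subseteq> carrier S \<times> V"
  shows "free_hom SM W (\<lambda>c. cls (frag_extend h c))"
  using assms
  by (intro free_hom.intro SM_abelian free_hom_axioms.intro homI)
    (auto simp: cls_closed frag_extend_add cls_add)

lemma (in symbols) in_cls:
  assumes "c' \<in> cls c" "Poly_Mapping.keys c \<subseteq> carrier S \<times> V"
  shows "Poly_Mapping.keys c' \<subseteq> carrier S \<times> V \<and> cls c' = cls c"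
proof -
  obtain r where r: "r \<in> Rel" "c' = r + c" using assms(1) by (auto simp: symbol_class_def r_coset_def)
  then show ?thesis
    using assms(2) Rel_keys[OF r(1)] by (simp add: cls_eq_iff keys_add_subset)
qed

lemma (in symbols) cls_self: "c \<in> cls c"
  using subgroup.one_closed[OF Rel_subgroup] by (force simp: symbol_class_def r_coset_def)

subsection \<open>The tensor product of two algebras\<close>

locale algebra_tensor = C: cring C + R: cring R + B: cring B
  for C :: "('c, 'x) ring_scheme" and R :: "('r, 'y) ring_scheme" and B :: "('b, 'z) ring_scheme" +
  fixes e f
  assumes e: "e \<in> ring_hom C R" and f: "f \<in> ring_hom C B"
begin

lemma f_cl [simp]: "c \<in> carrier C \<Longrightarrow> f c \<in> carrier B"
  using f by (auto simp: ring_hom_def)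
lemma e_cl [simp]: "c \<in> carrier C \<Longrightarrow> e c \<in> carrier R"
  using e by (auto simp: ring_hom_def)

abbreviation "BM \<equiv> restrict_scalars f (ring_as_module B)"

lemma BM_module: "module C BM"
  by (rule module_restrict_scalars[OF module_ring_as_module[OF B.is_cring] C.is_cring f])

sublocale tensor C R BM e
  by (intro tensor.intro tensor_axioms.intro C.is_cring R.is_cring BM_module e)

abbreviation "RT \<equiv> ring_tensor C R B e f"

text \<open>
  The multiplication of \<^const>\<open>ring_tensor\<close> is a formula on representatives.  The same product is
  built here from the universal property, one factor at a time, which makes it biadditive at once;
  \<open>RT_mult\<close> below identifies the two.
\<close>

definition tmul_left where
  "tmul_left r b = symbol_lift BC (\<lambda>r' b'. pt (r \<otimes>\<^bsub>R\<^esub> r') (b \<otimes>\<^bsub>B\<^esub> b'))"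

definition tmul where
  "tmul x y = symbol_lift BC (\<lambda>r b. tmul_left r b y) x"

lemma tmul_left:
  assumes "r \<in> carrier R" "b \<in> carrier B"
  shows tmul_left_hom: "tmul_left r b \<in> addhom BC BC"
    and tmul_left_pt: "r' \<in> carrier R \<Longrightarrow> b' \<in> carrier B \<Longrightarrow>
      tmul_left r b (pt r' b') = pt (r \<otimes>\<^bsub>R\<^esub> r') (b \<otimes>\<^bsub>B\<^esub> b')"
proof -
  have bal: "pt (r \<otimes>\<^bsub>R\<^esub> (s \<otimes>\<^bsub>R\<^esub> e a)) (b \<otimes>\<^bsub>B\<^esub> x) = pt (r \<otimes>\<^bsub>R\<^esub> s) (b \<otimes>\<^bsub>B\<^esub> (a \<odot>\<^bsub>BM\<^esub> x))"
    if "s \<in> carrier R" "a \<in> carrier C" "x \<in> carrier BM" for s a x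
    using pt_balance[of "r \<otimes>\<^bsub>R\<^esub> s" a "b \<otimes>\<^bsub>B\<^esub> x"] that assms by (simp add: R.m_assoc B.m_lcomm)
  note l = BC_lift[OF BC_abelian, where \<phi> = "\<lambda>r' b'. pt (r \<otimes>\<^bsub>R\<^esub> r') (b \<otimes>\<^bsub>B\<^esub> b')", OF _ _ _ bal]
  show "tmul_left r b \<in> addhom BC BC"
    unfolding tmul_left_def
    by (rule l) (use assms in \<open>auto simp: R.r_distr B.r_distr pt_add_left pt_add_right[simplified]\<close>)
  show "r' \<in> carrier R \<Longrightarrow> b' \<in> carrier B \<Longrightarrow>
      tmul_left r b (pt r' b') = pt (r \<otimes>\<^bsub>R\<^esub> r') (b \<otimes>\<^bsub>B\<^esub> b')"
    unfolding tmul_left_def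
    by (rule l) (use assms in \<open>auto simp: R.r_distr B.r_distr pt_add_left pt_add_right[simplified]\<close>)
qed

lemma tmul_lift:
  assumes y: "y \<in> carrier BC"
  shows tmul_hom_left: "(\<lambda>x. tmul x y) \<in> addhom BC BC"
    and tmul_pt_left: "r \<in> carrier R \<Longrightarrow> b \<in> carrier B \<Longrightarrow> tmul (pt r b) y = tmul_left r b y"
proof -
  note eq = BC_hom_eq[OF _ _ BC_abelian _ y]
  have 1: "tmul_left (r \<oplus>\<^bsub>R\<^esub> r') b y = tmul_left r b y \<oplus>\<^bsub>BC\<^esub> tmul_left r' b y"
    if "r \<in> carrier R" "r' \<in> carrier R" "b \<in> carrier BM" for r r' b
    by (rule eq) (use that in \<open>auto intro!: addhom_plus tmul_left_hom BC_abelian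
        simp: tmul_left_pt R.l_distr pt_add_left\<close>)
  have 2: "tmul_left r (b \<oplus>\<^bsub>BM\<^esub> b') y = tmul_left r b y \<oplus>\<^bsub>BC\<^esub> tmul_left r b' y"
    if "r \<in> carrier R" "b' \<in> carrier BM" "b \<in> carrier BM" for r b' b
    by (rule eq) (use that in \<open>auto intro!: addhom_plus tmul_left_hom BC_abelian
        simp: tmul_left_pt B.l_distr pt_add_right[simplified]\<close>)
  have 3: "tmul_left (r \<otimes>\<^bsub>R\<^esub> e a) b y = tmul_left r (a \<odot>\<^bsub>BM\<^esub> b) y"
    if "r \<in> carrier R" "a \<in> carrier C" "b \<in> carrier BM" for r a b
  proof (rule eq)
    fix s x assume sx: "s \<in> carrier R" "x \<in> carrier BM"
    show "tmul_left (r \<otimes>\<^bsub>R\<^esub> e a) b (pt s x) = tmul_left r (a \<odot>\<^bsub>BM\<^esub> b) (pt s x)"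
      using pt_balance[of "r \<otimes>\<^bsub>R\<^esub> s" a "b \<otimes>\<^bsub>B\<^esub> x"] that sx
      by (simp add: tmul_left_pt R.m_assoc R.m_comm[of s "e a"] B.m_assoc)
  qed (use that in \<open>auto intro!: tmul_left_hom\<close>)
  have 4: "tmul_left r b y \<in> carrier BC" if "r \<in> carrier R" "b \<in> carrier BM" for r b
    using addhom_closed[OF tmul_left_hom y] that by simp
  show "(\<lambda>x. tmul x y) \<in> addhom BC BC"
    unfolding tmul_def by (rule BC_lift_hom[OF BC_abelian 4 1 2 3])
  show "r \<in> carrier R \<Longrightarrow> b \<in> carrier B \<Longrightarrow> tmul (pt r b) y = tmul_left r b y"
    unfolding tmul_def by (rule BC_lift_pt[OF BC_abelian 4 1 2 3]) auto
qed

lemma tmul_pt: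
  "r \<in> carrier R \<Longrightarrow> b \<in> carrier B \<Longrightarrow> r' \<in> carrier R \<Longrightarrow> b' \<in> carrier B \<Longrightarrow>
    tmul (pt r b) (pt r' b') = pt (r \<otimes>\<^bsub>R\<^esub> r') (b \<otimes>\<^bsub>B\<^esub> b')"
  by (simp add: tmul_pt_left tmul_left_pt)

lemma tmul_hom_right:
  assumes x: "x \<in> carrier BC"
  shows "(\<lambda>y. tmul x y) \<in> addhom BC BC"
proof (rule addhomI)
  fix y assume "y \<in> carrier BC"
  then show "tmul x y \<in> carrier BC" using addhom_closed[OF tmul_hom_left x] by simp
next
  fix y z assume yz: "y \<in> carrier BC" "z \<in> carrier BC"
  interpret BC: abelian_group BC by (rule BC_abelian)
  show "tmul x (y \<oplus>\<^bsub>BC\<^esub> z) = tmul x y \<oplus>\<^bsub>BC\<^esub> tmul x z"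
    by (rule BC_hom_eq[OF _ _ BC_abelian _ x, where g = "\<lambda>x. tmul x (y \<oplus>\<^bsub>BC\<^esub> z)"])
      (use yz in \<open>auto intro!: tmul_hom_left addhom_plus BC_abelian simp: tmul_pt_left addhom_add[OF tmul_left_hom]\<close>)
qed

lemma RT_simps [simp]:
  "carrier RT = carrier BC" "ring.add RT = ring.add BC" "ring.zero RT = ring.zero BC" "\<one>\<^bsub>RT\<^esub> = pt \<one>\<^bsub>R\<^esub> \<one>\<^bsub>B\<^esub>"
  by (simp_all add: ring_tensor_def Let_def)

lemma RT_mult:
  assumes "x \<in> carrier BC" "y \<in> carrier BC"
  shows "x \<otimes>\<^bsub>RT\<^esub> y = tmul x y"
proof -
  let ?V = "carrier R \<times> carrier BM"
  let ?mm = "\<lambda>c d. frag_extend (\<lambda>(r, b). frag_extend (\<lambda>(r', b'). frag_of (r \<otimes>\<^bsub>R\<^esub> r', b \<otimes>\<^bsub>B\<^esub> b')) d) c"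
  have BCsy: "BC = sy.SM" by (simp add: base_change_def)
  have pt: "pt r b = sy.cls (frag_of (r, b))" for r b by (simp add: pure_tensor_def)
  have keys: "Poly_Mapping.keys (?mm c d) \<subseteq> ?V"
    if "Poly_Mapping.keys c \<subseteq> ?V" "Poly_Mapping.keys d \<subseteq> ?V" for c d
    using that(1)
  proof (rule keys_frag_extend_subset)
    fix x assume "x \<in> ?V"
    then show "Poly_Mapping.keys ((\<lambda>(r, b). frag_extend (\<lambda>(r', b'). frag_of (r \<otimes>\<^bsub>R\<^esub> r', b \<otimes>\<^bsub>B\<^esub> b')) d) x) \<subseteq> ?V"
      using that(2) by (cases x, simp) (erule keys_frag_extend_subset, auto)
  qed
  have key: "sy.cls (?mm c d) = tmul (sy.cls c) (sy.cls d)"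
    if c: "Poly_Mapping.keys c \<subseteq> ?V" and d: "Poly_Mapping.keys d \<subseteq> ?V" for c d
  proof (rule free_hom_eq[where N = BC and V = ?V, OF _ _ _ c])
    have dc: "sy.cls d \<in> carrier BC" using d sy.cls_closed BCsy by simp
    show "free_hom BC ?V (\<lambda>c. sy.cls (?mm c d))"
      unfolding BCsy using keys d by (intro sy.free_hom_cls_extend)
    show "free_hom BC ?V (\<lambda>c. tmul (sy.cls c) (sy.cls d))"
      using free_hom_comp[OF sy.cls.free_hom_axioms tmul_hom_left[OF dc, unfolded BCsy] sy.SM_abelian]
      by (simp add: BCsy)
    fix x assume x: "x \<in> ?V"
    obtain r b where rb: "x = (r, b)" "r \<in> carrier R" "b \<in> carrier B" using x by auto
    show "sy.cls (?mm (frag_of x) d) = tmul (sy.cls (frag_of x)) (sy.cls d)"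
      unfolding rb(1) pt[symmetric] tmul_pt_left[OF dc rb(2,3)] frag_extend_of prod.case
    proof (rule free_hom_eq[where N = BC and V = ?V, OF _ _ _ d])
      have k: "Poly_Mapping.keys (frag_extend (\<lambda>(r', b'). frag_of (r \<otimes>\<^bsub>R\<^esub> r', b \<otimes>\<^bsub>B\<^esub> b')) d) \<subseteq> ?V"
        if "Poly_Mapping.keys d \<subseteq> ?V" for d
        using that by (rule keys_frag_extend_subset) (use rb in auto)
      show "free_hom BC ?V (\<lambda>d. sy.cls (frag_extend (\<lambda>(r', b'). frag_of (r \<otimes>\<^bsub>R\<^esub> r', b \<otimes>\<^bsub>B\<^esub> b')) d))"
        unfolding BCsy using k by (intro sy.free_hom_cls_extend)
      show "free_hom BC ?V (\<lambda>c. tmul_left r b (sy.cls c))"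
        using free_hom_comp[OF sy.cls.free_hom_axioms tmul_left_hom[OF rb(2,3), unfolded BCsy] sy.SM_abelian]
        by (simp add: BCsy)
      fix x assume "x \<in> ?V"
      then show "sy.cls (frag_extend (\<lambda>(r', b'). frag_of (r \<otimes>\<^bsub>R\<^esub> r', b \<otimes>\<^bsub>B\<^esub> b')) (frag_of x)) =
          tmul_left r b (sy.cls (frag_of x))"
        using tmul_left_pt[OF rb(2,3), of "fst x" "snd x", unfolded pt] by (auto simp: case_prod_beta)
    qed
  qed
  obtain c d where c: "Poly_Mapping.keys c \<subseteq> ?V" "x = sy.cls c" and d: "Poly_Mapping.keys d \<subseteq> ?V" "y = sy.cls d"
    using assms unfolding BCsy sy.SM_carrier by auto
  have "x \<otimes>\<^bsub>RT\<^esub> y = (\<Union>c\<in>sy.cls c. \<Union>d\<in>sy.cls d. sy.cls (?mm c d))"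
    by (simp add: ring_tensor_def c d Let_def)
  also have "\<dots> = sy.cls (?mm c d)"
  proof -
    have eq: "sy.cls (?mm c' d') = sy.cls (?mm c d)" if "c' \<in> sy.cls c" "d' \<in> sy.cls d" for c' d'
      using sy.in_cls[OF that(1) c(1)] sy.in_cls[OF that(2) d(1)] key c(1) d(1) by metis
    have "(\<Union>d'\<in>sy.cls d. sy.cls (?mm c' d')) = sy.cls (?mm c d)" if "c' \<in> sy.cls c" for c'
      using UN_coset_const[OF sy.cls_self[of d], of "\<lambda>d'. sy.cls (?mm c' d')"] eq[OF that] sy.cls_self[of d] by metis
    then show ?thesis
      using UN_coset_const[OF sy.cls_self[of c], of "\<lambda>c'. \<Union>d'\<in>sy.cls d. sy.cls (?mm c' d')"] sy.cls_self[of c] by metis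
  qed
  also have "\<dots> = tmul x y" using key c d by simp
  finally show ?thesis .
qed

lemma RT_mult_pt:
  "r \<in> carrier R \<Longrightarrow> b \<in> carrier B \<Longrightarrow> r' \<in> carrier R \<Longrightarrow> b' \<in> carrier B \<Longrightarrow>
    pt r b \<otimes>\<^bsub>RT\<^esub> pt r' b' = pt (r \<otimes>\<^bsub>R\<^esub> r') (b \<otimes>\<^bsub>B\<^esub> b')"
  by (simp add: RT_mult tmul_pt)

lemma tmul_closed: "x \<in> carrier BC \<Longrightarrow> y \<in> carrier BC \<Longrightarrow> tmul x y \<in> carrier BC"
  using addhom_closed[OF tmul_hom_left] by blast

lemma tmul_comm:
  assumes x: "x \<in> carrier BC" and y: "y \<in> carrier BC"
  shows "tmul x y = tmul y x"
proof (rule BC_hom_eq[OF tmul_hom_left[OF y] tmul_hom_right[OF y] BC_abelian _ x])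
  fix r b assume rb: "r \<in> carrier R" "b \<in> carrier BM"
  show "tmul (pt r b) y = tmul y (pt r b)"
    by (rule BC_hom_eq[OF tmul_hom_right tmul_hom_left BC_abelian _ y])
      (use rb in \<open>auto simp: tmul_pt R.m_comm B.m_comm\<close>)
qed

lemma tmul_assoc:
  assumes x: "x \<in> carrier BC" and y: "y \<in> carrier BC" and z: "z \<in> carrier BC"
  shows "tmul (tmul x y) z = tmul x (tmul y z)"
proof (rule BC_hom_eq[OF addhom_comp[OF tmul_hom_left[OF y] tmul_hom_left[OF z]]
      tmul_hom_left[OF tmul_closed[OF y z]] BC_abelian _ x])
  fix r b assume "r \<in> carrier R" "b \<in> carrier BM"
  then have rb: "pt r b \<in> carrier BC" and rb': "r \<in> carrier R" "b \<in> carrier B" by auto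
  show "tmul (tmul (pt r b) y) z = tmul (pt r b) (tmul y z)"
  proof (rule BC_hom_eq[OF addhom_comp[OF tmul_hom_right[OF rb] tmul_hom_left[OF z]]
        addhom_comp[OF tmul_hom_left[OF z] tmul_hom_right[OF rb]] BC_abelian _ y])
    fix r' b' assume "r' \<in> carrier R" "b' \<in> carrier BM"
    then have rb1: "pt r' b' \<in> carrier BC" and rb1': "r' \<in> carrier R" "b' \<in> carrier B" by auto
    show "tmul (tmul (pt r b) (pt r' b')) z = tmul (pt r b) (tmul (pt r' b') z)"
      by (rule BC_hom_eq[OF tmul_hom_right[OF tmul_closed[OF rb rb1]]
            addhom_comp[OF tmul_hom_right[OF rb1] tmul_hom_right[OF rb]] BC_abelian _ z])
        (use rb' rb1' in \<open>auto simp: tmul_pt R.m_assoc B.m_assoc\<close>)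
  qed
qed

lemma RT_cring: "cring RT"
proof (rule cringI)
  interpret BC: abelian_group BC by (rule BC_abelian)
  show "abelian_group RT"
    by (rule abelian_group_transfer[OF BC_abelian]) auto
  have one: "tmul (pt \<one>\<^bsub>R\<^esub> \<one>\<^bsub>B\<^esub>) x = x" if x: "x \<in> carrier BC" for x
    by (rule BC_hom_eq[OF tmul_hom_right addhomI BC_abelian _ x])
      (auto simp: tmul_pt)
  show "Group.comm_monoid RT"
    by (rule comm_monoidI) (simp_all add: RT_mult tmul_closed tmul_assoc one, simp add: tmul_comm)
  show "(x \<oplus>\<^bsub>RT\<^esub> y) \<otimes>\<^bsub>RT\<^esub> z = x \<otimes>\<^bsub>RT\<^esub> z \<oplus>\<^bsub>RT\<^esub> y \<otimes>\<^bsub>RT\<^esub> z"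
    if "x \<in> carrier RT" "y \<in> carrier RT" "z \<in> carrier RT" for x y z
    using that addhom_add[OF tmul_hom_left[of z]] by (simp add: RT_mult)
qed

lemma RT_induct [consumes 1, case_names zero pure diff]:
  assumes "z \<in> carrier RT" "P \<zero>\<^bsub>RT\<^esub>"
    and "\<And>s x. s \<in> carrier R \<Longrightarrow> x \<in> carrier B \<Longrightarrow> P (pt s x)"
    and "\<And>y z. y \<in> carrier RT \<Longrightarrow> z \<in> carrier RT \<Longrightarrow> P y \<Longrightarrow> P z \<Longrightarrow> P (y \<ominus>\<^bsub>RT\<^esub> z)"
  shows "P z"
  using BC_induct[of z P] assms by (simp add: a_minus_def a_inv_transfer[of RT BC])

end

subsection \<open>Kaehler differentials\<close>

locale kaehler = C: cring C + R: cring R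
  for C :: "('c, 'x) ring_scheme" and R :: "('r, 'y) ring_scheme" +
  fixes e
  assumes e: "e \<in> ring_hom C R"
begin

abbreviation "Om \<equiv> differentials C R e"
abbreviation "\<delta> \<equiv> differential C R e"

lemma e_cl [simp]: "c \<in> carrier C \<Longrightarrow> e c \<in> carrier R"
  using e by (auto simp: ring_hom_def)

lemma relation_cases:
  assumes "c \<in> differential_relations C R e"
  obtains (add) r x y where "c = frag_of (r, x \<oplus>\<^bsub>R\<^esub> y) - frag_of (r, x) - frag_of (r, y)"
      "r \<in> carrier R" "x \<in> carrier R" "y \<in> carrier R"
    | (mult) r x y where "c = frag_of (r, x \<otimes>\<^bsub>R\<^esub> y) - frag_of (r \<otimes>\<^bsub>R\<^esub> x, y) - frag_of (r \<otimes>\<^bsub>R\<^esub> y, x)"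
      "r \<in> carrier R" "x \<in> carrier R" "y \<in> carrier R"
    | (const) r a where "c = frag_of (r, e a)" "r \<in> carrier R" "a \<in> carrier C"
  using assms unfolding differential_relations_def by blast

lemma relation_add: "r \<in> carrier R \<Longrightarrow> x \<in> carrier R \<Longrightarrow> y \<in> carrier R \<Longrightarrow>
    frag_of (r, x \<oplus>\<^bsub>R\<^esub> y) - frag_of (r, x) - frag_of (r, y) \<in> differential_relations C R e"
  unfolding differential_relations_def by blast
lemma relation_mult: "r \<in> carrier R \<Longrightarrow> x \<in> carrier R \<Longrightarrow> y \<in> carrier R \<Longrightarrow>
    frag_of (r, x \<otimes>\<^bsub>R\<^esub> y) - frag_of (r \<otimes>\<^bsub>R\<^esub> x, y) - frag_of (r \<otimes>\<^bsub>R\<^esub> y, x) \<in> differential_relations C R e"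
  unfolding differential_relations_def by blast
lemma relation_const: "r \<in> carrier R \<Longrightarrow> a \<in> carrier C \<Longrightarrow> frag_of (r, e a) \<in> differential_relations C R e"
  unfolding differential_relations_def by blast

sublocale sy: symbols R "carrier R" "differential_relations C R e"
proof (rule symbols.intro[OF R.is_cring], unfold_locales)
  fix c assume "c \<in> differential_relations C R e"
  then show "Poly_Mapping.keys c \<subseteq> carrier R \<times> carrier R"
    by (cases rule: relation_cases) (auto simp: keys_diff_subset simp del: mem_Times_iff dest!: subsetD[OF keys_diff] split: if_splits)
next
  fix s c assume s: "s \<in> carrier R" and "c \<in> differential_relations C R e"
  from this(2) show "symbol_act R s c \<in> differential_relations C R e"
  proof (cases rule: relation_cases)
    case (add r x y)
    then show ?thesis using relation_add[of "s \<otimes>\<^bsub>R\<^esub> r" x y] s by simp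
  next
    case (mult r x y)
    then show ?thesis using relation_mult[of "s \<otimes>\<^bsub>R\<^esub> r" x y] s by (simp add: R.m_assoc)
  next
    case (const r a)
    then show ?thesis using relation_const[of "s \<otimes>\<^bsub>R\<^esub> r" a] s by simp
  qed
qed

lemma Om_module: "module R Om"
  unfolding differentials_def by (rule sy.module_SM)
lemma Om_sy: "Om = sy.SM"
  by (simp add: differentials_def)

lemma delta_closed [simp]: "x \<in> carrier R \<Longrightarrow> \<delta> x \<in> carrier Om"
  by (simp add: differentials_def differential_def sy.cls_closed)

lemma smult_delta: "r \<in> carrier R \<Longrightarrow> x \<in> carrier R \<Longrightarrow> r \<odot>\<^bsub>Om\<^esub> \<delta> x = sy.cls (frag_of (r, x))"
  by (simp add: differentials_def differential_def sy.smult_sym)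

lemma delta_add:
  assumes "x \<in> carrier R" "y \<in> carrier R"
  shows "\<delta> (x \<oplus>\<^bsub>R\<^esub> y) = \<delta> x \<oplus>\<^bsub>Om\<^esub> \<delta> y"
proof -
  have "sy.cls (frag_of (\<one>\<^bsub>R\<^esub>, x \<oplus>\<^bsub>R\<^esub> y) - (frag_of (\<one>\<^bsub>R\<^esub>, x) + frag_of (\<one>\<^bsub>R\<^esub>, y))) = \<zero>\<^bsub>sy.SM\<^esub>"
    using sy.cls_relation[OF relation_add[of "\<one>\<^bsub>R\<^esub>" x y]] assms by (simp add: diff_diff_eq)
  then show ?thesis
    using assms by (simp add: Om_sy differential_def sy.cls.diff keys_add_subset
        sy.cls.N.diff_zero_iff sy.cls_closed sy.cls_add)
qed

lemma delta_mult:
  assumes "x \<in> carrier R" "y \<in> carrier R"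
  shows "\<delta> (x \<otimes>\<^bsub>R\<^esub> y) = x \<odot>\<^bsub>Om\<^esub> \<delta> y \<oplus>\<^bsub>Om\<^esub> y \<odot>\<^bsub>Om\<^esub> \<delta> x"
proof -
  have "sy.cls (frag_of (\<one>\<^bsub>R\<^esub>, x \<otimes>\<^bsub>R\<^esub> y) - (frag_of (x, y) + frag_of (y, x))) = \<zero>\<^bsub>sy.SM\<^esub>"
    using sy.cls_relation[OF relation_mult[of "\<one>\<^bsub>R\<^esub>" x y]] assms by (simp add: diff_diff_eq)
  then show ?thesis
    using assms by (simp add: smult_delta) (simp add: Om_sy differential_def sy.cls.diff keys_add_subset
        sy.cls.N.diff_zero_iff sy.cls_closed sy.cls_add)
qed

lemma delta_const: "c \<in> carrier C \<Longrightarrow> \<delta> (e c) = \<zero>\<^bsub>Om\<^esub>"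
  using sy.cls_relation[OF relation_const[of "\<one>\<^bsub>R\<^esub>" c]] by (simp add: Om_sy differential_def)

lemma Om_induct [consumes 1, case_names zero gen diff]:
  assumes "z \<in> carrier Om" "P \<zero>\<^bsub>Om\<^esub>"
    and "\<And>s x. s \<in> carrier R \<Longrightarrow> x \<in> carrier R \<Longrightarrow> P (s \<odot>\<^bsub>Om\<^esub> \<delta> x)"
    and "\<And>y z. y \<in> carrier Om \<Longrightarrow> z \<in> carrier Om \<Longrightarrow> P y \<Longrightarrow> P z \<Longrightarrow> P (y \<ominus>\<^bsub>Om\<^esub> z)"
  shows "P z"
  using sy.SM_induct[of z P] assms by (simp add: smult_delta) (simp add: Om_sy)

lemma Om_hom_eq:
  assumes "g \<in> addhom Om N" "h \<in> addhom Om N" "abelian_group N"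
    "\<And>s x. s \<in> carrier R \<Longrightarrow> x \<in> carrier R \<Longrightarrow> g (s \<odot>\<^bsub>Om\<^esub> \<delta> x) = h (s \<odot>\<^bsub>Om\<^esub> \<delta> x)" "z \<in> carrier Om"
  shows "g z = h z"
  using sy.SM_hom_eq[of g N h z] assms by (simp add: smult_delta) (simp add: Om_sy)

text \<open>
  The derivations needed below take values in \<open>B\<close>-modules, on which \<open>R\<close> acts through
  \<open>\<sigma> : R \<rightarrow> B\<close>.
\<close>

lemma Om_lift:
  assumes N: "module B N" and \<sigma>: "\<sigma> \<in> ring_hom R B" and D: "D \<in> addhom R N"
    and leib: "\<And>x y. x \<in> carrier R \<Longrightarrow> y \<in> carrier R \<Longrightarrow>
      D (x \<otimes>\<^bsub>R\<^esub> y) = \<sigma> x \<odot>\<^bsub>N\<^esub> D y \<oplus>\<^bsub>N\<^esub> \<sigma> y \<odot>\<^bsub>N\<^esub> D x"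
    and const: "\<And>c. c \<in> carrier C \<Longrightarrow> D (e c) = \<zero>\<^bsub>N\<^esub>"
  shows Om_lift_hom: "symbol_lift N (\<lambda>r x. \<sigma> r \<odot>\<^bsub>N\<^esub> D x) \<in> addhom Om N" (is "?L \<in> _")
    and Om_lift_delta: "r \<in> carrier R \<Longrightarrow> x \<in> carrier R \<Longrightarrow>
      symbol_lift N (\<lambda>r x. \<sigma> r \<odot>\<^bsub>N\<^esub> D x) (r \<odot>\<^bsub>Om\<^esub> \<delta> x) = \<sigma> r \<odot>\<^bsub>N\<^esub> D x"
    and Om_lift_smult: "r \<in> carrier R \<Longrightarrow> w \<in> carrier Om \<Longrightarrow>
      symbol_lift N (\<lambda>r x. \<sigma> r \<odot>\<^bsub>N\<^esub> D x) (r \<odot>\<^bsub>Om\<^esub> w) =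
        \<sigma> r \<odot>\<^bsub>N\<^esub> symbol_lift N (\<lambda>r x. \<sigma> r \<odot>\<^bsub>N\<^esub> D x) w"
    and Om_lift_d: "x \<in> carrier R \<Longrightarrow> symbol_lift N (\<lambda>r x. \<sigma> r \<odot>\<^bsub>N\<^esub> D x) (\<delta> x) = D x"
proof -
  interpret N: module B N by fact
  interpret Om: module R Om by (rule Om_module)
  have s [simp]: "r \<in> carrier R \<Longrightarrow> \<sigma> r \<in> carrier B" for r using \<sigma> by (auto simp: ring_hom_def)
  have Dc [simp]: "x \<in> carrier R \<Longrightarrow> D x \<in> carrier N" for x using D by (rule addhom_closed)
  have sa: "\<sigma> (r \<oplus>\<^bsub>R\<^esub> r') = \<sigma> r \<oplus>\<^bsub>B\<^esub> \<sigma> r'" "\<sigma> (r \<otimes>\<^bsub>R\<^esub> r') = \<sigma> r \<otimes>\<^bsub>B\<^esub> \<sigma> r'"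
    if "r \<in> carrier R" "r' \<in> carrier R" for r r'
    using \<sigma> that by (auto simp: ring_hom_def)
  let ?\<phi> = "\<lambda>r x. \<sigma> r \<odot>\<^bsub>N\<^esub> D x"
  let ?F = "frag_lift (add_monoid N) (case_prod ?\<phi>)"
  have cl: "?\<phi> r x \<in> carrier N" if "r \<in> carrier R" "x \<in> carrier R" for r x
    using that by simp
  interpret F: free_hom N "carrier R \<times> carrier R" ?F
    by (rule free_hom_frag_lift) (auto intro: N.abelian_group_axioms)
  have Fof: "?F (frag_of (s, x)) = ?\<phi> s x" if "s \<in> carrier R" "x \<in> carrier R" for s x
    using that cl by (subst frag_lift_of) (auto simp: N.a_comm_group)
  have van: "?F c = \<zero>\<^bsub>N\<^esub>" if "c \<in> differential_relations C R e" for c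
    using that
  proof (cases rule: relation_cases)
    case (add r x y)
    then show ?thesis
      by (simp add: diff_diff_eq F.diff F.add keys_add_subset Fof addhom_add[OF D] N.diff_zero_iff N.smult_r_distr)
  next
    case (mult r x y)
    then show ?thesis
      by (simp add: diff_diff_eq F.diff F.add keys_add_subset Fof leib sa N.diff_zero_iff N.smult_r_distr N.smult_assoc1)
  next
    case (const r a)
    then show ?thesis by (simp add: Fof assms(5))
  qed
  have ad: "?\<phi> (r \<oplus>\<^bsub>R\<^esub> r') x = ?\<phi> r x \<oplus>\<^bsub>N\<^esub> ?\<phi> r' x" if "r \<in> carrier R" "r' \<in> carrier R" "x \<in> carrier R" for r r' x
    using that by (simp add: sa N.smult_l_distr)
  show h: "?L \<in> addhom Om N"
    unfolding Om_sy by (rule sy.lift_hom[OF N.abelian_group_axioms cl ad van])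
  show l: "?L (r \<odot>\<^bsub>Om\<^esub> \<delta> x) = \<sigma> r \<odot>\<^bsub>N\<^esub> D x" if "r \<in> carrier R" "x \<in> carrier R" for r x
    unfolding smult_delta[OF that] by (rule sy.lift_sym[OF N.abelian_group_axioms cl ad van that])
  show "?L (\<delta> x) = D x" if "x \<in> carrier R" for x
    using l[OF R.one_closed that] that ring_hom_one[OF \<sigma>] by simp
  show "?L (r \<odot>\<^bsub>Om\<^esub> w) = \<sigma> r \<odot>\<^bsub>N\<^esub> ?L w" if r: "r \<in> carrier R" and w: "w \<in> carrier Om"
  proof (rule Om_hom_eq[OF _ _ N.abelian_group_axioms _ w])
    show "(\<lambda>w. ?L (r \<odot>\<^bsub>Om\<^esub> w)) \<in> addhom Om N"
      by (rule addhom_comp[OF module_smult_hom[OF Om_module r] h])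
    show "(\<lambda>w. \<sigma> r \<odot>\<^bsub>N\<^esub> ?L w) \<in> addhom Om N"
      by (rule addhom_comp[OF h module_smult_hom[OF N s[OF r]]])
    show "?L (r \<odot>\<^bsub>Om\<^esub> (s \<odot>\<^bsub>Om\<^esub> \<delta> x)) = \<sigma> r \<odot>\<^bsub>N\<^esub> ?L (s \<odot>\<^bsub>Om\<^esub> \<delta> x)"
      if "s \<in> carrier R" "x \<in> carrier R" for s x
      using that r by (simp add: l Om.smult_assoc1[symmetric] sa N.smult_assoc1)
  qed
qed

end

section \<open>Commutative monoids\<close>

lemma monoid_hom_closed: "h \<in> monoid_hom P N \<Longrightarrow> x \<in> carrier P \<Longrightarrow> h x \<in> carrier N"
  by (auto simp: monoid_hom_def hom_def)
lemma monoid_hom_mult: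
  "h \<in> monoid_hom P N \<Longrightarrow> x \<in> carrier P \<Longrightarrow> y \<in> carrier P \<Longrightarrow> h (x \<otimes>\<^bsub>P\<^esub> y) = h x \<otimes>\<^bsub>N\<^esub> h y"
  by (auto simp: monoid_hom_def hom_def)
lemma monoid_hom_one: "h \<in> monoid_hom P N \<Longrightarrow> h \<one>\<^bsub>P\<^esub> = \<one>\<^bsub>N\<^esub>"
  by (auto simp: monoid_hom_def)
lemma monoid_homI:
  assumes "\<And>x. x \<in> carrier P \<Longrightarrow> h x \<in> carrier N"
    "\<And>x y. x \<in> carrier P \<Longrightarrow> y \<in> carrier P \<Longrightarrow> h (x \<otimes>\<^bsub>P\<^esub> y) = h x \<otimes>\<^bsub>N\<^esub> h y"
    "h \<one>\<^bsub>P\<^esub> = \<one>\<^bsub>N\<^esub>"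
  shows "h \<in> monoid_hom P N"
  using assms by (auto simp: monoid_hom_def hom_def)

subsection \<open>Group completion\<close>

context comm_monoid
begin

lemma gp_rel_iff: "((a, b), (c, d)) \<in> gp_rel G \<longleftrightarrow>
    a \<in> carrier G \<and> b \<in> carrier G \<and> c \<in> carrier G \<and> d \<in> carrier G \<and>
     (\<exists>s\<in>carrier G. s \<otimes> (a \<otimes> d) = s \<otimes> (c \<otimes> b))"
  by (simp add: gp_rel_def)

lemma gp_rel_equiv: "equiv (carrier G \<times> carrier G) (gp_rel G)"
proof (rule equivI)
  show "refl_on (carrier G \<times> carrier G) (gp_rel G)"
    by (intro refl_onI) (auto simp: gp_rel_iff)
  show "gp_rel G \<subseteq> (carrier G \<times> carrier G) \<times> (carrier G \<times> carrier G)"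
    by (auto simp: gp_rel_def)
  show "sym (gp_rel G)"
    by (intro symI) (auto simp: gp_rel_def, metis)
  show "trans (gp_rel G)"
  proof (rule transI)
    fix x y z assume "(x, y) \<in> gp_rel G" "(y, z) \<in> gp_rel G"
    then obtain a b c d e f s t where xyz: "x = (a, b)" "y = (c, d)" "z = (e, f)"
      and c: "a \<in> carrier G" "b \<in> carrier G" "c \<in> carrier G" "d \<in> carrier G" "e \<in> carrier G" "f \<in> carrier G"
        "s \<in> carrier G" "t \<in> carrier G"
      and eq: "s \<otimes> (a \<otimes> d) = s \<otimes> (c \<otimes> b)" "t \<otimes> (c \<otimes> f) = t \<otimes> (e \<otimes> d)"
      by (auto simp: gp_rel_def)
    have "s \<otimes> t \<otimes> d \<otimes> (a \<otimes> f) = t \<otimes> f \<otimes> (s \<otimes> (a \<otimes> d))" using c by (simp add: m_ac)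
    also have "\<dots> = s \<otimes> b \<otimes> (t \<otimes> (c \<otimes> f))" unfolding eq(1) using c by (simp add: m_ac)
    also have "\<dots> = s \<otimes> t \<otimes> d \<otimes> (e \<otimes> b)" unfolding eq(2) using c by (simp add: m_ac)
    finally show "(x, z) \<in> gp_rel G"
      using c xyz by (auto simp: gp_rel_iff intro!: bexI[of _ "s \<otimes> t \<otimes> d"])
  qed
qed

lemma gp_frac_eq_iff:
  assumes "a \<in> carrier G" "b \<in> carrier G" "c \<in> carrier G" "d \<in> carrier G"
  shows "gp_frac G a b = gp_frac G c d \<longleftrightarrow> (\<exists>s\<in>carrier G. s \<otimes> (a \<otimes> d) = s \<otimes> (c \<otimes> b))"
  unfolding gp_frac_def using assms
  by (subst eq_equiv_class_iff[OF gp_rel_equiv]) (auto simp: gp_rel_iff)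

lemma gp_frac_eqI:
  assumes "a \<in> carrier G" "b \<in> carrier G" "c \<in> carrier G" "d \<in> carrier G" "a \<otimes> d = c \<otimes> b"
  shows "gp_frac G a b = gp_frac G c d"
  using assms by (auto simp: gp_frac_eq_iff)

lemma gp_frac_closed [simp]: "a \<in> carrier G \<Longrightarrow> b \<in> carrier G \<Longrightarrow> gp_frac G a b \<in> carrier (gp G)"
  by (auto simp: gp_def gp_frac_def intro: quotientI)

lemma gp_cases:
  assumes "x \<in> carrier (gp G)"
  obtains a b where "a \<in> carrier G" "b \<in> carrier G" "x = gp_frac G a b"
  using assms by (auto simp: gp_def gp_frac_def elim!: quotientE)

lemma in_gp_frac:
  assumes "(a', b') \<in> gp_frac G a b" "a \<in> carrier G" "b \<in> carrier G"
  shows "a' \<in> carrier G" "b' \<in> carrier G" "gp_frac G a' b' = gp_frac G a b"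
proof -
  have r: "((a, b), (a', b')) \<in> gp_rel G" using assms by (simp add: gp_frac_def)
  then show "a' \<in> carrier G" "b' \<in> carrier G" by (auto simp: gp_rel_iff)
  show "gp_frac G a' b' = gp_frac G a b"
    unfolding gp_frac_def using equiv_class_eq[OF gp_rel_equiv r] by simp
qed

lemma gp_frac_self: "a \<in> carrier G \<Longrightarrow> b \<in> carrier G \<Longrightarrow> (a, b) \<in> gp_frac G a b"
  by (auto simp: gp_frac_def gp_rel_iff)

lemma gp_UN:
  assumes "a \<in> carrier G" "b \<in> carrier G"
    "\<And>a' b'. a' \<in> carrier G \<Longrightarrow> b' \<in> carrier G \<Longrightarrow> gp_frac G a' b' = gp_frac G a b \<Longrightarrow> F a' b' = F a b"
  shows "(\<Union>(a, b)\<in>gp_frac G a b. F a b) = F a b"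
proof -
  have "(\<Union>x\<in>gp_frac G a b. case_prod F x) = case_prod F (a, b)"
  proof (rule UN_coset_const[OF gp_frac_self[OF assms(1,2)]])
    fix x assume "x \<in> gp_frac G a b"
    then show "case_prod F x = case_prod F (a, b)"
      using in_gp_frac[OF _ assms(1,2)] assms(3) by (cases x) simp
  qed
  then show ?thesis by simp
qed

lemma gp_frac_mult_cong:
  assumes "gp_frac G a b = gp_frac G a' b'" "a \<in> carrier G" "b \<in> carrier G" "a' \<in> carrier G" "b' \<in> carrier G"
    "c \<in> carrier G" "d \<in> carrier G"
  shows "gp_frac G (a \<otimes> c) (b \<otimes> d) = gp_frac G (a' \<otimes> c) (b' \<otimes> d)"
proof -
  obtain s where s: "s \<in> carrier G" "s \<otimes> (a \<otimes> b') = s \<otimes> (a' \<otimes> b)"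
    using assms by (auto simp: gp_frac_eq_iff)
  have "s \<otimes> (a \<otimes> c \<otimes> (b' \<otimes> d)) = s \<otimes> (a \<otimes> b') \<otimes> (c \<otimes> d)" using assms s(1) by (simp add: m_ac)
  also have "\<dots> = s \<otimes> (a' \<otimes> c \<otimes> (b \<otimes> d))" using assms s by (simp add: m_ac)
  finally show ?thesis using s assms by (auto simp: gp_frac_eq_iff)
qed

lemma gp_mult [simp]:
  assumes "a \<in> carrier G" "b \<in> carrier G" "c \<in> carrier G" "d \<in> carrier G"
  shows "gp_frac G a b \<otimes>\<^bsub>gp G\<^esub> gp_frac G c d = gp_frac G (a \<otimes> c) (b \<otimes> d)"
proof -
  have 1: "(\<Union>(c, d)\<in>gp_frac G c d. gp_frac G (a' \<otimes> c) (b' \<otimes> d)) = gp_frac G (a' \<otimes> c) (b' \<otimes> d)"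
    if "a' \<in> carrier G" "b' \<in> carrier G" for a' b'
  proof (rule gp_UN[OF assms(3,4)])
    fix c' d' assume "c' \<in> carrier G" "d' \<in> carrier G" "gp_frac G c' d' = gp_frac G c d"
    then show "gp_frac G (a' \<otimes> c') (b' \<otimes> d') = gp_frac G (a' \<otimes> c) (b' \<otimes> d)"
      using gp_frac_mult_cong[of c' d' c d a' b'] that assms(3,4) m_comm by metis
  qed
  have "gp_frac G a b \<otimes>\<^bsub>gp G\<^esub> gp_frac G c d =
     (\<Union>(a, b)\<in>gp_frac G a b. \<Union>(c, d)\<in>gp_frac G c d. gp_frac G (a \<otimes> c) (b \<otimes> d))"
    by (simp add: gp_def)
  also have "\<dots> = (\<Union>(c, d)\<in>gp_frac G c d. gp_frac G (a \<otimes> c) (b \<otimes> d))"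
  proof (rule gp_UN)
    fix a' b' assume "a' \<in> carrier G" "b' \<in> carrier G" "gp_frac G a' b' = gp_frac G a b"
    then show "(\<Union>(c, d)\<in>gp_frac G c d. gp_frac G (a' \<otimes> c) (b' \<otimes> d)) =
        (\<Union>(c, d)\<in>gp_frac G c d. gp_frac G (a \<otimes> c) (b \<otimes> d))"
      using 1 gp_frac_mult_cong assms by metis
  qed (use assms in auto)
  also have "\<dots> = gp_frac G (a \<otimes> c) (b \<otimes> d)" using 1 assms by simp
  finally show ?thesis .
qed

lemma gp_one: "\<one>\<^bsub>gp G\<^esub> = gp_frac G \<one> \<one>"
  by (simp add: gp_def)

lemma gp_frac_same [simp]: "a \<in> carrier G \<Longrightarrow> gp_frac G a a = \<one>\<^bsub>gp G\<^esub>"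
  unfolding gp_one by (intro gp_frac_eqI) auto

lemma gp_comm_group: "comm_group (gp G)"
proof (rule comm_groupI)
  fix x y assume "x \<in> carrier (gp G)" "y \<in> carrier (gp G)"
  then show "x \<otimes>\<^bsub>gp G\<^esub> y \<in> carrier (gp G)" "x \<otimes>\<^bsub>gp G\<^esub> y = y \<otimes>\<^bsub>gp G\<^esub> x"
    by (auto elim!: gp_cases simp: m_comm)
next
  fix x y z assume "x \<in> carrier (gp G)" "y \<in> carrier (gp G)" "z \<in> carrier (gp G)"
  then show "x \<otimes>\<^bsub>gp G\<^esub> y \<otimes>\<^bsub>gp G\<^esub> z = x \<otimes>\<^bsub>gp G\<^esub> (y \<otimes>\<^bsub>gp G\<^esub> z)"
    by (auto elim!: gp_cases simp: m_assoc)
next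
  fix x assume "x \<in> carrier (gp G)"
  then show "\<one>\<^bsub>gp G\<^esub> \<otimes>\<^bsub>gp G\<^esub> x = x"
    by (auto elim!: gp_cases simp: gp_one simp del: gp_frac_same)
  from \<open>x \<in> carrier (gp G)\<close> obtain a b where ab: "a \<in> carrier G" "b \<in> carrier G" "x = gp_frac G a b"
    by (rule gp_cases)
  then show "\<exists>y\<in>carrier (gp G). y \<otimes>\<^bsub>gp G\<^esub> x = \<one>\<^bsub>gp G\<^esub>"
    by (intro bexI[of _ "gp_frac G b a"]) (simp_all add: m_comm[of b a])
qed (simp add: gp_one del: gp_frac_same)

lemma gp_inv: "a \<in> carrier G \<Longrightarrow> b \<in> carrier G \<Longrightarrow> inv\<^bsub>gp G\<^esub> gp_frac G a b = gp_frac G b a"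
  by (intro group.inv_equality comm_group.axioms(2) gp_comm_group) (auto simp: m_comm[of b a])

lemma gp_frac_split:
  "a \<in> carrier G \<Longrightarrow> b \<in> carrier G \<Longrightarrow>
    gp_frac G a b = gp_frac G a \<one> \<otimes>\<^bsub>gp G\<^esub> inv\<^bsub>gp G\<^esub> gp_frac G b \<one>"
  by (simp add: gp_inv)

text \<open>The factor \<open>s\<close> in the relation defining the group completion cancels in \<open>H\<close>.\<close>

lemma gp_universal:
  assumes "comm_group H" "u \<in> monoid_hom G H"
  obtains w where "w \<in> hom (gp G) H"
    "\<And>a b. a \<in> carrier G \<Longrightarrow> b \<in> carrier G \<Longrightarrow> w (gp_frac G a b) = u a \<otimes>\<^bsub>H\<^esub> inv\<^bsub>H\<^esub> u b"
proof
  interpret H: comm_group H by fact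
  note uc = monoid_hom_closed[OF assms(2)] and um = monoid_hom_mult[OF assms(2)]
  let ?F = "\<lambda>(a, b). u a \<otimes>\<^bsub>H\<^esub> inv\<^bsub>H\<^esub> u b"
  let ?w = "\<lambda>x. ?F (SOME p. p \<in> carrier G \<times> carrier G \<and> x = gp_frac G (fst p) (snd p))"
  show w: "?w (gp_frac G a b) = u a \<otimes>\<^bsub>H\<^esub> inv\<^bsub>H\<^esub> u b" if ab: "a \<in> carrier G" "b \<in> carrier G" for a b
  proof -
    define p where "p = (SOME p. p \<in> carrier G \<times> carrier G \<and> gp_frac G a b = gp_frac G (fst p) (snd p))"
    have "p \<in> carrier G \<times> carrier G \<and> gp_frac G a b = gp_frac G (fst p) (snd p)"
      unfolding p_def by (rule someI[of _ "(a, b)"]) (use ab in auto)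
    then obtain c d where p: "p = (c, d)" "c \<in> carrier G" "d \<in> carrier G" "gp_frac G a b = gp_frac G c d"
      by (cases p) auto
    then obtain s where "s \<in> carrier G" "s \<otimes> (a \<otimes> d) = s \<otimes> (c \<otimes> b)"
      using ab by (auto simp: gp_frac_eq_iff)
    then have "u s \<otimes>\<^bsub>H\<^esub> (u a \<otimes>\<^bsub>H\<^esub> u d) = u s \<otimes>\<^bsub>H\<^esub> (u c \<otimes>\<^bsub>H\<^esub> u b)"
      using p ab by (metis um m_closed)
    then have e: "u a \<otimes>\<^bsub>H\<^esub> u d = u c \<otimes>\<^bsub>H\<^esub> u b"
      using p ab \<open>s \<in> _\<close> by (simp add: uc)
    have "u c = inv\<^bsub>H\<^esub> u b \<otimes>\<^bsub>H\<^esub> (u c \<otimes>\<^bsub>H\<^esub> u b)"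
      using p ab by (simp add: uc H.m_comm[of "u c"] H.m_assoc[symmetric])
    also have "\<dots> = (u a \<otimes>\<^bsub>H\<^esub> inv\<^bsub>H\<^esub> u b) \<otimes>\<^bsub>H\<^esub> u d"
      using p ab by (simp add: uc H.m_ac flip: e)
    finally have "u a \<otimes>\<^bsub>H\<^esub> inv\<^bsub>H\<^esub> u b = u c \<otimes>\<^bsub>H\<^esub> inv\<^bsub>H\<^esub> u d"
      using p ab by (subst H.inv_solve_right) (auto simp: uc)
    then show ?thesis unfolding p_def[symmetric] p(1) by simp
  qed
  show "?w \<in> hom (gp G) H"
  proof (rule homI)
    fix x assume "x \<in> carrier (gp G)"
    then show "?w x \<in> carrier H" by (rule gp_cases) (auto simp only: w uc H.m_closed H.inv_closed)
  next
    fix x y assume "x \<in> carrier (gp G)" "y \<in> carrier (gp G)"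
    then obtain a b c d where *: "a \<in> carrier G" "b \<in> carrier G" "x = gp_frac G a b"
      "c \<in> carrier G" "d \<in> carrier G" "y = gp_frac G c d" by (metis gp_cases)
    have "?w (x \<otimes>\<^bsub>gp G\<^esub> y) = u (a \<otimes> c) \<otimes>\<^bsub>H\<^esub> inv\<^bsub>H\<^esub> u (b \<otimes> d)"
      using * by (simp only: gp_mult w m_closed)
    also have "\<dots> = (u a \<otimes>\<^bsub>H\<^esub> inv\<^bsub>H\<^esub> u b) \<otimes>\<^bsub>H\<^esub> (u c \<otimes>\<^bsub>H\<^esub> inv\<^bsub>H\<^esub> u d)"
      using * by (simp add: um uc H.inv_mult H.m_ac)
    finally show "?w (x \<otimes>\<^bsub>gp G\<^esub> y) = ?w x \<otimes>\<^bsub>H\<^esub> ?w y"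
      using * by (simp only: w)
  qed
qed

end

lemma gp_map_frac:
  assumes "comm_monoid P" "comm_monoid N" "h \<in> monoid_hom P N" "a \<in> carrier P" "b \<in> carrier P"
  shows "gp_map N h (gp_frac P a b) = gp_frac N (h a) (h b)"
proof -
  interpret P: comm_monoid P by fact
  interpret N: comm_monoid N by fact
  note hc = monoid_hom_closed[OF assms(3)] and hm = monoid_hom_mult[OF assms(3)]
  show ?thesis
    unfolding gp_map_def
  proof (rule P.gp_UN[OF assms(4,5)])
    fix a' b' assume ab: "a' \<in> carrier P" "b' \<in> carrier P" "gp_frac P a' b' = gp_frac P a b"
    then obtain s where "s \<in> carrier P" "s \<otimes>\<^bsub>P\<^esub> (a' \<otimes>\<^bsub>P\<^esub> b) = s \<otimes>\<^bsub>P\<^esub> (a \<otimes>\<^bsub>P\<^esub> b')"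
      using assms by (auto simp: P.gp_frac_eq_iff)
    then have "h s \<otimes>\<^bsub>N\<^esub> (h a' \<otimes>\<^bsub>N\<^esub> h b) = h s \<otimes>\<^bsub>N\<^esub> (h a \<otimes>\<^bsub>N\<^esub> h b')"
      using ab assms by (metis hm P.m_closed)
    then show "gp_frac N (h a') (h b') = gp_frac N (h a) (h b)"
      using \<open>s \<in> _\<close> ab assms hc by (auto simp: N.gp_frac_eq_iff)
  qed
qed

lemma gp_map_hom:
  assumes "comm_monoid P" "comm_monoid N" "h \<in> monoid_hom P N"
  shows "gp_map N h \<in> hom (gp P) (gp N)"
proof -
  interpret P: comm_monoid P by fact
  interpret N: comm_monoid N by fact
  note hc = monoid_hom_closed[OF assms(3)] and hm = monoid_hom_mult[OF assms(3)]
  show ?thesis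
    by (intro homI) (auto elim!: P.gp_cases simp: gp_map_frac[OF assms] hc hm)
qed

subsection \<open>Amalgamated sums\<close>

locale amalgam = Q: comm_monoid Q + P: comm_monoid P + N: comm_monoid N
  for Q :: "('q, 'x) monoid_scheme" and P :: "('p, 'y) monoid_scheme" and N :: "('n, 'z) monoid_scheme" +
  fixes f g
  assumes f: "f \<in> monoid_hom Q P" and g: "g \<in> monoid_hom Q N"
begin

abbreviation "Am \<equiv> amalg Q P N f g"
abbreviation "ac \<equiv> amalg_class Q P N f g"
abbreviation "rel \<equiv> amalg_rel Q P N f g"

lemma rel_carrier: "(x, y) \<in> rel \<Longrightarrow> x \<in> carrier P \<times> carrier N \<and> y \<in> carrier P \<times> carrier N"
  by (induction rule: amalg_rel.induct) (auto simp: monoid_hom_closed[OF f] monoid_hom_closed[OF g])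

lemma rel_equiv: "equiv (carrier P \<times> carrier N) rel"
  by (intro equivI refl_onI symI transI) (auto intro: amalg_rel.intros dest: rel_carrier)

text \<open>
  The relation is generated by the gluing pairs, so a function that is balanced over \<open>Q\<close> is
  constant on the classes.
\<close>

lemma rel_invariant:
  assumes "(x, y) \<in> rel"
    and "\<And>q p n. q \<in> carrier Q \<Longrightarrow> p \<in> carrier P \<Longrightarrow> n \<in> carrier N \<Longrightarrow> F (p \<otimes>\<^bsub>P\<^esub> f q) n = F p (g q \<otimes>\<^bsub>N\<^esub> n)"
  shows "case_prod F x = case_prod F y"
  using assms(1) by induction (auto simp: assms(2))

lemma class_eq_iff:
  assumes "p \<in> carrier P" "n \<in> carrier N" "p' \<in> carrier P" "n' \<in> carrier N"
  shows "ac p n = ac p' n' \<longleftrightarrow> ((p, n), (p', n')) \<in> rel"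
  unfolding amalg_class_def using assms by (subst eq_equiv_class_iff[OF rel_equiv]) auto

lemma class_glue:
  "q \<in> carrier Q \<Longrightarrow> p \<in> carrier P \<Longrightarrow> n \<in> carrier N \<Longrightarrow> ac (p \<otimes>\<^bsub>P\<^esub> f q) n = ac p (g q \<otimes>\<^bsub>N\<^esub> n)"
  by (subst class_eq_iff) (auto simp: monoid_hom_closed[OF f] monoid_hom_closed[OF g] amalg_rel.glue)

lemma class_closed [simp]: "p \<in> carrier P \<Longrightarrow> n \<in> carrier N \<Longrightarrow> ac p n \<in> carrier Am"
  by (auto simp: amalg_def amalg_class_def intro: quotientI)

lemma Am_cases:
  assumes "x \<in> carrier Am"
  obtains p n where "p \<in> carrier P" "n \<in> carrier N" "x = ac p n"
  using assms by (auto simp: amalg_def amalg_class_def elim!: quotientE)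

lemma in_class:
  assumes "x \<in> ac p n" "p \<in> carrier P" "n \<in> carrier N"
  shows "((p, n), x) \<in> rel"
  using assms by (simp add: amalg_class_def)

lemma class_self: "p \<in> carrier P \<Longrightarrow> n \<in> carrier N \<Longrightarrow> (p, n) \<in> ac p n"
  by (simp add: amalg_class_def amalg_rel.refl)

text \<open>
  Maps out of the amalgamated sum are given by images or by unions over a class; for a balanced
  function both reduce to the value at any representative.
\<close>

lemma class_image:
  assumes "p \<in> carrier P" "n \<in> carrier N"
    and "\<And>q p n. q \<in> carrier Q \<Longrightarrow> p \<in> carrier P \<Longrightarrow> n \<in> carrier N \<Longrightarrow> F (p \<otimes>\<^bsub>P\<^esub> f q) n = F p (g q \<otimes>\<^bsub>N\<^esub> n)"
  shows "case_prod F ` ac p n = {F p n}"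
proof -
  have "case_prod F x = F p n" if "x \<in> ac p n" for x
    using rel_invariant[OF in_class[OF that assms(1,2)], of F] assms(3) by simp
  then show ?thesis using imageI[OF class_self[OF assms(1,2)], of "case_prod F"] by auto
qed

lemma class_the_elem:
  assumes "p \<in> carrier P" "n \<in> carrier N"
    and "\<And>q p n. q \<in> carrier Q \<Longrightarrow> p \<in> carrier P \<Longrightarrow> n \<in> carrier N \<Longrightarrow> F (p \<otimes>\<^bsub>P\<^esub> f q) n = F p (g q \<otimes>\<^bsub>N\<^esub> n)"
  shows "the_elem ((\<lambda>(p, n). F p n) ` ac p n) = F p n"
  using class_image[OF assms] by simp

lemma class_UN:
  assumes "p \<in> carrier P" "n \<in> carrier N"
    and "\<And>q p n. q \<in> carrier Q \<Longrightarrow> p \<in> carrier P \<Longrightarrow> n \<in> carrier N \<Longrightarrow> F (p \<otimes>\<^bsub>P\<^esub> f q) n = F p (g q \<otimes>\<^bsub>N\<^esub> n)"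
  shows "(\<Union>(p, n)\<in>ac p n. F p n) = F p n"
  using class_image[OF assms] by simp

lemma class_mult_right:
  assumes "q \<in> carrier Q" "p \<in> carrier P" "n \<in> carrier N" "p' \<in> carrier P" "n' \<in> carrier N"
  shows "ac (p \<otimes>\<^bsub>P\<^esub> f q \<otimes>\<^bsub>P\<^esub> p') (n \<otimes>\<^bsub>N\<^esub> n') = ac (p \<otimes>\<^bsub>P\<^esub> p') (g q \<otimes>\<^bsub>N\<^esub> n \<otimes>\<^bsub>N\<^esub> n')"
  using class_glue[of q "p \<otimes>\<^bsub>P\<^esub> p'" "n \<otimes>\<^bsub>N\<^esub> n'"] assms monoid_hom_closed[OF f] monoid_hom_closed[OF g]
  by (simp add: P.m_ac N.m_assoc)

lemma Am_mult [simp]: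
  assumes "p \<in> carrier P" "n \<in> carrier N" "p' \<in> carrier P" "n' \<in> carrier N"
  shows "ac p n \<otimes>\<^bsub>Am\<^esub> ac p' n' = ac (p \<otimes>\<^bsub>P\<^esub> p') (n \<otimes>\<^bsub>N\<^esub> n')"
proof -
  have 1: "(\<Union>(p', n')\<in>ac p' n'. ac (p \<otimes>\<^bsub>P\<^esub> p') (n \<otimes>\<^bsub>N\<^esub> n')) = ac (p \<otimes>\<^bsub>P\<^esub> p') (n \<otimes>\<^bsub>N\<^esub> n')"
    if pn: "p \<in> carrier P" "n \<in> carrier N" for p n
  proof (rule class_UN[OF assms(3,4)])
    fix q p' n' assume "q \<in> carrier Q" "p' \<in> carrier P" "n' \<in> carrier N"
    then show "ac (p \<otimes>\<^bsub>P\<^esub> (p' \<otimes>\<^bsub>P\<^esub> f q)) (n \<otimes>\<^bsub>N\<^esub> n') = ac (p \<otimes>\<^bsub>P\<^esub> p') (n \<otimes>\<^bsub>N\<^esub> (g q \<otimes>\<^bsub>N\<^esub> n'))"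
      using class_glue[of q "p \<otimes>\<^bsub>P\<^esub> p'" "n \<otimes>\<^bsub>N\<^esub> n'"] pn monoid_hom_closed[OF f] monoid_hom_closed[OF g]
      by (simp add: P.m_ac N.m_ac)
  qed
  have "ac p n \<otimes>\<^bsub>Am\<^esub> ac p' n' = (\<Union>(p, n)\<in>ac p n. \<Union>(p', n')\<in>ac p' n'. ac (p \<otimes>\<^bsub>P\<^esub> p') (n \<otimes>\<^bsub>N\<^esub> n'))"
    by (simp add: amalg_def)
  also have "\<dots> = (\<Union>(p', n')\<in>ac p' n'. ac (p \<otimes>\<^bsub>P\<^esub> p') (n \<otimes>\<^bsub>N\<^esub> n'))"
    by (rule class_UN[OF assms(1,2)])
      (use assms monoid_hom_closed[OF f] monoid_hom_closed[OF g] in \<open>simp add: 1 class_mult_right\<close>)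
  finally show ?thesis using 1 assms by simp
qed

lemma Am_one: "\<one>\<^bsub>Am\<^esub> = ac \<one>\<^bsub>P\<^esub> \<one>\<^bsub>N\<^esub>"
  by (simp add: amalg_def)

lemma Am_comm_monoid: "comm_monoid Am"
proof (rule comm_monoidI)
  fix x y assume "x \<in> carrier Am" "y \<in> carrier Am"
  then show "x \<otimes>\<^bsub>Am\<^esub> y = y \<otimes>\<^bsub>Am\<^esub> x"
    by (elim Am_cases) (simp, metis P.m_comm N.m_comm)
qed (auto elim!: Am_cases simp: Am_one P.m_assoc N.m_assoc)

end

subsection \<open>Monoid rings\<close>

context comm_monoid
begin

abbreviation "ZM \<equiv> monoid_ring G"

lemma ZM_simps [simp]:
  "c \<in> carrier ZM \<longleftrightarrow> Poly_Mapping.keys c \<subseteq> carrier G"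
  "c \<oplus>\<^bsub>ZM\<^esub> d = c + d" "\<zero>\<^bsub>ZM\<^esub> = 0" "\<one>\<^bsub>ZM\<^esub> = frag_of \<one>"
  by (simp_all add: monoid_ring_def)

lemma ZM_mult_def: "c \<otimes>\<^bsub>ZM\<^esub> d = frag_extend (\<lambda>x. frag_extend (\<lambda>y. frag_of (x \<otimes> y)) d) c"
  by (simp add: monoid_ring_def)

lemma ZM_mult_of [simp]: "frag_of x \<otimes>\<^bsub>ZM\<^esub> frag_of y = frag_of (x \<otimes> y)"
  by (simp add: ZM_mult_def)

lemma ZM_mult_left:
  "(c - d) \<otimes>\<^bsub>ZM\<^esub> z = c \<otimes>\<^bsub>ZM\<^esub> z - d \<otimes>\<^bsub>ZM\<^esub> z" "(c + d) \<otimes>\<^bsub>ZM\<^esub> z = c \<otimes>\<^bsub>ZM\<^esub> z + d \<otimes>\<^bsub>ZM\<^esub> z" "0 \<otimes>\<^bsub>ZM\<^esub> z = 0"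
  by (simp_all add: ZM_mult_def frag_extend_diff frag_extend_add)

lemma frag_extend_fun_diff: "frag_extend (\<lambda>x. u x - v x) c = frag_extend u c - frag_extend v c"
  using subset_UNIV[of "Poly_Mapping.keys c"] by (induction c rule: frag_induction) (auto simp: frag_extend_diff)

lemma ZM_mult_right:
  "z \<otimes>\<^bsub>ZM\<^esub> (c - d) = z \<otimes>\<^bsub>ZM\<^esub> c - z \<otimes>\<^bsub>ZM\<^esub> d" "z \<otimes>\<^bsub>ZM\<^esub> 0 = 0"
  by (simp_all add: ZM_mult_def frag_extend_diff frag_extend_fun_diff frag_extend_eq_0)

lemma ZM_mult_closed:
  "Poly_Mapping.keys c \<subseteq> carrier G \<Longrightarrow> Poly_Mapping.keys d \<subseteq> carrier G \<Longrightarrow> Poly_Mapping.keys (c \<otimes>\<^bsub>ZM\<^esub> d) \<subseteq> carrier G"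
  unfolding ZM_mult_def
  by (erule keys_frag_extend_subset, erule keys_frag_extend_subset) auto

lemma ZM_comm:
  assumes "Poly_Mapping.keys c \<subseteq> carrier G" "Poly_Mapping.keys d \<subseteq> carrier G"
  shows "c \<otimes>\<^bsub>ZM\<^esub> d = d \<otimes>\<^bsub>ZM\<^esub> c"
  using assms(1)
proof (induction c rule: frag_induction)
  case (one x)
  show ?case
    using assms(2) by (induction d rule: frag_induction) (auto simp: ZM_mult_left ZM_mult_right m_comm one)
qed (auto simp: ZM_mult_left ZM_mult_right)

lemma ZM_assoc:
  assumes "Poly_Mapping.keys c \<subseteq> carrier G" "Poly_Mapping.keys d \<subseteq> carrier G" "Poly_Mapping.keys z \<subseteq> carrier G"
  shows "(c \<otimes>\<^bsub>ZM\<^esub> d) \<otimes>\<^bsub>ZM\<^esub> z = c \<otimes>\<^bsub>ZM\<^esub> (d \<otimes>\<^bsub>ZM\<^esub> z)"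
  using assms(1)
proof (induction c rule: frag_induction)
  case (one x)
  show ?case
    using assms(2)
  proof (induction d rule: frag_induction)
    case (one y)
    show ?case
      using assms(3)
      by (induction z rule: frag_induction) (use one \<open>x \<in> _\<close> in \<open>auto simp: ZM_mult_left ZM_mult_right m_assoc\<close>)
  qed (auto simp: ZM_mult_left ZM_mult_right)
qed (auto simp: ZM_mult_left ZM_mult_right)

lemma ZM_one:
  assumes "Poly_Mapping.keys c \<subseteq> carrier G"
  shows "frag_of \<one> \<otimes>\<^bsub>ZM\<^esub> c = c"
  using assms by (induction c rule: frag_induction) (auto simp: ZM_mult_right)

lemma ZM_cring: "cring ZM"
proof (rule cringI)
  show "abelian_group ZM"
  proof (rule abelian_groupI)
    fix x assume "x \<in> carrier ZM"
    then show "\<exists>y\<in>carrier ZM. y \<oplus>\<^bsub>ZM\<^esub> x = \<zero>\<^bsub>ZM\<^esub>" by (intro bexI[of _ "- x"]) auto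
  qed (auto simp: keys_add_subset[THEN subsetD] add_ac)
  show "comm_monoid ZM"
    by (rule comm_monoidI) (simp_all add: ZM_mult_closed ZM_assoc ZM_one, rule ZM_comm)
  show "(x \<oplus>\<^bsub>ZM\<^esub> y) \<otimes>\<^bsub>ZM\<^esub> z = x \<otimes>\<^bsub>ZM\<^esub> z \<oplus>\<^bsub>ZM\<^esub> y \<otimes>\<^bsub>ZM\<^esub> z" for x y z
    by (simp add: ZM_mult_left)
qed

lemma ZM_neg: "Poly_Mapping.keys c \<subseteq> carrier G \<Longrightarrow> \<ominus>\<^bsub>ZM\<^esub> c = - c"
  using ZM_cring by (intro abelian_group.minus_equality ring.is_abelian_group cring.axioms) auto

lemma ZM_minus: "Poly_Mapping.keys d \<subseteq> carrier G \<Longrightarrow> c \<ominus>\<^bsub>ZM\<^esub> d = c - d"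
  by (simp add: a_minus_def ZM_neg)

lemma addhom_ZM: "addhom ZM N = hom (free_Abelian_group (carrier G)) (add_monoid N)"
  by (simp add: hom_def monoid_ring_def free_Abelian_group_def)

lemma free_hom_ZM: "f \<in> addhom ZM N \<Longrightarrow> abelian_group N \<Longrightarrow> free_hom N (carrier G) f"
  by (intro free_hom.intro free_hom_axioms.intro) (simp_all only: addhom_ZM)

text \<open>Both sides of multiplicativity are biadditive, so it suffices to compare them on the basis.\<close>

lemma ZM_ring_hom:
  assumes "cring R" "u \<in> monoid_hom G R"
  shows "frag_lift (add_monoid R) u \<in> ring_hom ZM R"
proof -
  interpret R: cring R by fact
  note uc = monoid_hom_closed[OF assms(2)]
  let ?F = "frag_lift (add_monoid R) u"
  interpret F: free_hom R "carrier G" ?F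
    by (rule free_hom_frag_lift) (auto intro: R.abelian_group_axioms uc)
  have Fof: "?F (frag_of x) = u x" if "x \<in> carrier G" for x
    using uc[OF that] by (subst frag_lift_of) (auto simp: R.a_comm_group)
  have m: "?F (c \<otimes>\<^bsub>ZM\<^esub> d) = ?F c \<otimes>\<^bsub>R\<^esub> ?F d"
    if c: "Poly_Mapping.keys c \<subseteq> carrier G" and d: "Poly_Mapping.keys d \<subseteq> carrier G" for c d
    using c
  proof (rule free_Abelian_group_induct)
    fix x y assume "Poly_Mapping.keys x \<subseteq> carrier G" "Poly_Mapping.keys y \<subseteq> carrier G"
      "?F (x \<otimes>\<^bsub>ZM\<^esub> d) = ?F x \<otimes>\<^bsub>R\<^esub> ?F d" "?F (y \<otimes>\<^bsub>ZM\<^esub> d) = ?F y \<otimes>\<^bsub>R\<^esub> ?F d"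
    then show "?F ((x - y) \<otimes>\<^bsub>ZM\<^esub> d) = ?F (x - y) \<otimes>\<^bsub>R\<^esub> ?F d"
      using d by (simp add: ZM_mult_left F.diff ZM_mult_closed F.closed a_minus_def R.l_distr R.l_minus)
  next
    fix x assume x: "x \<in> carrier G"
    show "?F (frag_of x \<otimes>\<^bsub>ZM\<^esub> d) = ?F (frag_of x) \<otimes>\<^bsub>R\<^esub> ?F d"
      using d
    proof (rule free_Abelian_group_induct)
      fix y z assume "Poly_Mapping.keys y \<subseteq> carrier G" "Poly_Mapping.keys z \<subseteq> carrier G"
        "?F (frag_of x \<otimes>\<^bsub>ZM\<^esub> y) = ?F (frag_of x) \<otimes>\<^bsub>R\<^esub> ?F y" "?F (frag_of x \<otimes>\<^bsub>ZM\<^esub> z) = ?F (frag_of x) \<otimes>\<^bsub>R\<^esub> ?F z"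
      then show "?F (frag_of x \<otimes>\<^bsub>ZM\<^esub> (y - z)) = ?F (frag_of x) \<otimes>\<^bsub>R\<^esub> ?F (y - z)"
        using x by (simp add: ZM_mult_right F.diff ZM_mult_closed F.closed a_minus_def R.r_distr R.r_minus)
    next
      fix y assume "y \<in> carrier G"
      then show "?F (frag_of x \<otimes>\<^bsub>ZM\<^esub> frag_of y) = ?F (frag_of x) \<otimes>\<^bsub>R\<^esub> ?F (frag_of y)"
        using x by (simp add: Fof monoid_hom_mult[OF assms(2)])
    qed (use x in \<open>simp add: ZM_mult_right F.zero F.closed\<close>)
  qed (use d in \<open>simp add: ZM_mult_left F.zero F.closed\<close>)
  show ?thesis
    by (rule ring_hom_memI) (auto simp: F.closed m F.add Fof monoid_hom_one[OF assms(2)])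
qed

lemma ZM_lift_of:
  assumes "abelian_group N" "u x \<in> carrier N"
  shows "frag_lift (add_monoid N) u (frag_of x) = u x"
  using assms by (intro frag_lift_of) (auto simp: abelian_group.a_comm_group)

end

lemma monoid_ring_map_ring_hom:
  assumes "comm_monoid P" "comm_monoid N" "h \<in> monoid_hom P N"
  shows "monoid_ring_map h \<in> ring_hom (monoid_ring P) (monoid_ring N)"
proof -
  interpret P: comm_monoid P by fact
  interpret N: comm_monoid N by fact
  note hc = monoid_hom_closed[OF assms(3)] and hm = monoid_hom_mult[OF assms(3)]
  have cl: "Poly_Mapping.keys (monoid_ring_map h c) \<subseteq> carrier N" if "Poly_Mapping.keys c \<subseteq> carrier P" for c
    unfolding monoid_ring_map_def using that by (rule keys_frag_extend_subset) (auto simp: hc)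
  have m: "monoid_ring_map h (c \<otimes>\<^bsub>P.ZM\<^esub> d) = monoid_ring_map h c \<otimes>\<^bsub>N.ZM\<^esub> monoid_ring_map h d"
    if c: "Poly_Mapping.keys c \<subseteq> carrier P" and d: "Poly_Mapping.keys d \<subseteq> carrier P" for c d
    using c
  proof (rule free_Abelian_group_induct)
    fix x assume x: "x \<in> carrier P"
    show "monoid_ring_map h (frag_of x \<otimes>\<^bsub>P.ZM\<^esub> d) = monoid_ring_map h (frag_of x) \<otimes>\<^bsub>N.ZM\<^esub> monoid_ring_map h d"
      using d by (rule free_Abelian_group_induct)
        (use x in \<open>auto simp: monoid_ring_map_def P.ZM_mult_right N.ZM_mult_right frag_extend_diff hm\<close>)
  qed (auto simp: monoid_ring_map_def P.ZM_mult_left N.ZM_mult_left frag_extend_diff)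
  show ?thesis
    by (rule ring_hom_memI)
      (use cl m in \<open>auto simp: monoid_ring_map_def frag_extend_add monoid_hom_one[OF assms(3)]\<close>)
qed

section \<open>The module \<open>D\<^sup>1\<close> in one simplicial degree\<close>

lemma module_sub:
  "module A M \<Longrightarrow> submodule K A M \<Longrightarrow> module A (M\<lparr>carrier := K\<rparr>)"
  by (rule submodule.submodule_is_module)

lemma a_inv_sub:
  assumes "module A M" "submodule K A M" "x \<in> K"
  shows "\<ominus>\<^bsub>M\<lparr>carrier := K\<rparr>\<^esub> x = \<ominus>\<^bsub>M\<^esub> x"
proof -
  interpret M: module A M by fact
  interpret K: module A "M\<lparr>carrier := K\<rparr>" by (rule module_sub) fact+
  have "\<ominus>\<^bsub>M\<lparr>carrier := K\<rparr>\<^esub> x \<oplus>\<^bsub>M\<^esub> x = \<zero>\<^bsub>M\<^esub>" using K.l_neg[of x] assms(3) by simp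
  moreover have "\<ominus>\<^bsub>M\<lparr>carrier := K\<rparr>\<^esub> x \<in> K" using K.a_inv_closed[of x] assms(3) by simp
  moreover have "K \<subseteq> carrier M"
    using subgroup.subset[OF submodule_subgroup[OF assms(2)]] by simp
  ultimately show ?thesis using M.minus_equality assms(3) by (metis subsetD)
qed

lemma prelog_homD:
  assumes "\<phi> \<in> prelog_hom A B"
  shows "fst \<phi> \<in> ring_hom (ring_of A) (ring_of B)" "snd \<phi> \<in> monoid_hom (monoid_of A) (monoid_of B)"
    "q \<in> carrier (monoid_of A) \<Longrightarrow> chart B (snd \<phi> q) = fst \<phi> (chart A q)"
  using assms by (auto simp: prelog_hom_def)

lemma monoid_hom_comp: "u \<in> monoid_hom P N \<Longrightarrow> v \<in> monoid_hom N L \<Longrightarrow> v \<circ> u \<in> monoid_hom P L"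
  by (rule monoid_homI) (simp_all add: monoid_hom_closed monoid_hom_mult monoid_hom_one)

lemma ring_hom_addhom: "u \<in> ring_hom R S \<Longrightarrow> u \<in> addhom R S"
  by (auto simp: ring_hom_def hom_def)

lemma int_to_ring_hom:
  assumes "cring B"
  shows "(\<lambda>k. add_pow B k \<one>\<^bsub>B\<^esub>) \<in> ring_hom \<Z> B"
proof -
  interpret cring B by fact
  have m: "add_pow B (a * b) \<one>\<^bsub>B\<^esub> = add_pow B a \<one>\<^bsub>B\<^esub> \<otimes>\<^bsub>B\<^esub> add_pow B b \<one>\<^bsub>B\<^esub>" for a b :: int
    using add.int_pow_pow[of "\<one>\<^bsub>B\<^esub>" a b] add.int_pow_pow[of "\<one>\<^bsub>B\<^esub>" b a] by (simp add: add_pow_ldistr_int mult.commute[of b a])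
  show ?thesis
    by (rule ring_hom_memI) (auto simp: add.int_pow_mult m)
qed

text \<open>
  One simplicial degree of a resolution: a factorization \<open>(C,Q) \<rightarrow> (R,P) \<rightarrow> (B,N)\<close>.  The modules
  \<open>D\<^sup>1\<close> and \<open>\<bbbL>\<close> and the map between them are constructed degree by degree.
\<close>

locale log_factorization =
  fixes F :: "('c, 'q, 'r, 'p, 'b, 'n) factorization"
  assumes src: "prelog_ring (source F)" and mid: "prelog_ring (middle F)" and tgt: "prelog_ring (target F)"
    and inc: "incl F \<in> prelog_hom (source F) (middle F)"
    and prj: "proj F \<in> prelog_hom (middle F) (target F)"
begin

abbreviation "C \<equiv> Cr F"
abbreviation "R \<equiv> Rr F"
abbreviation "B \<equiv> Br F"
abbreviation "e \<equiv> fst (incl F)"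
abbreviation "eQ \<equiv> snd (incl F)"
abbreviation "eps \<equiv> fst (proj F)"
abbreviation "h \<equiv> snd (proj F)"
abbreviation "\<chi> \<equiv> chart (middle F)"
abbreviation "\<beta> \<equiv> chart (target F)"

sublocale C: cring C using src by (simp add: prelog_ring_def)
sublocale R: cring R using mid by (simp add: prelog_ring_def)
sublocale B: cring B using tgt by (simp add: prelog_ring_def)
sublocale Q: comm_monoid "Qm F" using src by (simp add: prelog_ring_def)
sublocale P: comm_monoid "Pm F" using mid by (simp add: prelog_ring_def)
sublocale N: comm_monoid "Nm F" using tgt by (simp add: prelog_ring_def)

lemma e_hom: "e \<in> ring_hom C R" using prelog_homD(1)[OF inc] .
lemma eps_hom: "eps \<in> ring_hom R B" using prelog_homD(1)[OF prj] .
lemma eQ_hom: "eQ \<in> monoid_hom (Qm F) (Pm F)" using prelog_homD(2)[OF inc] .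
lemma h_hom: "h \<in> monoid_hom (Pm F) (Nm F)" using prelog_homD(2)[OF prj] .
lemma chi_hom: "\<chi> \<in> monoid_hom (Pm F) R" using mid by (simp add: prelog_ring_def)
lemma beta_hom: "\<beta> \<in> monoid_hom (Nm F) B" using tgt by (simp add: prelog_ring_def)

lemma e_cl [simp]: "c \<in> carrier C \<Longrightarrow> e c \<in> carrier R"
  using e_hom by (auto simp: ring_hom_def)
lemma eps_simps [simp]:
  "r \<in> carrier R \<Longrightarrow> eps r \<in> carrier B"
  "r \<in> carrier R \<Longrightarrow> r' \<in> carrier R \<Longrightarrow> eps (r \<otimes>\<^bsub>R\<^esub> r') = eps r \<otimes>\<^bsub>B\<^esub> eps r'"
  "r \<in> carrier R \<Longrightarrow> r' \<in> carrier R \<Longrightarrow> eps (r \<oplus>\<^bsub>R\<^esub> r') = eps r \<oplus>\<^bsub>B\<^esub> eps r'"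
  "eps \<one>\<^bsub>R\<^esub> = \<one>\<^bsub>B\<^esub>"
  using eps_hom by (auto simp: ring_hom_def)
lemma eQ_cl [simp]: "q \<in> carrier (Qm F) \<Longrightarrow> eQ q \<in> carrier (Pm F)"
  using eQ_hom by (auto simp: monoid_hom_def hom_def)
lemma h_simps [simp]:
  "p \<in> carrier (Pm F) \<Longrightarrow> h p \<in> carrier (Nm F)"
  "p \<in> carrier (Pm F) \<Longrightarrow> p' \<in> carrier (Pm F) \<Longrightarrow> h (p \<otimes>\<^bsub>Pm F\<^esub> p') = h p \<otimes>\<^bsub>Nm F\<^esub> h p'"
  "h \<one>\<^bsub>Pm F\<^esub> = \<one>\<^bsub>Nm F\<^esub>"
  using h_hom by (auto simp: monoid_hom_def hom_def)
lemma chi_simps [simp]: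
  "p \<in> carrier (Pm F) \<Longrightarrow> \<chi> p \<in> carrier R"
  "p \<in> carrier (Pm F) \<Longrightarrow> p' \<in> carrier (Pm F) \<Longrightarrow> \<chi> (p \<otimes>\<^bsub>Pm F\<^esub> p') = \<chi> p \<otimes>\<^bsub>R\<^esub> \<chi> p'"
  "\<chi> \<one>\<^bsub>Pm F\<^esub> = \<one>\<^bsub>R\<^esub>"
  using chi_hom by (auto simp: monoid_hom_def hom_def)
lemma beta_simps [simp]:
  "n \<in> carrier (Nm F) \<Longrightarrow> \<beta> n \<in> carrier B"
  "n \<in> carrier (Nm F) \<Longrightarrow> n' \<in> carrier (Nm F) \<Longrightarrow> \<beta> (n \<otimes>\<^bsub>Nm F\<^esub> n') = \<beta> n \<otimes>\<^bsub>B\<^esub> \<beta> n'"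
  "\<beta> \<one>\<^bsub>Nm F\<^esub> = \<one>\<^bsub>B\<^esub>"
  using beta_hom by (auto simp: monoid_hom_def hom_def)
lemma chi_eQ: "q \<in> carrier (Qm F) \<Longrightarrow> \<chi> (eQ q) = e (chart (source F) q)"
  using prelog_homD(3)[OF inc] .
lemma eps_chi [simp]: "p \<in> carrier (Pm F) \<Longrightarrow> eps (\<chi> p) = \<beta> (h p)"
  using prelog_homD(3)[OF prj] by simp
lemma chart_source [simp]: "q \<in> carrier (Qm F) \<Longrightarrow> chart (source F) q \<in> carrier C"
  using src by (auto simp: prelog_ring_def monoid_hom_def hom_def)

subsection \<open>The ring \<open>R \<otimes>\<^sub>C B\<close> and the augmentation ideal\<close>

sublocale T: algebra_tensor C R B e "eps \<circ> e"
  using ring_hom_trans[OF e_hom eps_hom]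
  by (intro algebra_tensor.intro algebra_tensor_axioms.intro C.is_cring R.is_cring B.is_cring e_hom)

lemma RB_eq: "RB F = T.RT" by (simp add: RB_def)
lemma RB_tensor_eq: "RB_tensor F = T.pt" by (simp add: RB_tensor_def)

sublocale RB: cring "RB F" unfolding RB_eq by (rule T.RT_cring)

lemma RB_tensor_closed [simp]: "r \<in> carrier R \<Longrightarrow> b \<in> carrier B \<Longrightarrow> RB_tensor F r b \<in> carrier (RB F)"
  by (simp add: RB_eq RB_tensor_eq)
lemma RB_tensor_add_left: "r \<in> carrier R \<Longrightarrow> r' \<in> carrier R \<Longrightarrow> b \<in> carrier B \<Longrightarrow>
    RB_tensor F (r \<oplus>\<^bsub>R\<^esub> r') b = RB_tensor F r b \<oplus>\<^bsub>RB F\<^esub> RB_tensor F r' b"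
  by (simp add: RB_eq RB_tensor_eq T.pt_add_left)
lemma RB_tensor_add_right: "r \<in> carrier R \<Longrightarrow> b \<in> carrier B \<Longrightarrow> b' \<in> carrier B \<Longrightarrow>
    RB_tensor F r (b \<oplus>\<^bsub>B\<^esub> b') = RB_tensor F r b \<oplus>\<^bsub>RB F\<^esub> RB_tensor F r b'"
  using T.pt_add_right by (simp add: RB_eq RB_tensor_eq)
lemma RB_tensor_balance: "r \<in> carrier R \<Longrightarrow> c \<in> carrier C \<Longrightarrow> b \<in> carrier B \<Longrightarrow>
    RB_tensor F (r \<otimes>\<^bsub>R\<^esub> e c) b = RB_tensor F r (eps (e c) \<otimes>\<^bsub>B\<^esub> b)"
  using T.pt_balance[of r c b] by (simp add: RB_tensor_eq)
lemma RB_tensor_mult: "r \<in> carrier R \<Longrightarrow> b \<in> carrier B \<Longrightarrow> r' \<in> carrier R \<Longrightarrow> b' \<in> carrier B \<Longrightarrow>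
    RB_tensor F r b \<otimes>\<^bsub>RB F\<^esub> RB_tensor F r' b' = RB_tensor F (r \<otimes>\<^bsub>R\<^esub> r') (b \<otimes>\<^bsub>B\<^esub> b')"
  by (simp add: RB_eq RB_tensor_eq T.RT_mult_pt)
lemma RB_one: "\<one>\<^bsub>RB F\<^esub> = RB_tensor F \<one>\<^bsub>R\<^esub> \<one>\<^bsub>B\<^esub>"
  by (simp add: RB_eq RB_tensor_eq)

lemma RB_induct [consumes 1, case_names zero pure diff]:
  assumes "z \<in> carrier (RB F)" "P \<zero>\<^bsub>RB F\<^esub>"
    and "\<And>r b. r \<in> carrier R \<Longrightarrow> b \<in> carrier B \<Longrightarrow> P (RB_tensor F r b)"
    and "\<And>y z. y \<in> carrier (RB F) \<Longrightarrow> z \<in> carrier (RB F) \<Longrightarrow> P y \<Longrightarrow> P z \<Longrightarrow> P (y \<ominus>\<^bsub>RB F\<^esub> z)"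
  shows "P z"
  using assms unfolding RB_eq RB_tensor_eq by (rule T.RT_induct)

lemma RB_addhom: "addhom (RB F) L = addhom T.BC L" "addhom L (RB F) = addhom L T.BC"
  unfolding RB_eq by (rule addhom_transfer; simp)+

lemma RB_hom_eq:
  assumes "f \<in> addhom (RB F) L" "g \<in> addhom (RB F) L" "abelian_group L"
    "\<And>r b. r \<in> carrier R \<Longrightarrow> b \<in> carrier B \<Longrightarrow> f (RB_tensor F r b) = g (RB_tensor F r b)" "z \<in> carrier (RB F)"
  shows "f z = g z"
  using assms(5)
proof (induction rule: RB_induct)
  case zero
  then show ?case using addhom_zero RB.abelian_group_axioms assms(1-3) by metis
next
  case (diff y z)
  then show ?case using addhom_diff RB.abelian_group_axioms assms(1-3) by metis
qed (fact assms(4))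

lemma RB_lift:
  assumes "abelian_group L"
    and "\<And>r b. r \<in> carrier R \<Longrightarrow> b \<in> carrier B \<Longrightarrow> \<phi> r b \<in> carrier L"
    and "\<And>r r' b. r \<in> carrier R \<Longrightarrow> r' \<in> carrier R \<Longrightarrow> b \<in> carrier B \<Longrightarrow> \<phi> (r \<oplus>\<^bsub>R\<^esub> r') b = \<phi> r b \<oplus>\<^bsub>L\<^esub> \<phi> r' b"
    and "\<And>r b b'. r \<in> carrier R \<Longrightarrow> b \<in> carrier B \<Longrightarrow> b' \<in> carrier B \<Longrightarrow> \<phi> r (b \<oplus>\<^bsub>B\<^esub> b') = \<phi> r b \<oplus>\<^bsub>L\<^esub> \<phi> r b'"
    and "\<And>r c b. r \<in> carrier R \<Longrightarrow> c \<in> carrier C \<Longrightarrow> b \<in> carrier B \<Longrightarrow> \<phi> (r \<otimes>\<^bsub>R\<^esub> e c) b = \<phi> r (eps (e c) \<otimes>\<^bsub>B\<^esub> b)"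
  shows RB_lift_hom: "symbol_lift L \<phi> \<in> addhom (RB F) L"
    and RB_lift_tensor: "r \<in> carrier R \<Longrightarrow> b \<in> carrier B \<Longrightarrow> symbol_lift L \<phi> (RB_tensor F r b) = \<phi> r b"
proof -
  show "symbol_lift L \<phi> \<in> addhom (RB F) L"
    unfolding RB_addhom by (rule T.BC_lift_hom) (use assms in simp_all)
  show "r \<in> carrier R \<Longrightarrow> b \<in> carrier B \<Longrightarrow> symbol_lift L \<phi> (RB_tensor F r b) = \<phi> r b"
    unfolding RB_tensor_eq by (rule T.BC_lift_pt) (use assms in simp_all)
qed

lemma RB_proj:
  shows RB_proj_addhom: "RB_proj F \<in> addhom (RB F) B"
    and RB_proj_tensor [simp]: "r \<in> carrier R \<Longrightarrow> b \<in> carrier B \<Longrightarrow> RB_proj F (RB_tensor F r b) = eps r \<otimes>\<^bsub>B\<^esub> b"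
proof -
  show "RB_proj F \<in> addhom (RB F) B"
    unfolding RB_proj_def
    by (rule RB_lift_hom[OF B.abelian_group_axioms]) (simp_all add: B.l_distr B.r_distr B.m_assoc)
  show "r \<in> carrier R \<Longrightarrow> b \<in> carrier B \<Longrightarrow> RB_proj F (RB_tensor F r b) = eps r \<otimes>\<^bsub>B\<^esub> b"
    unfolding RB_proj_def
    by (rule RB_lift_tensor[OF B.abelian_group_axioms]) (simp_all add: B.l_distr B.r_distr B.m_assoc)
qed

lemma RB_bilinear_eq:
  assumes "abelian_group L"
    and "\<And>z. z \<in> carrier (RB F) \<Longrightarrow> (\<lambda>w. f w z) \<in> addhom (RB F) L" "\<And>w. w \<in> carrier (RB F) \<Longrightarrow> f w \<in> addhom (RB F) L"
    and "\<And>z. z \<in> carrier (RB F) \<Longrightarrow> (\<lambda>w. g w z) \<in> addhom (RB F) L" "\<And>w. w \<in> carrier (RB F) \<Longrightarrow> g w \<in> addhom (RB F) L"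
    and "\<And>r b r' b'. r \<in> carrier R \<Longrightarrow> b \<in> carrier B \<Longrightarrow> r' \<in> carrier R \<Longrightarrow> b' \<in> carrier B \<Longrightarrow>
      f (RB_tensor F r b) (RB_tensor F r' b') = g (RB_tensor F r b) (RB_tensor F r' b')"
    and "w \<in> carrier (RB F)" "z \<in> carrier (RB F)"
  shows "f w z = g w z"
proof (rule RB_hom_eq[OF assms(2,4,1)])
  fix r b assume rb: "r \<in> carrier R" "b \<in> carrier B"
  then have "RB_tensor F r b \<in> carrier (RB F)" by simp
  from assms(3)[OF this] assms(5)[OF this] show "f (RB_tensor F r b) z = g (RB_tensor F r b) z"
    by (rule RB_hom_eq) (use assms rb in auto)
qed (use assms in auto)

lemma addhom_lmult: "cring S \<Longrightarrow> a \<in> carrier S \<Longrightarrow> (\<lambda>x. a \<otimes>\<^bsub>S\<^esub> x) \<in> addhom S S"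
  by (intro addhomI) (auto simp: cring_def ring.ring_simprules)
lemma addhom_rmult: "cring S \<Longrightarrow> a \<in> carrier S \<Longrightarrow> (\<lambda>x. x \<otimes>\<^bsub>S\<^esub> a) \<in> addhom S S"
  by (intro addhomI) (auto simp: cring_def ring.ring_simprules)

lemma RB_proj_hom: "RB_proj F \<in> ring_hom (RB F) B"
proof (rule ring_hom_memI)
  note cl = addhom_closed[OF RB_proj_addhom]
  fix x y assume xy: "x \<in> carrier (RB F)" "y \<in> carrier (RB F)"
  show "RB_proj F (x \<otimes>\<^bsub>RB F\<^esub> y) = RB_proj F x \<otimes>\<^bsub>B\<^esub> RB_proj F y"
  proof (rule RB_bilinear_eq[OF B.abelian_group_axioms _ _ _ _ _ xy])
    fix z assume z: "z \<in> carrier (RB F)"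
    show "(\<lambda>w. RB_proj F (w \<otimes>\<^bsub>RB F\<^esub> z)) \<in> addhom (RB F) B"
      by (rule addhom_comp[OF addhom_rmult[OF RB.is_cring z] RB_proj_addhom])
    show "(\<lambda>w. RB_proj F (z \<otimes>\<^bsub>RB F\<^esub> w)) \<in> addhom (RB F) B"
      by (rule addhom_comp[OF addhom_lmult[OF RB.is_cring z] RB_proj_addhom])
    show "(\<lambda>w. RB_proj F w \<otimes>\<^bsub>B\<^esub> RB_proj F z) \<in> addhom (RB F) B"
      by (rule addhom_comp[OF RB_proj_addhom addhom_rmult[OF B.is_cring cl[OF z]]])
    show "(\<lambda>w. RB_proj F z \<otimes>\<^bsub>B\<^esub> RB_proj F w) \<in> addhom (RB F) B"
      by (rule addhom_comp[OF RB_proj_addhom addhom_lmult[OF B.is_cring cl[OF z]]])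
  qed (simp add: RB_tensor_mult B.m_ac)
qed (auto simp: addhom_closed[OF RB_proj_addhom] addhom_add[OF RB_proj_addhom] RB_one)

lemma RB_proj_simps [simp]:
  "x \<in> carrier (RB F) \<Longrightarrow> RB_proj F x \<in> carrier B"
  "x \<in> carrier (RB F) \<Longrightarrow> y \<in> carrier (RB F) \<Longrightarrow> RB_proj F (x \<otimes>\<^bsub>RB F\<^esub> y) = RB_proj F x \<otimes>\<^bsub>B\<^esub> RB_proj F y"
  "x \<in> carrier (RB F) \<Longrightarrow> y \<in> carrier (RB F) \<Longrightarrow> RB_proj F (x \<oplus>\<^bsub>RB F\<^esub> y) = RB_proj F x \<oplus>\<^bsub>B\<^esub> RB_proj F y"
  "x \<in> carrier (RB F) \<Longrightarrow> y \<in> carrier (RB F) \<Longrightarrow> RB_proj F (x \<ominus>\<^bsub>RB F\<^esub> y) = RB_proj F x \<ominus>\<^bsub>B\<^esub> RB_proj F y"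
  "RB_proj F \<zero>\<^bsub>RB F\<^esub> = \<zero>\<^bsub>B\<^esub>"
  using RB_proj_hom addhom_diff[OF RB_proj_addhom RB.abelian_group_axioms B.abelian_group_axioms]
    addhom_zero[OF RB_proj_addhom RB.abelian_group_axioms B.abelian_group_axioms]
  by (auto simp: ring_hom_def)

text \<open>The section \<open>b \<mapsto> 1 \<otimes> b\<close> of the augmentation, which makes everything a \<open>B\<close>-module.\<close>

abbreviation "sec b \<equiv> RB_tensor F \<one>\<^bsub>R\<^esub> b"

lemma sec_hom: "sec \<in> ring_hom B (RB F)"
  by (rule ring_hom_memI) (auto simp: RB_tensor_mult RB_one RB_tensor_add_right)

abbreviation "Iset \<equiv> {x \<in> carrier (RB F). RB_proj F x = \<zero>\<^bsub>B\<^esub>}"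

lemma I_mod_simps [simp]:
  "carrier (I_mod F) = Iset" "(\<oplus>\<^bsub>I_mod F\<^esub>) = (\<oplus>\<^bsub>RB F\<^esub>)" "\<zero>\<^bsub>I_mod F\<^esub> = \<zero>\<^bsub>RB F\<^esub>"
  "a \<odot>\<^bsub>I_mod F\<^esub> x = a \<otimes>\<^bsub>RB F\<^esub> x"
proof -
  have *: "\<zero>\<^bsub>M\<lparr>carrier := K\<rparr>\<^esub> = \<zero>\<^bsub>M\<^esub>" "(\<oplus>\<^bsub>M\<lparr>carrier := K\<rparr>\<^esub>) = (\<oplus>\<^bsub>M\<^esub>)" "(\<odot>\<^bsub>M\<lparr>carrier := K\<rparr>\<^esub>) = (\<odot>\<^bsub>M\<^esub>)"
    for M :: "(('r, 'b) RB_elem, ('r, 'b) RB_elem) module" and K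
    by simp_all
  show "carrier (I_mod F) = Iset" "(\<oplus>\<^bsub>I_mod F\<^esub>) = (\<oplus>\<^bsub>RB F\<^esub>)" "\<zero>\<^bsub>I_mod F\<^esub> = \<zero>\<^bsub>RB F\<^esub>"
    "a \<odot>\<^bsub>I_mod F\<^esub> x = a \<otimes>\<^bsub>RB F\<^esub> x"
    unfolding I_mod_def * by (simp_all add: a_kernel_def')
qed

lemma I_submodule: "submodule Iset (RB F) (ring_as_module (RB F))"
  by (rule module.submoduleI[OF module_ring_as_module[OF RB.is_cring]])
    (auto simp: addhom_neg[OF RB_proj_addhom RB.abelian_group_axioms B.abelian_group_axioms])

lemma I_module: "module (RB F) (I_mod F)"
  using module_sub[OF module_ring_as_module[OF RB.is_cring] I_submodule]
  by (simp add: I_mod_def a_kernel_def')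

lemma I_neg: "x \<in> Iset \<Longrightarrow> \<ominus>\<^bsub>I_mod F\<^esub> x = \<ominus>\<^bsub>RB F\<^esub> x"
  using a_inv_sub[OF module_ring_as_module[OF RB.is_cring] I_submodule]
  by (simp add: I_mod_def a_kernel_def')

lemma I_diff: "x \<in> carrier (RB F) \<Longrightarrow> y \<in> Iset \<Longrightarrow> x \<ominus>\<^bsub>I_mod F\<^esub> y = x \<ominus>\<^bsub>RB F\<^esub> y"
  by (simp add: a_minus_def I_neg)

text \<open>The element \<open>r \<otimes> b - 1 \<otimes> \<epsilon>(r) b\<close>; these generate \<open>I\<close> additively.\<close>

definition gI :: "'b \<Rightarrow> 'r \<Rightarrow> ('r, 'b) RB_elem" where
  "gI b r = RB_tensor F r b \<ominus>\<^bsub>RB F\<^esub> sec (eps r \<otimes>\<^bsub>B\<^esub> b)"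

lemma gI_closed: "r \<in> carrier R \<Longrightarrow> b \<in> carrier B \<Longrightarrow> gI b r \<in> Iset"
  by (auto simp: gI_def B.r_neg a_minus_def[of B])

text \<open>
  For every \<open>z\<close> the difference \<open>z - 1 \<otimes> \<pi>(z)\<close> is a combination of the elements \<open>gI\<close>, and for \<open>z\<close> in
  \<open>I\<close> it is \<open>z\<close> itself.
\<close>

lemma I_induct [consumes 1, case_names zero gen diff]:
  assumes "z \<in> Iset" "P \<zero>\<^bsub>RB F\<^esub>"
    and "\<And>r b. r \<in> carrier R \<Longrightarrow> b \<in> carrier B \<Longrightarrow> P (gI b r)"
    and "\<And>y z. y \<in> Iset \<Longrightarrow> z \<in> Iset \<Longrightarrow> P y \<Longrightarrow> P z \<Longrightarrow> P (y \<ominus>\<^bsub>RB F\<^esub> z)"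
  shows "P z"
proof -
  have "P (z \<ominus>\<^bsub>RB F\<^esub> sec (RB_proj F z)) \<and> z \<ominus>\<^bsub>RB F\<^esub> sec (RB_proj F z) \<in> Iset" if "z \<in> carrier (RB F)"
    using that
  proof (induction rule: RB_induct)
    case zero
    have "sec \<zero>\<^bsub>B\<^esub> = \<zero>\<^bsub>RB F\<^esub>"
      using addhom_zero[OF ring_hom_addhom[OF sec_hom] B.abelian_group_axioms RB.abelian_group_axioms] .
    then show ?case using assms(2) by (simp add: RB.minus_eq)
  next
    case (pure r b)
    then show ?case using assms(3)[of r b] gI_closed[of r b] by (simp add: gI_def)
  next
    case (diff y z)
    have "(y \<ominus>\<^bsub>RB F\<^esub> z) \<ominus>\<^bsub>RB F\<^esub> sec (RB_proj F (y \<ominus>\<^bsub>RB F\<^esub> z)) =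
       (y \<ominus>\<^bsub>RB F\<^esub> sec (RB_proj F y)) \<ominus>\<^bsub>RB F\<^esub> (z \<ominus>\<^bsub>RB F\<^esub> sec (RB_proj F z))"
    proof -
      have "sec (RB_proj F (y \<ominus>\<^bsub>RB F\<^esub> z)) = sec (RB_proj F y) \<ominus>\<^bsub>RB F\<^esub> sec (RB_proj F z)"
        using diff addhom_diff[OF ring_hom_addhom[OF sec_hom] B.abelian_group_axioms RB.abelian_group_axioms]
        by simp
      then show ?thesis using diff by (simp add: RB.minus_eq RB.minus_add RB.a_ac)
    qed
    then show ?case using diff assms(4) by (auto simp: B.r_neg B.minus_eq)
  qed
  moreover have "sec \<zero>\<^bsub>B\<^esub> = \<zero>\<^bsub>RB F\<^esub>"
    using addhom_zero[OF ring_hom_addhom[OF sec_hom] B.abelian_group_axioms RB.abelian_group_axioms] .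
  ultimately show ?thesis using assms(1) by (simp add: RB.minus_eq)
qed

subsection \<open>The monoid \<open>P \<oplus>\<^sub>Q N\<close> and the group \<open>T\<close>\<close>

sublocale A: amalgam "Qm F" "Pm F" "Nm F" eQ "h \<circ> eQ"
  using monoid_hom_comp[OF eQ_hom h_hom]
  by (intro amalgam.intro amalgam_axioms.intro Q.comm_monoid_axioms P.comm_monoid_axioms N.comm_monoid_axioms eQ_hom)

lemma PN_eq: "PN F = A.Am" by (simp add: PN_def)
lemma PN_class_eq: "PN_class F = A.ac" by (simp add: PN_class_def)

sublocale PN: comm_monoid "PN F" unfolding PN_eq by (rule A.Am_comm_monoid)

lemma PN_class_closed [simp]: "p \<in> carrier (Pm F) \<Longrightarrow> n \<in> carrier (Nm F) \<Longrightarrow> PN_class F p n \<in> carrier (PN F)"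
  by (simp add: PN_eq PN_class_eq)
lemma PN_mult [simp]: "p \<in> carrier (Pm F) \<Longrightarrow> n \<in> carrier (Nm F) \<Longrightarrow> p' \<in> carrier (Pm F) \<Longrightarrow> n' \<in> carrier (Nm F) \<Longrightarrow>
    PN_class F p n \<otimes>\<^bsub>PN F\<^esub> PN_class F p' n' = PN_class F (p \<otimes>\<^bsub>Pm F\<^esub> p') (n \<otimes>\<^bsub>Nm F\<^esub> n')"
  by (simp add: PN_eq PN_class_eq)
lemma PN_one: "\<one>\<^bsub>PN F\<^esub> = PN_class F \<one>\<^bsub>Pm F\<^esub> \<one>\<^bsub>Nm F\<^esub>"
  by (simp add: PN_eq PN_class_eq A.Am_one)
lemma PN_glue: "q \<in> carrier (Qm F) \<Longrightarrow> p \<in> carrier (Pm F) \<Longrightarrow> n \<in> carrier (Nm F) \<Longrightarrow>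
    PN_class F (p \<otimes>\<^bsub>Pm F\<^esub> eQ q) n = PN_class F p (h (eQ q) \<otimes>\<^bsub>Nm F\<^esub> n)"
  using A.class_glue[of q p n] by (simp add: PN_class_eq)
lemma PN_cases:
  assumes "x \<in> carrier (PN F)"
  obtains p n where "p \<in> carrier (Pm F)" "n \<in> carrier (Nm F)" "x = PN_class F p n"
  using assms unfolding PN_eq PN_class_eq by (rule A.Am_cases)

lemma PN_proj_class [simp]: "p \<in> carrier (Pm F) \<Longrightarrow> n \<in> carrier (Nm F) \<Longrightarrow> PN_proj F (PN_class F p n) = h p \<otimes>\<^bsub>Nm F\<^esub> n"
  unfolding PN_proj_def PN_class_eq by (rule A.class_the_elem) (auto simp: N.m_assoc)

lemma PN_proj_hom: "PN_proj F \<in> monoid_hom (PN F) (Nm F)"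
  by (rule monoid_homI) (auto elim!: PN_cases simp: PN_one N.m_ac)

lemma PN_proj_closed [simp]: "x \<in> carrier (PN F) \<Longrightarrow> PN_proj F x \<in> carrier (Nm F)"
  by (rule monoid_hom_closed[OF PN_proj_hom])
lemma PN_proj_mult [simp]: "x \<in> carrier (PN F) \<Longrightarrow> y \<in> carrier (PN F) \<Longrightarrow> PN_proj F (x \<otimes>\<^bsub>PN F\<^esub> y) = PN_proj F x \<otimes>\<^bsub>Nm F\<^esub> PN_proj F y"
  by (rule monoid_hom_mult[OF PN_proj_hom])

text \<open>
  The section \<open>n \<mapsto> (1, n)\<close> of the projection to \<open>N\<close>, precomposed with that projection: a
  representative of each fibre of \<open>h\<close>.
\<close>

definition norm :: "('p, 'n) PN_elem \<Rightarrow> ('p, 'n) PN_elem" where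
  "norm x = PN_class F \<one>\<^bsub>Pm F\<^esub> (PN_proj F x)"

lemma norm_closed [simp]: "x \<in> carrier (PN F) \<Longrightarrow> norm x \<in> carrier (PN F)"
  by (simp add: norm_def)
lemma norm_proj [simp]: "x \<in> carrier (PN F) \<Longrightarrow> PN_proj F (norm x) = PN_proj F x"
  by (simp add: norm_def)
abbreviation "Tset \<equiv> {t \<in> carrier (gp (PN F)). gp_map (Nm F) (PN_proj F) t = \<one>\<^bsub>gp (Nm F)\<^esub>}"

lemma gp_proj_hom: "group_hom (gp (PN F)) (gp (Nm F)) (gp_map (Nm F) (PN_proj F))"
  using gp_map_hom[OF PN.comm_monoid_axioms N.comm_monoid_axioms PN_proj_hom]
  by (simp add: group_hom_def group_hom_axioms_def comm_group.axioms(2) PN.gp_comm_group N.gp_comm_group)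

lemma T_subgroup: "subgroup Tset (gp (PN F))"
  using group_hom.subgroup_kernel[OF gp_proj_hom] by (simp add: kernel_def)

lemma T_eq: "T_grp F = (gp (PN F))\<lparr>carrier := Tset\<rparr>"
  by (simp add: T_grp_def kernel_def)

lemma T_simps [simp]:
  "carrier (T_grp F) = Tset" "(\<otimes>\<^bsub>T_grp F\<^esub>) = (\<otimes>\<^bsub>gp (PN F)\<^esub>)" "\<one>\<^bsub>T_grp F\<^esub> = \<one>\<^bsub>gp (PN F)\<^esub>"
  by (simp_all add: T_eq)

lemma T_comm_group: "comm_group (T_grp F)"
proof (rule group.group_comm_groupI)
  show "group (T_grp F)"
    unfolding T_eq by (rule subgroup.subgroup_is_group[OF T_subgroup comm_group.axioms(2)[OF PN.gp_comm_group]])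
qed (use comm_monoid.m_comm[OF comm_group.axioms(1)[OF PN.gp_comm_group]] in \<open>simp only: T_simps mem_Collect_eq\<close>)

lemma T_inv: "t \<in> Tset \<Longrightarrow> inv\<^bsub>T_grp F\<^esub> t = inv\<^bsub>gp (PN F)\<^esub> t"
  unfolding T_eq by (rule group.m_inv_consistent[OF comm_group.axioms(2)[OF PN.gp_comm_group] T_subgroup])

lemma gp_proj_frac:
  "x \<in> carrier (PN F) \<Longrightarrow> y \<in> carrier (PN F) \<Longrightarrow>
    gp_map (Nm F) (PN_proj F) (gp_frac (PN F) x y) = gp_frac (Nm F) (PN_proj F x) (PN_proj F y)"
  by (rule gp_map_frac[OF PN.comm_monoid_axioms N.comm_monoid_axioms PN_proj_hom])

lemma frac_in_T:
  "x \<in> carrier (PN F) \<Longrightarrow> y \<in> carrier (PN F) \<Longrightarrow> PN_proj F x = PN_proj F y \<Longrightarrow> gp_frac (PN F) x y \<in> Tset"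
  by (simp add: gp_proj_frac)

text \<open>The element \<open>(p, 1) / (1, h p)\<close>; these generate \<open>T\<close>.\<close>

definition tau :: "'p \<Rightarrow> ('p, 'n) T_elem" where
  "tau p = gp_frac (PN F) (PN_class F p \<one>\<^bsub>Nm F\<^esub>) (PN_class F \<one>\<^bsub>Pm F\<^esub> (h p))"

lemma tau_closed: "p \<in> carrier (Pm F) \<Longrightarrow> tau p \<in> Tset"
  unfolding tau_def by (rule frac_in_T) auto

lemma frac_norm:
  "p \<in> carrier (Pm F) \<Longrightarrow> n \<in> carrier (Nm F) \<Longrightarrow> gp_frac (PN F) (PN_class F p n) (norm (PN_class F p n)) = tau p"
  unfolding tau_def norm_def by (rule PN.gp_frac_eqI) (auto simp: N.m_comm)

lemma frac_div:
  assumes "x \<in> carrier (PN F)" "y \<in> carrier (PN F)" "z \<in> carrier (PN F)"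
  shows "gp_frac (PN F) x z \<otimes>\<^bsub>gp (PN F)\<^esub> inv\<^bsub>gp (PN F)\<^esub> gp_frac (PN F) y z = gp_frac (PN F) x y"
  using assms by (simp add: PN.gp_inv) (intro PN.gp_frac_eqI, auto simp: PN.m_ac)

text \<open>
  For \<open>x / y\<close> in \<open>T\<close> the images \<open>h(x)\<close> and \<open>h(y)\<close> agree only up to a common factor \<open>s\<close> in \<open>N\<close>.
  Absorbing \<open>s\<close> into \<open>x\<close> and \<open>y\<close> does not change the fraction, and afterwards both can be divided by
  their common \<open>norm\<close>.
\<close>

lemma T_cases:
  assumes "t \<in> Tset"
  obtains p p' where "p \<in> carrier (Pm F)" "p' \<in> carrier (Pm F)" "t = tau p \<otimes>\<^bsub>gp (PN F)\<^esub> inv\<^bsub>gp (PN F)\<^esub> tau p'"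
proof -
  obtain x y where xy: "x \<in> carrier (PN F)" "y \<in> carrier (PN F)" "t = gp_frac (PN F) x y"
    using assms by (auto elim: PN.gp_cases)
  have "gp_frac (Nm F) (PN_proj F x) (PN_proj F y) = gp_frac (Nm F) \<one>\<^bsub>Nm F\<^esub> \<one>\<^bsub>Nm F\<^esub>"
    using assms xy by (simp only: mem_Collect_eq gp_proj_frac N.gp_one)
  then obtain s where s: "s \<in> carrier (Nm F)" "s \<otimes>\<^bsub>Nm F\<^esub> PN_proj F x = s \<otimes>\<^bsub>Nm F\<^esub> PN_proj F y"
    using xy unfolding N.gp_frac_eq_iff[OF PN_proj_closed PN_proj_closed N.one_closed N.one_closed, OF xy(1,2)] by auto
  obtain p n where p: "p \<in> carrier (Pm F)" "n \<in> carrier (Nm F)" "x = PN_class F p n" using xy by (auto elim: PN_cases)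
  obtain p' n' where p': "p' \<in> carrier (Pm F)" "n' \<in> carrier (Nm F)" "y = PN_class F p' n'" using xy by (auto elim: PN_cases)
  let ?x = "PN_class F p (s \<otimes>\<^bsub>Nm F\<^esub> n)" and ?y = "PN_class F p' (s \<otimes>\<^bsub>Nm F\<^esub> n')"
  have n: "norm ?x = norm ?y"
    using s p p' by (simp add: norm_def N.m_lcomm)
  have "t = gp_frac (PN F) ?x ?y"
    unfolding xy(3) p(3) p'(3) by (rule PN.gp_frac_eqI) (use p p' s in \<open>auto simp: N.m_ac P.m_comm\<close>)
  also have "\<dots> = gp_frac (PN F) ?x (norm ?x) \<otimes>\<^bsub>gp (PN F)\<^esub> inv\<^bsub>gp (PN F)\<^esub> gp_frac (PN F) ?y (norm ?y)"
    unfolding n by (rule frac_div[symmetric]) (use p p' s in auto)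
  also have "\<dots> = tau p \<otimes>\<^bsub>gp (PN F)\<^esub> inv\<^bsub>gp (PN F)\<^esub> tau p'"
    using p p' s by (simp add: frac_norm)
  finally show ?thesis using p p' that by blast
qed

lemma int_hom: "int_to_target F \<in> ring_hom \<Z> B"
  using int_to_ring_hom[OF B.is_cring] by (simp add: int_to_target_def[abs_def])

sublocale BT: tensor \<Z> B "int_module (T_grp F)" "int_to_target F"
  by (intro tensor.intro tensor_axioms.intro module_int_module T_comm_group int_hom int_is_cring B.is_cring)

lemma BT_eq: "BT_mod F = BT.BC" by (simp add: BT_mod_def)
lemma BT_tensor_eq: "BT_tensor F = BT.pt" by (simp add: BT_tensor_def)

lemma BT_module: "module B (BT_mod F)" unfolding BT_eq by (rule BT.BC_module)
sublocale BTm: module B "BT_mod F" by (rule BT_module)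

lemma BT_tensor_closed [simp]: "b \<in> carrier B \<Longrightarrow> t \<in> Tset \<Longrightarrow> BT_tensor F b t \<in> carrier (BT_mod F)"
  by (simp add: BT_eq BT_tensor_eq)
lemma BT_smult: "b \<in> carrier B \<Longrightarrow> b' \<in> carrier B \<Longrightarrow> t \<in> Tset \<Longrightarrow> b \<odot>\<^bsub>BT_mod F\<^esub> BT_tensor F b' t = BT_tensor F (b \<otimes>\<^bsub>B\<^esub> b') t"
  by (simp add: BT_eq BT_tensor_eq BT.pt_smult)
lemma BT_right_hom: "b \<in> carrier B \<Longrightarrow> BT_tensor F b \<in> hom (T_grp F) (add_monoid (BT_mod F))"
  using BT.pt_right_hom[of b] by (simp only: BT_eq BT_tensor_eq int_module_hom)

lemma BT_tensor_div:
  assumes "b \<in> carrier B" "t \<in> Tset" "t' \<in> Tset"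
  shows "BT_tensor F b (t \<otimes>\<^bsub>gp (PN F)\<^esub> inv\<^bsub>gp (PN F)\<^esub> t') = BT_tensor F b t \<ominus>\<^bsub>BT_mod F\<^esub> BT_tensor F b t'"
proof -
  interpret group_hom "T_grp F" "add_monoid (BT_mod F)" "BT_tensor F b"
    using BT_right_hom[OF assms(1)] T_comm_group BTm.a_group
    by (simp add: group_hom_def group_hom_axioms_def comm_group.axioms(2))
  have "inv\<^bsub>gp (PN F)\<^esub> t' \<in> Tset" using subgroup.m_inv_closed[OF T_subgroup assms(3)] .
  moreover have "BT_tensor F b (inv\<^bsub>gp (PN F)\<^esub> t') = \<ominus>\<^bsub>BT_mod F\<^esub> BT_tensor F b t'"
    using hom_inv[of t'] assms by (simp add: T_inv a_inv_def)
  ultimately show ?thesis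
    using hom_mult[of t "inv\<^bsub>gp (PN F)\<^esub> t'"] assms by (simp add: a_minus_def)
qed

lemma BT_induct [consumes 1, case_names zero gen diff]:
  assumes "z \<in> carrier (BT_mod F)" "P \<zero>\<^bsub>BT_mod F\<^esub>"
    and "\<And>b p. b \<in> carrier B \<Longrightarrow> p \<in> carrier (Pm F) \<Longrightarrow> P (BT_tensor F b (tau p))"
    and "\<And>y z. y \<in> carrier (BT_mod F) \<Longrightarrow> z \<in> carrier (BT_mod F) \<Longrightarrow> P y \<Longrightarrow> P z \<Longrightarrow> P (y \<ominus>\<^bsub>BT_mod F\<^esub> z)"
  shows "P z"
  using assms(1) unfolding BT_eq
proof (induction rule: BT.BC_induct)
  case (pure b t)
  then obtain p p' where "p \<in> carrier (Pm F)" "p' \<in> carrier (Pm F)" "t = tau p \<otimes>\<^bsub>gp (PN F)\<^esub> inv\<^bsub>gp (PN F)\<^esub> tau p'"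
    using T_cases[of t] by auto
  then show ?case
    using assms(3,4) pure(1) BT_tensor_div[of b "tau p" "tau p'"] tau_closed by (simp add: BT_tensor_eq[symmetric])
qed (use assms in \<open>simp_all add: BT_eq\<close>)

end

context log_factorization
begin

subsection \<open>The ideal \<open>J\<close> and the two maps out of \<open>U\<close>\<close>

definition PN_to_RB :: "('p, 'n) PN_elem \<Rightarrow> ('r, 'b) RB_elem" where
  "PN_to_RB V = the_elem ((\<lambda>(p, n). RB_tensor F (\<chi> p) (\<beta> n)) ` V)"

lemma PN_to_RB_class [simp]:
  assumes "p \<in> carrier (Pm F)" "n \<in> carrier (Nm F)"
  shows "PN_to_RB (PN_class F p n) = RB_tensor F (\<chi> p) (\<beta> n)"
  unfolding PN_to_RB_def PN_class_eq
proof (rule A.class_the_elem[OF assms])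
  fix q p n assume *: "q \<in> carrier (Qm F)" "p \<in> carrier (Pm F)" "n \<in> carrier (Nm F)"
  have "\<beta> (h (eQ q)) = eps (e (chart (source F) q))"
    using eps_chi[of "eQ q"] * by (simp add: chi_eQ)
  then show "RB_tensor F (\<chi> (p \<otimes>\<^bsub>Pm F\<^esub> eQ q)) (\<beta> n) = RB_tensor F (\<chi> p) (\<beta> ((h \<circ> eQ) q \<otimes>\<^bsub>Nm F\<^esub> n))"
    using * RB_tensor_balance[of "\<chi> p" "chart (source F) q" "\<beta> n"] by (simp add: chi_eQ)
qed

lemma PN_to_RB_hom: "PN_to_RB \<in> monoid_hom (PN F) (RB F)"
  by (rule monoid_homI) (auto elim!: PN_cases simp: PN_one RB_one RB_tensor_mult)

lemma PN_to_RB_closed [simp]: "x \<in> carrier (PN F) \<Longrightarrow> PN_to_RB x \<in> carrier (RB F)"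
  by (rule monoid_hom_closed[OF PN_to_RB_hom])

lemma RB_proj_PN_to_RB [simp]: "x \<in> carrier (PN F) \<Longrightarrow> RB_proj F (PN_to_RB x) = \<beta> (PN_proj F x)"
  by (auto elim!: PN_cases)

lemma ZPN_to_RB_eq: "ZPN_to_RB F = frag_lift (add_monoid (RB F)) PN_to_RB"
  by (simp add: ZPN_to_RB_def PN_to_RB_def[abs_def])

lemma ZPN_to_RB_hom: "ZPN_to_RB F \<in> ring_hom (ZPN F) (RB F)"
  unfolding ZPN_to_RB_eq ZPN_def by (rule PN.ZM_ring_hom[OF RB.is_cring PN_to_RB_hom])

lemma ZPN_to_RB_of [simp]: "x \<in> carrier (PN F) \<Longrightarrow> ZPN_to_RB F (frag_of x) = PN_to_RB x"
  unfolding ZPN_to_RB_eq by (rule PN.ZM_lift_of[OF RB.abelian_group_axioms]) simp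

sublocale ZPN: cring "ZPN F" unfolding ZPN_def by (rule PN.ZM_cring)

lemma ZPN_simps [simp]:
  "c \<in> carrier (ZPN F) \<longleftrightarrow> Poly_Mapping.keys c \<subseteq> carrier (PN F)"
  "(\<oplus>\<^bsub>ZPN F\<^esub>) = (+)" "\<zero>\<^bsub>ZPN F\<^esub> = 0" "\<one>\<^bsub>ZPN F\<^esub> = frag_of \<one>\<^bsub>PN F\<^esub>"
  by (simp_all add: ZPN_def) (simp add: monoid_ring_def)

sublocale zr: free_hom "RB F" "carrier (PN F)" "ZPN_to_RB F"
  unfolding ZPN_to_RB_eq by (rule free_hom_frag_lift[OF RB.abelian_group_axioms]) simp

lemma J_eq: "J_set F = {c. Poly_Mapping.keys c \<subseteq> carrier (PN F) \<and> monoid_ring_map (PN_proj F) c = 0}"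
  by (auto simp: J_set_def a_kernel_def')

lemma mr_hom: "monoid_ring_map (PN_proj F) \<in> ring_hom (ZPN F) (monoid_ring (Nm F))"
  unfolding ZPN_def by (rule monoid_ring_map_ring_hom[OF PN.comm_monoid_axioms N.comm_monoid_axioms PN_proj_hom])

lemma mr_simps [simp]:
  "monoid_ring_map u 0 = 0" "monoid_ring_map u (frag_of x) = frag_of (u x)"
  "monoid_ring_map u (c - d) = monoid_ring_map u c - monoid_ring_map u d"
  "monoid_ring_map u (c + d) = monoid_ring_map u c + monoid_ring_map u d"
  by (simp_all add: monoid_ring_map_def frag_extend_diff frag_extend_add)

lemma mr_neg [simp]: "monoid_ring_map u (- c) = - monoid_ring_map u c"
  using mr_simps(3)[of u 0 c] by simp

lemma J_submodule: "submodule (J_set F) (ZPN F) (ring_as_module (ZPN F))"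
proof (rule module.submoduleI[OF module_ring_as_module[OF ZPN.is_cring]])
  fix a x assume "a \<in> carrier (ZPN F)" "x \<in> J_set F"
  then have ax: "a \<in> carrier (ZPN F)" "x \<in> carrier (ZPN F)" "monoid_ring_map (PN_proj F) x = 0"
    by (auto simp: J_eq)
  have "monoid_ring_map (PN_proj F) (a \<otimes>\<^bsub>ZPN F\<^esub> x) = 0"
    using ring_hom_mult[OF mr_hom ax(1,2)] by (simp add: ax N.ZM_mult_right)
  then show "a \<odot>\<^bsub>ring_as_module (ZPN F)\<^esub> x \<in> J_set F"
    using ZPN.m_closed[OF ax(1,2)] by (simp add: J_eq)
next
  fix x assume "x \<in> J_set F"
  then show "\<ominus>\<^bsub>ring_as_module (ZPN F)\<^esub> x \<in> J_set F"
    using PN.ZM_neg by (simp add: J_eq ZPN_def)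
qed (auto simp: J_eq keys_add_subset[THEN subsetD])

lemma J_module: "module (ZPN F) (J_mod F)"
  unfolding J_mod_def by (rule module_sub[OF module_ring_as_module[OF ZPN.is_cring] J_submodule])

lemma J_simps [simp]:
  "carrier (J_mod F) = J_set F" "(\<oplus>\<^bsub>J_mod F\<^esub>) = (+)" "\<zero>\<^bsub>J_mod F\<^esub> = 0"
  "a \<odot>\<^bsub>J_mod F\<^esub> x = a \<otimes>\<^bsub>ZPN F\<^esub> x"
proof -
  have *: "\<zero>\<^bsub>M\<lparr>carrier := K\<rparr>\<^esub> = \<zero>\<^bsub>M\<^esub>" "(\<oplus>\<^bsub>M\<lparr>carrier := K\<rparr>\<^esub>) = (\<oplus>\<^bsub>M\<^esub>)" "(\<odot>\<^bsub>M\<lparr>carrier := K\<rparr>\<^esub>) = (\<odot>\<^bsub>M\<^esub>)"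
    for M :: "(('p, 'n) PN_elem \<Rightarrow>\<^sub>0 int, ('p, 'n) PN_elem \<Rightarrow>\<^sub>0 int) module" and K
    by simp_all
  show "carrier (J_mod F) = J_set F" "(\<oplus>\<^bsub>J_mod F\<^esub>) = (+)" "\<zero>\<^bsub>J_mod F\<^esub> = 0"
    "a \<odot>\<^bsub>J_mod F\<^esub> x = a \<otimes>\<^bsub>ZPN F\<^esub> x"
    unfolding J_mod_def * by simp_all
qed

lemma J_diff: "x \<in> J_set F \<Longrightarrow> y \<in> J_set F \<Longrightarrow> x \<ominus>\<^bsub>J_mod F\<^esub> y = x - y"
  using PN.ZM_neg[of y] a_inv_sub[OF module_ring_as_module[OF ZPN.is_cring] J_submodule, of y]
  by (simp add: a_minus_def J_mod_def[symmetric]) (simp add: J_eq ZPN_def)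

lemma J_diff_closed: "x \<in> J_set F \<Longrightarrow> y \<in> J_set F \<Longrightarrow> x - y \<in> J_set F"
  by (simp add: J_eq keys_diff_subset)

lemma frag_diff_J:
  "x \<in> carrier (PN F) \<Longrightarrow> y \<in> carrier (PN F) \<Longrightarrow> PN_proj F x = PN_proj F y \<Longrightarrow> frag_of x - frag_of y \<in> J_set F"
  by (simp add: J_eq keys_diff_subset)

text \<open>
  As for \<open>I\<close>: replacing each basis element \<open>x\<close> by \<open>x - norm x\<close> subtracts something that depends only on
  the image in \<open>\<int>[N]\<close>, hence nothing on \<open>J\<close>.
\<close>

lemma J_induct [consumes 1, case_names zero gen diff]:
  assumes "c \<in> J_set F" "P 0"
    and "\<And>x. x \<in> carrier (PN F) \<Longrightarrow> P (frag_of x - frag_of (norm x))"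
    and "\<And>c d. c \<in> J_set F \<Longrightarrow> d \<in> J_set F \<Longrightarrow> P c \<Longrightarrow> P d \<Longrightarrow> P (c - d)"
  shows "P c"
proof -
  let ?n = "\<lambda>c. monoid_ring_map (\<lambda>n. PN_class F \<one>\<^bsub>Pm F\<^esub> n) (monoid_ring_map (PN_proj F) c)"
  have "P (c - ?n c) \<and> c - ?n c \<in> J_set F" if "Poly_Mapping.keys c \<subseteq> carrier (PN F)" for c
    using that
  proof (rule free_Abelian_group_induct)
    fix x y assume "P (x - ?n x) \<and> x - ?n x \<in> J_set F" "P (y - ?n y) \<and> y - ?n y \<in> J_set F"
    moreover have "x - y - ?n (x - y) = (x - ?n x) - (y - ?n y)" by simp
    ultimately show "P (x - y - ?n (x - y)) \<and> x - y - ?n (x - y) \<in> J_set F"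
      using assms(4) J_diff_closed by metis
  next
    fix x assume x: "x \<in> carrier (PN F)"
    then show "P (frag_of x - ?n (frag_of x)) \<and> frag_of x - ?n (frag_of x) \<in> J_set F"
      using assms(3)[OF x] frag_diff_J[OF x norm_closed[OF x]] x by (simp add: norm_def)
  qed (use assms(2) in \<open>simp add: J_eq\<close>)
  from this[of c] show ?thesis using assms(1) by (simp add: J_eq)
qed

lemma J_addhomI:
  assumes "free_hom L (carrier (PN F)) f"
  shows "restrict f (J_set F) \<in> addhom (J_mod F) L"
proof -
  interpret f: free_hom L "carrier (PN F)" f by fact
  have "x + y \<in> J_set F" if "x \<in> J_set F" "y \<in> J_set F" for x y
    using that by (simp add: J_eq keys_add_subset)
  then show ?thesis by (intro addhomI) (auto simp: f.closed f.add J_eq)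
qed

lemma J_hom_eq:
  assumes "f \<in> addhom (J_mod F) L" "g \<in> addhom (J_mod F) L" "abelian_group L"
    "\<And>x. x \<in> carrier (PN F) \<Longrightarrow> f (frag_of x - frag_of (norm x)) = g (frag_of x - frag_of (norm x))" "c \<in> J_set F"
  shows "f c = g c"
  using assms(5)
proof (induction rule: J_induct)
  case zero
  then show ?case using addhom_zero[OF assms(1) module_abelian[OF J_module] assms(3)]
      addhom_zero[OF assms(2) module_abelian[OF J_module] assms(3)] by simp
next
  case (diff c d)
  then show ?case using addhom_diff[OF assms(1) module_abelian[OF J_module] assms(3), of c d]
      addhom_diff[OF assms(2) module_abelian[OF J_module] assms(3), of c d] by (simp add: J_diff)
qed (fact assms(4))

text \<open>
  The additive map on \<open>\<int>[P \<oplus>\<^sub>Q N]\<close> that sends \<open>x\<close> to \<open>h(x) \<otimes> x / norm x\<close> restricts on \<open>J\<close> to the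
  map defining \<open>\<beta>\<close>, since \<open>norm x\<close> only depends on \<open>h(x)\<close>.
\<close>

lemma J_to_BT:
  shows J_to_BT_hom: "J_to_BT F \<in> addhom (J_mod F) (BT_mod F)"
    and J_to_BT_frac: "x \<in> carrier (PN F) \<Longrightarrow> y \<in> carrier (PN F) \<Longrightarrow> PN_proj F x = PN_proj F y \<Longrightarrow>
      J_to_BT F (frag_of x - frag_of y) = BT_tensor F (\<beta> (PN_proj F y)) (gp_frac (PN F) x y)"
proof -
  let ?u = "\<lambda>x. BT_tensor F (\<beta> (PN_proj F x)) (gp_frac (PN F) x (norm x))"
  let ?G = "frag_lift (add_monoid (BT_mod F)) ?u"
  interpret G: free_hom "BT_mod F" "carrier (PN F)" ?G
    by (rule free_hom_frag_lift[OF BTm.abelian_group_axioms]) (use frac_in_T in auto)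
  have Gof: "?G (frag_of x) = ?u x" if "x \<in> carrier (PN F)" for x
    by (rule PN.ZM_lift_of[OF BTm.abelian_group_axioms]) (use that frac_in_T[OF that norm_closed] in auto)
  let ?f = "restrict ?G (J_set F)"
  define Q where "Q f \<longleftrightarrow> f \<in> addhom (J_mod F) (BT_mod F) \<and> f \<in> extensional (J_set F) \<and>
     (\<forall>x\<in>carrier (PN F). \<forall>y\<in>carrier (PN F). PN_proj F x = PN_proj F y \<longrightarrow>
        f (frag_of x - frag_of y) = BT_tensor F (\<beta> (PN_proj F y)) (gp_frac (PN F) x y))" for f
  have "Q ?f"
    unfolding Q_def
  proof (intro conjI ballI impI)
    fix x y assume xy: "x \<in> carrier (PN F)" "y \<in> carrier (PN F)" "PN_proj F x = PN_proj F y"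
    then have n: "norm x = norm y" by (simp add: norm_def)
    have "?f (frag_of x - frag_of y) = ?u x \<ominus>\<^bsub>BT_mod F\<^esub> ?u y"
      using xy by (simp add: frag_diff_J G.diff Gof)
    also have "\<dots> = BT_tensor F (\<beta> (PN_proj F y))
        (gp_frac (PN F) x (norm y) \<otimes>\<^bsub>gp (PN F)\<^esub> inv\<^bsub>gp (PN F)\<^esub> gp_frac (PN F) y (norm y))"
      using xy frac_in_T[of x "norm y"] frac_in_T[of y "norm y"] by (simp add: n BT_tensor_div)
    also have "\<dots> = BT_tensor F (\<beta> (PN_proj F y)) (gp_frac (PN F) x y)"
      using xy by (simp add: frac_div)
    finally show "?f (frag_of x - frag_of y) = BT_tensor F (\<beta> (PN_proj F y)) (gp_frac (PN F) x y)" .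
  qed (use J_addhomI[OF G.free_hom_axioms] in auto)
  moreover have "f = ?f" if "Q f" for f
  proof (rule extensionalityI[of _ "J_set F"])
    fix c assume c: "c \<in> J_set F"
    have Qn: "g (frag_of x - frag_of (norm x)) = BT_tensor F (\<beta> (PN_proj F (norm x))) (gp_frac (PN F) x (norm x))"
      if "Q g" "x \<in> carrier (PN F)" for g x
      using that(1) unfolding Q_def
      by (elim conjE, drule_tac bspec[OF _ that(2)], drule_tac bspec[OF _ norm_closed[OF that(2)]], elim mp)
        (rule norm_proj[OF that(2), symmetric])
    have Qh: "g \<in> addhom (J_mod F) (BT_mod F)" if "Q g" for g using that unfolding Q_def by (rule conjunct1)
    show "f c = ?f c"
      by (rule J_hom_eq[OF Qh[OF that] Qh[OF \<open>Q ?f\<close>] BTm.abelian_group_axioms _ c])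
        (simp only: Qn[OF that] Qn[OF \<open>Q ?f\<close>])
  next
    show "f \<in> extensional (J_set F)" using that unfolding Q_def by (elim conjE)
  qed simp
  ultimately have "Q (THE f. Q f)" by (rule theI)
  moreover have "J_to_BT F = (THE f. Q f)" by (simp add: J_to_BT_def Q_def)
  ultimately have "Q (J_to_BT F)" by simp
  then show "J_to_BT F \<in> addhom (J_mod F) (BT_mod F)"
    "x \<in> carrier (PN F) \<Longrightarrow> y \<in> carrier (PN F) \<Longrightarrow> PN_proj F x = PN_proj F y \<Longrightarrow>
      J_to_BT F (frag_of x - frag_of y) = BT_tensor F (\<beta> (PN_proj F y)) (gp_frac (PN F) x y)"
    unfolding Q_def by blast+
qed

lemma J_to_BT_closed [simp]: "c \<in> J_set F \<Longrightarrow> J_to_BT F c \<in> carrier (BT_mod F)"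
  using addhom_closed[OF J_to_BT_hom] by simp

lemma J_smult_closed: "a \<in> carrier (ZPN F) \<Longrightarrow> c \<in> J_set F \<Longrightarrow> a \<otimes>\<^bsub>ZPN F\<^esub> c \<in> J_set F"
  using module.smult_closed[OF J_module] by simp

text \<open>
  Multiplying by \<open>y\<close> multiplies numerator and denominator of \<open>x / norm x\<close> by \<open>y\<close>, so only the
  coefficient changes, by the image of \<open>h(y)\<close> in \<open>B\<close>.
\<close>

lemma J_to_BT_smult:
  assumes "Poly_Mapping.keys a \<subseteq> carrier (PN F)" and c: "c \<in> J_set F"
  shows "J_to_BT F (a \<otimes>\<^bsub>ZPN F\<^esub> c) = RB_proj F (ZPN_to_RB F a) \<odot>\<^bsub>BT_mod F\<^esub> J_to_BT F c"
proof (rule free_hom_eq[OF _ _ _ assms(1)])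
  show "free_hom (BT_mod F) (carrier (PN F)) (\<lambda>a. J_to_BT F (a \<otimes>\<^bsub>ZPN F\<^esub> c))"
  proof (intro free_hom.intro free_hom_axioms.intro homI BTm.abelian_group_axioms)
    fix a b assume "a \<in> carrier (free_Abelian_group (carrier (PN F)))" "b \<in> carrier (free_Abelian_group (carrier (PN F)))"
    then have ab: "a \<in> carrier (ZPN F)" "b \<in> carrier (ZPN F)" by simp_all
    have "(a + b) \<otimes>\<^bsub>ZPN F\<^esub> c = a \<otimes>\<^bsub>ZPN F\<^esub> c + b \<otimes>\<^bsub>ZPN F\<^esub> c"
      by (simp add: ZPN_def PN.ZM_mult_left)
    then show "J_to_BT F ((a \<otimes>\<^bsub>free_Abelian_group (carrier (PN F))\<^esub> b) \<otimes>\<^bsub>ZPN F\<^esub> c) =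
      J_to_BT F (a \<otimes>\<^bsub>ZPN F\<^esub> c) \<otimes>\<^bsub>add_monoid (BT_mod F)\<^esub> J_to_BT F (b \<otimes>\<^bsub>ZPN F\<^esub> c)"
      using addhom_add[OF J_to_BT_hom, of "a \<otimes>\<^bsub>ZPN F\<^esub> c" "b \<otimes>\<^bsub>ZPN F\<^esub> c"] J_smult_closed[OF _ c] ab by simp
  qed (use J_smult_closed[OF _ c] in simp)
  show "free_hom (BT_mod F) (carrier (PN F)) (\<lambda>a. RB_proj F (ZPN_to_RB F a) \<odot>\<^bsub>BT_mod F\<^esub> J_to_BT F c)"
    by (intro free_hom.intro free_hom_axioms.intro homI BTm.abelian_group_axioms)
      (use c in \<open>auto simp: zr.closed zr.add BTm.smult_l_distr\<close>)
next
  fix y assume y: "y \<in> carrier (PN F)"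
  have \<beta>y: "\<beta> (PN_proj F y) \<in> carrier B" using y by simp
  have yc: "frag_of y \<in> carrier (ZPN F)" using y by simp
  have 1: "(\<lambda>c. J_to_BT F (frag_of y \<otimes>\<^bsub>ZPN F\<^esub> c)) \<in> addhom (J_mod F) (BT_mod F)"
    using addhom_comp[OF module_smult_hom[OF J_module yc] J_to_BT_hom] by simp
  have 2: "(\<lambda>c. \<beta> (PN_proj F y) \<odot>\<^bsub>BT_mod F\<^esub> J_to_BT F c) \<in> addhom (J_mod F) (BT_mod F)"
    by (rule addhom_comp[OF J_to_BT_hom module_smult_hom[OF BT_module \<beta>y]])
  have "J_to_BT F (frag_of y \<otimes>\<^bsub>ZPN F\<^esub> c) = \<beta> (PN_proj F y) \<odot>\<^bsub>BT_mod F\<^esub> J_to_BT F c"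
  proof (rule J_hom_eq[OF 1 2 BTm.abelian_group_axioms _ c])
    fix x assume x: "x \<in> carrier (PN F)"
    have "frag_of y \<otimes>\<^bsub>ZPN F\<^esub> (frag_of x - frag_of (norm x)) = frag_of (y \<otimes>\<^bsub>PN F\<^esub> x) - frag_of (y \<otimes>\<^bsub>PN F\<^esub> norm x)"
      by (simp add: ZPN_def PN.ZM_mult_right)
    moreover have "gp_frac (PN F) (y \<otimes>\<^bsub>PN F\<^esub> x) (y \<otimes>\<^bsub>PN F\<^esub> norm x) = gp_frac (PN F) x (norm x)"
      by (rule PN.gp_frac_eqI) (use x y in \<open>auto simp: PN.m_ac\<close>)
    ultimately show "J_to_BT F (frag_of y \<otimes>\<^bsub>ZPN F\<^esub> (frag_of x - frag_of (norm x))) =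
      \<beta> (PN_proj F y) \<odot>\<^bsub>BT_mod F\<^esub> J_to_BT F (frag_of x - frag_of (norm x))"
      using x y frac_in_T[OF x norm_closed[OF x]] by (simp add: J_to_BT_frac BT_smult)
  qed
  then show "J_to_BT F (frag_of y \<otimes>\<^bsub>ZPN F\<^esub> c) =
      RB_proj F (ZPN_to_RB F (frag_of y)) \<odot>\<^bsub>BT_mod F\<^esub> J_to_BT F c"
    using y by simp
qed

sublocale U: tensor "ZPN F" "RB F" "J_mod F" "ZPN_to_RB F"
  by (intro tensor.intro tensor_axioms.intro ZPN.is_cring RB.is_cring J_module ZPN_to_RB_hom)

lemma U_eq: "U_mod F = U.BC" by (simp add: U_mod_def)

lemma RB_proj_zr_J: "c \<in> J_set F \<Longrightarrow> RB_proj F (ZPN_to_RB F c) = \<zero>\<^bsub>B\<^esub>"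
proof (induction rule: J_induct)
  case zero
  show ?case by (simp add: zr.zero)
next
  case (gen x)
  then show ?case by (simp add: zr.diff B.diff_zero_iff)
next
  case (diff c d)
  then show ?case by (simp add: J_eq zr.diff zr.closed B.minus_eq)
qed

lemma J_keys: "c \<in> J_set F \<Longrightarrow> Poly_Mapping.keys c \<subseteq> carrier (PN F)"
  by (simp add: J_eq)

lemma U_to_I:
  shows U_to_I_hom: "U_to_I F \<in> addhom (U_mod F) (I_mod F)"
    and U_to_I_pure: "z \<in> carrier (RB F) \<Longrightarrow> c \<in> J_set F \<Longrightarrow> U_to_I F (U.pt z c) = z \<otimes>\<^bsub>RB F\<^esub> ZPN_to_RB F c"
proof -
  have bal: "z \<otimes>\<^bsub>RB F\<^esub> ZPN_to_RB F a \<otimes>\<^bsub>RB F\<^esub> ZPN_to_RB F x = z \<otimes>\<^bsub>RB F\<^esub> ZPN_to_RB F (a \<odot>\<^bsub>J_mod F\<^esub> x)"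
    if "z \<in> carrier (RB F)" "a \<in> carrier (ZPN F)" "x \<in> carrier (J_mod F)" for z a x
    using that ring_hom_mult[OF ZPN_to_RB_hom, of a x] by (simp add: J_keys zr.closed RB.m_assoc)
  note l = module_abelian[OF I_module] _ _ _ bal
  show "U_to_I F \<in> addhom (U_mod F) (I_mod F)"
    unfolding U_eq U_to_I_def
    by (rule U.BC_lift_hom[OF l])
      (auto simp: J_keys zr.closed RB_proj_zr_J RB.l_distr RB.r_distr zr.add)
  show "z \<in> carrier (RB F) \<Longrightarrow> c \<in> J_set F \<Longrightarrow> U_to_I F (U.pt z c) = z \<otimes>\<^bsub>RB F\<^esub> ZPN_to_RB F c"
    unfolding U_to_I_def
    by (rule U.BC_lift_pt[OF l])
      (auto simp: J_keys zr.closed RB_proj_zr_J RB.l_distr RB.r_distr zr.add)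
qed

lemma U_to_BT:
  shows U_to_BT_hom: "U_to_BT F \<in> addhom (U_mod F) (BT_mod F)"
    and U_to_BT_pure: "z \<in> carrier (RB F) \<Longrightarrow> c \<in> J_set F \<Longrightarrow> U_to_BT F (U.pt z c) = RB_proj F z \<odot>\<^bsub>BT_mod F\<^esub> J_to_BT F c"
proof -
  have bal: "RB_proj F (z \<otimes>\<^bsub>RB F\<^esub> ZPN_to_RB F a) \<odot>\<^bsub>BT_mod F\<^esub> J_to_BT F x = RB_proj F z \<odot>\<^bsub>BT_mod F\<^esub> J_to_BT F (a \<odot>\<^bsub>J_mod F\<^esub> x)"
    if "z \<in> carrier (RB F)" "a \<in> carrier (ZPN F)" "x \<in> carrier (J_mod F)" for z a x
    using that by (simp add: J_to_BT_smult zr.closed BTm.smult_assoc1)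
  have ad: "J_to_BT F (x + y) = J_to_BT F x \<oplus>\<^bsub>BT_mod F\<^esub> J_to_BT F y" if "x \<in> J_set F" "y \<in> J_set F" for x y
    using addhom_add[OF J_to_BT_hom, of x y] that by simp
  note l = module_abelian[OF BT_module] _ _ _ bal
  show "U_to_BT F \<in> addhom (U_mod F) (BT_mod F)"
    unfolding U_eq U_to_BT_def
    by (rule U.BC_lift_hom[OF l]) (auto simp: BTm.smult_l_distr BTm.smult_r_distr ad)
  show "z \<in> carrier (RB F) \<Longrightarrow> c \<in> J_set F \<Longrightarrow> U_to_BT F (U.pt z c) = RB_proj F z \<odot>\<^bsub>BT_mod F\<^esub> J_to_BT F c"
    unfolding U_to_BT_def
    by (rule U.BC_lift_pt[OF l]) (auto simp: BTm.smult_l_distr BTm.smult_r_distr ad)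
qed

subsection \<open>The pushout\<close>

abbreviation "BTR \<equiv> restrict_scalars (RB_proj F) (BT_mod F)"
abbreviation "IBT \<equiv> direct_sum (I_mod F) BTR"
abbreviation "rel1 \<equiv> pushout_rel (U_mod F) (I_mod F) BTR (U_to_I F) (U_to_BT F)"

lemma IBT_module: "module (RB F) IBT"
  by (rule module_direct_sum[OF I_module module_restrict_scalars[OF BT_module RB.is_cring RB_proj_hom]])

lemma rel1_subgroup: "subgroup rel1 (add_monoid IBT)"
proof (rule pushout_rel_subgroup)
  show "U_to_BT F \<in> addhom (U_mod F) BTR" using U_to_BT_hom by (simp only: restrict_scalars_hom)
  show "abelian_group (U_mod F)" unfolding U_eq by (rule U.BC_abelian)
  show "U_to_I F \<in> addhom (U_mod F) (I_mod F)" by (rule U_to_I_hom)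
qed (intro module_abelian[OF I_module] module_abelian[OF BT_module] restrict_scalars_abelian)+

text \<open>The relation identifying the images of \<open>z \<otimes> ((p, 1) - (1, h p))\<close>.\<close>

definition gU :: "('r, 'b) RB_elem \<Rightarrow> 'p \<Rightarrow> ('r, 'b) RB_elem \<times> ('p, 'b, 'n) BT_elem" where
  "gU z p = (z \<otimes>\<^bsub>RB F\<^esub> gI \<one>\<^bsub>B\<^esub> (\<chi> p), \<ominus>\<^bsub>BT_mod F\<^esub> BT_tensor F (RB_proj F z \<otimes>\<^bsub>B\<^esub> \<beta> (h p)) (tau p))"

abbreviation "kappa u \<equiv> (U_to_I F u, \<ominus>\<^bsub>BT_mod F\<^esub> U_to_BT F u)"

lemma rel1_eq: "rel1 = kappa ` carrier (U_mod F)"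
  by (simp add: pushout_rel_def)

lemma kappa_hom: "kappa \<in> addhom (U_mod F) IBT"
  by (rule addhom_pair[OF U_to_I_hom]) (simp only: restrict_scalars_hom, rule addhom_uminus[OF BTm.abelian_group_axioms U_to_BT_hom])

text \<open>
  Since \<open>(p, n) - norm (p, n)\<close> is \<open>(1, n)\<close> times \<open>(p, 1) - (1, h p)\<close>, the factor \<open>(1, n)\<close> moves into \<open>z\<close>,
  and the elements \<open>gU\<close> generate all relations.
\<close>

lemma kappa_gen:
  assumes "z \<in> carrier (RB F)" "p \<in> carrier (Pm F)" "n \<in> carrier (Nm F)"
  defines "x \<equiv> PN_class F p n"
  shows "kappa (U.pt z (frag_of x - frag_of (norm x))) = gU (z \<otimes>\<^bsub>RB F\<^esub> sec (\<beta> n)) p"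
proof -
  have x: "x \<in> carrier (PN F)" using assms by simp
  have J: "frag_of x - frag_of (norm x) \<in> J_set F" using frag_diff_J x by simp
  have g: "gI \<one>\<^bsub>B\<^esub> (\<chi> p) \<in> carrier (RB F)" using gI_closed assms by simp
  have "ZPN_to_RB F (frag_of x - frag_of (norm x)) = RB_tensor F (\<chi> p) (\<beta> n) \<ominus>\<^bsub>RB F\<^esub> sec (\<beta> (h p) \<otimes>\<^bsub>B\<^esub> \<beta> n)"
    using x assms(2,3) by (simp add: zr.diff norm_def) (simp add: x_def)
  also have "\<dots> = sec (\<beta> n) \<otimes>\<^bsub>RB F\<^esub> gI \<one>\<^bsub>B\<^esub> (\<chi> p)"
    using assms(2,3) by (simp add: gI_def RB.minus_eq RB.r_distr RB.r_minus RB_tensor_mult B.m_comm[of "\<beta> n"])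
  finally have 1: "U_to_I F (U.pt z (frag_of x - frag_of (norm x))) = z \<otimes>\<^bsub>RB F\<^esub> sec (\<beta> n) \<otimes>\<^bsub>RB F\<^esub> gI \<one>\<^bsub>B\<^esub> (\<chi> p)"
    using assms J g by (simp add: U_to_I_pure RB.m_assoc)
  have t: "tau p \<in> Tset" by (rule tau_closed[OF assms(2)])
  have "J_to_BT F (frag_of x - frag_of (norm x)) = BT_tensor F (\<beta> (h p) \<otimes>\<^bsub>B\<^esub> \<beta> n) (tau p)"
    using assms(2,3) x frac_norm[OF assms(2,3)] by (simp add: J_to_BT_frac) (simp add: x_def)
  then have "U_to_BT F (U.pt z (frag_of x - frag_of (norm x))) =
      BT_tensor F (RB_proj F (z \<otimes>\<^bsub>RB F\<^esub> sec (\<beta> n)) \<otimes>\<^bsub>B\<^esub> \<beta> (h p)) (tau p)"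
    using assms J t by (simp add: U_to_BT_pure BT_smult B.m_assoc B.m_comm[of "\<beta> n"])
  with 1 show ?thesis by (simp add: gU_def)
qed

lemma gU_in_rel1:
  assumes "z \<in> carrier (RB F)" "p \<in> carrier (Pm F)"
  shows "gU z p \<in> rel1"
proof -
  let ?x = "PN_class F p \<one>\<^bsub>Nm F\<^esub>"
  have "kappa (U.pt z (frag_of ?x - frag_of (norm ?x))) = gU z p"
    using kappa_gen[OF assms N.one_closed] assms by (simp add: RB_one[symmetric])
  moreover have "U.pt z (frag_of ?x - frag_of (norm ?x)) \<in> carrier (U_mod F)"
    using assms frag_diff_J[of ?x "norm ?x"] unfolding U_eq by (intro U.pt_closed) auto
  ultimately show ?thesis unfolding rel1_eq using imageI[of "U.pt z (frag_of ?x - frag_of (norm ?x))" "carrier (U_mod F)" kappa]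
    by simp
qed

lemma rel1_induct [consumes 1, case_names zero gen diff]:
  assumes "x \<in> rel1" "P \<zero>\<^bsub>IBT\<^esub>"
    and "\<And>z p. z \<in> carrier (RB F) \<Longrightarrow> p \<in> carrier (Pm F) \<Longrightarrow> P (gU z p)"
    and "\<And>x y. x \<in> rel1 \<Longrightarrow> y \<in> rel1 \<Longrightarrow> P x \<Longrightarrow> P y \<Longrightarrow> P (x \<ominus>\<^bsub>IBT\<^esub> y)"
  shows "P x"
proof -
  have U_ab: "abelian_group (U_mod F)" unfolding U_eq by (rule U.BC_abelian)
  note IBT_ab = module_abelian[OF IBT_module]
  have k0: "kappa \<zero>\<^bsub>U_mod F\<^esub> = \<zero>\<^bsub>IBT\<^esub>" by (rule addhom_zero[OF kappa_hom U_ab IBT_ab])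
  have kd: "kappa (u \<ominus>\<^bsub>U_mod F\<^esub> v) = kappa u \<ominus>\<^bsub>IBT\<^esub> kappa v" if "u \<in> carrier (U_mod F)" "v \<in> carrier (U_mod F)" for u v
    by (rule addhom_diff[OF kappa_hom U_ab IBT_ab that])
  have d: "P (kappa (u \<ominus>\<^bsub>U_mod F\<^esub> v))" if "u \<in> carrier (U_mod F)" "v \<in> carrier (U_mod F)" "P (kappa u)" "P (kappa v)" for u v
    unfolding kd[OF that(1,2)] using that by (intro assms(4)) (simp_all add: rel1_eq)
  have "P (kappa u)" if "u \<in> carrier (U_mod F)" for u
    using that unfolding U_eq
  proof (induction rule: U.BC_induct)
    case zero
    then show ?case using assms(2) k0 by (simp only: U_eq)
  next
    case (pure z c)
    have zc: "z \<in> carrier (RB F)" "c \<in> J_set F" using pure by simp_all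
    note zh = U.pt_right_hom[OF zc(1)]
    from zc(2) show ?case
    proof (induction rule: J_induct)
      case zero
      have "U.pt z 0 = \<zero>\<^bsub>U_mod F\<^esub>"
        using addhom_zero[OF zh module_abelian[OF J_module] U.BC_abelian] by (simp add: U_eq)
      then show ?case using k0 assms(2) by simp
    next
      case (gen x)
      then obtain p n where x: "p \<in> carrier (Pm F)" "n \<in> carrier (Nm F)" "x = PN_class F p n" by (auto elim: PN_cases)
      then show ?case using kappa_gen[OF zc(1) x(1,2)] assms(3) zc by simp
    next
      case (diff c d)
      have "U.pt z (c - d) = U.pt z c \<ominus>\<^bsub>U_mod F\<^esub> U.pt z d"
        using addhom_diff[OF zh module_abelian[OF J_module] U.BC_abelian, of c d] diff by (simp add: U_eq J_diff)
      then show ?case using d[of "U.pt z c" "U.pt z d"] diff zc by (simp add: U_eq)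
    qed
  next
    case (diff y z)
    then show ?case using d[of y z] by (simp only: U_eq)
  qed
  then show ?thesis using assms(1) by (auto simp: rel1_eq)
qed

lemma gU_smult: "a \<in> carrier (RB F) \<Longrightarrow> z \<in> carrier (RB F) \<Longrightarrow> p \<in> carrier (Pm F) \<Longrightarrow> a \<odot>\<^bsub>IBT\<^esub> gU z p = gU (a \<otimes>\<^bsub>RB F\<^esub> z) p"
  using gI_closed[of "\<chi> p" "\<one>\<^bsub>B\<^esub>"] tau_closed[of p]
  by (simp add: gU_def RB.m_assoc BTm.smult_r_minus BT_smult B.m_assoc)

lemma rel1_submodule: "submodule rel1 (RB F) IBT"
proof (rule submoduleI'[OF rel1_subgroup])
  interpret IBT: module "RB F" IBT by (rule IBT_module)
  interpret mq: module_quotient IBT rel1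
    by (intro module_quotient.intro module_quotient_axioms.intro rel1_subgroup IBT.abelian_group_axioms)
  fix a x assume a: "a \<in> carrier (RB F)" and "x \<in> rel1"
  from this(2) show "a \<odot>\<^bsub>IBT\<^esub> x \<in> rel1"
  proof (induction rule: rel1_induct)
    case zero
    then show ?case using mq.K_zero IBT.smult_r_null[OF a] by metis
  next
    case (gen z p)
    then show ?case using a by (simp add: gU_smult gU_in_rel1)
  next
    case (diff x y)
    then have "a \<odot>\<^bsub>IBT\<^esub> (x \<ominus>\<^bsub>IBT\<^esub> y) = a \<odot>\<^bsub>IBT\<^esub> x \<ominus>\<^bsub>IBT\<^esub> a \<odot>\<^bsub>IBT\<^esub> y"
      using addhom_diff[OF module_smult_hom[OF IBT_module a] IBT.abelian_group_axioms IBT.abelian_group_axioms]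
        mq.K_closed by blast
    then show ?case using diff mq.K_diff by metis
  qed
qed

sublocale D: module_quotient IBT rel1
  by (rule submodule_quotient[OF IBT_module rel1_submodule])

lemma D1_eq: "D1_mod F = quot_module IBT rel1"
  by (simp add: D1_mod_def pushout_module_def)

lemma D1_class_eq: "D1_class F i t = rel1 +>\<^bsub>IBT\<^esub> (i, t)"
  by (simp add: D1_class_def pushout_class_def)

lemma D1_module: "module (RB F) (D1_mod F)"
  unfolding D1_eq by (rule module_quot_module[OF IBT_module rel1_submodule])

sublocale D1m: module "RB F" "D1_mod F" by (rule D1_module)

text \<open>The comparison with the cotangent complex takes place over \<open>B\<close>.\<close>

abbreviation "DB \<equiv> restrict_scalars (RB_tensor F \<one>\<^bsub>R\<^esub>) (D1_mod F)"

lemma DB_module: "module B DB"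
  by (rule module_restrict_scalars[OF D1_module B.is_cring sec_hom])

sublocale DB: module B DB by (rule DB_module)

lemma D1_class_closed [simp]: "i \<in> Iset \<Longrightarrow> t \<in> carrier (BT_mod F) \<Longrightarrow> D1_class F i t \<in> carrier (D1_mod F)"
  by (simp add: D1_class_eq D1_eq D.quot_closed)

lemma D1_class_smult: "b \<in> carrier B \<Longrightarrow> i \<in> Iset \<Longrightarrow> t \<in> carrier (BT_mod F) \<Longrightarrow>
    b \<odot>\<^bsub>DB\<^esub> D1_class F i t = D1_class F (sec b \<otimes>\<^bsub>RB F\<^esub> i) (b \<odot>\<^bsub>BT_mod F\<^esub> t)"
  by (simp add: D1_class_eq D1_eq quot_module_smult[OF IBT_module rel1_submodule])

text \<open>
  The elements \<open>dI\<close> and \<open>dT\<close> generate \<open>D\<^sup>1\<close> additively, so that identities between additive maps can be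
  checked on them.  They correspond to \<open>b \<otimes> dr\<close> and \<open>b \<otimes> p\<close> in the cotangent complex.
\<close>

definition dI :: "'b \<Rightarrow> 'r \<Rightarrow> ('r, 'p, 'b, 'n) D1_elem" where
  "dI b r = D1_class F (gI b r) \<zero>\<^bsub>BT_mod F\<^esub>"

definition dT :: "'b \<Rightarrow> 'p \<Rightarrow> ('r, 'p, 'b, 'n) D1_elem" where
  "dT b p = D1_class F \<zero>\<^bsub>RB F\<^esub> (BT_tensor F b (tau p))"

lemma D1_class_hom: "(\<lambda>(i, t). D1_class F i t) \<in> addhom IBT DB"
  using D.quot_hom by (simp only: D1_class_eq[abs_def] D1_eq case_prod_eta restrict_scalars_hom)

lemma D1_class_I_hom: "(\<lambda>i. D1_class F i \<zero>\<^bsub>BT_mod F\<^esub>) \<in> addhom (I_mod F) DB"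
proof -
  have "(\<lambda>i. (i, \<zero>\<^bsub>BT_mod F\<^esub>)) \<in> addhom (I_mod F) IBT"
    by (rule addhomI) simp_all
  from addhom_comp[OF this D1_class_hom] show ?thesis by simp
qed

lemma D1_class_T_hom: "(\<lambda>t. D1_class F \<zero>\<^bsub>RB F\<^esub> t) \<in> addhom (BT_mod F) DB"
proof -
  have "(\<lambda>t. (\<zero>\<^bsub>RB F\<^esub>, t)) \<in> addhom (BT_mod F) IBT"
    by (rule addhomI) simp_all
  from addhom_comp[OF this D1_class_hom] show ?thesis by simp
qed

lemma dI_closed [simp]: "b \<in> carrier B \<Longrightarrow> r \<in> carrier R \<Longrightarrow> dI b r \<in> carrier (D1_mod F)"
  unfolding dI_def by (intro D1_class_closed gI_closed) auto
lemma dT_closed [simp]: "b \<in> carrier B \<Longrightarrow> p \<in> carrier (Pm F) \<Longrightarrow> dT b p \<in> carrier (D1_mod F)"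
  unfolding dT_def using tau_closed by (intro D1_class_closed) auto

lemma D1_class_split:
  assumes "i \<in> Iset" "t \<in> carrier (BT_mod F)"
  shows "D1_class F i t = D1_class F i \<zero>\<^bsub>BT_mod F\<^esub> \<oplus>\<^bsub>DB\<^esub> D1_class F \<zero>\<^bsub>RB F\<^esub> t"
  using addhom_add[OF D1_class_hom, of "(i, \<zero>\<^bsub>BT_mod F\<^esub>)" "(\<zero>\<^bsub>RB F\<^esub>, t)"] assms by simp

lemma D1_induct [consumes 1, case_names zero I T diff]:
  assumes "x \<in> carrier DB" and z: "P \<zero>\<^bsub>DB\<^esub>"
    and "\<And>b r. b \<in> carrier B \<Longrightarrow> r \<in> carrier R \<Longrightarrow> P (dI b r)"
    and "\<And>b p. b \<in> carrier B \<Longrightarrow> p \<in> carrier (Pm F) \<Longrightarrow> P (dT b p)"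
    and d: "\<And>x y. x \<in> carrier DB \<Longrightarrow> y \<in> carrier DB \<Longrightarrow> P x \<Longrightarrow> P y \<Longrightarrow> P (x \<ominus>\<^bsub>DB\<^esub> y)"
  shows "P x"
proof -
  obtain i t where it: "i \<in> Iset" "t \<in> carrier (BT_mod F)" "x = D1_class F i t"
    using assms(1) by (auto simp: D1_eq D.quot_carrier D1_class_eq)
  have 1: "P (D1_class F i \<zero>\<^bsub>BT_mod F\<^esub>)"
    using it(1)
  proof (induction rule: I_induct)
    case zero
    then show ?case using z addhom_zero[OF D1_class_I_hom module_abelian[OF I_module] DB.abelian_group_axioms] by simp
  next
    case (gen r b)
    then show ?case using assms(3) by (simp add: dI_def)
  next
    case (diff y z)
    then show ?case using d addhom_diff[OF D1_class_I_hom module_abelian[OF I_module] DB.abelian_group_axioms, of y z]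
      by (simp add: I_diff)
  qed
  have 2: "P (D1_class F \<zero>\<^bsub>RB F\<^esub> t)"
    using it(2)
  proof (induction rule: BT_induct)
    case zero
    then show ?case using z addhom_zero[OF D1_class_T_hom BTm.abelian_group_axioms DB.abelian_group_axioms] by simp
  next
    case (gen b p)
    then show ?case using assms(4) by (simp add: dT_def)
  next
    case (diff y z)
    then show ?case using d addhom_diff[OF D1_class_T_hom BTm.abelian_group_axioms DB.abelian_group_axioms, of y z]
      by simp
  qed
  have c: "D1_class F i \<zero>\<^bsub>BT_mod F\<^esub> \<in> carrier DB" "D1_class F \<zero>\<^bsub>RB F\<^esub> t \<in> carrier DB" using it by simp_all
  have "P (D1_class F i \<zero>\<^bsub>BT_mod F\<^esub> \<ominus>\<^bsub>DB\<^esub> (\<zero>\<^bsub>DB\<^esub> \<ominus>\<^bsub>DB\<^esub> D1_class F \<zero>\<^bsub>RB F\<^esub> t))"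
    by (intro d 1 2 z c DB.zero_closed DB.M.minus_closed)
  then show ?thesis using c it by (simp add: D1_class_split[OF it(1,2)] D1m.M.minus_eq)
qed

lemma DB_hom_eq:
  assumes "f \<in> addhom DB L" "g \<in> addhom DB L" "abelian_group L" "x \<in> carrier DB"
    "\<And>b r. b \<in> carrier B \<Longrightarrow> r \<in> carrier R \<Longrightarrow> f (dI b r) = g (dI b r)"
    "\<And>b p. b \<in> carrier B \<Longrightarrow> p \<in> carrier (Pm F) \<Longrightarrow> f (dT b p) = g (dT b p)"
  shows "f x = g x"
  using assms(4)
proof (induction rule: D1_induct)
  case zero
  show ?case
    by (simp only: addhom_zero[OF assms(1) DB.abelian_group_axioms assms(3)]
        addhom_zero[OF assms(2) DB.abelian_group_axioms assms(3)])
next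
  case (diff y z)
  then show ?case
    by (simp only: addhom_diff[OF assms(1) DB.abelian_group_axioms assms(3)]
        addhom_diff[OF assms(2) DB.abelian_group_axioms assms(3)])
qed (simp_all add: assms(5,6))

lemma dI_smult: "b \<in> carrier B \<Longrightarrow> b' \<in> carrier B \<Longrightarrow> r \<in> carrier R \<Longrightarrow> b \<odot>\<^bsub>DB\<^esub> dI b' r = dI (b \<otimes>\<^bsub>B\<^esub> b') r"
  unfolding dI_def using gI_closed[of r b']
  by (subst D1_class_smult)
    (auto simp: gI_def RB.minus_eq RB.r_distr RB.r_minus RB_tensor_mult B.m_lcomm)
lemma dT_smult: "b \<in> carrier B \<Longrightarrow> b' \<in> carrier B \<Longrightarrow> p \<in> carrier (Pm F) \<Longrightarrow> b \<odot>\<^bsub>DB\<^esub> dT b' p = dT (b \<otimes>\<^bsub>B\<^esub> b') p"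
  unfolding dT_def using tau_closed[of p] by (subst D1_class_smult) (auto simp: BT_smult)

end

section \<open>The logarithmic cotangent complex in one simplicial degree\<close>

context log_factorization
begin

sublocale K: kaehler C R e
  by (intro kaehler.intro kaehler_axioms.intro C.is_cring R.is_cring e_hom)

sublocale Om: module R K.Om by (rule K.Om_module)

sublocale OR: tensor R B K.Om eps
  by (intro tensor.intro tensor_axioms.intro R.is_cring B.is_cring K.Om_module eps_hom)

lemma BOmR_eq: "BOmR_mod F = OR.BC" by (simp add: BOmR_mod_def)
lemma BOmR_tensor_eq: "BOmR_tensor F = OR.pt" by (simp add: BOmR_tensor_def)

lemma BOmR_module: "module B (BOmR_mod F)" unfolding BOmR_eq by (rule OR.BC_module)
sublocale OB: module B "BOmR_mod F" by (rule BOmR_module)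

text \<open>The generator \<open>b \<otimes> dr\<close>.\<close>

abbreviation "bd b r \<equiv> BOmR_tensor F b (K.\<delta> r)"

lemma BOmR_tensor_closed [simp]: "b \<in> carrier B \<Longrightarrow> w \<in> carrier K.Om \<Longrightarrow> BOmR_tensor F b w \<in> carrier (BOmR_mod F)"
  by (simp add: BOmR_eq BOmR_tensor_eq)
lemma BOmR_add_left: "b \<in> carrier B \<Longrightarrow> b' \<in> carrier B \<Longrightarrow> w \<in> carrier K.Om \<Longrightarrow>
    BOmR_tensor F (b \<oplus>\<^bsub>B\<^esub> b') w = BOmR_tensor F b w \<oplus>\<^bsub>BOmR_mod F\<^esub> BOmR_tensor F b' w"
  by (simp add: BOmR_eq BOmR_tensor_eq OR.pt_add_left)
lemma BOmR_add_right: "b \<in> carrier B \<Longrightarrow> w \<in> carrier K.Om \<Longrightarrow> w' \<in> carrier K.Om \<Longrightarrow>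
    BOmR_tensor F b (w \<oplus>\<^bsub>K.Om\<^esub> w') = BOmR_tensor F b w \<oplus>\<^bsub>BOmR_mod F\<^esub> BOmR_tensor F b w'"
  by (simp add: BOmR_eq BOmR_tensor_eq OR.pt_add_right)
lemma BOmR_balance: "b \<in> carrier B \<Longrightarrow> r \<in> carrier R \<Longrightarrow> w \<in> carrier K.Om \<Longrightarrow>
    BOmR_tensor F b (r \<odot>\<^bsub>K.Om\<^esub> w) = BOmR_tensor F (b \<otimes>\<^bsub>B\<^esub> eps r) w"
  by (simp add: BOmR_tensor_eq OR.pt_balance)
lemma BOmR_smult: "b \<in> carrier B \<Longrightarrow> b' \<in> carrier B \<Longrightarrow> w \<in> carrier K.Om \<Longrightarrow>
    b \<odot>\<^bsub>BOmR_mod F\<^esub> BOmR_tensor F b' w = BOmR_tensor F (b \<otimes>\<^bsub>B\<^esub> b') w"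
  by (simp add: BOmR_eq BOmR_tensor_eq OR.pt_smult)

lemma bd_const: "b \<in> carrier B \<Longrightarrow> c \<in> carrier C \<Longrightarrow> bd b (e c) = \<zero>\<^bsub>BOmR_mod F\<^esub>"
  using addhom_zero[OF OR.pt_right_hom Om.M.abelian_group_axioms OR.BC_abelian]
  by (simp add: K.delta_const BOmR_eq BOmR_tensor_eq)

lemma bd_mult: "b \<in> carrier B \<Longrightarrow> x \<in> carrier R \<Longrightarrow> y \<in> carrier R \<Longrightarrow>
    bd b (x \<otimes>\<^bsub>R\<^esub> y) = bd (b \<otimes>\<^bsub>B\<^esub> eps x) y \<oplus>\<^bsub>BOmR_mod F\<^esub> bd (b \<otimes>\<^bsub>B\<^esub> eps y) x"
  by (simp add: K.delta_mult BOmR_add_right BOmR_balance)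

lemma BOmR_induct [consumes 1, case_names zero gen diff]:
  assumes "z \<in> carrier (BOmR_mod F)" "P \<zero>\<^bsub>BOmR_mod F\<^esub>"
    and "\<And>b r. b \<in> carrier B \<Longrightarrow> r \<in> carrier R \<Longrightarrow> P (bd b r)"
    and "\<And>y z. y \<in> carrier (BOmR_mod F) \<Longrightarrow> z \<in> carrier (BOmR_mod F) \<Longrightarrow> P y \<Longrightarrow> P z \<Longrightarrow> P (y \<ominus>\<^bsub>BOmR_mod F\<^esub> z)"
  shows "P z"
  using assms(1) unfolding BOmR_eq
proof (induction rule: OR.BC_induct)
  case (pure b w)
  note h = OR.pt_right_hom[OF pure(1)]
  from pure(2) show ?case
  proof (induction rule: K.Om_induct)
    case zero
    then show ?case
      using assms(2) addhom_zero[OF h Om.M.abelian_group_axioms OR.BC_abelian] by (simp add: BOmR_eq)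
  next
    case (gen s x)
    then show ?case
      using assms(3)[of "b \<otimes>\<^bsub>B\<^esub> eps s" x] pure(1) BOmR_balance[of b s "K.\<delta> x"] by (simp add: BOmR_tensor_eq)
  next
    case (diff y z)
    then show ?case
      using assms(4) addhom_diff[OF h Om.M.abelian_group_axioms OR.BC_abelian] pure(1) by (simp add: BOmR_eq)
  qed
qed (use assms in \<open>simp_all add: BOmR_eq\<close>)

subsection \<open>The group \<open>P\<^sup>g\<^sup>p / Q\<^sup>g\<^sup>p\<close>\<close>

abbreviation "Qim \<equiv> gp_map (Pm F) eQ ` carrier (gp (Qm F))"
abbreviation "PQ \<equiv> Pgp_mod_Qgp F"

lemma gp_eQ_hom: "group_hom (gp (Qm F)) (gp (Pm F)) (gp_map (Pm F) eQ)"
  using gp_map_hom[OF Q.comm_monoid_axioms P.comm_monoid_axioms eQ_hom]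
  by (simp add: group_hom_def group_hom_axioms_def comm_group.axioms(2) P.gp_comm_group Q.gp_comm_group)

lemma Qim_subgroup: "subgroup Qim (gp (Pm F))"
  using group_hom.img_is_subgroup[OF gp_eQ_hom] .

lemma PQ_comm_group: "comm_group PQ"
  unfolding Pgp_mod_Qgp_def by (rule FactGroup_comm_group[OF P.gp_comm_group Qim_subgroup])

lemma PQ_proj_hom: "(\<lambda>x. Qim #>\<^bsub>gp (Pm F)\<^esub> x) \<in> hom (gp (Pm F)) PQ"
  unfolding Pgp_mod_Qgp_def by (rule FactGroup_hom[OF P.gp_comm_group Qim_subgroup])

lemma bar_p_closed [simp]: "p \<in> carrier (Pm F) \<Longrightarrow> bar_p F p \<in> carrier PQ"
  unfolding bar_p_def using PQ_proj_hom by (auto simp: hom_def)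

lemma bar_p_mult: "p \<in> carrier (Pm F) \<Longrightarrow> p' \<in> carrier (Pm F) \<Longrightarrow> bar_p F (p \<otimes>\<^bsub>Pm F\<^esub> p') = bar_p F p \<otimes>\<^bsub>PQ\<^esub> bar_p F p'"
  unfolding bar_p_def by (subst hom_mult[OF PQ_proj_hom, symmetric]) auto

lemma bar_p_eQ [simp]: "q \<in> carrier (Qm F) \<Longrightarrow> bar_p F (eQ q) = \<one>\<^bsub>PQ\<^esub>"
proof -
  assume q: "q \<in> carrier (Qm F)"
  have "gp_map (Pm F) eQ (gp_frac (Qm F) q \<one>\<^bsub>Qm F\<^esub>) = gp_frac (Pm F) (eQ q) \<one>\<^bsub>Pm F\<^esub>"
    using q by (simp add: gp_map_frac[OF Q.comm_monoid_axioms P.comm_monoid_axioms eQ_hom] monoid_hom_one[OF eQ_hom])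
  then have "gp_frac (Pm F) (eQ q) \<one>\<^bsub>Pm F\<^esub> \<in> Qim"
    using q by (metis imageI Q.gp_frac_closed Q.one_closed)
  then show ?thesis
    using q unfolding bar_p_def Pgp_mod_Qgp_def by (subst FactGroup_one_iff[OF P.gp_comm_group Qim_subgroup]) auto
qed

lemma bar_p_hom: "bar_p F \<in> monoid_hom (Pm F) PQ"
  using bar_p_eQ[OF Q.one_closed] by (intro monoid_homI) (auto simp: bar_p_mult monoid_hom_one[OF eQ_hom])

lemma bar_p_frac:
  assumes "p \<in> carrier (Pm F)" "p' \<in> carrier (Pm F)"
  shows "Qim #>\<^bsub>gp (Pm F)\<^esub> gp_frac (Pm F) p p' = bar_p F p \<otimes>\<^bsub>PQ\<^esub> inv\<^bsub>PQ\<^esub> bar_p F p'"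
proof -
  interpret group_hom "gp (Pm F)" PQ "\<lambda>x. Qim #>\<^bsub>gp (Pm F)\<^esub> x"
    using PQ_proj_hom by (simp add: group_hom_def group_hom_axioms_def comm_group.axioms(2) P.gp_comm_group PQ_comm_group)
  have c: "gp_frac (Pm F) p \<one>\<^bsub>Pm F\<^esub> \<in> carrier (gp (Pm F))" "gp_frac (Pm F) p' \<one>\<^bsub>Pm F\<^esub> \<in> carrier (gp (Pm F))"
    using assms by simp_all
  show ?thesis
    unfolding bar_p_def P.gp_frac_split[OF assms] hom_mult[OF c(1) group.inv_closed[OF comm_group.axioms(2)[OF P.gp_comm_group] c(2)]] hom_inv[OF c(2)] ..
qed

lemma PQ_cases:
  assumes "t \<in> carrier PQ"
  obtains p p' where "p \<in> carrier (Pm F)" "p' \<in> carrier (Pm F)" "t = bar_p F p \<otimes>\<^bsub>PQ\<^esub> inv\<^bsub>PQ\<^esub> bar_p F p'"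
proof -
  obtain x where "x \<in> carrier (gp (Pm F))" "t = Qim #>\<^bsub>gp (Pm F)\<^esub> x"
    using assms unfolding Pgp_mod_Qgp_def FactGroup_carrier_rcos by auto
  then show ?thesis using that by (auto elim!: P.gp_cases simp: bar_p_frac)
qed

sublocale BG: tensor \<Z> B "int_module PQ" "int_to_target F"
  by (intro tensor.intro tensor_axioms.intro module_int_module PQ_comm_group int_hom int_is_cring B.is_cring)

lemma BG_eq: "BG_mod F = BG.BC" by (simp add: BG_mod_def)
lemma BG_tensor_eq: "BG_tensor F = BG.pt" by (simp add: BG_tensor_def)

lemma BG_module: "module B (BG_mod F)" unfolding BG_eq by (rule BG.BC_module)
sublocale BGm: module B "BG_mod F" by (rule BG_module)

lemma BG_tensor_closed [simp]: "b \<in> carrier B \<Longrightarrow> t \<in> carrier PQ \<Longrightarrow> BG_tensor F b t \<in> carrier (BG_mod F)"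
  by (simp add: BG_eq BG_tensor_eq)
lemma BG_smult: "b \<in> carrier B \<Longrightarrow> b' \<in> carrier B \<Longrightarrow> t \<in> carrier PQ \<Longrightarrow> b \<odot>\<^bsub>BG_mod F\<^esub> BG_tensor F b' t = BG_tensor F (b \<otimes>\<^bsub>B\<^esub> b') t"
  by (simp add: BG_eq BG_tensor_eq BG.pt_smult)
lemma BG_right_hom: "b \<in> carrier B \<Longrightarrow> BG_tensor F b \<in> hom PQ (add_monoid (BG_mod F))"
  using BG.pt_right_hom[of b] by (simp only: BG_eq BG_tensor_eq int_module_hom)

lemma BG_right_group_hom: "b \<in> carrier B \<Longrightarrow> group_hom PQ (add_monoid (BG_mod F)) (BG_tensor F b)"
  using BG_right_hom PQ_comm_group BGm.a_group
  by (simp add: group_hom_def group_hom_axioms_def comm_group.axioms(2))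

lemma BG_tensor_one: "b \<in> carrier B \<Longrightarrow> BG_tensor F b \<one>\<^bsub>PQ\<^esub> = \<zero>\<^bsub>BG_mod F\<^esub>"
  using group_hom.hom_one[OF BG_right_group_hom] by simp

lemma BG_tensor_mult:
  "b \<in> carrier B \<Longrightarrow> t \<in> carrier PQ \<Longrightarrow> t' \<in> carrier PQ \<Longrightarrow>
    BG_tensor F b (t \<otimes>\<^bsub>PQ\<^esub> t') = BG_tensor F b t \<oplus>\<^bsub>BG_mod F\<^esub> BG_tensor F b t'"
  using group_hom.hom_mult[OF BG_right_group_hom, of b t t'] by simp

lemma BG_tensor_div:
  assumes "b \<in> carrier B" "t \<in> carrier PQ" "t' \<in> carrier PQ"
  shows "BG_tensor F b (t \<otimes>\<^bsub>PQ\<^esub> inv\<^bsub>PQ\<^esub> t') = BG_tensor F b t \<ominus>\<^bsub>BG_mod F\<^esub> BG_tensor F b t'"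
proof -
  interpret group_hom PQ "add_monoid (BG_mod F)" "BG_tensor F b" by (rule BG_right_group_hom[OF assms(1)])
  show ?thesis
    using assms by (simp add: hom_mult[simplified] hom_inv[simplified] a_minus_def a_inv_def)
qed

lemma BG_induct [consumes 1, case_names zero gen diff]:
  assumes "z \<in> carrier (BG_mod F)" "P \<zero>\<^bsub>BG_mod F\<^esub>"
    and "\<And>b p. b \<in> carrier B \<Longrightarrow> p \<in> carrier (Pm F) \<Longrightarrow> P (BG_tensor F b (bar_p F p))"
    and "\<And>y z. y \<in> carrier (BG_mod F) \<Longrightarrow> z \<in> carrier (BG_mod F) \<Longrightarrow> P y \<Longrightarrow> P z \<Longrightarrow> P (y \<ominus>\<^bsub>BG_mod F\<^esub> z)"
  shows "P z"
  using assms(1) unfolding BG_eq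
proof (induction rule: BG.BC_induct)
  case (pure b t)
  then obtain p p' where "p \<in> carrier (Pm F)" "p' \<in> carrier (Pm F)" "t = bar_p F p \<otimes>\<^bsub>PQ\<^esub> inv\<^bsub>PQ\<^esub> bar_p F p'"
    using PQ_cases[of t] by auto
  then show ?case
    using assms(3,4) pure(1) BG_tensor_div[of b "bar_p F p" "bar_p F p'"] by (simp add: BG_tensor_eq[symmetric])
qed (use assms in \<open>simp_all add: BG_eq\<close>)

subsection \<open>The two maps out of \<open>B \<otimes> \<Omega>\<close> for \<open>\<int>[P]\<close> over \<open>\<int>[Q]\<close>\<close>

lemma ZP_to_R_hom: "ZP_to_R F \<in> ring_hom P.ZM R"
  unfolding ZP_to_R_def by (rule P.ZM_ring_hom[OF R.is_cring chi_hom])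
lemma ZP_to_R_of [simp]: "p \<in> carrier (Pm F) \<Longrightarrow> ZP_to_R F (frag_of p) = \<chi> p"
  unfolding ZP_to_R_def by (rule P.ZM_lift_of[OF R.abelian_group_axioms]) simp

lemma bar_h_eq: "bar_h F p = \<beta> (h p)" by (simp add: bar_h_def)

lemma ZP_to_B_hom: "ZP_to_B F \<in> ring_hom P.ZM B"
  unfolding ZP_to_B_def
  by (rule P.ZM_ring_hom[OF B.is_cring]) (rule monoid_homI, auto simp: bar_h_eq)
lemma ZP_to_B_of [simp]: "p \<in> carrier (Pm F) \<Longrightarrow> ZP_to_B F (frag_of p) = \<beta> (h p)"
  unfolding ZP_to_B_def by (subst P.ZM_lift_of[OF B.abelian_group_axioms]) (auto simp: bar_h_eq)

lemma ZP_to_B_eq: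
  assumes "Poly_Mapping.keys c \<subseteq> carrier (Pm F)"
  shows "eps (ZP_to_R F c) = ZP_to_B F c"
proof (rule free_hom_eq[OF _ _ _ assms])
  show "free_hom B (carrier (Pm F)) (\<lambda>c. eps (ZP_to_R F c))"
    by (rule P.free_hom_ZM[OF addhom_comp[OF ring_hom_addhom[OF ZP_to_R_hom] ring_hom_addhom[OF eps_hom]] B.abelian_group_axioms])
  show "free_hom B (carrier (Pm F)) (ZP_to_B F)"
    by (rule P.free_hom_ZM[OF ring_hom_addhom[OF ZP_to_B_hom] B.abelian_group_axioms])
qed simp

lemma eQ_ring_hom: "monoid_ring_map eQ \<in> ring_hom Q.ZM P.ZM"
  by (rule monoid_ring_map_ring_hom[OF Q.comm_monoid_axioms P.comm_monoid_axioms eQ_hom])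

sublocale KP: kaehler Q.ZM P.ZM "monoid_ring_map eQ"
  by (intro kaehler.intro kaehler_axioms.intro Q.ZM_cring P.ZM_cring eQ_ring_hom)

sublocale OmP: module P.ZM KP.Om by (rule KP.Om_module)

sublocale OP: tensor P.ZM B KP.Om "ZP_to_B F"
  by (intro tensor.intro tensor_axioms.intro P.ZM_cring B.is_cring KP.Om_module ZP_to_B_hom)

lemma BOmP_eq: "BOmP_mod F = OP.BC" by (simp add: BOmP_mod_def)

lemma ZP_to_R_closed [simp]: "Poly_Mapping.keys c \<subseteq> carrier (Pm F) \<Longrightarrow> ZP_to_R F c \<in> carrier R"
  using ring_hom_closed[OF ZP_to_R_hom, of c] by simp
lemma ZP_to_R_const:
  assumes "Poly_Mapping.keys c \<subseteq> carrier (Qm F)"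
  shows "K.\<delta> (ZP_to_R F (monoid_ring_map eQ c)) = \<zero>\<^bsub>K.Om\<^esub>"
proof (rule free_hom_eq[where G = "\<lambda>c. \<zero>\<^bsub>K.Om\<^esub>", OF _ _ _ assms])
  have "K.\<delta> \<in> addhom R K.Om" by (intro addhomI) (auto simp: K.delta_add)
  from addhom_comp[OF addhom_comp[OF ring_hom_addhom[OF eQ_ring_hom] ring_hom_addhom[OF ZP_to_R_hom]] this]
  show "free_hom K.Om (carrier (Qm F)) (\<lambda>c. K.\<delta> (ZP_to_R F (monoid_ring_map eQ c)))"
    by (rule Q.free_hom_ZM[OF _ Om.M.abelian_group_axioms])
  show "free_hom K.Om (carrier (Qm F)) (\<lambda>c. \<zero>\<^bsub>K.Om\<^esub>)"
    using addhom_const_zero[OF Om.M.abelian_group_axioms] by (rule Q.free_hom_ZM[OF _ Om.M.abelian_group_axioms])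
qed (simp add: chi_eQ K.delta_const)

lemma delta_ZP_hom: "(\<lambda>x. K.\<delta> (ZP_to_R F x)) \<in> addhom P.ZM K.Om"
proof -
  have "K.\<delta> \<in> addhom R K.Om" by (intro addhomI) (auto simp: K.delta_add)
  from addhom_comp[OF ring_hom_addhom[OF ZP_to_R_hom] this] show ?thesis .
qed

lemma BOmP_to_BOmR:
  shows BOmP_to_BOmR_hom: "BOmP_to_BOmR F \<in> addhom (BOmP_mod F) (BOmR_mod F)"
    and BOmP_to_BOmR_gen: "b \<in> carrier B \<Longrightarrow> p \<in> carrier (Pm F) \<Longrightarrow>
      BOmP_to_BOmR F (OP.pt b (KP.\<delta> (frag_of p))) = bd b (\<chi> p)"
proof -
  let ?D = "\<lambda>x. K.\<delta> (ZP_to_R F x)"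
  let ?\<kappa> = "symbol_lift K.Om (\<lambda>z x. ZP_to_R F z \<odot>\<^bsub>K.Om\<^esub> ?D x)"
  have leib: "?D (x \<otimes>\<^bsub>P.ZM\<^esub> y) = ZP_to_R F x \<odot>\<^bsub>K.Om\<^esub> ?D y \<oplus>\<^bsub>K.Om\<^esub> ZP_to_R F y \<odot>\<^bsub>K.Om\<^esub> ?D x"
    if "x \<in> carrier P.ZM" "y \<in> carrier P.ZM" for x y
    using that ring_hom_mult[OF ZP_to_R_hom that] by (simp add: K.delta_mult)
  have const: "?D (monoid_ring_map eQ c) = \<zero>\<^bsub>K.Om\<^esub>" if "c \<in> carrier Q.ZM" for c
    using that ZP_to_R_const by simp
  note l = KP.Om_lift[OF K.Om_module ZP_to_R_hom delta_ZP_hom leib const]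
  have lh: "?\<kappa> \<in> addhom KP.Om K.Om" by (rule l(1))
  have ld: "?\<kappa> (KP.\<delta> x) = ?D x" if "x \<in> carrier P.ZM" for x by (rule l(4)[OF _ _ _ that])
  have \<kappa>c: "?\<kappa> w \<in> carrier K.Om" if "w \<in> carrier KP.Om" for w
    using addhom_closed[OF lh that] .
  have eq: "BOmP_to_BOmR F = symbol_lift (BOmR_mod F) (\<lambda>b w. BOmR_tensor F b (?\<kappa> w))"
    by (simp add: BOmP_to_BOmR_def Let_def)
  have bal: "BOmR_tensor F (b \<otimes>\<^bsub>B\<^esub> ZP_to_B F a) (?\<kappa> w) = BOmR_tensor F b (?\<kappa> (a \<odot>\<^bsub>KP.Om\<^esub> w))"
    if "b \<in> carrier B" "a \<in> carrier P.ZM" "w \<in> carrier KP.Om" for b a w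
    using that \<kappa>c[OF that(3)] l(3)[OF _ _ _ that(2,3)] by (simp add: BOmR_balance ZP_to_B_eq)
  note m = OP.BC_lift[OF OB.M.abelian_group_axioms _ _ _ bal]
  show "BOmP_to_BOmR F \<in> addhom (BOmP_mod F) (BOmR_mod F)"
    unfolding eq BOmP_eq by (rule m(1)) (simp_all add: \<kappa>c BOmR_add_left BOmR_add_right addhom_add[OF lh])
  show "BOmP_to_BOmR F (OP.pt b (KP.\<delta> (frag_of p))) = bd b (\<chi> p)"
    if "b \<in> carrier B" "p \<in> carrier (Pm F)"
  proof -
    have "symbol_lift (BOmR_mod F) (\<lambda>b w. BOmR_tensor F b (?\<kappa> w)) (OP.pt b (KP.\<delta> (frag_of p))) =
        BOmR_tensor F b (?\<kappa> (KP.\<delta> (frag_of p)))"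
      by (rule m(2)) (use that in \<open>simp_all add: \<kappa>c BOmR_add_left BOmR_add_right addhom_add[OF lh]\<close>)
    then show ?thesis unfolding eq using that by (simp add: ld)
  qed
qed

text \<open>The derivation \<open>\<int>[P] \<rightarrow> B \<otimes> P\<^sup>g\<^sup>p / Q\<^sup>g\<^sup>p\<close>, \<open>p \<mapsto> h(p) \<otimes> p\<close>.\<close>

abbreviation "dlog \<equiv> frag_lift (add_monoid (BG_mod F)) (\<lambda>p. BG_tensor F (bar_h F p) (bar_p F p))"

sublocale dl: free_hom "BG_mod F" "carrier (Pm F)" dlog
  by (rule free_hom_frag_lift[OF BGm.M.abelian_group_axioms]) (simp add: bar_h_eq)

lemma dlog_of [simp]: "p \<in> carrier (Pm F) \<Longrightarrow> dlog (frag_of p) = BG_tensor F (\<beta> (h p)) (bar_p F p)"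
  by (subst P.ZM_lift_of[OF BGm.M.abelian_group_axioms]) (simp_all add: bar_h_eq)

lemma dlog_hom: "dlog \<in> addhom P.ZM (BG_mod F)"
  unfolding P.addhom_ZM by (rule dl.F)

text \<open>
  On basis elements this is \<open>h(p p') \<otimes> p p' = h(p) h(p') \<otimes> p' + h(p') h(p) \<otimes> p\<close>.
\<close>

lemma dlog_mult:
  assumes x: "Poly_Mapping.keys x \<subseteq> carrier (Pm F)" and y: "Poly_Mapping.keys y \<subseteq> carrier (Pm F)"
  shows "dlog (x \<otimes>\<^bsub>P.ZM\<^esub> y) = ZP_to_B F x \<odot>\<^bsub>BG_mod F\<^esub> dlog y \<oplus>\<^bsub>BG_mod F\<^esub> ZP_to_B F y \<odot>\<^bsub>BG_mod F\<^esub> dlog x"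
proof -
  have ab: "abelian_group (BG_mod F)" by (rule BGm.M.abelian_group_axioms)
  have act: "(\<lambda>x. ZP_to_B F x \<odot>\<^bsub>BG_mod F\<^esub> v) \<in> addhom P.ZM (BG_mod F)" if "v \<in> carrier (BG_mod F)" for v
  proof -
    have "(\<lambda>b. b \<odot>\<^bsub>BG_mod F\<^esub> v) \<in> addhom B (BG_mod F)"
      by (rule addhomI) (use that in \<open>auto simp: BGm.smult_l_distr\<close>)
    from addhom_comp[OF ring_hom_addhom[OF ZP_to_B_hom] this] show ?thesis .
  qed
  have xc: "x \<in> carrier P.ZM" and yc: "y \<in> carrier P.ZM" using x y by simp_all
  show ?thesis
  proof (rule free_hom_eq[OF P.free_hom_ZM[OF _ ab] P.free_hom_ZM[OF _ ab] _ x])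
    show "(\<lambda>x. dlog (x \<otimes>\<^bsub>P.ZM\<^esub> y)) \<in> addhom P.ZM (BG_mod F)"
      by (rule addhom_comp[OF addhom_rmult[OF P.ZM_cring yc] dlog_hom])
    show "(\<lambda>x. ZP_to_B F x \<odot>\<^bsub>BG_mod F\<^esub> dlog y \<oplus>\<^bsub>BG_mod F\<^esub> ZP_to_B F y \<odot>\<^bsub>BG_mod F\<^esub> dlog x) \<in> addhom P.ZM (BG_mod F)"
      by (rule addhom_plus[OF ab act addhom_comp[OF dlog_hom module_smult_hom[OF BG_module]]])
        (use y in \<open>simp_all add: dl.closed\<close>)
    fix p assume p: "p \<in> carrier (Pm F)"
    then have pc: "frag_of p \<in> carrier P.ZM" and pb: "ZP_to_B F (frag_of p) \<in> carrier B" by simp_all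
    show "dlog (frag_of p \<otimes>\<^bsub>P.ZM\<^esub> y) =
      ZP_to_B F (frag_of p) \<odot>\<^bsub>BG_mod F\<^esub> dlog y \<oplus>\<^bsub>BG_mod F\<^esub> ZP_to_B F y \<odot>\<^bsub>BG_mod F\<^esub> dlog (frag_of p)"
    proof (rule free_hom_eq[OF P.free_hom_ZM[OF _ ab] P.free_hom_ZM[OF _ ab] _ y])
      show "(\<lambda>y. dlog (frag_of p \<otimes>\<^bsub>P.ZM\<^esub> y)) \<in> addhom P.ZM (BG_mod F)"
        by (rule addhom_comp[OF addhom_lmult[OF P.ZM_cring pc] dlog_hom])
      show "(\<lambda>y. ZP_to_B F (frag_of p) \<odot>\<^bsub>BG_mod F\<^esub> dlog y \<oplus>\<^bsub>BG_mod F\<^esub> ZP_to_B F y \<odot>\<^bsub>BG_mod F\<^esub> dlog (frag_of p)) \<in> addhom P.ZM (BG_mod F)"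
        by (rule addhom_plus[OF ab addhom_comp[OF dlog_hom module_smult_hom[OF BG_module pb]] act])
          (use p in \<open>simp_all add: dl.closed\<close>)
      fix p' assume "p' \<in> carrier (Pm F)"
      then show "dlog (frag_of p \<otimes>\<^bsub>P.ZM\<^esub> frag_of p') =
        ZP_to_B F (frag_of p) \<odot>\<^bsub>BG_mod F\<^esub> dlog (frag_of p') \<oplus>\<^bsub>BG_mod F\<^esub> ZP_to_B F (frag_of p') \<odot>\<^bsub>BG_mod F\<^esub> dlog (frag_of p)"
        using p by (simp add: bar_p_mult BG_tensor_mult BG_smult BGm.M.a_comm B.m_comm)
    qed
  qed
qed

lemma dlog_const:
  assumes "c \<in> carrier Q.ZM"
  shows "dlog (monoid_ring_map eQ c) = \<zero>\<^bsub>BG_mod F\<^esub>"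
proof (rule free_hom_eq[where N = "BG_mod F" and V = "carrier (Qm F)"
      and F = "\<lambda>c. dlog (monoid_ring_map eQ c)" and G = "\<lambda>c. \<zero>\<^bsub>BG_mod F\<^esub>"])
  show "free_hom (BG_mod F) (carrier (Qm F)) (\<lambda>c. dlog (monoid_ring_map eQ c))"
    by (rule Q.free_hom_ZM[OF addhom_comp[OF ring_hom_addhom[OF eQ_ring_hom] dlog_hom] BGm.M.abelian_group_axioms])
  show "free_hom (BG_mod F) (carrier (Qm F)) (\<lambda>c. \<zero>\<^bsub>BG_mod F\<^esub>)"
    using addhom_const_zero[OF BGm.M.abelian_group_axioms] by (rule Q.free_hom_ZM[OF _ BGm.M.abelian_group_axioms])
qed (use assms in \<open>simp_all add: BG_tensor_one\<close>)

lemma BOmP_to_BG: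
  shows BOmP_to_BG_hom: "BOmP_to_BG F \<in> addhom (BOmP_mod F) (BG_mod F)"
    and BOmP_to_BG_gen: "b \<in> carrier B \<Longrightarrow> p \<in> carrier (Pm F) \<Longrightarrow>
      BOmP_to_BG F (OP.pt b (KP.\<delta> (frag_of p))) = BG_tensor F (b \<otimes>\<^bsub>B\<^esub> \<beta> (h p)) (bar_p F p)"
proof -
  let ?\<gamma> = "symbol_lift (BG_mod F) (\<lambda>z x. ZP_to_B F z \<odot>\<^bsub>BG_mod F\<^esub> dlog x)"
  have leib: "dlog (x \<otimes>\<^bsub>P.ZM\<^esub> y) = ZP_to_B F x \<odot>\<^bsub>BG_mod F\<^esub> dlog y \<oplus>\<^bsub>BG_mod F\<^esub> ZP_to_B F y \<odot>\<^bsub>BG_mod F\<^esub> dlog x"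
    if "x \<in> carrier P.ZM" "y \<in> carrier P.ZM" for x y
    using dlog_mult that by simp
  note l = KP.Om_lift[OF BG_module ZP_to_B_hom dlog_hom leib dlog_const]
  have lh: "?\<gamma> \<in> addhom KP.Om (BG_mod F)" by (rule l(1))
  have ld: "?\<gamma> (KP.\<delta> x) = dlog x" if "x \<in> carrier P.ZM" for x by (rule l(4)[OF _ _ _ that])
  have \<gamma>c: "?\<gamma> w \<in> carrier (BG_mod F)" if "w \<in> carrier KP.Om" for w
    using addhom_closed[OF lh that] .
  have eq: "BOmP_to_BG F = symbol_lift (BG_mod F) (\<lambda>b w. b \<odot>\<^bsub>BG_mod F\<^esub> ?\<gamma> w)"
    by (simp add: BOmP_to_BG_def Let_def)
  have bal: "(b \<otimes>\<^bsub>B\<^esub> ZP_to_B F a) \<odot>\<^bsub>BG_mod F\<^esub> ?\<gamma> w = b \<odot>\<^bsub>BG_mod F\<^esub> ?\<gamma> (a \<odot>\<^bsub>KP.Om\<^esub> w)"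
    if "b \<in> carrier B" "a \<in> carrier P.ZM" "w \<in> carrier KP.Om" for b a w
    using that \<gamma>c[OF that(3)] l(3)[OF _ _ _ that(2,3)] by (simp add: BGm.smult_assoc1)
  note m = OP.BC_lift[OF BGm.M.abelian_group_axioms _ _ _ bal]
  show "BOmP_to_BG F \<in> addhom (BOmP_mod F) (BG_mod F)"
    unfolding eq BOmP_eq by (rule m(1)) (simp_all add: \<gamma>c BGm.smult_l_distr BGm.smult_r_distr addhom_add[OF lh])
  show "BOmP_to_BG F (OP.pt b (KP.\<delta> (frag_of p))) = BG_tensor F (b \<otimes>\<^bsub>B\<^esub> \<beta> (h p)) (bar_p F p)"
    if "b \<in> carrier B" "p \<in> carrier (Pm F)"
  proof -
    have "symbol_lift (BG_mod F) (\<lambda>b w. b \<odot>\<^bsub>BG_mod F\<^esub> ?\<gamma> w) (OP.pt b (KP.\<delta> (frag_of p))) =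
        b \<odot>\<^bsub>BG_mod F\<^esub> ?\<gamma> (KP.\<delta> (frag_of p))"
      by (rule m(2)) (use that in \<open>simp_all add: \<gamma>c BGm.smult_l_distr BGm.smult_r_distr addhom_add[OF lh]\<close>)
    then show ?thesis unfolding eq using that by (simp add: ld BG_smult)
  qed
qed

text \<open>
  The coefficient \<open>z\<close> of \<open>b \<otimes> z dx\<close> moves into \<open>b\<close>, and what remains is additive in \<open>x\<close>.
\<close>

lemma BOmP_induct [consumes 1, case_names zero gen diff]:
  assumes "z \<in> carrier (BOmP_mod F)" "P \<zero>\<^bsub>BOmP_mod F\<^esub>"
    and "\<And>b p. b \<in> carrier B \<Longrightarrow> p \<in> carrier (Pm F) \<Longrightarrow> P (OP.pt b (KP.\<delta> (frag_of p)))"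
    and "\<And>y z. y \<in> carrier (BOmP_mod F) \<Longrightarrow> z \<in> carrier (BOmP_mod F) \<Longrightarrow> P y \<Longrightarrow> P z \<Longrightarrow> P (y \<ominus>\<^bsub>BOmP_mod F\<^esub> z)"
  shows "P z"
  using assms(1) unfolding BOmP_eq
proof (induction rule: OP.BC_induct)
  case (pure b w)
  note h = OP.pt_right_hom[OF pure(1)]
  have g0: "P (OP.pt b (KP.\<delta> x))" if b: "b \<in> carrier B" and "Poly_Mapping.keys x \<subseteq> carrier (Pm F)" for b x
  proof -
    have "KP.\<delta> \<in> addhom P.ZM KP.Om" by (intro addhomI) (auto simp: KP.delta_add[simplified])
    from P.free_hom_ZM[OF addhom_comp[OF this OP.pt_right_hom[OF b]] OP.BC_abelian]
    interpret f: free_hom OP.BC "carrier (Pm F)" "\<lambda>x. OP.pt b (KP.\<delta> x)" .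
    from that(2) show ?thesis
      by (rule free_Abelian_group_induct)
        (use assms(2-) b in \<open>simp_all add: BOmP_eq f.zero f.diff f.closed\<close>)
  qed
  from pure(2) show ?case
  proof (induction rule: KP.Om_induct)
    case zero
    then show ?case
      using assms(2) addhom_zero[OF h OmP.M.abelian_group_axioms OP.BC_abelian] by (simp add: BOmP_eq)
  next
    case (gen s x)
    then show ?case
      using g0[of "b \<otimes>\<^bsub>B\<^esub> ZP_to_B F s" x] pure(1) OP.pt_balance[of b s "KP.\<delta> x"]
      by simp
  next
    case (diff y z)
    then show ?case
      using assms(4) addhom_diff[OF h OmP.M.abelian_group_axioms OP.BC_abelian] pure(1) by (simp add: BOmP_eq)
  qed
qed (use assms in \<open>simp_all add: BOmP_eq\<close>)

subsection \<open>The pushout defining the cotangent complex\<close>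

abbreviation "OG \<equiv> direct_sum (BOmR_mod F) (BG_mod F)"
abbreviation "rel2 \<equiv> pushout_rel (BOmP_mod F) (BOmR_mod F) (BG_mod F) (BOmP_to_BOmR F) (BOmP_to_BG F)"
abbreviation "kappa2 u \<equiv> (BOmP_to_BOmR F u, \<ominus>\<^bsub>BG_mod F\<^esub> BOmP_to_BG F u)"

text \<open>The relation identifying the two images of \<open>b \<otimes> dp\<close>, the counterpart of \<open>gU\<close>.\<close>

definition gL :: "'b \<Rightarrow> 'p \<Rightarrow> ('r, 'b) BOm_elem \<times> ('p, 'b) BG_elem" where
  "gL b p = (bd b (\<chi> p), \<ominus>\<^bsub>BG_mod F\<^esub> BG_tensor F (b \<otimes>\<^bsub>B\<^esub> \<beta> (h p)) (bar_p F p))"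

lemma OG_module: "module B OG"
  by (rule module_direct_sum[OF BOmR_module BG_module])

lemma rel2_subgroup: "subgroup rel2 (add_monoid OG)"
proof (rule pushout_rel_subgroup)
  show "abelian_group (BOmP_mod F)" unfolding BOmP_eq by (rule OP.BC_abelian)
qed (rule BOmP_to_BOmR_hom BOmP_to_BG_hom OB.M.abelian_group_axioms BGm.M.abelian_group_axioms)+

lemma kappa2_hom: "kappa2 \<in> addhom (BOmP_mod F) OG"
  by (rule addhom_pair[OF BOmP_to_BOmR_hom addhom_uminus[OF BGm.M.abelian_group_axioms BOmP_to_BG_hom]])

lemma rel2_eq: "rel2 = kappa2 ` carrier (BOmP_mod F)"
  by (simp add: pushout_rel_def)

lemma gL_in_rel2:
  assumes "b \<in> carrier B" "p \<in> carrier (Pm F)"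
  shows "gL b p \<in> rel2"
proof -
  have "kappa2 (OP.pt b (KP.\<delta> (frag_of p))) = gL b p"
    using assms by (simp add: BOmP_to_BOmR_gen BOmP_to_BG_gen gL_def)
  moreover have "OP.pt b (KP.\<delta> (frag_of p)) \<in> carrier (BOmP_mod F)"
    using assms unfolding BOmP_eq by simp
  ultimately show ?thesis unfolding rel2_eq using imageI[of "OP.pt b (KP.\<delta> (frag_of p))" "carrier (BOmP_mod F)" kappa2]
    by simp
qed

lemma rel2_induct [consumes 1, case_names zero gen diff]:
  assumes "x \<in> rel2" "P \<zero>\<^bsub>OG\<^esub>"
    and "\<And>b p. b \<in> carrier B \<Longrightarrow> p \<in> carrier (Pm F) \<Longrightarrow> P (gL b p)"
    and "\<And>x y. x \<in> rel2 \<Longrightarrow> y \<in> rel2 \<Longrightarrow> P x \<Longrightarrow> P y \<Longrightarrow> P (x \<ominus>\<^bsub>OG\<^esub> y)"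
  shows "P x"
proof -
  have ab: "abelian_group (BOmP_mod F)" unfolding BOmP_eq by (rule OP.BC_abelian)
  note OG_ab = module_abelian[OF OG_module]
  have "P (kappa2 u)" if "u \<in> carrier (BOmP_mod F)" for u
    using that
  proof (induction rule: BOmP_induct)
    case zero
    then show ?case using assms(2) addhom_zero[OF kappa2_hom ab OG_ab] by (simp only:)
  next
    case (gen b p)
    then show ?case using assms(3) by (simp add: BOmP_to_BOmR_gen BOmP_to_BG_gen gL_def)
  next
    case (diff y z)
    then show ?case
      unfolding addhom_diff[OF kappa2_hom ab OG_ab diff(1,2)] by (intro assms(4)) (simp_all add: rel2_eq)
  qed
  then show ?thesis using assms(1) by (auto simp: rel2_eq)
qed

lemma rel2_submodule: "submodule rel2 B OG"
proof (rule submoduleI'[OF rel2_subgroup])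
  interpret OG: module B OG by (rule OG_module)
  interpret mq: module_quotient OG rel2
    by (intro module_quotient.intro module_quotient_axioms.intro rel2_subgroup OG.abelian_group_axioms)
  fix a x assume a: "a \<in> carrier B" and "x \<in> rel2"
  from this(2) show "a \<odot>\<^bsub>OG\<^esub> x \<in> rel2"
  proof (induction rule: rel2_induct)
    case zero
    then show ?case using mq.K_zero OG.smult_r_null[OF a] by metis
  next
    case (gen b p)
    then have "a \<odot>\<^bsub>OG\<^esub> gL b p = gL (a \<otimes>\<^bsub>B\<^esub> b) p"
      using a by (simp add: gL_def BOmR_smult BGm.smult_r_minus BG_smult B.m_assoc)
    then show ?case using a gen by (simp add: gL_in_rel2)
  next
    case (diff x y)
    then have "a \<odot>\<^bsub>OG\<^esub> (x \<ominus>\<^bsub>OG\<^esub> y) = a \<odot>\<^bsub>OG\<^esub> x \<ominus>\<^bsub>OG\<^esub> a \<odot>\<^bsub>OG\<^esub> y"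
      using addhom_diff[OF module_smult_hom[OF OG_module a] OG.abelian_group_axioms OG.abelian_group_axioms]
        mq.K_closed by blast
    then show ?case using diff mq.K_diff by metis
  qed
qed

sublocale L: module_quotient OG rel2
  by (rule submodule_quotient[OF OG_module rel2_submodule])

lemma L_eq: "L_mod F = quot_module OG rel2"
  by (simp add: L_mod_def pushout_module_def)

lemma L_class_eq: "L_class F w t = rel2 +>\<^bsub>OG\<^esub> (w, t)"
  by (simp add: L_class_def pushout_class_def)

lemma L_module: "module B (L_mod F)"
  unfolding L_eq by (rule module_quot_module[OF OG_module rel2_submodule])

sublocale Lm: module B "L_mod F" by (rule L_module)

lemma L_class_closed [simp]: "w \<in> carrier (BOmR_mod F) \<Longrightarrow> t \<in> carrier (BG_mod F) \<Longrightarrow> L_class F w t \<in> carrier (L_mod F)"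
  by (simp add: L_class_eq L_eq L.quot_closed)

lemma L_class_smult: "b \<in> carrier B \<Longrightarrow> w \<in> carrier (BOmR_mod F) \<Longrightarrow> t \<in> carrier (BG_mod F) \<Longrightarrow>
    b \<odot>\<^bsub>L_mod F\<^esub> L_class F w t = L_class F (b \<odot>\<^bsub>BOmR_mod F\<^esub> w) (b \<odot>\<^bsub>BG_mod F\<^esub> t)"
  by (simp add: L_class_eq L_eq quot_module_smult[OF OG_module rel2_submodule])

text \<open>The counterparts of \<open>dI\<close> and \<open>dT\<close>.\<close>

definition lI :: "'b \<Rightarrow> 'r \<Rightarrow> ('r, 'p, 'b) L_elem" where
  "lI b r = L_class F (bd b r) \<zero>\<^bsub>BG_mod F\<^esub>"

definition lT :: "'b \<Rightarrow> 'p \<Rightarrow> ('r, 'p, 'b) L_elem" where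
  "lT b p = L_class F \<zero>\<^bsub>BOmR_mod F\<^esub> (BG_tensor F b (bar_p F p))"

lemma lI_smult: "b \<in> carrier B \<Longrightarrow> b' \<in> carrier B \<Longrightarrow> r \<in> carrier R \<Longrightarrow> b \<odot>\<^bsub>L_mod F\<^esub> lI b' r = lI (b \<otimes>\<^bsub>B\<^esub> b') r"
  unfolding lI_def by (simp add: L_class_smult BOmR_smult)
lemma lT_smult: "b \<in> carrier B \<Longrightarrow> b' \<in> carrier B \<Longrightarrow> p \<in> carrier (Pm F) \<Longrightarrow> b \<odot>\<^bsub>L_mod F\<^esub> lT b' p = lT (b \<otimes>\<^bsub>B\<^esub> b') p"
  unfolding lT_def by (simp add: L_class_smult BG_smult)

lemma L_class_hom: "(\<lambda>(w, t). L_class F w t) \<in> addhom OG (L_mod F)"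
  using L.quot_hom by (simp only: L_class_eq[abs_def] L_eq case_prod_eta)

lemma L_class_I_hom: "(\<lambda>w. L_class F w \<zero>\<^bsub>BG_mod F\<^esub>) \<in> addhom (BOmR_mod F) (L_mod F)"
proof -
  have "(\<lambda>w. (w, \<zero>\<^bsub>BG_mod F\<^esub>)) \<in> addhom (BOmR_mod F) OG"
    by (rule addhomI) simp_all
  from addhom_comp[OF this L_class_hom] show ?thesis by simp
qed

lemma L_class_T_hom: "(\<lambda>t. L_class F \<zero>\<^bsub>BOmR_mod F\<^esub> t) \<in> addhom (BG_mod F) (L_mod F)"
proof -
  have "(\<lambda>t. (\<zero>\<^bsub>BOmR_mod F\<^esub>, t)) \<in> addhom (BG_mod F) OG"
    by (rule addhomI) simp_all
  from addhom_comp[OF this L_class_hom] show ?thesis by simp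
qed

lemma L_induct [consumes 1, case_names zero I T diff]:
  assumes "x \<in> carrier (L_mod F)" and z: "P \<zero>\<^bsub>L_mod F\<^esub>"
    and "\<And>b r. b \<in> carrier B \<Longrightarrow> r \<in> carrier R \<Longrightarrow> P (lI b r)"
    and "\<And>b p. b \<in> carrier B \<Longrightarrow> p \<in> carrier (Pm F) \<Longrightarrow> P (lT b p)"
    and d: "\<And>x y. x \<in> carrier (L_mod F) \<Longrightarrow> y \<in> carrier (L_mod F) \<Longrightarrow> P x \<Longrightarrow> P y \<Longrightarrow> P (x \<ominus>\<^bsub>L_mod F\<^esub> y)"
  shows "P x"
proof -
  obtain w t where it: "w \<in> carrier (BOmR_mod F)" "t \<in> carrier (BG_mod F)" "x = L_class F w t"
    using assms(1) by (auto simp: L_eq L.quot_carrier L_class_eq)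
  have 1: "P (L_class F w \<zero>\<^bsub>BG_mod F\<^esub>)"
    using it(1)
  proof (induction rule: BOmR_induct)
    case zero
    then show ?case using z addhom_zero[OF L_class_I_hom OB.M.abelian_group_axioms Lm.M.abelian_group_axioms] by simp
  next
    case (gen b r)
    then show ?case using assms(3) by (simp add: lI_def)
  next
    case (diff y z)
    then show ?case using d addhom_diff[OF L_class_I_hom OB.M.abelian_group_axioms Lm.M.abelian_group_axioms, of y z] by simp
  qed
  have 2: "P (L_class F \<zero>\<^bsub>BOmR_mod F\<^esub> t)"
    using it(2)
  proof (induction rule: BG_induct)
    case zero
    then show ?case using z addhom_zero[OF L_class_T_hom BGm.M.abelian_group_axioms Lm.M.abelian_group_axioms] by simp
  next
    case (gen b p)
    then show ?case using assms(4) by (simp add: lT_def)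
  next
    case (diff y z)
    then show ?case using d addhom_diff[OF L_class_T_hom BGm.M.abelian_group_axioms Lm.M.abelian_group_axioms, of y z] by simp
  qed
  have c: "L_class F w \<zero>\<^bsub>BG_mod F\<^esub> \<in> carrier (L_mod F)" "L_class F \<zero>\<^bsub>BOmR_mod F\<^esub> t \<in> carrier (L_mod F)"
    using it by simp_all
  have "L_class F w t = L_class F w \<zero>\<^bsub>BG_mod F\<^esub> \<oplus>\<^bsub>L_mod F\<^esub> L_class F \<zero>\<^bsub>BOmR_mod F\<^esub> t"
    using addhom_add[OF L_class_hom, of "(w, \<zero>\<^bsub>BG_mod F\<^esub>)" "(\<zero>\<^bsub>BOmR_mod F\<^esub>, t)"] it by simp
  moreover have "P (L_class F w \<zero>\<^bsub>BG_mod F\<^esub> \<ominus>\<^bsub>L_mod F\<^esub> (\<zero>\<^bsub>L_mod F\<^esub> \<ominus>\<^bsub>L_mod F\<^esub> L_class F \<zero>\<^bsub>BOmR_mod F\<^esub> t))"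
    by (intro d 1 2 z c Lm.M.zero_closed Lm.M.minus_closed)
  ultimately show ?thesis using c it by (simp add: Lm.M.minus_eq)
qed

end

section \<open>The comparison map from \<open>D\<^sup>1\<close> to the cotangent complex\<close>

lemma addhom_smult_left: "module A M \<Longrightarrow> v \<in> carrier M \<Longrightarrow> (\<lambda>a. a \<odot>\<^bsub>M\<^esub> v) \<in> addhom A M"
  by (intro addhomI) (auto simp: module.smult_l_distr module.smult_closed)

text \<open>
  The \<open>B\<close>-linear extension \<open>b \<otimes> t \<mapsto> b u(t)\<close>; it is balanced over \<open>\<int>\<close> because \<open>u\<close> takes powers to integer
  multiples.
\<close>

lemma int_tensor_lift:
  fixes G :: "('t, 'z) monoid_scheme" and B :: "('b, 'y) ring_scheme" and L :: "('b, 'l) module"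
  assumes G: "comm_group G" and L: "module B L" and u: "u \<in> hom G (add_monoid L)"
    and eq: "\<And>b t. b \<in> carrier B \<Longrightarrow> t \<in> carrier G \<Longrightarrow> \<phi> b t = b \<odot>\<^bsub>L\<^esub> u t"
  defines "i \<equiv> (\<lambda>k :: int. add_pow B k \<one>\<^bsub>B\<^esub>)"
  shows int_tensor_lift_hom: "symbol_lift L \<phi> \<in> addhom (base_change \<Z> B i (int_module G)) L"
    and int_tensor_lift_pure: "b \<in> carrier B \<Longrightarrow> t \<in> carrier G \<Longrightarrow>
      symbol_lift L \<phi> (pure_tensor \<Z> B i (int_module G) b t) = b \<odot>\<^bsub>L\<^esub> u t"
proof -
  interpret G: comm_group G by fact
  interpret L: module B L by fact
  have i: "i \<in> ring_hom \<Z> B" unfolding i_def by (rule int_to_ring_hom[OF L.is_cring])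
  interpret T: tensor \<Z> B "int_module G" i
    by (intro tensor.intro tensor_axioms.intro module_int_module G int_is_cring L.is_cring i)
  interpret u: group_hom G "add_monoid L" u
    using u by (simp add: group_hom_def group_hom_axioms_def L.M.a_group)
  have uc: "u t \<in> carrier L" if "t \<in> carrier G" for t using u.hom_closed that by simp
  have um: "u (t \<otimes>\<^bsub>G\<^esub> t') = u t \<oplus>\<^bsub>L\<^esub> u t'" if "t \<in> carrier G" "t' \<in> carrier G" for t t'
    using u.hom_mult[of t t'] that by simp
  have pow: "u (t [^]\<^bsub>G\<^esub> k) = i k \<odot>\<^bsub>L\<^esub> u t" if t: "t \<in> carrier G" for t and k :: int
  proof -
    have "group_hom (add_monoid B) (add_monoid L) (\<lambda>b. b \<odot>\<^bsub>L\<^esub> u t)"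
      by (rule addhom_group_hom[OF addhom_smult_left[OF L uc[OF t]] L.R.abelian_group_axioms L.M.abelian_group_axioms])
    from group_hom.hom_int_pow[OF this, of "\<one>\<^bsub>B\<^esub>" k] u.hom_int_pow[of t k] show ?thesis
      using uc[OF t] t by (simp add: i_def add_pow_def)
  qed
  have 1: "\<phi> b t \<in> carrier L" if "b \<in> carrier B" "t \<in> carrier (int_module G)" for b t
    using that by (simp add: eq uc)
  have 2: "\<phi> (b \<oplus>\<^bsub>B\<^esub> b') t = \<phi> b t \<oplus>\<^bsub>L\<^esub> \<phi> b' t"
    if "b \<in> carrier B" "b' \<in> carrier B" "t \<in> carrier (int_module G)" for b b' t
    using that by (simp add: eq uc L.smult_l_distr)
  have 3: "\<phi> b (t \<oplus>\<^bsub>int_module G\<^esub> t') = \<phi> b t \<oplus>\<^bsub>L\<^esub> \<phi> b t'"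
    if "b \<in> carrier B" "t \<in> carrier (int_module G)" "t' \<in> carrier (int_module G)" for b t t'
    using that by (simp add: eq uc um L.smult_r_distr)
  have 4: "\<phi> (b \<otimes>\<^bsub>B\<^esub> i k) t = \<phi> b (k \<odot>\<^bsub>int_module G\<^esub> t)"
    if "b \<in> carrier B" "t \<in> carrier (int_module G)" for b k t
    using that ring_hom_closed[OF i, of k] by (simp add: eq uc pow L.smult_assoc1)
  show "symbol_lift L \<phi> \<in> addhom T.BC L"
    by (rule T.BC_lift_hom[OF L.M.abelian_group_axioms 1 2 3 4])
  show "b \<in> carrier B \<Longrightarrow> t \<in> carrier G \<Longrightarrow> symbol_lift L \<phi> (T.pt b t) = b \<odot>\<^bsub>L\<^esub> u t"
    using T.BC_lift_pt[OF L.M.abelian_group_axioms 1 2 3 4, of b t] eq by simp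
qed

context log_factorization
begin

sublocale PQ: comm_group PQ by (rule PQ_comm_group)

text \<open>The derivation \<open>r \<otimes> b \<mapsto> b \<otimes> dr\<close> of \<open>R \<otimes>\<^sub>C B\<close>; it induces \<open>I / I\<^sup>2 \<cong> B \<otimes> \<Omega>\<close>.\<close>

definition dRB :: "('r, 'b) RB_elem \<Rightarrow> ('r, 'b) BOm_elem" where
  "dRB = symbol_lift (BOmR_mod F) (\<lambda>r b. bd b r)"

lemma bd_balance: "r \<in> carrier R \<Longrightarrow> c \<in> carrier C \<Longrightarrow> b \<in> carrier B \<Longrightarrow> bd b (r \<otimes>\<^bsub>R\<^esub> e c) = bd (eps (e c) \<otimes>\<^bsub>B\<^esub> b) r"
  by (simp add: bd_mult bd_const B.m_comm)

lemma dRB_hom: "dRB \<in> addhom (RB F) (BOmR_mod F)"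
  unfolding dRB_def
  by (rule RB_lift_hom[OF OB.M.abelian_group_axioms])
    (simp_all add: K.delta_add BOmR_add_left BOmR_add_right bd_balance)

lemma dRB_tensor [simp]: "r \<in> carrier R \<Longrightarrow> b \<in> carrier B \<Longrightarrow> dRB (RB_tensor F r b) = bd b r"
  unfolding dRB_def
  by (rule RB_lift_tensor[OF OB.M.abelian_group_axioms])
    (simp_all add: K.delta_add BOmR_add_left BOmR_add_right bd_balance)

lemma dRB_closed [simp]: "z \<in> carrier (RB F) \<Longrightarrow> dRB z \<in> carrier (BOmR_mod F)"
  by (rule addhom_closed[OF dRB_hom])

lemma dRB_mult:
  assumes "z \<in> carrier (RB F)" "w \<in> carrier (RB F)"
  shows "dRB (z \<otimes>\<^bsub>RB F\<^esub> w) = RB_proj F z \<odot>\<^bsub>BOmR_mod F\<^esub> dRB w \<oplus>\<^bsub>BOmR_mod F\<^esub> RB_proj F w \<odot>\<^bsub>BOmR_mod F\<^esub> dRB z"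
proof (rule RB_bilinear_eq[OF OB.M.abelian_group_axioms _ _ _ _ _ assms])
  fix z assume z: "z \<in> carrier (RB F)"
  note act = addhom_comp[OF RB_proj_addhom addhom_smult_left[OF BOmR_module dRB_closed[OF z]]]
    and sm = addhom_comp[OF dRB_hom module_smult_hom[OF BOmR_module RB_proj_simps(1)[OF z]]]
  show "(\<lambda>w. dRB (w \<otimes>\<^bsub>RB F\<^esub> z)) \<in> addhom (RB F) (BOmR_mod F)"
    by (rule addhom_comp[OF addhom_rmult[OF RB.is_cring z] dRB_hom])
  show "(\<lambda>w. dRB (z \<otimes>\<^bsub>RB F\<^esub> w)) \<in> addhom (RB F) (BOmR_mod F)"
    by (rule addhom_comp[OF addhom_lmult[OF RB.is_cring z] dRB_hom])
  show "(\<lambda>w. RB_proj F w \<odot>\<^bsub>BOmR_mod F\<^esub> dRB z \<oplus>\<^bsub>BOmR_mod F\<^esub> RB_proj F z \<odot>\<^bsub>BOmR_mod F\<^esub> dRB w) \<in> addhom (RB F) (BOmR_mod F)"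
    by (rule addhom_plus[OF OB.M.abelian_group_axioms act sm])
  show "(\<lambda>w. RB_proj F z \<odot>\<^bsub>BOmR_mod F\<^esub> dRB w \<oplus>\<^bsub>BOmR_mod F\<^esub> RB_proj F w \<odot>\<^bsub>BOmR_mod F\<^esub> dRB z) \<in> addhom (RB F) (BOmR_mod F)"
    by (rule addhom_plus[OF OB.M.abelian_group_axioms sm act])
next
  fix r b r' b' assume "r \<in> carrier R" "b \<in> carrier B" "r' \<in> carrier R" "b' \<in> carrier B"
  then show "dRB (RB_tensor F r b \<otimes>\<^bsub>RB F\<^esub> RB_tensor F r' b') =
    RB_proj F (RB_tensor F r b) \<odot>\<^bsub>BOmR_mod F\<^esub> dRB (RB_tensor F r' b') \<oplus>\<^bsub>BOmR_mod F\<^esub>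
    RB_proj F (RB_tensor F r' b') \<odot>\<^bsub>BOmR_mod F\<^esub> dRB (RB_tensor F r b)"
    by (simp add: RB_tensor_mult bd_mult BOmR_smult B.m_ac)
qed

lemma dRB_gI: "r \<in> carrier R \<Longrightarrow> b \<in> carrier B \<Longrightarrow> dRB (gI b r) = bd b r"
  using bd_const[of "eps r \<otimes>\<^bsub>B\<^esub> b" "\<one>\<^bsub>C\<^esub>"] ring_hom_one[OF e_hom]
  by (simp add: gI_def addhom_diff[OF dRB_hom RB.abelian_group_axioms OB.M.abelian_group_axioms] OB.minus_eq)

text \<open>
  The map \<open>T \<rightarrow> P\<^sup>g\<^sup>p / Q\<^sup>g\<^sup>p\<close> is the restriction of \<open>(p, n) \<mapsto> p\<close> on \<open>(P \<oplus>\<^sub>Q N)\<^sup>g\<^sup>p\<close>.  Every element of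
  the latter is a fraction, so the choice in \<open>T_to_PQ\<close> has only one option on the carrier.
\<close>

definition PN_to_PQ :: "('p, 'n) PN_elem \<Rightarrow> ('p \<times> 'p) set set" where
  "PN_to_PQ V = the_elem ((\<lambda>(p, n). bar_p F p) ` V)"

lemma PN_to_PQ_class [simp]: "p \<in> carrier (Pm F) \<Longrightarrow> n \<in> carrier (Nm F) \<Longrightarrow> PN_to_PQ (PN_class F p n) = bar_p F p"
  unfolding PN_to_PQ_def PN_class_eq
  by (rule A.class_the_elem) (simp_all add: bar_p_mult)

lemma PN_to_PQ_hom: "PN_to_PQ \<in> monoid_hom (PN F) PQ"
  using monoid_hom_one[OF bar_p_hom] by (intro monoid_homI) (auto elim!: PN_cases simp: bar_p_mult PN_one)

definition T_to_PQ :: "('p, 'n) T_elem \<Rightarrow> ('p \<times> 'p) set set" where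
  "T_to_PQ = (SOME w. w \<in> hom (gp (PN F)) PQ \<and> (\<forall>x\<in>carrier (PN F). \<forall>y\<in>carrier (PN F).
     w (gp_frac (PN F) x y) = PN_to_PQ x \<otimes>\<^bsub>PQ\<^esub> inv\<^bsub>PQ\<^esub> PN_to_PQ y))"

lemma T_to_PQ:
  shows T_to_PQ_hom: "T_to_PQ \<in> hom (gp (PN F)) PQ"
    and T_to_PQ_frac: "x \<in> carrier (PN F) \<Longrightarrow> y \<in> carrier (PN F) \<Longrightarrow>
      T_to_PQ (gp_frac (PN F) x y) = PN_to_PQ x \<otimes>\<^bsub>PQ\<^esub> inv\<^bsub>PQ\<^esub> PN_to_PQ y"
proof -
  obtain w where w: "w \<in> hom (gp (PN F)) PQ"
    "\<And>a b. a \<in> carrier (PN F) \<Longrightarrow> b \<in> carrier (PN F) \<Longrightarrow> w (gp_frac (PN F) a b) = PN_to_PQ a \<otimes>\<^bsub>PQ\<^esub> inv\<^bsub>PQ\<^esub> PN_to_PQ b"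
    using PN.gp_universal[OF PQ_comm_group PN_to_PQ_hom] by blast
  then have "\<exists>w. w \<in> hom (gp (PN F)) PQ \<and> (\<forall>x\<in>carrier (PN F). \<forall>y\<in>carrier (PN F).
     w (gp_frac (PN F) x y) = PN_to_PQ x \<otimes>\<^bsub>PQ\<^esub> inv\<^bsub>PQ\<^esub> PN_to_PQ y)" by blast
  from someI_ex[OF this] have "T_to_PQ \<in> hom (gp (PN F)) PQ \<and> (\<forall>x\<in>carrier (PN F). \<forall>y\<in>carrier (PN F).
     T_to_PQ (gp_frac (PN F) x y) = PN_to_PQ x \<otimes>\<^bsub>PQ\<^esub> inv\<^bsub>PQ\<^esub> PN_to_PQ y)"
    unfolding T_to_PQ_def[symmetric] .
  then show "T_to_PQ \<in> hom (gp (PN F)) PQ"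
    "x \<in> carrier (PN F) \<Longrightarrow> y \<in> carrier (PN F) \<Longrightarrow>
      T_to_PQ (gp_frac (PN F) x y) = PN_to_PQ x \<otimes>\<^bsub>PQ\<^esub> inv\<^bsub>PQ\<^esub> PN_to_PQ y"
    by blast+
qed

lemma T_to_PQ_tau: "p \<in> carrier (Pm F) \<Longrightarrow> T_to_PQ (tau p) = bar_p F p"
  using monoid_hom_one[OF bar_p_hom] by (simp add: tau_def T_to_PQ_frac)

lemma T_to_PQ_closed: "t \<in> Tset \<Longrightarrow> T_to_PQ t \<in> carrier PQ"
  using T_to_PQ_hom by (auto simp: hom_def)

lemma int_to_target_eq: "int_to_target F = (\<lambda>k. add_pow B k \<one>\<^bsub>B\<^esub>)"
  by (simp add: int_to_target_def[abs_def])

lemma BT_lift: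
  fixes L :: "('b, 'l) module"
  assumes "module B L" "u \<in> hom (T_grp F) (add_monoid L)"
    "\<And>b t. b \<in> carrier B \<Longrightarrow> t \<in> Tset \<Longrightarrow> \<phi> b t = b \<odot>\<^bsub>L\<^esub> u t"
  shows BT_lift_hom: "symbol_lift L \<phi> \<in> addhom (BT_mod F) L"
    and BT_lift_tensor: "b \<in> carrier B \<Longrightarrow> t \<in> Tset \<Longrightarrow> symbol_lift L \<phi> (BT_tensor F b t) = b \<odot>\<^bsub>L\<^esub> u t"
  using int_tensor_lift[OF T_comm_group assms(1,2), of \<phi>] assms(3)
  by (simp_all add: BT_mod_def BT_tensor_def int_to_target_eq)

lemma BG_lift:
  fixes L :: "('b, 'l) module"
  assumes "module B L" "u \<in> hom PQ (add_monoid L)"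
    "\<And>b t. b \<in> carrier B \<Longrightarrow> t \<in> carrier PQ \<Longrightarrow> \<phi> b t = b \<odot>\<^bsub>L\<^esub> u t"
  shows BG_lift_hom: "symbol_lift L \<phi> \<in> addhom (BG_mod F) L"
    and BG_lift_tensor: "b \<in> carrier B \<Longrightarrow> t \<in> carrier PQ \<Longrightarrow> symbol_lift L \<phi> (BG_tensor F b t) = b \<odot>\<^bsub>L\<^esub> u t"
  using int_tensor_lift[OF PQ_comm_group assms(1,2), of \<phi>] assms(3)
  by (simp_all add: BG_mod_def BG_tensor_def int_to_target_eq)

definition dBT :: "('p, 'b, 'n) BT_elem \<Rightarrow> ('p, 'b) BG_elem" where
  "dBT = symbol_lift (BG_mod F) (\<lambda>b t. BG_tensor F b (T_to_PQ t))"

lemma dBT: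
  shows dBT_hom: "dBT \<in> addhom (BT_mod F) (BG_mod F)"
    and dBT_tau [simp]: "b \<in> carrier B \<Longrightarrow> p \<in> carrier (Pm F) \<Longrightarrow> dBT (BT_tensor F b (tau p)) = BG_tensor F b (bar_p F p)"
proof -
  have u: "(\<lambda>t. BG_tensor F \<one>\<^bsub>B\<^esub> (T_to_PQ t)) \<in> hom (T_grp F) (add_monoid (BG_mod F))"
    using hom_mult[OF T_to_PQ_hom] by (intro homI) (auto simp: T_to_PQ_closed BG_tensor_mult)
  have eq: "BG_tensor F b (T_to_PQ t) = b \<odot>\<^bsub>BG_mod F\<^esub> BG_tensor F \<one>\<^bsub>B\<^esub> (T_to_PQ t)"
    if "b \<in> carrier B" "t \<in> Tset" for b t
    using that by (simp add: BG_smult T_to_PQ_closed)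
  show "dBT \<in> addhom (BT_mod F) (BG_mod F)"
    unfolding dBT_def by (rule BT_lift_hom[OF BG_module u eq])
  show "dBT (BT_tensor F b (tau p)) = BG_tensor F b (bar_p F p)" if "b \<in> carrier B" "p \<in> carrier (Pm F)"
    unfolding dBT_def using BT_lift_tensor[OF BG_module u eq, of b "tau p"] that tau_closed[OF that(2)]
    by (simp add: T_to_PQ_tau BG_smult)
qed

abbreviation "dpair \<equiv> \<lambda>(i, t). (dRB i, dBT t)"

definition D1_to_L :: "('r, 'p, 'b, 'n) D1_elem \<Rightarrow> ('r, 'p, 'b) L_elem" where
  "D1_to_L Z = (\<Union>y\<in>Z. rel2 +>\<^bsub>OG\<^esub> dpair y)"

lemma dpair_hom: "dpair \<in> addhom IBT OG"
proof (rule addhom_map_prod)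
  show "dRB \<in> addhom (I_mod F) (BOmR_mod F)"
    by (rule addhomI) (simp_all add: addhom_add[OF dRB_hom])
qed (simp only: restrict_scalars_hom dBT_hom)

text \<open>
  The derivation takes \<open>z\<close> times an element of \<open>I\<close> to \<open>\<pi>(z)\<close> times its differential, so the relation
  with coefficient \<open>z\<close> goes to the one with coefficient \<open>\<pi>(z)\<close>.
\<close>

lemma dpair_rel:
  assumes "x \<in> rel1"
  shows "dpair x \<in> rel2"
  using assms
proof (induction rule: rel1_induct)
  case zero
  show ?case
    using addhom_zero[OF dpair_hom D.abelian_group_axioms L.abelian_group_axioms] L.K_zero by (simp only:)
next
  case (gen z p)
  have g: "gI \<one>\<^bsub>B\<^esub> (\<chi> p) \<in> carrier (RB F)" "RB_proj F (gI \<one>\<^bsub>B\<^esub> (\<chi> p)) = \<zero>\<^bsub>B\<^esub>"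
    using gI_closed[of "\<chi> p" "\<one>\<^bsub>B\<^esub>"] gen by auto
  have "dpair (gU z p) = gL (RB_proj F z) p"
    using gen g tau_closed[of p]
    by (simp add: gU_def gL_def dRB_mult dRB_gI BOmR_smult addhom_neg[OF dBT_hom BTm.M.abelian_group_axioms BGm.M.abelian_group_axioms])
  then show ?case using gen by (simp add: gL_in_rel2)
next
  case (diff x y)
  then show ?case
    using addhom_diff[OF dpair_hom D.abelian_group_axioms L.abelian_group_axioms] D.K_closed L.K_diff by metis
qed

lemma D1_to_L_hom: "D1_to_L \<in> addhom DB (L_mod F)"
  using D.quot_map_hom[OF L.module_quotient_axioms dpair_hom dpair_rel]
  by (simp only: D1_to_L_def[abs_def] D1_eq L_eq restrict_scalars_hom)

lemma D1_to_L_class: "i \<in> Iset \<Longrightarrow> t \<in> carrier (BT_mod F) \<Longrightarrow> D1_to_L (D1_class F i t) = L_class F (dRB i) (dBT t)"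
  using D.quot_map[OF L.module_quotient_axioms dpair_hom dpair_rel, of "(i, t)"]
  by (simp add: D1_to_L_def D1_class_eq L_class_eq)

lemma D1_to_L_dI [simp]: "b \<in> carrier B \<Longrightarrow> r \<in> carrier R \<Longrightarrow> D1_to_L (dI b r) = lI b r"
  using gI_closed[of r b] addhom_zero[OF dBT_hom BTm.M.abelian_group_axioms BGm.M.abelian_group_axioms]
  by (simp add: dI_def lI_def D1_to_L_class dRB_gI)

lemma D1_to_L_dT [simp]: "b \<in> carrier B \<Longrightarrow> p \<in> carrier (Pm F) \<Longrightarrow> D1_to_L (dT b p) = lT b p"
  using tau_closed[of p] addhom_zero[OF dRB_hom RB.abelian_group_axioms OB.M.abelian_group_axioms]
  by (simp add: dT_def lT_def D1_to_L_class)

lemma D1_to_L_lin: "D1_to_L \<in> lin_maps B DB (L_mod F)"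
proof (rule lin_mapsI[OF D1_to_L_hom])
  fix a x assume a: "a \<in> carrier B" and x: "x \<in> carrier DB"
  show "D1_to_L (a \<odot>\<^bsub>DB\<^esub> x) = a \<odot>\<^bsub>L_mod F\<^esub> D1_to_L x"
    by (rule DB_hom_eq[OF addhom_comp[OF module_smult_hom[OF DB_module a] D1_to_L_hom]
          addhom_comp[OF D1_to_L_hom module_smult_hom[OF L_module a]] Lm.M.abelian_group_axioms x])
      (use a in \<open>simp_all only: dI_smult dT_smult D1_to_L_dI D1_to_L_dT B.m_closed lI_smult lT_smult\<close>)
qed

lemma D1_to_L_surj: "D1_to_L ` carrier DB = carrier (L_mod F)"
proof
  show "D1_to_L ` carrier DB \<subseteq> carrier (L_mod F)" using addhom_closed[OF D1_to_L_hom] by auto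
  show "carrier (L_mod F) \<subseteq> D1_to_L ` carrier DB"
  proof
    fix x assume "x \<in> carrier (L_mod F)"
    then show "x \<in> D1_to_L ` carrier DB"
    proof (induction rule: L_induct)
      case zero
      then show ?case
        using addhom_zero[OF D1_to_L_hom DB.M.abelian_group_axioms Lm.M.abelian_group_axioms] DB.M.zero_closed by (metis imageI)
    next
      case (I b r)
      then show ?case by (intro image_eqI[of _ _ "dI b r"]) simp_all
    next
      case (T b p)
      then show ?case by (intro image_eqI[of _ _ "dT b p"]) simp_all
    next
      case (diff x y)
      then obtain x' y' where "x' \<in> carrier DB" "x = D1_to_L x'" "y' \<in> carrier DB" "y = D1_to_L y'" by blast
      then show ?case
        using addhom_diff[OF D1_to_L_hom DB.M.abelian_group_axioms Lm.M.abelian_group_axioms, of x' y'] DB.M.minus_closed[of x' y']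
        by (metis imageI)
    qed
  qed
qed

text \<open>By the Leibniz rule, since \<open>\<pi>\<close> vanishes on both factors.\<close>

lemma D1_to_L_product:
  assumes "a \<in> Iset" "b \<in> Iset"
  shows "D1_to_L (D1_class F (a \<otimes>\<^bsub>RB F\<^esub> b) \<zero>\<^bsub>BT_mod F\<^esub>) = \<zero>\<^bsub>L_mod F\<^esub>"
  using assms addhom_zero[OF dBT_hom BTm.M.abelian_group_axioms BGm.M.abelian_group_axioms]
    addhom_zero[OF L_class_I_hom OB.M.abelian_group_axioms Lm.M.abelian_group_axioms]
  by (simp add: D1_to_L_class dRB_mult)

end

context log_factorization
begin

lemma gI_add: "b \<in> carrier B \<Longrightarrow> x \<in> carrier R \<Longrightarrow> y \<in> carrier R \<Longrightarrow> gI b (x \<oplus>\<^bsub>R\<^esub> y) = gI b x \<oplus>\<^bsub>RB F\<^esub> gI b y"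
  by (simp add: gI_def RB_tensor_add_left B.l_distr RB_tensor_add_right RB.four_diff)

lemma dI_add: "b \<in> carrier B \<Longrightarrow> x \<in> carrier R \<Longrightarrow> y \<in> carrier R \<Longrightarrow> dI b (x \<oplus>\<^bsub>R\<^esub> y) = dI b x \<oplus>\<^bsub>DB\<^esub> dI b y"
  unfolding dI_def using gI_closed[of x b] gI_closed[of y b] addhom_add[OF D1_class_I_hom, of "gI b x" "gI b y"]
  by (simp add: gI_add)

lemma D1_class_zero: "D1_class F \<zero>\<^bsub>RB F\<^esub> \<zero>\<^bsub>BT_mod F\<^esub> = \<zero>\<^bsub>DB\<^esub>"
  using addhom_zero[OF D1_class_I_hom module_abelian[OF I_module] DB.M.abelian_group_axioms] by simp

lemma gI_const: "c \<in> carrier C \<Longrightarrow> b \<in> carrier B \<Longrightarrow> gI b (e c) = \<zero>\<^bsub>RB F\<^esub>"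
  using RB_tensor_balance[of "\<one>\<^bsub>R\<^esub>" c b] by (simp add: gI_def RB.diff_zero_iff)

text \<open>
  This is \<open>u v - a c = (u - a) (v - c) + a (v - c) + c (u - a)\<close> with \<open>u = x \<otimes> 1\<close>, \<open>v = y \<otimes> 1\<close>,
  \<open>a = 1 \<otimes> \<epsilon>(x)\<close> and \<open>c = 1 \<otimes> \<epsilon>(y)\<close>.  Modulo products of elements of \<open>I\<close> it is the Leibniz rule.
\<close>

lemma gI_mult:
  assumes "x \<in> carrier R" "y \<in> carrier R"
  shows "gI \<one>\<^bsub>B\<^esub> (x \<otimes>\<^bsub>R\<^esub> y) = gI \<one>\<^bsub>B\<^esub> x \<otimes>\<^bsub>RB F\<^esub> gI \<one>\<^bsub>B\<^esub> y \<oplus>\<^bsub>RB F\<^esub>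
    (sec (eps x) \<otimes>\<^bsub>RB F\<^esub> gI \<one>\<^bsub>B\<^esub> y \<oplus>\<^bsub>RB F\<^esub> sec (eps y) \<otimes>\<^bsub>RB F\<^esub> gI \<one>\<^bsub>B\<^esub> x)"
proof -
  have id: "u \<otimes>\<^bsub>S\<^esub> v \<ominus>\<^bsub>S\<^esub> a \<otimes>\<^bsub>S\<^esub> c = (u \<ominus>\<^bsub>S\<^esub> a) \<otimes>\<^bsub>S\<^esub> (v \<ominus>\<^bsub>S\<^esub> c) \<oplus>\<^bsub>S\<^esub> (a \<otimes>\<^bsub>S\<^esub> (v \<ominus>\<^bsub>S\<^esub> c) \<oplus>\<^bsub>S\<^esub> c \<otimes>\<^bsub>S\<^esub> (u \<ominus>\<^bsub>S\<^esub> a))"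
    if "cring S" "u \<in> carrier S" "v \<in> carrier S" "a \<in> carrier S" "c \<in> carrier S"
    for S :: "('r, 'b) RB_elem ring" and u v a c
  proof -
    interpret S: cring S by fact
    from that(2-) show ?thesis by algebra
  qed
  show ?thesis
    using id[OF RB.is_cring, of "RB_tensor F x \<one>\<^bsub>B\<^esub>" "RB_tensor F y \<one>\<^bsub>B\<^esub>" "sec (eps x)" "sec (eps y)"] assms
    by (simp add: gI_def RB_tensor_mult)
qed

lemma tau_mult: "p \<in> carrier (Pm F) \<Longrightarrow> p' \<in> carrier (Pm F) \<Longrightarrow> tau (p \<otimes>\<^bsub>Pm F\<^esub> p') = tau p \<otimes>\<^bsub>gp (PN F)\<^esub> tau p'"
  by (simp add: tau_def)

lemma BT_tensor_mult: "b \<in> carrier B \<Longrightarrow> t \<in> Tset \<Longrightarrow> t' \<in> Tset \<Longrightarrow>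
    BT_tensor F b (t \<otimes>\<^bsub>gp (PN F)\<^esub> t') = BT_tensor F b t \<oplus>\<^bsub>BT_mod F\<^esub> BT_tensor F b t'"
  using hom_mult[OF BT_right_hom, of b t t'] by simp

lemma BT_tensor_one: "b \<in> carrier B \<Longrightarrow> BT_tensor F b \<one>\<^bsub>gp (PN F)\<^esub> = \<zero>\<^bsub>BT_mod F\<^esub>"
  using hom_one[OF BT_right_hom, of b] T_comm_group BTm.M.a_group by (simp add: comm_group.axioms(2))

lemma dT_mult: "b \<in> carrier B \<Longrightarrow> p \<in> carrier (Pm F) \<Longrightarrow> p' \<in> carrier (Pm F) \<Longrightarrow>
    dT b (p \<otimes>\<^bsub>Pm F\<^esub> p') = dT b p \<oplus>\<^bsub>DB\<^esub> dT b p'"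
  unfolding dT_def using tau_closed[of p] tau_closed[of p']
    addhom_add[OF D1_class_T_hom, of "BT_tensor F b (tau p)" "BT_tensor F b (tau p')"]
  by (simp add: tau_mult BT_tensor_mult)

lemma dT_eQ: "b \<in> carrier B \<Longrightarrow> q \<in> carrier (Qm F) \<Longrightarrow> dT b (eQ q) = \<zero>\<^bsub>DB\<^esub>"
proof -
  assume bq: "b \<in> carrier B" "q \<in> carrier (Qm F)"
  have "PN_class F (eQ q) \<one>\<^bsub>Nm F\<^esub> = PN_class F \<one>\<^bsub>Pm F\<^esub> (h (eQ q))"
    using PN_glue[of q "\<one>\<^bsub>Pm F\<^esub>" "\<one>\<^bsub>Nm F\<^esub>"] bq by simp
  then have "tau (eQ q) = \<one>\<^bsub>gp (PN F)\<^esub>"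
    using bq by (simp add: tau_def)
  then show ?thesis using bq by (simp add: dT_def BT_tensor_one D1_class_zero[simplified])
qed

text \<open>The pushout relation given by \<open>(1 \<otimes> b) \<otimes> ((p, 1) - (1, h p))\<close> in \<open>U\<close>.\<close>

lemma dI_dT_relation:
  assumes "b \<in> carrier B" "p \<in> carrier (Pm F)"
  shows "dI b (\<chi> p) = dT (b \<otimes>\<^bsub>B\<^esub> \<beta> (h p)) p"
proof -
  have t: "BT_tensor F (b \<otimes>\<^bsub>B\<^esub> \<beta> (h p)) (tau p) \<in> carrier (BT_mod F)"
    using assms tau_closed[of p] by simp
  have g: "gI b (\<chi> p) \<in> Iset" using assms gI_closed by simp
  have "sec b \<otimes>\<^bsub>RB F\<^esub> gI \<one>\<^bsub>B\<^esub> (\<chi> p) = gI b (\<chi> p)"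
    using assms by (simp add: gI_def RB.minus_eq RB.r_distr RB.r_minus RB_tensor_mult B.m_comm)
  then have "(gI b (\<chi> p), \<ominus>\<^bsub>BT_mod F\<^esub> BT_tensor F (b \<otimes>\<^bsub>B\<^esub> \<beta> (h p)) (tau p)) \<in> rel1"
    using gU_in_rel1[of "sec b" p] assms by (simp add: gU_def)
  moreover have "(gI b (\<chi> p), \<zero>\<^bsub>BT_mod F\<^esub>) \<ominus>\<^bsub>IBT\<^esub> (\<zero>\<^bsub>RB F\<^esub>, BT_tensor F (b \<otimes>\<^bsub>B\<^esub> \<beta> (h p)) (tau p)) =
      (gI b (\<chi> p), \<ominus>\<^bsub>BT_mod F\<^esub> BT_tensor F (b \<otimes>\<^bsub>B\<^esub> \<beta> (h p)) (tau p))"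
    using t g by (simp add: direct_sum_diff module_abelian[OF I_module] restrict_scalars_abelian[OF BTm.M.abelian_group_axioms]
        I_diff RB.minus_eq BTm.M.minus_eq)
  ultimately show ?thesis
    unfolding dI_def dT_def D1_class_eq using t g by (subst D.quot_eq_iff) auto
qed

text \<open>
  The kernel of the comparison map is the image of \<open>I\<^sup>2\<close>; here \<open>W\<close> is any submodule containing that
  image.  An inverse \<open>\<bbbL> \<rightarrow> D\<^sup>1 / W\<close> sends \<open>b \<otimes> dr\<close> to the class of \<open>r \<otimes> b - 1 \<otimes> \<epsilon>(r) b\<close>, which is a
  derivation in \<open>r\<close> modulo products, and \<open>b \<otimes> p\<close> to the class of \<open>b \<otimes> (p, 1) / (1, h p)\<close>.
\<close>

lemma D1_to_L_kernel:
  assumes W: "submodule W B DB"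
    and prod: "\<And>a b. a \<in> Iset \<Longrightarrow> b \<in> Iset \<Longrightarrow> D1_class F (a \<otimes>\<^bsub>RB F\<^esub> b) \<zero>\<^bsub>BT_mod F\<^esub> \<in> W"
    and x: "x \<in> carrier DB" "D1_to_L x = \<zero>\<^bsub>L_mod F\<^esub>"
  shows "x \<in> W"
proof -
  interpret W: module_quotient DB W by (rule submodule_quotient[OF DB_module W])
  let ?Q = "quot_module DB W" and ?q = "\<lambda>x. W +>\<^bsub>DB\<^esub> x"
  have Qm: "module B ?Q" by (rule module_quot_module[OF DB_module W])
  interpret Q: module B ?Q by (rule Qm)
  have qh: "?q \<in> addhom DB ?Q" by (rule W.quot_hom)
  have qc: "?q x \<in> carrier ?Q" if "x \<in> carrier (D1_mod F)" for x using W.quot_closed that by simp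
  have qs: "b \<odot>\<^bsub>?Q\<^esub> ?q x = ?q (b \<odot>\<^bsub>DB\<^esub> x)" if "b \<in> carrier B" "x \<in> carrier (D1_mod F)" for b x
    using quot_module_smult[OF DB_module W] that by simp
  have q0: "?q \<zero>\<^bsub>DB\<^esub> = \<zero>\<^bsub>?Q\<^esub>" using addhom_zero[OF qh DB.M.abelian_group_axioms Q.M.abelian_group_axioms] .
  let ?D = "\<lambda>r. ?q (dI \<one>\<^bsub>B\<^esub> r)"
  have D: "?D \<in> addhom R ?Q"
    using addhom_add[OF qh] by (intro addhomI) (simp_all add: qc dI_add)
  have leib: "?D (x \<otimes>\<^bsub>R\<^esub> y) = eps x \<odot>\<^bsub>?Q\<^esub> ?D y \<oplus>\<^bsub>?Q\<^esub> eps y \<odot>\<^bsub>?Q\<^esub> ?D x"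
    if xy: "x \<in> carrier R" "y \<in> carrier R" for x y
  proof -
    have g: "gI \<one>\<^bsub>B\<^esub> x \<in> Iset" "gI \<one>\<^bsub>B\<^esub> y \<in> Iset" using gI_closed xy by simp_all
    have m: "sec (eps x) \<otimes>\<^bsub>RB F\<^esub> gI \<one>\<^bsub>B\<^esub> y \<in> Iset" "sec (eps y) \<otimes>\<^bsub>RB F\<^esub> gI \<one>\<^bsub>B\<^esub> x \<in> Iset"
      "gI \<one>\<^bsub>B\<^esub> x \<otimes>\<^bsub>RB F\<^esub> gI \<one>\<^bsub>B\<^esub> y \<in> Iset" using g xy by auto
    have s: "eps x \<odot>\<^bsub>DB\<^esub> dI \<one>\<^bsub>B\<^esub> y = D1_class F (sec (eps x) \<otimes>\<^bsub>RB F\<^esub> gI \<one>\<^bsub>B\<^esub> y) \<zero>\<^bsub>BT_mod F\<^esub>"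
      "eps y \<odot>\<^bsub>DB\<^esub> dI \<one>\<^bsub>B\<^esub> x = D1_class F (sec (eps y) \<otimes>\<^bsub>RB F\<^esub> gI \<one>\<^bsub>B\<^esub> x) \<zero>\<^bsub>BT_mod F\<^esub>"
      using xy g by (simp_all only: dI_def D1_class_smult eps_simps BTm.smult_r_null BTm.M.zero_closed)
    let ?c = "\<lambda>i. D1_class F i \<zero>\<^bsub>BT_mod F\<^esub>"
    have cc: "?c i \<in> carrier DB" if "i \<in> Iset" for i using that by simp
    have "dI \<one>\<^bsub>B\<^esub> (x \<otimes>\<^bsub>R\<^esub> y) = ?c (gI \<one>\<^bsub>B\<^esub> x \<otimes>\<^bsub>RB F\<^esub> gI \<one>\<^bsub>B\<^esub> y) \<oplus>\<^bsub>DB\<^esub> (eps x \<odot>\<^bsub>DB\<^esub> dI \<one>\<^bsub>B\<^esub> y \<oplus>\<^bsub>DB\<^esub> eps y \<odot>\<^bsub>DB\<^esub> dI \<one>\<^bsub>B\<^esub> x)"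
      unfolding s unfolding dI_def gI_mult[OF xy]
      using addhom_add[OF D1_class_I_hom] m by simp
    then have "?D (x \<otimes>\<^bsub>R\<^esub> y) = ?q (?c (gI \<one>\<^bsub>B\<^esub> x \<otimes>\<^bsub>RB F\<^esub> gI \<one>\<^bsub>B\<^esub> y)) \<oplus>\<^bsub>?Q\<^esub> (?q (eps x \<odot>\<^bsub>DB\<^esub> dI \<one>\<^bsub>B\<^esub> y) \<oplus>\<^bsub>?Q\<^esub> ?q (eps y \<odot>\<^bsub>DB\<^esub> dI \<one>\<^bsub>B\<^esub> x))"
      unfolding s using cc m addhom_add[OF qh] DB.M.a_closed by (simp only:)
    moreover have "?q (?c (gI \<one>\<^bsub>B\<^esub> x \<otimes>\<^bsub>RB F\<^esub> gI \<one>\<^bsub>B\<^esub> y)) = \<zero>\<^bsub>?Q\<^esub>"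
      using prod[OF g] W.quot_zero_iff[OF cc[OF m(3)]] by simp
    ultimately show ?thesis
      using xy qc[of "dI \<one>\<^bsub>B\<^esub> x"] qc[of "dI \<one>\<^bsub>B\<^esub> y"] by (simp add: qs[symmetric] del: restrict_scalars_simps)
  qed
  have const: "?D (e c) = \<zero>\<^bsub>?Q\<^esub>" if "c \<in> carrier C" for c
    using that q0 D1_class_zero by (simp add: dI_def gI_const)
  note l = K.Om_lift[OF Qm eps_hom D leib const]
  let ?u = "symbol_lift ?Q (\<lambda>r x. eps r \<odot>\<^bsub>?Q\<^esub> ?D x)"
  have uh: "?u \<in> addhom K.Om ?Q" by (rule l(1))
  have ud: "?u (K.\<delta> r) = ?D r" if "r \<in> carrier R" for r by (rule l(4)[OF _ _ _ that])
  have us: "?u (r \<odot>\<^bsub>K.Om\<^esub> w) = eps r \<odot>\<^bsub>?Q\<^esub> ?u w" if "r \<in> carrier R" "w \<in> carrier K.Om" for r w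
    by (rule l(3)[OF _ _ _ that])
  have uc: "?u w \<in> carrier ?Q" if "w \<in> carrier K.Om" for w using addhom_closed[OF uh that] .
  \<comment> \<open>the inverse on \<open>B \<otimes>\<^sub>R \<Omega>\<close>, from the derivation \<open>?D\<close>\<close>
  let ?\<psi>1 = "symbol_lift ?Q (\<lambda>b w. b \<odot>\<^bsub>?Q\<^esub> ?u w)"
  have bal: "(b \<otimes>\<^bsub>B\<^esub> eps r) \<odot>\<^bsub>?Q\<^esub> ?u w = b \<odot>\<^bsub>?Q\<^esub> ?u (r \<odot>\<^bsub>K.Om\<^esub> w)"
    if "b \<in> carrier B" "r \<in> carrier R" "w \<in> carrier K.Om" for b r w
    using that uc[OF that(3)] by (simp add: us Q.smult_assoc1)
  note m = OR.BC_lift[OF Q.M.abelian_group_axioms _ _ _ bal]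
  have \<psi>1h: "?\<psi>1 \<in> addhom (BOmR_mod F) ?Q"
    unfolding BOmR_eq by (rule m(1)) (simp_all add: uc Q.smult_l_distr Q.smult_r_distr addhom_add[OF uh])
  have \<psi>1v: "?\<psi>1 (bd b r) = ?q (dI b r)" if "b \<in> carrier B" "r \<in> carrier R" for b r
  proof -
    have "?\<psi>1 (bd b r) = b \<odot>\<^bsub>?Q\<^esub> ?u (K.\<delta> r)"
      unfolding BOmR_tensor_eq
      by (rule m(2)) (use that in \<open>simp_all add: uc Q.smult_l_distr Q.smult_r_distr addhom_add[OF uh]\<close>)
    also have "\<dots> = ?q (b \<odot>\<^bsub>DB\<^esub> dI \<one>\<^bsub>B\<^esub> r)" unfolding ud[OF that(2)] using that by (intro qs) simp_all
    finally show ?thesis using that dI_smult[of b "\<one>\<^bsub>B\<^esub>" r] by simp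
  qed
  \<comment> \<open>the inverse on \<open>B \<otimes> P\<^sup>g\<^sup>p / Q\<^sup>g\<^sup>p\<close>; it is trivial on \<open>Q\<close> because \<open>dT\<close> vanishes there\<close>
  let ?v = "\<lambda>p. ?q (dT \<one>\<^bsub>B\<^esub> p)"
  have vh: "?v \<in> monoid_hom (Pm F) (add_monoid ?Q)"
  proof (rule monoid_homI)
    show "?v \<one>\<^bsub>Pm F\<^esub> = \<one>\<^bsub>add_monoid ?Q\<^esub>"
      using dT_eQ[OF B.one_closed Q.one_closed] monoid_hom_one[OF eQ_hom] q0 by simp
  qed (use addhom_add[OF qh] in \<open>simp_all add: qc dT_mult\<close>)
  obtain w where w: "w \<in> hom (gp (Pm F)) (add_monoid ?Q)"
    and wv: "\<And>a b. a \<in> carrier (Pm F) \<Longrightarrow> b \<in> carrier (Pm F) \<Longrightarrow>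
      w (gp_frac (Pm F) a b) = ?v a \<otimes>\<^bsub>add_monoid ?Q\<^esub> inv\<^bsub>add_monoid ?Q\<^esub> ?v b"
    using P.gp_universal[OF Q.M.a_comm_group vh] by blast
  have wv: "w (gp_frac (Pm F) a b) = ?v a \<ominus>\<^bsub>?Q\<^esub> ?v b" if "a \<in> carrier (Pm F)" "b \<in> carrier (Pm F)" for a b
    using wv[OF that] by (simp add: a_minus_def a_inv_def)
  interpret w: group_hom "gp (Pm F)" "add_monoid ?Q" w
    using w by (simp add: group_hom_def group_hom_axioms_def comm_group.axioms(2) P.gp_comm_group Q.M.a_group)
  have wp: "w (gp_frac (Pm F) p \<one>\<^bsub>Pm F\<^esub>) = ?v p" if "p \<in> carrier (Pm F)" for p
    using wv[OF that P.one_closed] monoid_hom_one[OF vh] qc[of "dT \<one>\<^bsub>B\<^esub> p"] that by (simp add: Q.M.minus_eq)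
  have "Qim \<subseteq> kernel (gp (Pm F)) (add_monoid ?Q) w"
  proof
    fix y assume "y \<in> Qim"
    then obtain a b where ab: "a \<in> carrier (Qm F)" "b \<in> carrier (Qm F)" "y = gp_frac (Pm F) (eQ a) (eQ b)"
      by (auto elim!: Q.gp_cases simp: gp_map_frac[OF Q.comm_monoid_axioms P.comm_monoid_axioms eQ_hom])
    have "?v (eQ a) = \<zero>\<^bsub>?Q\<^esub>" "?v (eQ b) = \<zero>\<^bsub>?Q\<^esub>" using ab dT_eQ q0 by simp_all
    then show "y \<in> kernel (gp (Pm F)) (add_monoid ?Q) w"
      using ab by (simp add: kernel_def wv Q.M.minus_eq)
  qed
  then obtain u2 where u2: "u2 \<in> hom PQ (add_monoid ?Q)"
    "\<And>x. x \<in> carrier (gp (Pm F)) \<Longrightarrow> u2 (Qim #>\<^bsub>gp (Pm F)\<^esub> x) = w x"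
    using w.FactGroup_universal_kernel[OF comm_group.subgroup_imp_normal[OF P.gp_comm_group Qim_subgroup]]
    unfolding Pgp_mod_Qgp_def by blast
  have u2v: "u2 (bar_p F p) = ?v p" if "p \<in> carrier (Pm F)" for p
    unfolding bar_p_def using u2(2)[of "gp_frac (Pm F) p \<one>\<^bsub>Pm F\<^esub>"] wp[OF that] that by simp
  let ?\<psi>2 = "symbol_lift ?Q (\<lambda>b t. b \<odot>\<^bsub>?Q\<^esub> u2 t)"
  have \<psi>2h: "?\<psi>2 \<in> addhom (BG_mod F) ?Q"
    by (rule BG_lift_hom[OF Qm u2(1)]) simp
  have \<psi>2v: "?\<psi>2 (BG_tensor F b (bar_p F p)) = ?q (dT b p)" if "b \<in> carrier B" "p \<in> carrier (Pm F)" for b p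
  proof -
    have "?\<psi>2 (BG_tensor F b (bar_p F p)) = b \<odot>\<^bsub>?Q\<^esub> u2 (bar_p F p)"
      by (rule BG_lift_tensor[OF Qm u2(1)]) (use that in simp_all)
    also have "\<dots> = ?q (b \<odot>\<^bsub>DB\<^esub> dT \<one>\<^bsub>B\<^esub> p)" unfolding u2v[OF that(2)] using that by (intro qs) simp_all
    finally show ?thesis using that dT_smult[of b "\<one>\<^bsub>B\<^esub>" p] by simp
  qed
  \<comment> \<open>the two parts agree on \<open>dp\<close> because of \<open>dI_dT_relation\<close>\<close>
  let ?\<psi> = "\<lambda>(x, y). ?\<psi>1 x \<oplus>\<^bsub>?Q\<^esub> ?\<psi>2 y"
  have \<psi>h: "?\<psi> \<in> addhom OG ?Q"
    by (rule addhom_on_pair[OF Q.M.abelian_group_axioms \<psi>1h \<psi>2h])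
  have \<psi>r: "?\<psi> y = \<zero>\<^bsub>?Q\<^esub>" if "y \<in> rel2" for y
    using that
  proof (induction rule: rel2_induct)
    case zero
    show ?case using addhom_zero[OF \<psi>h L.abelian_group_axioms Q.M.abelian_group_axioms] .
  next
    case (gen b p)
    have "?\<psi> (gL b p) = ?q (dI b (\<chi> p)) \<oplus>\<^bsub>?Q\<^esub> \<ominus>\<^bsub>?Q\<^esub> ?q (dT (b \<otimes>\<^bsub>B\<^esub> \<beta> (h p)) p)"
      using gen by (simp add: gL_def \<psi>1v addhom_neg[OF \<psi>2h BGm.M.abelian_group_axioms Q.M.abelian_group_axioms] \<psi>2v)
    then show ?case using gen qc by (simp add: dI_dT_relation Q.M.r_neg)
  next
    case (diff x y)
    have "?\<psi> (x \<ominus>\<^bsub>OG\<^esub> y) = ?\<psi> x \<ominus>\<^bsub>?Q\<^esub> ?\<psi> y"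
      by (rule addhom_diff[OF \<psi>h L.abelian_group_axioms Q.M.abelian_group_axioms]) (rule L.K_closed[OF diff(1)] L.K_closed[OF diff(2)])+
    then show ?case using diff by (simp only: Q.M.minus_eq) (simp add: Q.M.r_neg)
  qed
  obtain G where G: "G \<in> addhom (L_mod F) ?Q" "\<And>x. x \<in> carrier OG \<Longrightarrow> G (rel2 +>\<^bsub>OG\<^esub> x) = ?\<psi> x"
    using L.quot_universal[OF Q.M.abelian_group_axioms \<psi>h \<psi>r] unfolding L_eq by blast
  have "G (D1_to_L x) = ?q x"
  proof (rule DB_hom_eq[OF addhom_comp[OF D1_to_L_hom G(1)] qh Q.M.abelian_group_axioms x(1)])
    fix b r assume br: "b \<in> carrier B" "r \<in> carrier R"
    then show "G (D1_to_L (dI b r)) = ?q (dI b r)"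
      using G(2)[of "(bd b r, \<zero>\<^bsub>BG_mod F\<^esub>)"] addhom_zero[OF \<psi>2h BGm.M.abelian_group_axioms Q.M.abelian_group_axioms]
        qc[of "dI b r"] by (simp add: lI_def L_class_eq \<psi>1v)
  next
    fix b p assume "b \<in> carrier B" "p \<in> carrier (Pm F)"
    then show "G (D1_to_L (dT b p)) = ?q (dT b p)"
      using G(2)[of "(\<zero>\<^bsub>BOmR_mod F\<^esub>, BG_tensor F b (bar_p F p))"]
        addhom_zero[OF \<psi>1h OB.M.abelian_group_axioms Q.M.abelian_group_axioms]
        qc[of "dT b p"] by (simp add: lT_def L_class_eq \<psi>2v)
  qed
  then have "?q x = \<zero>\<^bsub>?Q\<^esub>"
    using x(2) addhom_zero[OF G(1) Lm.M.abelian_group_axioms Q.M.abelian_group_axioms] by simp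
  then show ?thesis using W.quot_zero_iff[OF x(1)] by simp
qed

end

section \<open>Functoriality in the middle term\<close>

text \<open>
  A face or degeneracy map of a resolution: a map between middle terms, under \<open>(C,Q)\<close> and over \<open>(B,N)\<close>.
\<close>

locale log_morphism = S: log_factorization F
  for F F' :: "('c, 'q, 'r, 'p, 'b, 'n) factorization" +
  fixes k
  assumes F': "log_factorization F'"
    and src_eq: "source F' = source F" and tgt_eq: "target F' = target F"
    and k: "k \<in> prelog_hom (middle F) (middle F')"
    and k_incl: "\<And>c. c \<in> carrier (Cr F) \<Longrightarrow> fst k (fst (incl F) c) = fst (incl F') c"
      "\<And>q. q \<in> carrier (Qm F) \<Longrightarrow> snd k (snd (incl F) q) = snd (incl F') q"
    and k_proj: "\<And>r. r \<in> carrier (Rr F) \<Longrightarrow> fst (proj F') (fst k r) = fst (proj F) r"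
      "\<And>p. p \<in> carrier (Pm F) \<Longrightarrow> snd (proj F') (snd k p) = snd (proj F) p"
begin

sublocale T: log_factorization F'
  rewrites "source F' = source F" and "target F' = target F"
  by (rule F') (fact src_eq tgt_eq)+

abbreviation "kR \<equiv> fst k"
abbreviation "kP \<equiv> snd k"

lemma kR_hom: "kR \<in> ring_hom (Rr F) (Rr F')" by (rule prelog_homD(1)[OF k])
lemma kP_hom: "kP \<in> monoid_hom (Pm F) (Pm F')" by (rule prelog_homD(2)[OF k])
lemma k_chart: "p \<in> carrier (Pm F) \<Longrightarrow> chart (middle F') (kP p) = kR (chart (middle F) p)"
  by (rule prelog_homD(3)[OF k])

lemma kR_simps [simp]:
  "r \<in> carrier (Rr F) \<Longrightarrow> kR r \<in> carrier (Rr F')"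
  "r \<in> carrier (Rr F) \<Longrightarrow> r' \<in> carrier (Rr F) \<Longrightarrow> kR (r \<otimes>\<^bsub>Rr F\<^esub> r') = kR r \<otimes>\<^bsub>Rr F'\<^esub> kR r'"
  "r \<in> carrier (Rr F) \<Longrightarrow> r' \<in> carrier (Rr F) \<Longrightarrow> kR (r \<oplus>\<^bsub>Rr F\<^esub> r') = kR r \<oplus>\<^bsub>Rr F'\<^esub> kR r'"
  "kR \<one>\<^bsub>Rr F\<^esub> = \<one>\<^bsub>Rr F'\<^esub>"
  using kR_hom by (auto simp: ring_hom_def)
lemma kP_simps [simp]:
  "p \<in> carrier (Pm F) \<Longrightarrow> kP p \<in> carrier (Pm F')"
  "p \<in> carrier (Pm F) \<Longrightarrow> p' \<in> carrier (Pm F) \<Longrightarrow> kP (p \<otimes>\<^bsub>Pm F\<^esub> p') = kP p \<otimes>\<^bsub>Pm F'\<^esub> kP p'"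
  "kP \<one>\<^bsub>Pm F\<^esub> = \<one>\<^bsub>Pm F'\<^esub>"
  using kP_hom by (auto simp: monoid_hom_def hom_def)

declare k_proj [simp]

abbreviation "Om' \<equiv> differentials (Cr F) (Rr F') (fst (incl F'))"
abbreviation "dl' \<equiv> differential (Cr F) (Rr F') (fst (incl F'))"
abbreviation "bd' b r \<equiv> BOmR_tensor F' b (dl' r)"
abbreviation "Tset' \<equiv> {t \<in> carrier (gp (PN F')). gp_map (Nm F) (PN_proj F') t = \<one>\<^bsub>gp (Nm F)\<^esub>}"
abbreviation "Qim' \<equiv> gp_map (Pm F') (snd (incl F')) ` carrier (gp (Qm F))"

subsection \<open>The map on \<open>D\<^sup>1\<close>\<close>

lemma RB_map:
  shows RB_map_hom: "RB_map F' k \<in> addhom (RB F) (RB F')"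
    and RB_map_tensor [simp]: "r \<in> carrier (Rr F) \<Longrightarrow> b \<in> carrier (Br F) \<Longrightarrow> RB_map F' k (RB_tensor F r b) = RB_tensor F' (kR r) b"
proof -
  have bal: "RB_tensor F' (kR (r \<otimes>\<^bsub>Rr F\<^esub> S.e c)) b = RB_tensor F' (kR r) (S.eps (S.e c) \<otimes>\<^bsub>Br F\<^esub> b)"
    if "r \<in> carrier (Rr F)" "c \<in> carrier (Cr F)" "b \<in> carrier (Br F)" for r c b
    using that T.RB_tensor_balance[of "kR r" c b] k_proj(1)[of "S.e c"] by (simp add: k_incl)
  note l = S.RB_lift[OF T.RB.abelian_group_axioms, where \<phi> = "\<lambda>r b. RB_tensor F' (kR r) b", OF _ _ _ bal]
  show "RB_map F' k \<in> addhom (RB F) (RB F')"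
    unfolding RB_map_def by (rule l(1)) (simp_all add: T.RB_tensor_add_left T.RB_tensor_add_right)
  show "r \<in> carrier (Rr F) \<Longrightarrow> b \<in> carrier (Br F) \<Longrightarrow> RB_map F' k (RB_tensor F r b) = RB_tensor F' (kR r) b"
    unfolding RB_map_def by (rule l(2)) (simp_all add: T.RB_tensor_add_left T.RB_tensor_add_right)
qed

lemma RB_map_closed [simp]: "z \<in> carrier (RB F) \<Longrightarrow> RB_map F' k z \<in> carrier (RB F')"
  by (rule addhom_closed[OF RB_map_hom])

lemma RB_map_mult:
  assumes "z \<in> carrier (RB F)" "w \<in> carrier (RB F)"
  shows "RB_map F' k (z \<otimes>\<^bsub>RB F\<^esub> w) = RB_map F' k z \<otimes>\<^bsub>RB F'\<^esub> RB_map F' k w"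
proof (rule S.RB_bilinear_eq[OF T.RB.abelian_group_axioms _ _ _ _ _ assms])
  fix z assume z: "z \<in> carrier (RB F)"
  show "(\<lambda>w. RB_map F' k (w \<otimes>\<^bsub>RB F\<^esub> z)) \<in> addhom (RB F) (RB F')"
    by (rule addhom_comp[OF S.addhom_rmult[OF S.RB.is_cring z] RB_map_hom])
  show "(\<lambda>w. RB_map F' k (z \<otimes>\<^bsub>RB F\<^esub> w)) \<in> addhom (RB F) (RB F')"
    by (rule addhom_comp[OF S.addhom_lmult[OF S.RB.is_cring z] RB_map_hom])
  show "(\<lambda>w. RB_map F' k w \<otimes>\<^bsub>RB F'\<^esub> RB_map F' k z) \<in> addhom (RB F) (RB F')"
    by (rule addhom_comp[OF RB_map_hom S.addhom_rmult[OF T.RB.is_cring RB_map_closed[OF z]]])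
  show "(\<lambda>w. RB_map F' k z \<otimes>\<^bsub>RB F'\<^esub> RB_map F' k w) \<in> addhom (RB F) (RB F')"
    by (rule addhom_comp[OF RB_map_hom S.addhom_lmult[OF T.RB.is_cring RB_map_closed[OF z]]])
qed (simp add: S.RB_tensor_mult T.RB_tensor_mult)

lemma RB_map_proj [simp]:
  assumes "z \<in> carrier (RB F)"
  shows "RB_proj F' (RB_map F' k z) = RB_proj F z"
  by (rule S.RB_hom_eq[OF addhom_comp[OF RB_map_hom T.RB_proj_addhom] S.RB_proj_addhom S.B.abelian_group_axioms _ assms])
    simp

lemma RB_map_gI: "r \<in> carrier (Rr F) \<Longrightarrow> b \<in> carrier (Br F) \<Longrightarrow> RB_map F' k (S.gI b r) = T.gI b (kR r)"
  by (simp add: S.gI_def T.gI_def addhom_diff[OF RB_map_hom S.RB.abelian_group_axioms T.RB.abelian_group_axioms])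

lemma PN_map_class [simp]:
  assumes "p \<in> carrier (Pm F)" "n \<in> carrier (Nm F)"
  shows "PN_map F' k (PN_class F p n) = PN_class F' (kP p) n"
  unfolding PN_map_def S.PN_class_eq
proof (rule S.A.class_UN[OF assms])
  fix q p n assume *: "q \<in> carrier (Qm F)" "p \<in> carrier (Pm F)" "n \<in> carrier (Nm F)"
  then show "PN_class F' (kP (p \<otimes>\<^bsub>Pm F\<^esub> S.eQ q)) n = PN_class F' (kP p) ((S.h \<circ> S.eQ) q \<otimes>\<^bsub>Nm F\<^esub> n)"
    using T.PN_glue[of q "kP p" n] k_proj(2)[of "S.eQ q"] by (simp add: k_incl)
qed

lemma PN_map_hom: "PN_map F' k \<in> monoid_hom (PN F) (PN F')"
  by (rule monoid_homI) (auto elim!: S.PN_cases simp: S.PN_one T.PN_one)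

lemma PN_map_proj: "x \<in> carrier (PN F) \<Longrightarrow> PN_proj F' (PN_map F' k x) = PN_proj F x"
  by (auto elim!: S.PN_cases)

abbreviation "kT \<equiv> gp_map (PN F') (PN_map F' k)"

lemma kT_frac: "x \<in> carrier (PN F) \<Longrightarrow> y \<in> carrier (PN F) \<Longrightarrow> kT (gp_frac (PN F) x y) = gp_frac (PN F') (PN_map F' k x) (PN_map F' k y)"
  by (rule gp_map_frac[OF S.PN.comm_monoid_axioms T.PN.comm_monoid_axioms PN_map_hom])

lemma kT_tau [simp]: "p \<in> carrier (Pm F) \<Longrightarrow> kT (S.tau p) = T.tau (kP p)"
  by (simp add: S.tau_def T.tau_def kT_frac)

lemma kT_hom: "kT \<in> hom (gp (PN F)) (gp (PN F'))"
  by (rule gp_map_hom[OF S.PN.comm_monoid_axioms T.PN.comm_monoid_axioms PN_map_hom])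

lemma kT_closed: "t \<in> S.Tset \<Longrightarrow> kT t \<in> Tset'"
proof -
  assume t: "t \<in> S.Tset"
  then obtain x y where xy: "x \<in> carrier (PN F)" "y \<in> carrier (PN F)" "t = gp_frac (PN F) x y"
    by (auto elim: S.PN.gp_cases)
  have "PN_map F' k x \<in> carrier (PN F')" "PN_map F' k y \<in> carrier (PN F')"
    using monoid_hom_closed[OF PN_map_hom] xy by simp_all
  then show ?thesis
    using t xy by (simp add: kT_frac T.gp_proj_frac S.gp_proj_frac PN_map_proj)
qed

lemma BT_map:
  shows BT_map_hom: "BT_map F' k \<in> addhom (BT_mod F) (BT_mod F')"
    and BT_map_tau [simp]: "b \<in> carrier (Br F) \<Longrightarrow> p \<in> carrier (Pm F) \<Longrightarrow>
      BT_map F' k (BT_tensor F b (S.tau p)) = BT_tensor F' b (T.tau (kP p))"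
proof -
  have u: "(\<lambda>t. BT_tensor F' \<one>\<^bsub>Br F\<^esub> (kT t)) \<in> hom (T_grp F) (add_monoid (BT_mod F'))"
    using hom_mult[OF kT_hom] kT_closed by (intro homI) (auto simp: T.BT_tensor_mult)
  have eq: "BT_tensor F' b (kT t) = b \<odot>\<^bsub>BT_mod F'\<^esub> BT_tensor F' \<one>\<^bsub>Br F\<^esub> (kT t)"
    if "b \<in> carrier (Br F)" "t \<in> S.Tset" for b t
    using that kT_closed[OF that(2)] by (simp add: T.BT_smult)
  show "BT_map F' k \<in> addhom (BT_mod F) (BT_mod F')"
    unfolding BT_map_def by (rule S.BT_lift_hom[OF T.BT_module u eq])
  show "BT_map F' k (BT_tensor F b (S.tau p)) = BT_tensor F' b (T.tau (kP p))"
    if "b \<in> carrier (Br F)" "p \<in> carrier (Pm F)"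
    unfolding BT_map_def using S.BT_lift_tensor[OF T.BT_module u eq, of b "S.tau p"] that
      S.tau_closed[OF that(2)] T.tau_closed[of "kP p"]
    by (simp add: T.BT_smult)
qed

abbreviation "kpair \<equiv> \<lambda>(i, t). (RB_map F' k i, BT_map F' k t)"

lemma kpair_hom: "kpair \<in> addhom S.IBT T.IBT"
proof (rule addhom_map_prod)
  show "RB_map F' k \<in> addhom (I_mod F) (I_mod F')"
    by (rule addhomI) (simp_all add: addhom_add[OF RB_map_hom])
qed (simp only: restrict_scalars_hom BT_map_hom)

lemma kpair_rel:
  assumes "x \<in> S.rel1"
  shows "kpair x \<in> T.rel1"
  using assms
proof (induction rule: S.rel1_induct)
  case zero
  show ?case
    using addhom_zero[OF kpair_hom S.D.abelian_group_axioms T.D.abelian_group_axioms] T.D.K_zero by (simp only:)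
next
  case (gen z p)
  have "S.gI \<one>\<^bsub>Br F\<^esub> (S.\<chi> p) \<in> carrier (RB F)"
    using S.gI_closed[of "S.\<chi> p" "\<one>\<^bsub>Br F\<^esub>"] gen by auto
  then have "kpair (S.gU z p) = T.gU (RB_map F' k z) (kP p)"
    using gen S.tau_closed[of p]
    by (simp add: S.gU_def T.gU_def RB_map_mult RB_map_gI k_chart
        addhom_neg[OF BT_map_hom S.BTm.M.abelian_group_axioms T.BTm.M.abelian_group_axioms])
  then show ?case using gen by (simp add: T.gU_in_rel1)
next
  case (diff x y)
  have "kpair (x \<ominus>\<^bsub>S.IBT\<^esub> y) = kpair x \<ominus>\<^bsub>T.IBT\<^esub> kpair y"
    by (rule addhom_diff[OF kpair_hom S.D.abelian_group_axioms T.D.abelian_group_axioms])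
      (rule S.D.K_closed[OF diff(1)] S.D.K_closed[OF diff(2)])+
  then show ?case using diff T.D.K_diff by (simp only:)
qed

lemma D1_map_eq: "D1_map F' k = (\<lambda>Z. \<Union>y\<in>Z. T.rel1 +>\<^bsub>T.IBT\<^esub> kpair y)"
  by (intro ext) (simp add: D1_map_def T.D1_class_eq case_prod_beta)

lemma D1_map_hom: "D1_map F' k \<in> addhom S.DB T.DB"
  using S.D.quot_map_hom[OF T.D.module_quotient_axioms kpair_hom kpair_rel]
  by (simp only: D1_map_eq S.D1_eq T.D1_eq restrict_scalars_hom)

lemma D1_map_class: "i \<in> S.Iset \<Longrightarrow> t \<in> carrier (BT_mod F) \<Longrightarrow>
    D1_map F' k (D1_class F i t) = D1_class F' (RB_map F' k i) (BT_map F' k t)"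
  using S.D.quot_map[OF T.D.module_quotient_axioms kpair_hom kpair_rel, of "(i, t)"]
  by (simp add: D1_map_eq S.D1_class_eq T.D1_class_eq)

lemma D1_map_dI [simp]: "b \<in> carrier (Br F) \<Longrightarrow> r \<in> carrier (Rr F) \<Longrightarrow> D1_map F' k (S.dI b r) = T.dI b (kR r)"
  using S.gI_closed[of r b] addhom_zero[OF BT_map_hom S.BTm.M.abelian_group_axioms T.BTm.M.abelian_group_axioms]
  by (simp add: S.dI_def T.dI_def D1_map_class RB_map_gI)

lemma D1_map_dT [simp]: "b \<in> carrier (Br F) \<Longrightarrow> p \<in> carrier (Pm F) \<Longrightarrow> D1_map F' k (S.dT b p) = T.dT b (kP p)"
  using S.tau_closed[of p] addhom_zero[OF RB_map_hom S.RB.abelian_group_axioms T.RB.abelian_group_axioms]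
  by (simp add: S.dT_def T.dT_def D1_map_class)

lemma D1_map_lin: "D1_map F' k \<in> lin_maps (Br F) S.DB T.DB"
proof (rule lin_mapsI[OF D1_map_hom])
  fix a x assume a: "a \<in> carrier (Br F)" and x: "x \<in> carrier S.DB"
  show "D1_map F' k (a \<odot>\<^bsub>S.DB\<^esub> x) = a \<odot>\<^bsub>T.DB\<^esub> D1_map F' k x"
    by (rule S.DB_hom_eq[OF addhom_comp[OF module_smult_hom[OF S.DB_module a] D1_map_hom]
          addhom_comp[OF D1_map_hom module_smult_hom[OF T.DB_module a]] T.DB.M.abelian_group_axioms x])
      (use a in \<open>simp_all only: S.dI_smult S.dT_smult T.dI_smult T.dT_smult D1_map_dI D1_map_dT S.B.m_closed kR_simps(1) kP_simps(1)\<close>)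
qed

subsection \<open>The map on the cotangent complex\<close>

lemma BOmR_map:
  shows BOmR_map_hom: "BOmR_map F' k \<in> addhom (BOmR_mod F) (BOmR_mod F')"
    and BOmR_map_bd [simp]: "b \<in> carrier (Br F) \<Longrightarrow> r \<in> carrier (Rr F) \<Longrightarrow> BOmR_map F' k (S.bd b r) = bd' b (kR r)"
proof -
  let ?D = "\<lambda>x. dl' (kR x)"
  let ?\<kappa> = "symbol_lift Om' (\<lambda>r x. kR r \<odot>\<^bsub>Om'\<^esub> ?D x)"
  have D: "?D \<in> addhom (Rr F) Om'"
    by (intro addhomI) (simp_all add: T.K.delta_add)
  have leib: "?D (x \<otimes>\<^bsub>Rr F\<^esub> y) = kR x \<odot>\<^bsub>Om'\<^esub> ?D y \<oplus>\<^bsub>Om'\<^esub> kR y \<odot>\<^bsub>Om'\<^esub> ?D x"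
    if "x \<in> carrier (Rr F)" "y \<in> carrier (Rr F)" for x y
    using that by (simp add: T.K.delta_mult)
  have const: "?D (S.e c) = \<zero>\<^bsub>Om'\<^esub>" if "c \<in> carrier (Cr F)" for c
    using that by (simp add: k_incl T.K.delta_const)
  note l = S.K.Om_lift[OF T.K.Om_module kR_hom D leib const]
  have lh: "?\<kappa> \<in> addhom S.K.Om Om'" by (rule l(1))
  have ls: "?\<kappa> (r \<odot>\<^bsub>S.K.Om\<^esub> w) = kR r \<odot>\<^bsub>Om'\<^esub> ?\<kappa> w" if "r \<in> carrier (Rr F)" "w \<in> carrier S.K.Om" for r w
    by (rule l(3)[OF _ _ _ that])
  have ld: "?\<kappa> (S.K.\<delta> x) = ?D x" if "x \<in> carrier (Rr F)" for x by (rule l(4)[OF _ _ _ that])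
  have \<kappa>c: "?\<kappa> w \<in> carrier Om'" if "w \<in> carrier S.K.Om" for w
    using addhom_closed[OF lh that] .
  have eq: "BOmR_map F' k = symbol_lift (BOmR_mod F') (\<lambda>b w. BOmR_tensor F' b (?\<kappa> w))"
    by (simp add: BOmR_map_def Let_def src_eq)
  have bal: "BOmR_tensor F' (b \<otimes>\<^bsub>Br F\<^esub> S.eps a) (?\<kappa> w) = BOmR_tensor F' b (?\<kappa> (a \<odot>\<^bsub>S.K.Om\<^esub> w))"
    if "b \<in> carrier (Br F)" "a \<in> carrier (Rr F)" "w \<in> carrier S.K.Om" for b a w
    using that \<kappa>c[OF that(3)] by (simp add: ls T.BOmR_balance)
  note m = S.OR.BC_lift[OF T.OB.M.abelian_group_axioms _ _ _ bal]
  show "BOmR_map F' k \<in> addhom (BOmR_mod F) (BOmR_mod F')"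
    unfolding eq S.BOmR_eq by (rule m(1)) (simp_all add: \<kappa>c T.BOmR_add_left T.BOmR_add_right addhom_add[OF lh])
  show "BOmR_map F' k (S.bd b r) = bd' b (kR r)" if "b \<in> carrier (Br F)" "r \<in> carrier (Rr F)"
  proof -
    have "symbol_lift (BOmR_mod F') (\<lambda>b w. BOmR_tensor F' b (?\<kappa> w)) (S.bd b r) = BOmR_tensor F' b (?\<kappa> (S.K.\<delta> r))"
      unfolding S.BOmR_tensor_eq
      by (rule m(2)) (use that in \<open>simp_all add: \<kappa>c T.BOmR_add_left T.BOmR_add_right addhom_add[OF lh]\<close>)
    then show ?thesis unfolding eq using that by (simp add: ld)
  qed
qed

abbreviation "kPQ \<equiv> Pgp_mod_Qgp_map F' k"

lemma kPQ_coset: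
  assumes "x \<in> carrier (gp (Pm F))"
  shows "kPQ (S.Qim #>\<^bsub>gp (Pm F)\<^esub> x) = Qim' #>\<^bsub>gp (Pm F')\<^esub> gp_map (Pm F') kP x"
proof -
  note gh = gp_map_hom[OF S.P.comm_monoid_axioms T.P.comm_monoid_axioms kP_hom]
  interpret g: group_hom "gp (Pm F)" "gp (Pm F')" "gp_map (Pm F') kP"
    using gh by (simp add: group_hom_def group_hom_axioms_def comm_group.axioms(2) S.P.gp_comm_group T.P.gp_comm_group)
  have Qim: "gp_map (Pm F') kP y \<in> Qim'" if yQ: "y \<in> S.Qim" for y
  proof -
    obtain a b where ab: "a \<in> carrier (Qm F)" "b \<in> carrier (Qm F)" "y = gp_frac (Pm F) (S.eQ a) (S.eQ b)"
      using yQ by (auto elim!: S.Q.gp_cases simp: gp_map_frac[OF S.Q.comm_monoid_axioms S.P.comm_monoid_axioms S.eQ_hom])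
    have "gp_map (Pm F') kP y = gp_frac (Pm F') (T.eQ a) (T.eQ b)"
      using ab by (simp add: gp_map_frac[OF S.P.comm_monoid_axioms T.P.comm_monoid_axioms kP_hom] k_incl)
    also have "\<dots> = gp_map (Pm F') T.eQ (gp_frac (Qm F) a b)"
      using ab by (simp add: gp_map_frac[OF S.Q.comm_monoid_axioms T.P.comm_monoid_axioms T.eQ_hom])
    finally show ?thesis using ab by simp
  qed
  show ?thesis
    unfolding Pgp_mod_Qgp_map_def src_eq
  proof (rule FactGroup_UN[OF S.P.gp_comm_group S.Qim_subgroup assms])
    fix y assume y: "y \<in> carrier (gp (Pm F))" "y \<otimes>\<^bsub>gp (Pm F)\<^esub> inv\<^bsub>gp (Pm F)\<^esub> x \<in> S.Qim"
    from Qim[OF y(2)] show "Qim' #>\<^bsub>gp (Pm F')\<^esub> gp_map (Pm F') kP y = Qim' #>\<^bsub>gp (Pm F')\<^esub> gp_map (Pm F') kP x"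
      using y(1) assms by (subst FactGroup_eq_iff[OF T.P.gp_comm_group T.Qim_subgroup]) auto
  qed
qed

lemma kPQ_bar_p [simp]: "p \<in> carrier (Pm F) \<Longrightarrow> kPQ (bar_p F p) = bar_p F' (kP p)"
  by (simp add: bar_p_def kPQ_coset src_eq gp_map_frac[OF S.P.comm_monoid_axioms T.P.comm_monoid_axioms kP_hom])

lemma kPQ_hom: "kPQ \<in> hom S.PQ T.PQ"
proof (rule homI)
  note gh = gp_map_hom[OF S.P.comm_monoid_axioms T.P.comm_monoid_axioms kP_hom]
  fix x assume "x \<in> carrier S.PQ"
  then obtain x' where x: "x' \<in> carrier (gp (Pm F))" "x = S.Qim #>\<^bsub>gp (Pm F)\<^esub> x'"
    unfolding Pgp_mod_Qgp_def FactGroup_carrier_rcos by auto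
  have kx: "gp_map (Pm F') kP x' \<in> carrier (gp (Pm F'))" using gh x by (auto simp: hom_def)
  show "kPQ x \<in> carrier T.PQ"
    unfolding x(2) kPQ_coset[OF x(1)] using T.PQ_proj_hom kx by (auto simp: hom_def)
  fix y assume "y \<in> carrier S.PQ"
  then obtain y' where y: "y' \<in> carrier (gp (Pm F))" "y = S.Qim #>\<^bsub>gp (Pm F)\<^esub> y'"
    unfolding Pgp_mod_Qgp_def FactGroup_carrier_rcos by auto
  have ky: "gp_map (Pm F') kP y' \<in> carrier (gp (Pm F'))" using gh y by (auto simp: hom_def)
  have xy: "x' \<otimes>\<^bsub>gp (Pm F)\<^esub> y' \<in> carrier (gp (Pm F))"
    using x y monoid.m_closed[OF group.is_monoid[OF comm_group.axioms(2)[OF S.P.gp_comm_group]]] by blast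
  show "kPQ (x \<otimes>\<^bsub>S.PQ\<^esub> y) = kPQ x \<otimes>\<^bsub>T.PQ\<^esub> kPQ y"
    unfolding x(2) y(2) hom_mult[OF S.PQ_proj_hom x(1) y(1), symmetric] kPQ_coset[OF x(1)] kPQ_coset[OF y(1)]
      kPQ_coset[OF xy] hom_mult[OF gh x(1) y(1)] hom_mult[OF T.PQ_proj_hom kx ky] ..
qed

lemma kPQ_closed: "t \<in> carrier S.PQ \<Longrightarrow> kPQ t \<in> carrier T.PQ"
  using kPQ_hom by (auto simp: hom_def)

lemma BG_map:
  shows BG_map_hom: "BG_map F' k \<in> addhom (BG_mod F) (BG_mod F')"
    and BG_map_bar_p [simp]: "b \<in> carrier (Br F) \<Longrightarrow> p \<in> carrier (Pm F) \<Longrightarrow>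
      BG_map F' k (BG_tensor F b (bar_p F p)) = BG_tensor F' b (bar_p F' (kP p))"
proof -
  have u: "(\<lambda>t. BG_tensor F' \<one>\<^bsub>Br F\<^esub> (kPQ t)) \<in> hom S.PQ (add_monoid (BG_mod F'))"
    using hom_mult[OF kPQ_hom] kPQ_closed by (intro homI) (auto simp: T.BG_tensor_mult)
  have eq: "BG_tensor F' b (kPQ t) = b \<odot>\<^bsub>BG_mod F'\<^esub> BG_tensor F' \<one>\<^bsub>Br F\<^esub> (kPQ t)"
    if "b \<in> carrier (Br F)" "t \<in> carrier S.PQ" for b t
    using that kPQ_closed[OF that(2)] by (simp add: T.BG_smult)
  show "BG_map F' k \<in> addhom (BG_mod F) (BG_mod F')"
    unfolding BG_map_def by (rule S.BG_lift_hom[OF T.BG_module u eq])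
  show "BG_map F' k (BG_tensor F b (bar_p F p)) = BG_tensor F' b (bar_p F' (kP p))"
    if "b \<in> carrier (Br F)" "p \<in> carrier (Pm F)"
    unfolding BG_map_def using S.BG_lift_tensor[OF T.BG_module u eq, of b "bar_p F p"] that
    by (simp add: T.BG_smult)
qed

abbreviation "lpair \<equiv> \<lambda>(w, t). (BOmR_map F' k w, BG_map F' k t)"

lemma lpair_hom: "lpair \<in> addhom S.OG T.OG"
  by (rule addhom_map_prod[OF BOmR_map_hom BG_map_hom])

lemma lpair_rel:
  assumes "x \<in> S.rel2"
  shows "lpair x \<in> T.rel2"
  using assms
proof (induction rule: S.rel2_induct)
  case zero
  show ?case
    using addhom_zero[OF lpair_hom S.L.abelian_group_axioms T.L.abelian_group_axioms] T.L.K_zero by (simp only:)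
next
  case (gen b p)
  then have "lpair (S.gL b p) = T.gL b (kP p)"
    by (simp add: S.gL_def T.gL_def k_chart
        addhom_neg[OF BG_map_hom S.BGm.M.abelian_group_axioms T.BGm.M.abelian_group_axioms])
  then show ?case using gen by (simp add: T.gL_in_rel2)
next
  case (diff x y)
  have "lpair (x \<ominus>\<^bsub>S.OG\<^esub> y) = lpair x \<ominus>\<^bsub>T.OG\<^esub> lpair y"
    by (rule addhom_diff[OF lpair_hom S.L.abelian_group_axioms T.L.abelian_group_axioms])
      (rule S.L.K_closed[OF diff(1)] S.L.K_closed[OF diff(2)])+
  then show ?case using diff T.L.K_diff by (simp only:)
qed

lemma L_map_eq: "L_map F' k = (\<lambda>Z. \<Union>y\<in>Z. T.rel2 +>\<^bsub>T.OG\<^esub> lpair y)"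
  by (intro ext) (simp add: L_map_def T.L_class_eq case_prod_beta)

lemma L_map_hom: "L_map F' k \<in> addhom (L_mod F) (L_mod F')"
  using S.L.quot_map_hom[OF T.L.module_quotient_axioms lpair_hom lpair_rel]
  by (simp only: L_map_eq S.L_eq T.L_eq)

lemma L_map_class: "w \<in> carrier (BOmR_mod F) \<Longrightarrow> t \<in> carrier (BG_mod F) \<Longrightarrow>
    L_map F' k (L_class F w t) = L_class F' (BOmR_map F' k w) (BG_map F' k t)"
  using S.L.quot_map[OF T.L.module_quotient_axioms lpair_hom lpair_rel, of "(w, t)"]
  by (simp add: L_map_eq S.L_class_eq T.L_class_eq)

lemma L_map_lI [simp]: "b \<in> carrier (Br F) \<Longrightarrow> r \<in> carrier (Rr F) \<Longrightarrow> L_map F' k (S.lI b r) = T.lI b (kR r)"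
  using addhom_zero[OF BG_map_hom S.BGm.M.abelian_group_axioms T.BGm.M.abelian_group_axioms]
  by (simp add: S.lI_def T.lI_def L_map_class)

lemma L_map_lT [simp]: "b \<in> carrier (Br F) \<Longrightarrow> p \<in> carrier (Pm F) \<Longrightarrow> L_map F' k (S.lT b p) = T.lT b (kP p)"
  using addhom_zero[OF BOmR_map_hom S.OB.M.abelian_group_axioms T.OB.M.abelian_group_axioms]
  by (simp add: S.lT_def T.lT_def L_map_class)

text \<open>
  On the generators, both composites replace \<open>dI\<close> and \<open>dT\<close> by \<open>lI\<close> and \<open>lT\<close> and apply \<open>k\<close> to the argument.
\<close>

lemma D1_to_L_natural:
  assumes "x \<in> carrier S.DB"
  shows "T.D1_to_L (D1_map F' k x) = L_map F' k (S.D1_to_L x)"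
  by (rule S.DB_hom_eq[OF addhom_comp[OF D1_map_hom T.D1_to_L_hom] addhom_comp[OF S.D1_to_L_hom L_map_hom]
        T.Lm.M.abelian_group_axioms assms])
    simp_all

lemma L_map_lin: "L_map F' k \<in> lin_maps (Br F) (L_mod F) (L_mod F')"
proof (rule lin_mapsI[OF L_map_hom])
  fix a x assume a: "a \<in> carrier (Br F)" and "x \<in> carrier (L_mod F)"
  then obtain y where y: "y \<in> carrier S.DB" "x = S.D1_to_L y" using S.D1_to_L_surj by blast
  have cl: "a \<odot>\<^bsub>S.DB\<^esub> y \<in> carrier S.DB" "D1_map F' k y \<in> carrier T.DB"
    using S.DB.smult_closed[OF a y(1)] addhom_closed[OF D1_map_hom y(1)] by simp_all
  show "L_map F' k (a \<odot>\<^bsub>L_mod F\<^esub> x) = a \<odot>\<^bsub>L_mod F'\<^esub> L_map F' k x"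
    unfolding y(2) lin_maps_smult[OF S.D1_to_L_lin a y(1), symmetric] D1_to_L_natural[OF y(1), symmetric]
      D1_to_L_natural[OF cl(1), symmetric] lin_maps_smult[OF D1_map_lin a y(1)] lin_maps_smult[OF T.D1_to_L_lin a cl(2)] ..
qed

end

section \<open>The spectral sequence of a two-step filtration\<close>

lemma submodule_subset: "submodule Z A M \<Longrightarrow> Z \<subseteq> carrier M"
  using subgroup.subset[OF submodule_subgroup] by simp

lemma submodule_mem: "submodule Z A M \<Longrightarrow> x \<in> Z \<Longrightarrow> x \<in> carrier M"
  using submodule_subset by blast

lemma submodule_zero: "submodule Z A M \<Longrightarrow> \<zero>\<^bsub>M\<^esub> \<in> Z"
  using subgroup.one_closed[OF submodule_subgroup] by simp

lemma submodule_add: "submodule Z A M \<Longrightarrow> x \<in> Z \<Longrightarrow> y \<in> Z \<Longrightarrow> x \<oplus>\<^bsub>M\<^esub> y \<in> Z"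
  using subgroup.m_closed[OF submodule_subgroup] by simp

lemma submodule_diff: "submodule Z A M \<Longrightarrow> x \<in> Z \<Longrightarrow> y \<in> Z \<Longrightarrow> x \<ominus>\<^bsub>M\<^esub> y \<in> Z"
  using subgroup.m_inv_closed[OF submodule_subgroup, of Z A M y] by (simp add: a_minus_def a_inv_def submodule_add)

lemma submoduleI_diff:
  assumes "module A M" "Z \<subseteq> carrier M" "\<zero>\<^bsub>M\<^esub> \<in> Z" "\<And>x y. x \<in> Z \<Longrightarrow> y \<in> Z \<Longrightarrow> x \<ominus>\<^bsub>M\<^esub> y \<in> Z"
    "\<And>a x. a \<in> carrier A \<Longrightarrow> x \<in> Z \<Longrightarrow> a \<odot>\<^bsub>M\<^esub> x \<in> Z"
  shows "submodule Z A M"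
proof (rule module.submoduleI[OF assms(1,2,3) _ _ assms(5)])
  interpret M: module A M by fact
  show n: "\<ominus>\<^bsub>M\<^esub> x \<in> Z" if "x \<in> Z" for x
    using assms(4)[OF assms(3) that] that assms(2) by (auto simp: M.minus_eq)
  show "x \<oplus>\<^bsub>M\<^esub> y \<in> Z" if "x \<in> Z" "y \<in> Z" for x y
    using assms(4)[OF that(1) n[OF that(2)]] that assms(2) by (auto simp: M.minus_eq)
qed

lemma submodule_image:
  assumes "module A M" "module A N" "f \<in> lin_maps A M N" "submodule Z A M"
  shows "submodule (f ` Z) A N"
proof (rule submoduleI_diff[OF assms(2)])
  interpret M: module A M by fact
  interpret N: module A N by fact
  note f = lin_maps_addhom[OF assms(3)]
  note mem = submodule_mem[OF assms(4)]
  show "f ` Z \<subseteq> carrier N" using addhom_closed[OF f] mem by blast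
  show "\<zero>\<^bsub>N\<^esub> \<in> f ` Z"
    using addhom_zero[OF f M.abelian_group_axioms N.abelian_group_axioms] submodule_zero[OF assms(4)] by (metis imageI)
  show "x \<ominus>\<^bsub>N\<^esub> y \<in> f ` Z" if "x \<in> f ` Z" "y \<in> f ` Z" for x y
    using that addhom_diff[OF f M.abelian_group_axioms N.abelian_group_axioms] submodule_diff[OF assms(4)] mem
    by (smt (verit) image_iff)
  show "a \<odot>\<^bsub>N\<^esub> x \<in> f ` Z" if "a \<in> carrier A" "x \<in> f ` Z" for a x
    using that lin_maps_smult[OF assms(3)] submodule_smult[OF assms(4)] mem by (smt (verit) image_iff)
qed

lemma submodule_vimage:
  assumes "module A M" "module A N" "f \<in> lin_maps A M N" "submodule Z A N"
  shows "submodule {x \<in> carrier M. f x \<in> Z} A M"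
proof (rule submoduleI_diff[OF assms(1)])
  interpret M: module A M by fact
  interpret N: module A N by fact
  note f = lin_maps_addhom[OF assms(3)]
  show "\<zero>\<^bsub>M\<^esub> \<in> {x \<in> carrier M. f x \<in> Z}"
    using addhom_zero[OF f M.abelian_group_axioms N.abelian_group_axioms] submodule_zero[OF assms(4)] by simp
qed (use assms addhom_diff[OF lin_maps_addhom[OF assms(3)] module_abelian[OF assms(1)] module_abelian[OF assms(2)]] in
  \<open>auto simp: submodule_diff submodule_smult lin_maps_smult module.smult_closed abelian_group.minus_closed module_abelian\<close>)

lemma submodule_Int: "module A M \<Longrightarrow> submodule Z A M \<Longrightarrow> submodule W A M \<Longrightarrow> submodule (Z \<inter> W) A M"
  by (rule submoduleI_diff) (auto simp: submodule_zero submodule_diff submodule_smult submodule_mem)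

lemma submodule_zero_module: "module A M \<Longrightarrow> submodule {\<zero>\<^bsub>M\<^esub>} A M"
proof -
  assume M: "module A M"
  interpret module A M by fact
  show ?thesis by (rule submoduleI_diff[OF M]) (auto simp: M.minus_eq)
qed

lemma submodule_carrier: "module A M \<Longrightarrow> submodule (carrier M) A M"
  by (rule module.carrier_is_submodule)

definition sum_sub :: "('a, 'm) module \<Rightarrow> 'm set \<Rightarrow> 'm set \<Rightarrow> 'm set" where
  "sum_sub M Z W = {x \<oplus>\<^bsub>M\<^esub> y | x y. x \<in> Z \<and> y \<in> W}"

lemma submodule_sum:
  assumes "module A M" "submodule Z A M" "submodule W A M"
  shows "submodule (sum_sub M Z W) A M"
proof (rule submoduleI_diff[OF assms(1)])
  interpret M: module A M by fact
  note mem = submodule_mem[OF assms(2)] submodule_mem[OF assms(3)]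
  show "sum_sub M Z W \<subseteq> carrier M" using mem by (auto simp: sum_sub_def)
  show "\<zero>\<^bsub>M\<^esub> \<in> sum_sub M Z W"
    using submodule_zero[OF assms(2)] submodule_zero[OF assms(3)] M.l_zero[OF M.zero_closed] unfolding sum_sub_def by force
  show "u \<ominus>\<^bsub>M\<^esub> v \<in> sum_sub M Z W" if uv: "u \<in> sum_sub M Z W" "v \<in> sum_sub M Z W" for u v
  proof -
    obtain x y x' y' where *: "u = x \<oplus>\<^bsub>M\<^esub> y" "v = x' \<oplus>\<^bsub>M\<^esub> y'" "x \<in> Z" "x' \<in> Z" "y \<in> W" "y' \<in> W"
      using uv unfolding sum_sub_def by auto
    have "u \<ominus>\<^bsub>M\<^esub> v = (x \<ominus>\<^bsub>M\<^esub> x') \<oplus>\<^bsub>M\<^esub> (y \<ominus>\<^bsub>M\<^esub> y')"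
      unfolding * using * mem by (intro M.four_diff) auto
    then show ?thesis unfolding sum_sub_def using submodule_diff[OF assms(2)] submodule_diff[OF assms(3)] * by blast
  qed
  show "a \<odot>\<^bsub>M\<^esub> u \<in> sum_sub M Z W" if a: "a \<in> carrier A" and u: "u \<in> sum_sub M Z W" for a u
  proof -
    obtain x y where *: "u = x \<oplus>\<^bsub>M\<^esub> y" "x \<in> Z" "y \<in> W" using u unfolding sum_sub_def by auto
    have "a \<odot>\<^bsub>M\<^esub> u = a \<odot>\<^bsub>M\<^esub> x \<oplus>\<^bsub>M\<^esub> a \<odot>\<^bsub>M\<^esub> y" unfolding * using * a mem by (simp add: M.smult_r_distr)
    then show ?thesis unfolding sum_sub_def using submodule_smult[OF assms(2) a] submodule_smult[OF assms(3) a] * by blast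
  qed
qed

lemma sum_subI_left: "module A M \<Longrightarrow> submodule W A M \<Longrightarrow> Z \<subseteq> carrier M \<Longrightarrow> x \<in> Z \<Longrightarrow> x \<in> sum_sub M Z W"
proof -
  assume *: "module A M" "submodule W A M" "Z \<subseteq> carrier M" "x \<in> Z"
  interpret module A M by fact
  have "x = x \<oplus>\<^bsub>M\<^esub> \<zero>\<^bsub>M\<^esub>" using * by auto
  then show ?thesis using * submodule_zero[OF *(2)] unfolding sum_sub_def by blast
qed

lemma sum_subI_right: "module A M \<Longrightarrow> submodule Z A M \<Longrightarrow> W \<subseteq> carrier M \<Longrightarrow> x \<in> W \<Longrightarrow> x \<in> sum_sub M Z W"
proof -
  assume *: "module A M" "submodule Z A M" "W \<subseteq> carrier M" "x \<in> W"
  interpret module A M by fact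
  have "x = \<zero>\<^bsub>M\<^esub> \<oplus>\<^bsub>M\<^esub> x" using * by auto
  then show ?thesis using * submodule_zero[OF *(2)] unfolding sum_sub_def by blast
qed

subsection \<open>Subquotients\<close>

text \<open>Both modules are \<open>Y\<close> modulo the common kernel, and \<open>u y \<mapsto> v y\<close> is the isomorphism.\<close>

lemma module_iso_same_kernel:
  assumes Y: "module A Y" and X1: "module A X1" and X2: "module A X2"
    and u: "u \<in> lin_maps A Y X1" "u ` carrier Y = carrier X1"
    and v: "v \<in> lin_maps A Y X2" "v ` carrier Y = carrier X2"
    and ker: "\<And>y. y \<in> carrier Y \<Longrightarrow> u y = \<zero>\<^bsub>X1\<^esub> \<longleftrightarrow> v y = \<zero>\<^bsub>X2\<^esub>"
  shows "module_iso A X1 X2"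
proof -
  interpret Y: module A Y by fact
  interpret X1: module A X1 by fact
  interpret X2: module A X2 by fact
  note uh = lin_maps_addhom[OF u(1)] and vh = lin_maps_addhom[OF v(1)]
  note uc = addhom_closed[OF uh] and vc = addhom_closed[OF vh]
  have eq: "u y = u z \<longleftrightarrow> v y = v z" if yz: "y \<in> carrier Y" "z \<in> carrier Y" for y z
  proof -
    have "u y = u z \<longleftrightarrow> u (y \<ominus>\<^bsub>Y\<^esub> z) = \<zero>\<^bsub>X1\<^esub>"
      unfolding addhom_diff[OF uh Y.abelian_group_axioms X1.abelian_group_axioms yz]
      using X1.diff_zero_iff[OF uc[OF yz(1)] uc[OF yz(2)]] by blast
    also have "\<dots> \<longleftrightarrow> v (y \<ominus>\<^bsub>Y\<^esub> z) = \<zero>\<^bsub>X2\<^esub>" using yz by (intro ker) simp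
    also have "\<dots> \<longleftrightarrow> v y = v z"
      unfolding addhom_diff[OF vh Y.abelian_group_axioms X2.abelian_group_axioms yz]
      using X2.diff_zero_iff[OF vc[OF yz(1)] vc[OF yz(2)]] by blast
    finally show ?thesis .
  qed
  define s where "s x = (SOME y. y \<in> carrier Y \<and> u y = x)" for x
  have s: "s x \<in> carrier Y \<and> u (s x) = x" if "x \<in> carrier X1" for x
  proof -
    have "x \<in> u ` carrier Y" unfolding u(2) by (rule that)
    then have "\<exists>y. y \<in> carrier Y \<and> u y = x" by blast
    then show ?thesis unfolding s_def by (rule someI_ex)
  qed
  let ?f = "\<lambda>x. v (s x)"
  have f: "?f (u y) = v y" if y: "y \<in> carrier Y" for y
  proof -
    note sy = s[OF uc[OF y]]
    show ?thesis using eq[OF conjunct1[OF sy] y] conjunct2[OF sy] by (rule iffD1)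
  qed
  have sY: "\<exists>y. y \<in> carrier Y \<and> x = u y" if "x \<in> carrier X1" for x
    using s[OF that] by metis
  have "?f \<in> lin_maps A X1 X2"
  proof (rule lin_mapsI[OF addhomI])
    fix x assume "x \<in> carrier X1" then show "?f x \<in> carrier X2" using s vc by blast
  next
    fix x x' assume "x \<in> carrier X1" "x' \<in> carrier X1"
    then obtain y y' where y: "y \<in> carrier Y" "x = u y" "y' \<in> carrier Y" "x' = u y'" using sY by meson
    have "?f (u (y \<oplus>\<^bsub>Y\<^esub> y')) = v (y \<oplus>\<^bsub>Y\<^esub> y')" using y by (intro f) simp
    then show "?f (x \<oplus>\<^bsub>X1\<^esub> x') = ?f x \<oplus>\<^bsub>X2\<^esub> ?f x'"
      unfolding y(2,4) addhom_add[OF uh y(1,3)] addhom_add[OF vh y(1,3)] f[OF y(1)] f[OF y(3)] .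
  next
    fix a x assume a: "a \<in> carrier A" and "x \<in> carrier X1"
    then obtain y where y: "y \<in> carrier Y" "x = u y" using sY by meson
    have "?f (u (a \<odot>\<^bsub>Y\<^esub> y)) = v (a \<odot>\<^bsub>Y\<^esub> y)" using y a by (intro f) simp
    then show "?f (a \<odot>\<^bsub>X1\<^esub> x) = a \<odot>\<^bsub>X2\<^esub> ?f x"
      unfolding y(2) lin_maps_smult[OF u(1) a y(1)] lin_maps_smult[OF v(1) a y(1)] f[OF y(1)] .
  qed
  moreover have "bij_betw ?f (carrier X1) (carrier X2)"
    unfolding bij_betw_def
  proof
    show "inj_on ?f (carrier X1)"
    proof (rule inj_onI)
      fix x x' assume x: "x \<in> carrier X1" "x' \<in> carrier X1" "?f x = ?f x'"
      note sx = s[OF x(1)] s[OF x(2)]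
      show "x = x'" using eq[OF conjunct1[OF sx(1)] conjunct1[OF sx(2)]] x(3) sx by simp
    qed
    show "?f ` carrier X1 = carrier X2"
    proof
      show "?f ` carrier X1 \<subseteq> carrier X2" using s vc by auto
      show "carrier X2 \<subseteq> ?f ` carrier X1"
      proof
        fix z assume "z \<in> carrier X2"
        then have "z \<in> v ` carrier Y" unfolding v(2) .
        then obtain y where y: "y \<in> carrier Y" "z = v y" by blast
        show "z \<in> ?f ` carrier X1" unfolding y(2) f[OF y(1), symmetric] using uc[OF y(1)] by (rule imageI)
      qed
    qed
  qed
  ultimately show ?thesis unfolding module_iso_def by blast
qed

locale subquotient = M: module A M for A :: "('a, 'z) ring_scheme" and M :: "('a, 'm) module" +
  fixes Z W
  assumes Z: "submodule Z A M" and W: "submodule W A M" and WZ: "W \<subseteq> Z"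
begin

abbreviation "SQ \<equiv> subquot_module M Z W"
abbreviation "MZ \<equiv> M\<lparr>carrier := Z\<rparr>"
abbreviation "pr \<equiv> \<lambda>x. W +>\<^bsub>M\<^esub> x"

lemma MZ_module: "module A MZ" by (rule module_sub[OF M.module_axioms Z])

lemma MZ_simps [simp]: "carrier MZ = Z" "x \<oplus>\<^bsub>MZ\<^esub> y = x \<oplus>\<^bsub>M\<^esub> y" "\<zero>\<^bsub>MZ\<^esub> = \<zero>\<^bsub>M\<^esub>" "a \<odot>\<^bsub>MZ\<^esub> x = a \<odot>\<^bsub>M\<^esub> x"
  by simp_all

lemma MZ_neg: "x \<in> Z \<Longrightarrow> \<ominus>\<^bsub>MZ\<^esub> x = \<ominus>\<^bsub>M\<^esub> x" by (rule a_inv_sub[OF M.module_axioms Z])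

lemma MZ_diff: "y \<in> Z \<Longrightarrow> x \<ominus>\<^bsub>MZ\<^esub> y = x \<ominus>\<^bsub>M\<^esub> y" by (simp add: a_minus_def MZ_neg)

lemma W_sub: "submodule W A MZ"
  by (rule submoduleI_diff[OF MZ_module])
    (use WZ submodule_zero[OF W] submodule_diff[OF W] submodule_smult[OF W] in \<open>auto simp: MZ_diff\<close>)

lemma pr_eq: "W +>\<^bsub>MZ\<^esub> x = pr x"
  by (simp add: a_r_coset_def r_coset_def)

sublocale q: module_quotient MZ W by (rule submodule_quotient[OF MZ_module W_sub])

lemma SQ_module: "module A SQ"
  unfolding subquot_module_def by (rule module_quot_module[OF MZ_module W_sub])

lemma SQ_carrier: "carrier SQ = pr ` Z"
  using q.quot_carrier by (simp add: subquot_module_def pr_eq)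

lemma pr_lin: "pr \<in> lin_maps A MZ SQ"
  using lin_mapsI[OF q.quot_hom, of A] quot_module_smult[OF MZ_module W_sub]
  by (simp add: subquot_module_def pr_eq)

lemma pr_lin_on: "Y \<subseteq> Z \<Longrightarrow> pr \<in> lin_maps A (M\<lparr>carrier := Y\<rparr>) SQ"
proof (rule lin_mapsI[OF addhomI])
  note h = lin_maps_addhom[OF pr_lin] 
  assume Y: "Y \<subseteq> Z"
  show "pr x \<in> carrier SQ" if "x \<in> carrier (M\<lparr>carrier := Y\<rparr>)" for x
    using addhom_closed[OF h, of x] that Y by auto
  show "pr (x \<oplus>\<^bsub>M\<lparr>carrier := Y\<rparr>\<^esub> y) = pr x \<oplus>\<^bsub>SQ\<^esub> pr y"
    if "x \<in> carrier (M\<lparr>carrier := Y\<rparr>)" "y \<in> carrier (M\<lparr>carrier := Y\<rparr>)" for x y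
    using addhom_add[OF h, of x y] that Y by auto
  show "pr (a \<odot>\<^bsub>M\<lparr>carrier := Y\<rparr>\<^esub> x) = a \<odot>\<^bsub>SQ\<^esub> pr x"
    if "a \<in> carrier A" "x \<in> carrier (M\<lparr>carrier := Y\<rparr>)" for a x
    using lin_maps_smult[OF pr_lin that(1), of x] that Y by auto
qed

lemma pr_zero_iff: "x \<in> Z \<Longrightarrow> pr x = \<zero>\<^bsub>SQ\<^esub> \<longleftrightarrow> x \<in> W"
  using q.quot_zero_iff[of x] by (simp add: subquot_module_def pr_eq)

lemma pr_eq_iff: "x \<in> Z \<Longrightarrow> y \<in> Z \<Longrightarrow> pr x = pr y \<longleftrightarrow> x \<ominus>\<^bsub>M\<^esub> y \<in> W"
  using q.quot_eq_iff[of x y] by (simp add: pr_eq MZ_diff)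

lemma pr_closed: "x \<in> Z \<Longrightarrow> pr x \<in> carrier SQ" by (simp add: SQ_carrier)

lemma pr_UN:
  assumes "x \<in> Z" "\<And>y. y \<in> Z \<Longrightarrow> y \<ominus>\<^bsub>M\<^esub> x \<in> W \<Longrightarrow> f y = f x"
  shows "(\<Union>y\<in>pr x. f y) = f x"
  using q.quot_UN[of x f] assms by (simp add: pr_eq MZ_diff)

lemma pr_submodule:
  assumes "submodule Y A M" "Y \<subseteq> Z"
  shows "submodule (pr ` Y) A SQ"
proof (rule submodule_image[OF MZ_module SQ_module pr_lin])
  show "submodule Y A MZ"
    by (rule submoduleI_diff[OF MZ_module])
      (use assms submodule_zero[OF assms(1)] submodule_diff[OF assms(1)] submodule_smult[OF assms(1)] in \<open>auto simp: MZ_diff\<close>)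
qed

end

lemma subquot_zero_module:
  assumes "module A M" "submodule Z A M"
  shows "zero_module (subquot_module M Z Z)"
proof -
  interpret subquotient A M Z Z
    using assms by (simp add: subquotient_def subquotient_axioms_def)
  have "carrier SQ = {\<zero>\<^bsub>SQ\<^esub>}"
    using pr_zero_iff submodule_zero[OF Z] by (auto simp: SQ_carrier image_iff)
  then show ?thesis by (simp add: zero_module_def)
qed

lemma module_iso_zero:
  assumes "module A M" "module A N" "zero_module M" "zero_module N"
  shows "module_iso A M N"
proof -
  interpret M: module A M by fact
  interpret N: module A N by fact
  have "(\<lambda>x. \<zero>\<^bsub>N\<^esub>) \<in> lin_maps A M N"
    by (rule lin_mapsI[OF addhom_const_zero[OF N.abelian_group_axioms]]) simp
  moreover have "bij_betw (\<lambda>x. \<zero>\<^bsub>N\<^esub>) (carrier M) (carrier N)"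
    using assms(3,4) by (simp add: zero_module_def bij_betw_def)
  ultimately show ?thesis unfolding module_iso_def by blast
qed

text \<open>
  Both sides receive a surjection from \<open>Y\<close>, by \<open>s1\<close> and \<open>s2\<close>, and by \<open>ker\<close> the two surjections have the
  same kernel.  The identification of each page with the homology of the previous one, and that of
  the limit page with the graded pieces of the abutment, have this form.
\<close>

lemma (in subquotient) nested_iso:
  assumes 1: "subquotient A M Z1 W1" and 2: "subquotient A M Z' W'" and Z': "Z' \<subseteq> Z"
    and Y: "submodule Y A M" "Y \<subseteq> Z1" "Y \<subseteq> Z'"
    and s1: "\<And>z. z \<in> Z1 \<Longrightarrow> \<exists>y\<in>Y. z \<ominus>\<^bsub>M\<^esub> y \<in> W1"
    and s2: "\<And>z. z \<in> Z' \<Longrightarrow> \<exists>y\<in>Y. z \<ominus>\<^bsub>M\<^esub> y \<in> W'"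
    and ker: "\<And>y. y \<in> Y \<Longrightarrow> y \<in> W1 \<longleftrightarrow> (\<exists>w\<in>W'. y \<ominus>\<^bsub>M\<^esub> w \<in> W)"
  shows "module_iso A (subquot_module M Z1 W1) (subquot_module SQ (pr ` Z') (pr ` W'))"
proof -
  interpret s1: subquotient A M Z1 W1 by fact
  interpret s2: subquotient A M Z' W' by fact
  interpret n: subquotient A SQ "pr ` Z'" "pr ` W'"
    using SQ_module pr_submodule[OF s2.Z Z'] pr_submodule[OF s2.W] s2.WZ Z'
    by (auto simp: subquotient_def subquotient_axioms_def)
  have Yc: "y \<in> Z" "y \<in> Z1" "y \<in> Z'" if "y \<in> Y" for y using that Y Z' by auto
  let ?Y = "M\<lparr>carrier := Y\<rparr>"
  have prY: "pr y \<in> pr ` Z'" if "y \<in> Y" for y using Yc that by simp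
  show ?thesis
  proof (rule module_iso_same_kernel[where Y = ?Y and u = s1.pr and v = "\<lambda>y. n.pr (pr y)"])
    show "module A ?Y" by (rule module_sub[OF M.module_axioms Y(1)])
    show "s1.pr \<in> lin_maps A ?Y s1.SQ"
      by (rule s1.pr_lin_on[OF Y(2)])
    show "(\<lambda>y. n.pr (pr y)) \<in> lin_maps A ?Y n.SQ"
    proof (rule lin_mapsI[OF addhomI])
      fix x y assume "x \<in> carrier ?Y" "y \<in> carrier ?Y"
      then show "n.pr (pr (x \<oplus>\<^bsub>?Y\<^esub> y)) = n.pr (pr x) \<oplus>\<^bsub>n.SQ\<^esub> n.pr (pr y)"
        using addhom_add[OF lin_maps_addhom[OF pr_lin], of x y] addhom_add[OF lin_maps_addhom[OF n.pr_lin], of "pr x" "pr y"]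
          Yc prY by simp
    next
      fix a x assume "a \<in> carrier A" "x \<in> carrier ?Y"
      then show "n.pr (pr (a \<odot>\<^bsub>?Y\<^esub> x)) = a \<odot>\<^bsub>n.SQ\<^esub> n.pr (pr x)"
        using lin_maps_smult[OF pr_lin, of a x] lin_maps_smult[OF n.pr_lin, of a "pr x"] Yc prY by simp
    qed (use n.pr_closed prY in simp)
    show "s1.pr ` carrier ?Y = carrier s1.SQ"
      unfolding s1.SQ_carrier using s1 s1.pr_eq_iff Yc by (auto simp: image_iff)
    show "(\<lambda>y. n.pr (pr y)) ` carrier ?Y = carrier n.SQ"
    proof -
      have "n.pr (pr z) \<in> (\<lambda>y. n.pr (pr y)) ` Y" if z: "z \<in> Z'" for z
      proof -
        obtain y where y: "y \<in> Y" "z \<ominus>\<^bsub>M\<^esub> y \<in> W'" using s2[OF z] by blast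
        have "pr z \<ominus>\<^bsub>SQ\<^esub> pr y = pr (z \<ominus>\<^bsub>M\<^esub> y)"
          using addhom_diff[OF lin_maps_addhom[OF pr_lin] q.abelian_group_axioms module_abelian[OF SQ_module], of z y] z y Yc Z'
          by (auto simp: MZ_diff)
        then have "n.pr (pr z) = n.pr (pr y)" using z y prY by (subst n.pr_eq_iff) auto
        then show ?thesis using y by blast
      qed
      then show ?thesis unfolding n.SQ_carrier using prY by auto
    qed
    show "s1.pr y = \<zero>\<^bsub>s1.SQ\<^esub> \<longleftrightarrow> n.pr (pr y) = \<zero>\<^bsub>n.SQ\<^esub>" if "y \<in> carrier ?Y" for y
    proof -
      have y: "y \<in> Y" using that by simp
      have "n.pr (pr y) = \<zero>\<^bsub>n.SQ\<^esub> \<longleftrightarrow> (\<exists>w\<in>W'. pr y = pr w)"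
        using n.pr_zero_iff[OF prY[OF y]] by auto
      also have "\<dots> \<longleftrightarrow> (\<exists>w\<in>W'. y \<ominus>\<^bsub>M\<^esub> w \<in> W)"
        using pr_eq_iff[OF Yc(1)[OF y]] s2.WZ Z' by (intro bex_cong refl) auto
      finally show ?thesis using s1.pr_zero_iff[OF Yc(2)[OF y]] ker[OF y] by simp
    qed
  qed (use s1.SQ_module n.SQ_module in auto)
qed

lemma subquotientI:
  "module A M \<Longrightarrow> submodule Z A M \<Longrightarrow> submodule W A M \<Longrightarrow> W \<subseteq> Z \<Longrightarrow> subquotient A M Z W"
  by (simp add: subquotient_def subquotient_axioms_def)

lemma (in subquotient) third_isomorphism:
  assumes Z': "submodule Z' A M" "Z' \<subseteq> Z" and W': "submodule W' A M" "W \<subseteq> W'" "W' \<subseteq> Z'"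
  shows "module_iso A (subquot_module M Z' W') (subquot_module SQ (pr ` Z') (pr ` W'))"
proof (rule nested_iso[OF _ _ Z'(2), where Y = Z'])
  show sq: "subquotient A M Z' W'" "subquotient A M Z' W'"
    using M.module_axioms Z'(1) W'(1,3) by (blast intro: subquotientI)+
  have d: "z \<ominus>\<^bsub>M\<^esub> z = \<zero>\<^bsub>M\<^esub>" if "z \<in> Z'" for z
    using submodule_mem[OF Z'(1) that] by (simp add: M.minus_eq M.r_neg)
  show s: "\<exists>y\<in>Z'. z \<ominus>\<^bsub>M\<^esub> y \<in> W'" if "z \<in> Z'" for z
    by (rule bexI[OF _ that]) (simp only: d[OF that] submodule_zero[OF W'(1)])
  show "\<exists>y\<in>Z'. z \<ominus>\<^bsub>M\<^esub> y \<in> W'" if "z \<in> Z'" for z by (rule s[OF that])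
  show "y \<in> W' \<longleftrightarrow> (\<exists>w\<in>W'. y \<ominus>\<^bsub>M\<^esub> w \<in> W)" if y: "y \<in> Z'" for y
  proof
    assume "y \<in> W'" then show "\<exists>w\<in>W'. y \<ominus>\<^bsub>M\<^esub> w \<in> W"
      using d[OF y] submodule_zero[OF W] by force
  next
    assume "\<exists>w\<in>W'. y \<ominus>\<^bsub>M\<^esub> w \<in> W"
    then obtain w where w: "w \<in> W'" "y \<ominus>\<^bsub>M\<^esub> w \<in> W'" using W'(2) by blast
    have "y = (y \<ominus>\<^bsub>M\<^esub> w) \<oplus>\<^bsub>M\<^esub> w"
      using submodule_mem[OF Z'(1) y] submodule_mem[OF W'(1) w(1)] by (simp add: M.minus_eq M.a_assoc M.l_neg)
    then show "y \<in> W'" using submodule_add[OF W'(1) w(2,1)] by simp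
  qed
qed (use Z' in auto)

text \<open>
  A surjection of complexes whose kernel \<open>K\<close> has no homology in degrees \<open>0\<close> and \<open>1\<close>: in degree \<open>0\<close>
  because \<open>D\<close> vanishes there, in degree \<open>1\<close> because every element of \<open>K\<close> bounds in \<open>K\<close>.
\<close>

locale chain_surjection =
  fixes A :: "('a, 'z) ring_scheme" and D :: "('a, 'm) smodule" and L :: "('a, 'k) smodule"
    and g :: "nat \<Rightarrow> 'm \<Rightarrow> 'k"
  assumes D_module: "module A (obj D n)" and L_module: "module A (obj L n)"
    and D_bd: "boundary D (Suc n) \<in> lin_maps A (obj D (Suc n)) (obj D n)"
    and L_bd: "boundary L (Suc n) \<in> lin_maps A (obj L (Suc n)) (obj L n)"
    and D_bd_bd: "x \<in> carrier (obj D (Suc (Suc n))) \<Longrightarrow> boundary D (Suc n) (boundary D (Suc (Suc n)) x) = \<zero>\<^bsub>obj D n\<^esub>"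
    and g_lin: "g n \<in> lin_maps A (obj D n) (obj L n)"
    and g_surj: "g n ` carrier (obj D n) = carrier (obj L n)"
    and g_bd: "x \<in> carrier (obj D (Suc n)) \<Longrightarrow> g n (boundary D (Suc n) x) = boundary L (Suc n) (g (Suc n) x)"
    and D_zero: "carrier (obj D 0) = {\<zero>\<^bsub>obj D 0\<^esub>}"
    and kernel_1: "x \<in> carrier (obj D 1) \<Longrightarrow> g 1 x = \<zero>\<^bsub>obj L 1\<^esub> \<Longrightarrow>
      \<exists>y\<in>carrier (obj D 2). g 2 y = \<zero>\<^bsub>obj L 2\<^esub> \<and> boundary D 2 y = x"
begin

abbreviation "M \<equiv> obj D"
abbreviation "bd \<equiv> boundary D"

text \<open>
  In the notions below, an index \<open>m\<close> refers to degree \<open>m + 1\<close>: as \<open>D\<close> vanishes in degree \<open>0\<close>, everything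
  of interest happens in positive degrees.  The chains in \<open>pre m\<close> are the lifts of cycles of \<open>L\<close>.
  The homology of \<open>L\<close> is \<open>pre m\<close> modulo \<open>bdsK m\<close>, that of \<open>K\<close> is \<open>cK m\<close> modulo \<open>bdK m\<close>.
\<close>

definition "K n = {x \<in> carrier (M n). g n x = \<zero>\<^bsub>obj L n\<^esub>}"
definition "cyc m = {x \<in> carrier (M (Suc m)). bd (Suc m) x = \<zero>\<^bsub>M m\<^esub>}"
definition "pre m = {x \<in> carrier (M (Suc m)). bd (Suc m) x \<in> K m}"
definition "bds m = bd (Suc (Suc m)) ` carrier (M (Suc (Suc m)))"
definition "bdK m = bd (Suc (Suc m)) ` K (Suc (Suc m))"
definition "cK m = cyc m \<inter> K (Suc m)"
definition "bK m = bds m \<inter> K (Suc m)"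
definition "cycK m = sum_sub (M (Suc m)) (cyc m) (K (Suc m))"
definition "bdsK m = sum_sub (M (Suc m)) (bds m) (K (Suc m))"

sublocale M: module A "M n" for n by (rule D_module)
sublocale LL: module A "obj L n" for n by (rule L_module)

lemmas ab = M.abelian_group_axioms LL.abelian_group_axioms
lemmas bd_hom = lin_maps_addhom[OF D_bd]
lemmas g_hom = lin_maps_addhom[OF g_lin]
lemmas bd_closed [simp] = addhom_closed[OF bd_hom]
lemmas g_closed [simp] = addhom_closed[OF g_hom]
lemmas g_zero [simp] = addhom_zero[OF g_hom ab]
lemmas bd_zero [simp] = addhom_zero[OF bd_hom ab(1,1)]
lemmas g_diff = addhom_diff[OF g_hom ab]
lemmas bd_diff = addhom_diff[OF bd_hom ab(1,1)]
lemmas bd_add = addhom_add[OF bd_hom]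

lemma M_cancel_left:
  "c \<in> carrier (M n) \<Longrightarrow> k \<in> carrier (M n) \<Longrightarrow> c \<oplus>\<^bsub>M n\<^esub> k \<ominus>\<^bsub>M n\<^esub> c = k"
  by (subst M.a_comm) (simp_all add: M.minus_eq M.a_assoc M.r_neg)

lemma K_sub: "submodule (K n) A (M n)"
  using submodule_vimage[OF D_module L_module g_lin submodule_zero_module[OF L_module]] by (simp add: K_def)

lemmas K_carrier = submodule_mem[OF K_sub]

lemma bd_K: "x \<in> K (Suc n) \<Longrightarrow> bd (Suc n) x \<in> K n"
  using addhom_zero[OF lin_maps_addhom[OF L_bd] ab(2,2)] by (simp add: K_def g_bd)

lemma cyc_sub: "submodule (cyc m) A (M (Suc m))"
  using submodule_vimage[OF D_module D_module D_bd submodule_zero_module[OF D_module]] by (simp add: cyc_def)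

lemma pre_sub: "submodule (pre m) A (M (Suc m))"
  using submodule_vimage[OF D_module D_module D_bd K_sub] by (simp add: pre_def)

lemma bds_sub: "submodule (bds m) A (M (Suc m))"
  unfolding bds_def by (rule submodule_image[OF D_module D_module D_bd submodule_carrier[OF D_module]])

lemma bdK_sub: "submodule (bdK m) A (M (Suc m))"
  unfolding bdK_def by (rule submodule_image[OF D_module D_module D_bd K_sub])

lemma cK_sub: "submodule (cK m) A (M (Suc m))"
  unfolding cK_def by (rule submodule_Int[OF D_module cyc_sub K_sub])

lemma bK_sub: "submodule (bK m) A (M (Suc m))"
  unfolding bK_def by (rule submodule_Int[OF D_module bds_sub K_sub])

lemma cycK_sub: "submodule (cycK m) A (M (Suc m))"
  unfolding cycK_def by (rule submodule_sum[OF D_module cyc_sub K_sub])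

lemma bdsK_sub: "submodule (bdsK m) A (M (Suc m))"
  unfolding bdsK_def by (rule submodule_sum[OF D_module bds_sub K_sub])

lemmas subs = cyc_sub pre_sub bds_sub bdK_sub cK_sub bK_sub cycK_sub bdsK_sub

lemma bds_cyc: "bds m \<subseteq> cyc m" using D_bd_bd by (auto simp: bds_def cyc_def)

lemma bdK_bK: "bdK m \<subseteq> bK m" using bd_K K_carrier by (auto simp: bdK_def bK_def bds_def)

lemma bK_cK: "bK m \<subseteq> cK m" using bds_cyc by (auto simp: bK_def cK_def)

lemma cyc_cycK: "cyc m \<subseteq> cycK m"
  unfolding cycK_def using sum_subI_left[OF D_module K_sub submodule_subset[OF cyc_sub]] by blast

lemma K_bdsK: "K (Suc m) \<subseteq> bdsK m"
  unfolding bdsK_def using sum_subI_right[OF D_module bds_sub submodule_subset[OF K_sub]] by blast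

lemma bdsK_cycK: "bdsK m \<subseteq> cycK m"
  using bds_cyc unfolding bdsK_def cycK_def sum_sub_def by blast

lemma K_pre: "K (Suc m) \<subseteq> pre m" using bd_K K_carrier by (auto simp: pre_def)

lemma cyc_pre: "cyc m \<subseteq> pre m" using submodule_zero[OF K_sub] by (auto simp: pre_def cyc_def)

lemma cycK_pre: "cycK m \<subseteq> pre m"
  using submodule_add[OF pre_sub] cyc_pre K_pre unfolding cycK_def sum_sub_def by blast

lemma bdsK_pre: "bdsK m \<subseteq> pre m" using bdsK_cycK cycK_pre by blast

text \<open>
  The kernel of the connecting homomorphism: a chain with the same boundary as some element \<open>k\<close> of
  \<open>K\<close> differs from \<open>k\<close> by a cycle.
\<close>

lemma cycK_iff:
  assumes x: "x \<in> carrier (M (Suc (Suc m)))"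
  shows "x \<in> cycK (Suc m) \<longleftrightarrow> bd (Suc (Suc m)) x \<in> bdK m"
proof
  assume "x \<in> cycK (Suc m)"
  then obtain c k where c: "x = c \<oplus>\<^bsub>M (Suc (Suc m))\<^esub> k" "c \<in> cyc (Suc m)" "k \<in> K (Suc (Suc m))"
    unfolding cycK_def sum_sub_def by blast
  have "bd (Suc (Suc m)) x = bd (Suc (Suc m)) k"
    using c K_carrier[OF c(3)] by (simp add: cyc_def bd_add)
  then show "bd (Suc (Suc m)) x \<in> bdK m" using c(3) by (simp add: bdK_def)
next
  assume "bd (Suc (Suc m)) x \<in> bdK m"
  then obtain k where k: "k \<in> K (Suc (Suc m))" "bd (Suc (Suc m)) x = bd (Suc (Suc m)) k" unfolding bdK_def by blast
  note kc = K_carrier[OF k(1)]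
  have "x \<ominus>\<^bsub>M (Suc (Suc m))\<^esub> k \<in> cyc (Suc m)"
    using x kc k(2) by (simp add: cyc_def bd_diff M.diff_zero_iff)
  moreover have "x = (x \<ominus>\<^bsub>M (Suc (Suc m))\<^esub> k) \<oplus>\<^bsub>M (Suc (Suc m))\<^esub> k"
    using x kc by (simp add: M.minus_eq M.a_assoc M.l_neg)
  ultimately show "x \<in> cycK (Suc m)" using k(1) unfolding cycK_def sum_sub_def by blast
qed

lemma K1_bdK: "K (Suc 0) \<subseteq> bdK 0"
  using kernel_1 by (fastforce simp: K_def bdK_def numeral_2_eq_2)

text \<open>
  For \<open>m < 2\<close> the target of the connecting homomorphism is the homology of \<open>K\<close> in degree \<open>0\<close> or \<open>1\<close>,
  which vanishes.
\<close>

lemma pre_cycK_low: "m < 2 \<Longrightarrow> pre m = cycK m"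
proof -
  assume "m < 2"
  then consider "m = 0" | "m = 1" by linarith
  then have "pre m \<subseteq> cycK m"
  proof cases
    case 1
    have "cyc 0 = carrier (M (Suc 0))" using bd_closed[of _ 0] by (auto simp: cyc_def D_zero simp del: bd_closed)
    then show ?thesis using 1 cyc_cycK[of 0] by (auto simp: pre_def)
  next
    case 2
    then show ?thesis using K1_bdK cycK_iff[of _ 0] by (auto simp: pre_def)
  qed
  then show ?thesis using cycK_pre by blast
qed

subsection \<open>The pages\<close>

text \<open>
  The homology of \<open>L\<close> in degree \<open>p + 1\<close> is put at \<open>(p, 1)\<close> and that of \<open>K\<close> in degree \<open>q \<ge> 2\<close> at \<open>(0, q)\<close>.
  Then the connecting homomorphism from degree \<open>r + 1\<close> to degree \<open>r\<close> goes from \<open>(r, 1)\<close> to \<open>(0, r)\<close>,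
  which is the bidegree of \<open>d\<^sup>r\<close>.  The page at \<open>(p, q)\<close> is \<open>numer / denom\<close> inside degree \<open>deg p q\<close> of \<open>D\<close>:
  after page \<open>p\<close> the numerator at \<open>(p, 1)\<close> shrinks to the kernel of this homomorphism, and after page \<open>q\<close>
  the denominator at \<open>(0, q)\<close> grows to its image.  All other spots are zero.
\<close>

definition deg :: "int \<Rightarrow> int \<Rightarrow> nat" where
  "deg p q = (if q = 1 \<and> 0 \<le> p then Suc (nat p) else if p = 0 \<and> 2 \<le> q then Suc (nat q - 1) else 0)"

definition numer :: "nat \<Rightarrow> int \<Rightarrow> int \<Rightarrow> 'm set" where
  "numer r p q = (if q = 1 \<and> 0 \<le> p then if int r \<le> p then pre (nat p) else cycK (nat p)
     else if p = 0 \<and> 2 \<le> q then cK (nat q - 1) else {\<zero>\<^bsub>M 0\<^esub>})"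

definition denom :: "nat \<Rightarrow> int \<Rightarrow> int \<Rightarrow> 'm set" where
  "denom r p q = (if q = 1 \<and> 0 \<le> p then bdsK (nat p)
     else if p = 0 \<and> 2 \<le> q then if int r \<le> q then bdK (nat q - 1) else bK (nat q - 1) else {\<zero>\<^bsub>M 0\<^esub>})"

definition E :: "nat \<Rightarrow> int \<Rightarrow> int \<Rightarrow> ('a, 'm set) module" where
  "E r p q = subquot_module (M (deg p q)) (numer r p q) (denom r p q)"

definition d :: "nat \<Rightarrow> int \<Rightarrow> int \<Rightarrow> 'm set \<Rightarrow> 'm set" where
  "d r p q = (if p = int r \<and> q = 1
     then (\<lambda>V. \<Union>x\<in>V. bdK (r - 1) +>\<^bsub>M r\<^esub> bd (Suc r) x)
     else (\<lambda>V. \<zero>\<^bsub>E r (p - int r) (q + int r - 1)\<^esub>))"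

lemma bidegree_cases [case_names line axis outside]:
  obtains "q = 1" "0 \<le> p" "deg p q = Suc (nat p)"
      "\<And>r. numer r p q = (if int r \<le> p then pre (nat p) else cycK (nat p))" "\<And>r. denom r p q = bdsK (nat p)"
  | "p = 0" "2 \<le> q" "deg p q = Suc (nat q - 1)"
      "\<And>r. numer r p q = cK (nat q - 1)" "\<And>r. denom r p q = (if int r \<le> q then bdK (nat q - 1) else bK (nat q - 1))"
  | "\<not> (q = 1 \<and> 0 \<le> p)" "\<not> (p = 0 \<and> 2 \<le> q)" "deg p q = 0" "\<And>r. numer r p q = {\<zero>\<^bsub>M 0\<^esub>}" "\<And>r. denom r p q = {\<zero>\<^bsub>M 0\<^esub>}"
  by (cases "q = 1 \<and> 0 \<le> p"; cases "p = 0 \<and> 2 \<le> q") (auto simp: deg_def numer_def denom_def)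

lemma page_subquotient: "subquotient A (M (deg p q)) (numer r p q) (denom r p q)"
proof (cases rule: bidegree_cases[where p = p and q = q])
  case line
  show ?thesis unfolding line(3-5)
    by (rule subquotientI[OF D_module _ bdsK_sub]) (use pre_sub cycK_sub bdsK_pre bdsK_cycK in auto)
next
  case axis
  show ?thesis unfolding axis(3-5)
    by (rule subquotientI[OF D_module cK_sub]) (simp_all add: bdK_sub bK_sub bK_cK subset_trans[OF bdK_bK bK_cK])
next
  case outside
  show ?thesis unfolding outside(3-5)
    by (rule subquotientI[OF D_module submodule_zero_module[OF D_module] submodule_zero_module[OF D_module] subset_refl])
qed

lemma numer_Suc: "numer (Suc r) p q \<subseteq> numer r p q" using cycK_pre by (auto simp: numer_def)
lemma denom_Suc: "denom r p q \<subseteq> denom (Suc r) p q" using bdK_bK by (auto simp: denom_def)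

lemma E_module: "module A (E r p q)"
  unfolding E_def by (rule subquotient.SQ_module[OF page_subquotient])

lemma E_outside: "\<not> (q = 1 \<and> 0 \<le> p) \<Longrightarrow> \<not> (p = 0 \<and> 2 \<le> q) \<Longrightarrow> zero_module (E r p q)"
  using subquot_zero_module[OF D_module submodule_zero_module[OF D_module], of 0]
  by (simp only: E_def numer_def denom_def deg_def if_False)

text \<open>
  The only differential on page \<open>r\<close> that is not defined to be zero is the connecting homomorphism: a
  class of \<open>L\<close> is lifted to a chain with boundary in \<open>K\<close>, and two lifts differ by a boundary plus an
  element of \<open>K\<close>, so that the boundary of the lift is well defined modulo boundaries of \<open>K\<close>.
\<close>

lemma connecting_hom:
  assumes "r = Suc (Suc j)"
  shows "d r (int r) 1 \<in> lin_maps A (E r (int r) 1) (E r 0 (int r))"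
    and "x \<in> pre r \<Longrightarrow> d r (int r) 1 (bdsK r +>\<^bsub>M (Suc r)\<^esub> x) = bdK (Suc j) +>\<^bsub>M r\<^esub> bd (Suc r) x"
proof -
  interpret s: subquotient A "M (Suc r)" "pre r" "bdsK r"
    using subs D_module bdsK_pre by (intro subquotientI) auto
  interpret t: subquotient A "M r" "cK (Suc j)" "bdK (Suc j)"
    using subs(4,5)[of "Suc j"] D_module bdK_bK bK_cK assms by (intro subquotientI) blast+
  have Es: "E r (int r) 1 = s.SQ" by (simp add: E_def deg_def numer_def denom_def)
  have Et: "E r 0 (int r) = t.SQ" using assms by (simp add: E_def deg_def numer_def denom_def nat_add_distrib)
  have prec: "x \<in> carrier (M (Suc r))" if "x \<in> pre r" for x by (rule submodule_mem[OF pre_sub that])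
  have cl: "bd (Suc r) x \<in> cK (Suc j)" if "x \<in> pre r" for x
    using that D_bd_bd[of x "Suc j"] assms by (simp add: pre_def cK_def cyc_def)
  have wd: "t.pr (bd (Suc r) y) = t.pr (bd (Suc r) x)"
    if "x \<in> pre r" "y \<in> pre r" "y \<ominus>\<^bsub>M (Suc r)\<^esub> x \<in> bdsK r" for x y
  proof (subst t.pr_eq_iff)
    have "bd (Suc r) (y \<ominus>\<^bsub>M (Suc r)\<^esub> x) \<in> bdK (Suc j)"
      using that cycK_iff[of "y \<ominus>\<^bsub>M (Suc r)\<^esub> x" "Suc j"] bdsK_cycK prec assms by auto
    then show "bd (Suc r) y \<ominus>\<^bsub>M r\<^esub> bd (Suc r) x \<in> bdK (Suc j)"
      using that prec by (simp add: bd_diff)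
  qed (use cl that in auto)
  have dd: "d r (int r) 1 = (\<lambda>V. \<Union>x\<in>V. t.pr (bd (Suc r) x))" using assms by (simp add: d_def)
  show d: "d r (int r) 1 (s.pr x) = t.pr (bd (Suc r) x)" if "x \<in> pre r" for x
    unfolding dd by (rule s.pr_UN[OF that]) (rule wd[OF that])
  show "d r (int r) 1 \<in> lin_maps A (E r (int r) 1) (E r 0 (int r))"
    unfolding Es Et
  proof (rule lin_mapsI[OF addhomI])
    fix V assume "V \<in> carrier s.SQ"
    then obtain x where x: "x \<in> pre r" "V = s.pr x" unfolding s.SQ_carrier by blast
    show "d r (int r) 1 V \<in> carrier t.SQ" unfolding x(2) d[OF x(1)] by (rule t.pr_closed[OF cl[OF x(1)]])
  next
    fix V V' assume "V \<in> carrier s.SQ" "V' \<in> carrier s.SQ"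
    then obtain x x' where x: "x \<in> pre r" "V = s.pr x" "x' \<in> pre r" "V' = s.pr x'" unfolding s.SQ_carrier by blast
    have e: "V \<oplus>\<^bsub>s.SQ\<^esub> V' = s.pr (x \<oplus>\<^bsub>M (Suc r)\<^esub> x')"
      using addhom_add[OF lin_maps_addhom[OF s.pr_lin], of x x'] x by simp
    have "d r (int r) 1 (V \<oplus>\<^bsub>s.SQ\<^esub> V') = t.pr (bd (Suc r) (x \<oplus>\<^bsub>M (Suc r)\<^esub> x'))"
      unfolding e by (rule d[OF submodule_add[OF pre_sub x(1,3)]])
    also have "\<dots> = t.pr (bd (Suc r) x) \<oplus>\<^bsub>t.SQ\<^esub> t.pr (bd (Suc r) x')"
      using addhom_add[OF lin_maps_addhom[OF t.pr_lin], of "bd (Suc r) x" "bd (Suc r) x'"] cl x(1,3) prec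
      by (simp add: bd_add)
    finally show "d r (int r) 1 (V \<oplus>\<^bsub>s.SQ\<^esub> V') = d r (int r) 1 V \<oplus>\<^bsub>t.SQ\<^esub> d r (int r) 1 V'"
      unfolding x(2,4) d[OF x(1)] d[OF x(3)] .
  next
    fix a V assume a: "a \<in> carrier A" and "V \<in> carrier s.SQ"
    then obtain x where x: "x \<in> pre r" "V = s.pr x" unfolding s.SQ_carrier by blast
    have e: "a \<odot>\<^bsub>s.SQ\<^esub> V = s.pr (a \<odot>\<^bsub>M (Suc r)\<^esub> x)"
      using lin_maps_smult[OF s.pr_lin a, of x] x by simp
    have "d r (int r) 1 (a \<odot>\<^bsub>s.SQ\<^esub> V) = t.pr (bd (Suc r) (a \<odot>\<^bsub>M (Suc r)\<^esub> x))"
      unfolding e by (rule d[OF submodule_smult[OF pre_sub a x(1)]])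
    also have "\<dots> = a \<odot>\<^bsub>t.SQ\<^esub> t.pr (bd (Suc r) x)"
      using lin_maps_smult[OF t.pr_lin a, of "bd (Suc r) x"] lin_maps_smult[OF D_bd a prec[OF x(1)]] cl x(1)
      by simp
    finally show "d r (int r) 1 (a \<odot>\<^bsub>s.SQ\<^esub> V) = a \<odot>\<^bsub>t.SQ\<^esub> d r (int r) 1 V"
      unfolding x(2) d[OF x(1)] .
  qed
qed

lemma d_const:
  "\<not> (p = int r \<and> q = 1) \<Longrightarrow> d r p q = (\<lambda>V. \<zero>\<^bsub>E r (p - int r) (q + int r - 1)\<^esub>)"
  unfolding d_def by (rule if_not_P)

lemma d_lin:
  assumes "2 \<le> r"
  shows "d r p q \<in> lin_maps A (E r p q) (E r (p - int r) (q + int r - 1))"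
proof (cases "p = int r \<and> q = 1")
  case True
  obtain j where j: "r = Suc (Suc j)" using assms by (metis add_2_eq_Suc le_Suc_ex)
  show ?thesis using connecting_hom(1)[OF j] True by simp
next
  case False
  interpret T: module A "E r (p - int r) (q + int r - 1)" by (rule E_module)
  show ?thesis unfolding d_const[OF False]
    by (rule lin_mapsI[OF addhom_const_zero[OF T.abelian_group_axioms]]) simp
qed

lemma d_d:
  assumes "2 \<le> r" "V \<in> carrier (E r (p + int r) (q - int r + 1))"
  shows "d r p q (d r (p + int r) (q - int r + 1) V) = \<zero>\<^bsub>E r (p - int r) (q + int r - 1)\<^esub>"
proof (cases "p = int r \<and> q = 1")
  case True
  then have "\<not> (p + int r = int r \<and> q - int r + 1 = 1)" using assms(1) by simp
  note dc = d_const[OF this]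
  have "d r p q \<zero>\<^bsub>E r p q\<^esub> = \<zero>\<^bsub>E r (p - int r) (q + int r - 1)\<^esub>"
    by (rule addhom_zero[OF lin_maps_addhom[OF d_lin[OF assms(1)]] module_abelian[OF E_module] module_abelian[OF E_module]])
  moreover have "d r (p + int r) (q - int r + 1) V = \<zero>\<^bsub>E r p q\<^esub>" unfolding dc by simp
  ultimately show ?thesis by simp
next
  case False
  show ?thesis unfolding d_const[OF False] ..
qed

text \<open>
  Away from \<open>(r, 1)\<close> and \<open>(0, r)\<close> the pages \<open>r\<close> and \<open>r + 1\<close> have the same numerator and denominator.
  At \<open>(r, 1)\<close> the kernel is given by \<open>cycK_iff\<close>, and at \<open>(0, r)\<close> the image consists of the classes of
  those boundaries that lie in \<open>K\<close>.
\<close>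

lemma d_kernel:
  assumes r: "2 \<le> r"
  shows "{V \<in> carrier (E r p q). d r p q V = \<zero>\<^bsub>E r (p - int r) (q + int r - 1)\<^esub>}
    = (\<lambda>x. denom r p q +>\<^bsub>M (deg p q)\<^esub> x) ` numer (Suc r) p q"
proof (cases "p = int r \<and> q = 1")
  case False
  have "numer (Suc r) p q = numer r p q"
    using False by (auto simp: numer_def)
  then show ?thesis
    using subquotient.SQ_carrier[OF page_subquotient, of p q r] unfolding d_const[OF False] E_def by simp
next
  case True
  then have pq: "p = int r" "q = 1" by auto
  obtain j where j: "r = Suc (Suc j)" using assms by (metis add_2_eq_Suc le_Suc_ex)
  interpret s: subquotient A "M (Suc r)" "pre r" "bdsK r"
    by (rule subquotientI[OF D_module pre_sub bdsK_sub bdsK_pre])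
  interpret t: subquotient A "M r" "cK (Suc j)" "bdK (Suc j)"
    unfolding j by (rule subquotientI[OF D_module cK_sub bdK_sub subset_trans[OF bdK_bK bK_cK]])
  have Es: "E r (int r) 1 = s.SQ" by (simp add: E_def deg_def numer_def denom_def)
  have Et: "E r 0 (int r) = t.SQ" using r j by (simp add: E_def deg_def numer_def denom_def nat_add_distrib)
  have k: "d r (int r) 1 (s.pr x) = \<zero>\<^bsub>t.SQ\<^esub> \<longleftrightarrow> x \<in> cycK r" if x: "x \<in> pre r" for x
  proof -
    have xc: "x \<in> carrier (M (Suc r))" by (rule submodule_mem[OF pre_sub x])
    have "bd (Suc r) x \<in> cK (Suc j)"
      using x xc D_bd_bd[of x "Suc j"] j by (simp add: pre_def cK_def cyc_def)
    then show ?thesis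
      unfolding connecting_hom(2)[OF j x] using t.pr_zero_iff cycK_iff[of x "Suc j"] xc j by simp
  qed
  have "{V \<in> s.pr ` pre r. d r (int r) 1 V = \<zero>\<^bsub>t.SQ\<^esub>} = s.pr ` cycK r"
    using k cycK_pre by blast
  then show ?thesis
    unfolding pq by (simp add: Es Et s.SQ_carrier) (simp add: deg_def numer_def denom_def)
qed

lemma d_image:
  assumes r: "2 \<le> r"
  shows "d r (p + int r) (q - int r + 1) ` carrier (E r (p + int r) (q - int r + 1))
    = (\<lambda>x. denom r p q +>\<^bsub>M (deg p q)\<^esub> x) ` denom (Suc r) p q"
proof (cases "p = 0 \<and> q = int r")
  case False
  have W: "denom (Suc r) p q = denom r p q"
    using False by (auto simp: denom_def)
  interpret s: subquotient A "M (deg p q)" "numer r p q" "denom r p q" by (rule page_subquotient)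
  have dc: "d r (p + int r) (q - int r + 1) = (\<lambda>V. \<zero>\<^bsub>E r p q\<^esub>)"
    using d_const[of "p + int r" r "q - int r + 1"] False by simp
  have "s.pr x = \<zero>\<^bsub>s.SQ\<^esub>" if "x \<in> denom r p q" for x using s.pr_zero_iff[of x] that s.WZ by auto
  then have "s.pr ` denom r p q = {\<zero>\<^bsub>s.SQ\<^esub>}" using submodule_zero[OF s.W] by force
  moreover have "carrier (E r (p + int r) (q - int r + 1)) \<noteq> {}"
    using submodule_zero[OF submodule_carrier[OF E_module]] by blast
  ultimately show ?thesis unfolding W dc by (simp add: E_def image_constant_conv)
next
  case True
  then have pq: "p = 0" "q = int r" by auto
  obtain j where j: "r = Suc (Suc j)" using assms by (metis add_2_eq_Suc le_Suc_ex)
  interpret s: subquotient A "M (Suc r)" "pre r" "bdsK r"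
    by (rule subquotientI[OF D_module pre_sub bdsK_sub bdsK_pre])
  have Es: "E r (int r) 1 = s.SQ" by (simp add: E_def deg_def numer_def denom_def)
  have bd: "bd (Suc r) ` pre r = bK (Suc j)"
    unfolding pre_def bK_def bds_def j by auto
  have "d r (int r) 1 ` s.pr ` pre r = (\<lambda>x. bdK (Suc j) +>\<^bsub>M r\<^esub> x) ` bd (Suc r) ` pre r"
    unfolding image_image by (rule image_cong[OF HOL.refl]) (rule connecting_hom(2)[OF j])
  moreover have "deg p q = r" "denom r p q = bdK (Suc j)" "denom (Suc r) p q = bK (Suc j)"
    using r unfolding pq by (simp_all add: deg_def denom_def j nat_add_distrib)
  moreover have "carrier (E r (p + int r) (q - int r + 1)) = s.pr ` pre r"
    unfolding pq using Es s.SQ_carrier by simp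
  moreover have "d r (p + int r) (q - int r + 1) = d r (int r) 1" unfolding pq by simp
  ultimately show ?thesis unfolding bd by simp
qed

lemma E_spectral_sequence: "first_quadrant_spectral_sequence A E d"
  unfolding first_quadrant_spectral_sequence_def
proof (intro allI impI conjI ballI)
  fix r :: nat and p q :: int assume r: "2 \<le> r"
  show "module A (E r p q)" by (rule E_module)
  show "zero_module (E r p q)" if "p < 0 \<or> q < 0" using that by (intro E_outside) auto
  show "d r p q \<in> lin_maps A (E r p q) (E r (p - int r) (q + int r - 1))" by (rule d_lin[OF r])
  show "d r p q (d r (p + int r) (q - int r + 1) V) = \<zero>\<^bsub>E r (p - int r) (q + int r - 1)\<^esub>"
    if "V \<in> carrier (E r (p + int r) (q - int r + 1))" for V by (rule d_d[OF r that])
  interpret s: subquotient A "M (deg p q)" "numer r p q" "denom r p q" by (rule page_subquotient)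
  interpret s': subquotient A "M (deg p q)" "numer (Suc r) p q" "denom (Suc r) p q" by (rule page_subquotient)
  have "module_iso A s'.SQ (subquot_module s.SQ (s.pr ` numer (Suc r) p q) (s.pr ` denom (Suc r) p q))"
    by (rule s.third_isomorphism[OF s'.Z numer_Suc s'.W denom_Suc s'.WZ])
  then show "module_iso A (E (r + 1) p q) (subquot_module (E r p q)
      {x \<in> carrier (E r p q). d r p q x = \<zero>\<^bsub>E r (p - int r) (q + int r - 1)\<^esub>}
      (d r (p + int r) (q - int r + 1) ` carrier (E r (p + int r) (q - int r + 1))))"
    unfolding d_kernel[OF r] d_image[OF r] by (simp add: E_def)
qed

subsection \<open>The abutment\<close>

lemma homology_0: "zero_module (homology D 0)" "module A (homology D 0)"
proof -
  have b: "bd (Suc 0) ` carrier (M (Suc 0)) = {\<zero>\<^bsub>M 0\<^esub>}"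
    using bd_closed[of _ 0] bd_zero[of 0] M.zero_closed[of "Suc 0"] unfolding D_zero by (auto simp del: bd_closed bd_zero)
  have h: "homology D 0 = subquot_module (M 0) {\<zero>\<^bsub>M 0\<^esub>} {\<zero>\<^bsub>M 0\<^esub>}"
    using b by (simp add: homology_def cycles_def D_zero)
  note z = submodule_zero_module[OF D_module, of 0]
  show "zero_module (homology D 0)" unfolding h by (rule subquot_zero_module[OF D_module z])
  show "module A (homology D 0)" unfolding h
    by (rule subquotient.SQ_module[OF subquotientI[OF D_module z z subset_refl]])
qed

lemma homology_Suc: "homology D (Suc m) = subquot_module (M (Suc m)) (cyc m) (bds m)"
  by (simp add: homology_def cycles_def cyc_def bds_def)

text \<open>
  In degree \<open>n = m + 1\<close> the filtration has two steps: the image of the homology of \<open>K\<close>, which is the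
  \<open>E\<^sup>\<infinity>\<close>-term at \<open>(0, n)\<close>, and from \<open>p = m\<close> on everything, with \<open>E\<^sup>\<infinity>\<close>-term at \<open>(m, 1)\<close>.  For \<open>m = 0\<close> the
  first step is zero, since the homology of \<open>K\<close> in degree \<open>1\<close> vanishes.
\<close>

lemma E_converges: "converges_to A E (homology D)"
  unfolding converges_to_def
proof
  fix n
  show "\<exists>\<Phi>. (\<forall>p. submodule (\<Phi> p) A (homology D n)) \<and> (\<forall>p. \<Phi> (p - 1) \<subseteq> \<Phi> p) \<and>
     (\<forall>p<0. \<Phi> p = {\<zero>\<^bsub>homology D n\<^esub>}) \<and> (\<forall>p\<ge>int n. \<Phi> p = carrier (homology D n)) \<and>
     (\<forall>p q r. 0 \<le> p \<longrightarrow> 0 \<le> q \<longrightarrow> p + q = int n \<longrightarrow> 2 \<le> r \<longrightarrow> p < int r \<longrightarrow> q + 1 < int r \<longrightarrow>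
        module_iso A (E r p q) (subquot_module (homology D n) (\<Phi> p) (\<Phi> (p - 1))))"
  proof (cases n)
    case 0
    have z: "carrier (homology D 0) = {\<zero>\<^bsub>homology D 0\<^esub>}" using homology_0(1) by (simp add: zero_module_def)
    note s = submodule_carrier[OF homology_0(2)]
    show ?thesis
    proof (rule exI[of _ "\<lambda>p. carrier (homology D n)"], intro conjI allI impI)
      fix p q :: int and r assume "0 \<le> p" "0 \<le> q" "p + q = int n"
      then have pq: "p = 0" "q = 0" using 0 by auto
      show "module_iso A (E r p q) (subquot_module (homology D n) (carrier (homology D n)) (carrier (homology D n)))"
        unfolding 0 by (rule module_iso_zero[OF E_module _ E_outside subquot_zero_module[OF homology_0(2) s]])
          (use pq subquotient.SQ_module[OF subquotientI[OF homology_0(2) s s subset_refl]] in auto)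
    qed (use 0 z s in auto)
  next
    case (Suc m)
    interpret h: subquotient A "M (Suc m)" "cyc m" "bds m"
      by (rule subquotientI[OF D_module cyc_sub bds_sub bds_cyc])
    have H: "homology D n = h.SQ" unfolding Suc by (rule homology_Suc)
    define F where "F p = (if p < 0 then {\<zero>\<^bsub>M (Suc m)\<^esub>} else if p < int m then cK m else cyc m)" for p :: int
    have F_sub: "submodule (F p) A (M (Suc m))" for p
      using cyc_sub cK_sub submodule_zero_module[OF D_module] by (simp add: F_def)
    have F_cyc: "F p \<subseteq> cyc m" for p
      using submodule_zero[OF cyc_sub] by (auto simp: F_def cK_def)
    have F_mono: "F (p - 1) \<subseteq> F p" for p
      using submodule_zero[OF cyc_sub] submodule_zero[OF cK_sub] by (auto simp: F_def cK_def)
    note Fs = h.pr_submodule[OF F_sub F_cyc]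
    show ?thesis
    proof (rule exI[of _ "\<lambda>p. h.pr ` F p"], unfold H, intro conjI allI impI)
      show "submodule (h.pr ` F p) A h.SQ" for p by (rule Fs)
      show "h.pr ` F (p - 1) \<subseteq> h.pr ` F p" for p by (rule image_mono[OF F_mono])
      show "h.pr ` F p = {\<zero>\<^bsub>h.SQ\<^esub>}" if "p < 0" for p
        using that h.pr_zero_iff[OF submodule_zero[OF cyc_sub]] submodule_zero[OF bds_sub] by (simp add: F_def)
      show "h.pr ` F p = carrier h.SQ" if "int n \<le> p" for p
        using that Suc by (simp add: F_def h.SQ_carrier)
      fix p q :: int and r assume pq: "0 \<le> p" "0 \<le> q" "p + q = int n" and r: "p < int r" "q + 1 < int r"
      have zero: "module_iso A (E r p q) (subquot_module h.SQ (h.pr ` F p) (h.pr ` F (p - 1)))"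
        if "q \<noteq> 1" "\<not> (p = 0 \<and> 2 \<le> q)" "F (p - 1) = F p"
        unfolding that(3)
        by (rule module_iso_zero[OF E_module _ E_outside subquot_zero_module[OF h.SQ_module Fs]])
          (use that subquotient.SQ_module[OF subquotientI[OF h.SQ_module Fs Fs subset_refl]] in auto)
      have FF: "subquotient A (M (Suc m)) (F p) (F (p - 1))"
        by (rule subquotientI[OF D_module F_sub F_sub F_mono])
      have dz: "z \<ominus>\<^bsub>M (Suc m)\<^esub> z = \<zero>\<^bsub>M (Suc m)\<^esub>" if "z \<in> carrier (M (Suc m))" for z
        using that by (simp add: M.minus_eq M.r_neg)
      have self: "\<exists>y\<in>Y. z \<ominus>\<^bsub>M (Suc m)\<^esub> y \<in> W" if "z \<in> Y" "submodule Y A (M (Suc m))" "submodule W A (M (Suc m))" for z Y W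
        by (rule bexI[OF _ that(1)]) (simp only: dz[OF submodule_mem[OF that(2,1)]] submodule_zero[OF that(3)])
      have minus_zero: "z \<ominus>\<^bsub>M (Suc m)\<^esub> \<zero>\<^bsub>M (Suc m)\<^esub> = z" if "z \<in> carrier (M (Suc m))" for z
        using that by (simp add: M.minus_eq)
      consider "q = 0" | "q = 1" | "2 \<le> q" "1 \<le> p" | "2 \<le> q" "p = 0" using pq by linarith
      then show "module_iso A (E r p q) (subquot_module h.SQ (h.pr ` F p) (h.pr ` F (p - 1)))"
      proof cases
        case 1
        then show ?thesis using pq Suc by (intro zero) (auto simp: F_def)
      next
        case 3
        then show ?thesis using pq Suc by (intro zero) (auto simp: F_def)
      next
        case 2
        have p: "p = int m" using 2 pq Suc by simp
        have Fp: "F p = cyc m" by (simp add: F_def p)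
        have E: "E r p q = subquot_module (M (Suc m)) (cycK m) (bdsK m)"
          using p r 2 by (simp add: E_def deg_def numer_def denom_def)
        show ?thesis unfolding E
        proof (rule h.nested_iso[OF subquotientI[OF D_module cycK_sub bdsK_sub bdsK_cycK] FF F_cyc cyc_sub cyc_cycK])
          show "cyc m \<subseteq> F p" by (simp add: Fp)
          show "\<exists>y\<in>cyc m. z \<ominus>\<^bsub>M (Suc m)\<^esub> y \<in> bdsK m" if z: "z \<in> cycK m" for z
          proof -
            obtain c k where c: "z = c \<oplus>\<^bsub>M (Suc m)\<^esub> k" "c \<in> cyc m" "k \<in> K (Suc m)"
              using z unfolding cycK_def sum_sub_def by blast
            have "z \<ominus>\<^bsub>M (Suc m)\<^esub> c = k"
              unfolding c(1) by (rule M_cancel_left[OF submodule_mem[OF cyc_sub c(2)] K_carrier[OF c(3)]])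
            then show ?thesis using c K_bdsK by (intro bexI[OF _ c(2)]) auto
          qed
          show "\<exists>y\<in>cyc m. z \<ominus>\<^bsub>M (Suc m)\<^esub> y \<in> F (p - 1)" if "z \<in> F p" for z
            using that unfolding Fp by (rule self[OF _ cyc_sub F_sub])
          show "y \<in> bdsK m \<longleftrightarrow> (\<exists>w\<in>F (p - 1). y \<ominus>\<^bsub>M (Suc m)\<^esub> w \<in> bds m)" if y: "y \<in> cyc m" for y
          proof
            note yc = submodule_mem[OF cyc_sub y]
            assume "y \<in> bdsK m"
            then obtain b k where b: "y = b \<oplus>\<^bsub>M (Suc m)\<^esub> k" "b \<in> bds m" "k \<in> K (Suc m)"
              unfolding bdsK_def sum_sub_def by blast
            note bc = submodule_mem[OF bds_sub b(2)] and kc = K_carrier[OF b(3)]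
            have yk: "y \<ominus>\<^bsub>M (Suc m)\<^esub> k = b" using bc kc unfolding b(1) by (simp add: M.minus_eq M.a_assoc M.r_neg)
            show "\<exists>w\<in>F (p - 1). y \<ominus>\<^bsub>M (Suc m)\<^esub> w \<in> bds m"
            proof (cases "m = 0")
              case True
              have "k \<in> bds m" using K1_bdK bdK_bK b(3) True by (auto simp: bK_def)
              then have "y \<in> bds m" unfolding b(1) by (rule submodule_add[OF bds_sub b(2)])
              then show ?thesis using p True minus_zero[OF yc] by (simp add: F_def)
            next
              case False
              have "y \<ominus>\<^bsub>M (Suc m)\<^esub> b = k" unfolding b(1) by (rule M_cancel_left[OF bc kc])
              then have "k \<in> cyc m" using submodule_diff[OF cyc_sub y, of b] b(2) bds_cyc by auto
              then have "k \<in> F (p - 1)" using False p b(3) by (simp add: F_def cK_def)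
              then show ?thesis using yk b(2) by blast
            qed
          next
            note yc = submodule_mem[OF cyc_sub y]
            assume "\<exists>w\<in>F (p - 1). y \<ominus>\<^bsub>M (Suc m)\<^esub> w \<in> bds m"
            then obtain w where w: "w \<in> F (p - 1)" "y \<ominus>\<^bsub>M (Suc m)\<^esub> w \<in> bds m" by blast
            have "w \<in> K (Suc m)" using w(1) submodule_zero[OF K_sub] p by (auto simp: F_def cK_def split: if_splits)
            moreover from K_carrier[OF this] have "y = (y \<ominus>\<^bsub>M (Suc m)\<^esub> w) \<oplus>\<^bsub>M (Suc m)\<^esub> w"
              using yc by (simp add: M.minus_eq M.a_assoc M.l_neg)
            ultimately show "y \<in> bdsK m" using w(2) unfolding bdsK_def sum_sub_def by blast
          qed
        qed
      next
        case 4
        have q: "q = int (Suc m)" "0 < m" using 4 pq Suc by auto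
        have Fp: "F p = cK m" "F (p - 1) = {\<zero>\<^bsub>M (Suc m)\<^esub>}" using 4 q by (auto simp: F_def)
        have E: "E r p q = subquot_module (M (Suc m)) (cK m) (bK m)"
          using q r 4 by (simp add: E_def deg_def numer_def denom_def nat_add_distrib)
        show ?thesis unfolding E
        proof (rule h.nested_iso[OF subquotientI[OF D_module cK_sub bK_sub bK_cK] FF F_cyc cK_sub subset_refl])
          show "cK m \<subseteq> F p" by (simp add: Fp)
          show "\<exists>y\<in>cK m. z \<ominus>\<^bsub>M (Suc m)\<^esub> y \<in> bK m" if "z \<in> cK m" for z
            by (rule self[OF that cK_sub bK_sub])
          show "\<exists>y\<in>cK m. z \<ominus>\<^bsub>M (Suc m)\<^esub> y \<in> F (p - 1)" if "z \<in> F p" for z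
            using that unfolding Fp(1) by (rule self[OF _ cK_sub F_sub])
          show "y \<in> bK m \<longleftrightarrow> (\<exists>w\<in>F (p - 1). y \<ominus>\<^bsub>M (Suc m)\<^esub> w \<in> bds m)" if y: "y \<in> cK m" for y
            using y minus_zero[OF submodule_mem[OF cK_sub y]] unfolding Fp(2) by (auto simp: bK_def cK_def)
        qed
      qed
    qed
  qed
qed

lemma E2_bottom_row: "zero_module (E 2 p 0)"
  by (rule E_outside) auto

text \<open>
  On page \<open>2\<close> the numerator at \<open>(p, 1)\<close> is \<open>pre p\<close>, by \<open>pre_cycK_low\<close> also for \<open>p < 2\<close>, and both sides are
  the quotient of \<open>pre p\<close> by \<open>bdsK p\<close>.
\<close>

lemma E2_first_row: "module_iso A (E 2 (int p) 1) (homology L (p + 1))"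
proof -
  interpret s: subquotient A "M (Suc p)" "pre p" "bdsK p"
    by (rule subquotientI[OF D_module pre_sub bdsK_sub bdsK_pre])
  let ?Z = "{z \<in> carrier (obj L (Suc p)). boundary L (Suc p) z = \<zero>\<^bsub>obj L p\<^esub>}"
  let ?W = "boundary L (Suc (Suc p)) ` carrier (obj L (Suc (Suc p)))"
  have gs: "\<exists>x\<in>carrier (M n). z = g n x" if "z \<in> carrier (obj L n)" for n z
    using that unfolding g_surj[symmetric] by blast
  interpret t: subquotient A "obj L (Suc p)" ?Z ?W
  proof (rule subquotientI[OF L_module _ submodule_image[OF L_module L_module L_bd submodule_carrier[OF L_module]]])
    show "submodule ?Z A (obj L (Suc p))"
      using submodule_vimage[OF L_module L_module L_bd submodule_zero_module[OF L_module]] by simp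
    show "?W \<subseteq> ?Z"
    proof
      fix w assume "w \<in> ?W"
      then obtain z where z: "w = boundary L (Suc (Suc p)) z" "z \<in> carrier (obj L (Suc (Suc p)))" by blast
      then obtain x where x: "x \<in> carrier (M (Suc (Suc p)))" "z = g (Suc (Suc p)) x" using gs by blast
      have w: "w = g (Suc p) (bd (Suc (Suc p)) x)" unfolding z(1) x(2) by (rule g_bd[OF x(1), symmetric])
      show "w \<in> ?Z" unfolding w using x(1) by (simp add: g_bd[symmetric] D_bd_bd)
    qed
  qed
  have E: "E 2 (int p) 1 = s.SQ"
    using pre_cycK_low[of p] by (auto simp: E_def deg_def numer_def denom_def)
  have H: "homology L (p + 1) = t.SQ" by (simp add: homology_def cycles_def)
  have prec: "x \<in> carrier (M (Suc p))" if "x \<in> pre p" for x by (rule submodule_mem[OF pre_sub that])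
  have gz: "g (Suc p) x \<in> ?Z" if "x \<in> pre p" for x
    using that by (simp add: pre_def K_def g_bd[symmetric])
  show ?thesis unfolding E H
  proof (rule module_iso_same_kernel[where Y = s.MZ and u = s.pr and v = "\<lambda>x. t.pr (g (Suc p) x)"])
    show "s.pr ` carrier s.MZ = carrier s.SQ" by (simp add: s.SQ_carrier)
    show "(\<lambda>x. t.pr (g (Suc p) x)) \<in> lin_maps A s.MZ t.SQ"
    proof (rule lin_mapsI[OF addhomI])
      fix x y assume "x \<in> carrier s.MZ" "y \<in> carrier s.MZ"
      then have xy: "x \<in> pre p" "y \<in> pre p" by auto
      show "t.pr (g (Suc p) (x \<oplus>\<^bsub>s.MZ\<^esub> y)) = t.pr (g (Suc p) x) \<oplus>\<^bsub>t.SQ\<^esub> t.pr (g (Suc p) y)"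
        using addhom_add[OF lin_maps_addhom[OF t.pr_lin], of "g (Suc p) x" "g (Suc p) y"] gz[OF xy(1)] gz[OF xy(2)]
          addhom_add[OF g_hom prec[OF xy(1)] prec[OF xy(2)]] by simp
    next
      fix a x assume a: "a \<in> carrier A" and "x \<in> carrier s.MZ"
      then have x: "x \<in> pre p" by auto
      show "t.pr (g (Suc p) (a \<odot>\<^bsub>s.MZ\<^esub> x)) = a \<odot>\<^bsub>t.SQ\<^esub> t.pr (g (Suc p) x)"
        using lin_maps_smult[OF t.pr_lin a, of "g (Suc p) x"] gz[OF x] lin_maps_smult[OF g_lin a prec[OF x]] by simp
    qed (use t.pr_closed gz in auto)
    show "(\<lambda>x. t.pr (g (Suc p) x)) ` carrier s.MZ = carrier t.SQ"
    proof -
      have "z \<in> g (Suc p) ` pre p" if z: "z \<in> ?Z" for z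
      proof -
        obtain x where x: "x \<in> carrier (M (Suc p))" "z = g (Suc p) x" using gs z by blast
        have "x \<in> pre p" using z x by (simp add: pre_def K_def g_bd)
        then show ?thesis using x(2) by blast
      qed
      then have "g (Suc p) ` pre p = ?Z" using gz by blast
      then show ?thesis unfolding t.SQ_carrier by (simp add: image_image[symmetric, of t.pr "g (Suc p)"])
    qed
    show "s.pr x = \<zero>\<^bsub>s.SQ\<^esub> \<longleftrightarrow> t.pr (g (Suc p) x) = \<zero>\<^bsub>t.SQ\<^esub>" if "x \<in> carrier s.MZ" for x
    proof -
      have x: "x \<in> pre p" using that by simp
      have "x \<in> bdsK p \<longleftrightarrow> g (Suc p) x \<in> ?W"
      proof
        assume "x \<in> bdsK p"
        then obtain y k where y: "x = bd (Suc (Suc p)) y \<oplus>\<^bsub>M (Suc p)\<^esub> k" "y \<in> carrier (M (Suc (Suc p)))" "k \<in> K (Suc p)"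
          unfolding bdsK_def sum_sub_def bds_def by blast
        have "g (Suc p) x = boundary L (Suc (Suc p)) (g (Suc (Suc p)) y)"
          using y K_carrier[OF y(3)] addhom_add[OF g_hom, of "bd (Suc (Suc p)) y" "Suc p" k]
          addhom_closed[OF lin_maps_addhom[OF L_bd], of "g (Suc (Suc p)) y"] by (simp add: g_bd K_def)
        then show "g (Suc p) x \<in> ?W" using y(2) by simp
      next
        assume "g (Suc p) x \<in> ?W"
        then obtain z where z: "g (Suc p) x = boundary L (Suc (Suc p)) z" "z \<in> carrier (obj L (Suc (Suc p)))" by blast
        then obtain y where y: "y \<in> carrier (M (Suc (Suc p)))" "z = g (Suc (Suc p)) y" using gs by blast
        have "x \<ominus>\<^bsub>M (Suc p)\<^esub> bd (Suc (Suc p)) y \<in> K (Suc p)"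
          using y z prec[OF x] addhom_closed[OF lin_maps_addhom[OF L_bd], of "g (Suc (Suc p)) y"]
          by (simp add: K_def g_diff g_bd LL.minus_eq LL.r_neg)
        moreover have "x = bd (Suc (Suc p)) y \<oplus>\<^bsub>M (Suc p)\<^esub> (x \<ominus>\<^bsub>M (Suc p)\<^esub> bd (Suc (Suc p)) y)"
          using y prec[OF x] by (simp add: M.minus_eq M.a_ac M.r_neg1 M.r_neg)
        ultimately show "x \<in> bdsK p" using y(1) unfolding bdsK_def sum_sub_def bds_def by blast
      qed
      then show ?thesis using s.pr_zero_iff[OF x] t.pr_zero_iff[OF gz[OF x]] by simp
    qed
  qed (use s.MZ_module s.SQ_module t.SQ_module s.pr_lin in auto)
qed

theorem spectral_sequence:
  "\<exists>(E :: nat \<Rightarrow> int \<Rightarrow> int \<Rightarrow> ('a, 'm set) module) d.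
    first_quadrant_spectral_sequence A E d \<and> converges_to A E (homology D) \<and>
    (\<forall>p. zero_module (E 2 p 0)) \<and> (\<forall>p. module_iso A (E 2 (int p) 1) (homology L (p + 1)))"
  using E_spectral_sequence E_converges E2_bottom_row E2_first_row by blast

end

section \<open>The chain complex of a simplicial module\<close>

lemma addhom_finsum:
  assumes "h \<in> addhom M N" "abelian_group M" "abelian_group N" "finite S" "f \<in> S \<rightarrow> carrier M"
  shows "h (finsum M f S) = finsum N (\<lambda>i. h (f i)) S"
  using assms(4,5)
proof (induction S)
  case empty
  interpret M: abelian_group M by fact
  interpret N: abelian_group N by fact
  show ?case using addhom_zero[OF assms(1-3)] by simp
next
  case (insert i S)
  interpret M: abelian_group M by fact
  interpret N: abelian_group N by fact
  have f: "f \<in> S \<rightarrow> carrier M" "f i \<in> carrier M" using insert by auto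
  then have "(\<lambda>i. h (f i)) \<in> S \<rightarrow> carrier N" "h (f i) \<in> carrier N" using addhom_closed[OF assms(1)] by auto
  then show ?case
    using insert.IH[OF f(1)] insert(1,2) f M.finsum_closed[OF f(1)] addhom_add[OF assms(1) f(2)]
    by (simp add: M.finsum_insert N.finsum_insert)
qed

lemma (in abelian_group) finsum_zero_eqI: "(\<And>x. x \<in> S \<Longrightarrow> f x = \<zero>) \<Longrightarrow> finsum G f S = \<zero>"
  using add.finprod_one_eqI[of S f] by (simp add: finsum_def)

abbreviation alt :: "('m, 'z) ring_scheme \<Rightarrow> nat \<Rightarrow> 'm \<Rightarrow> 'm" where
  "alt M i y \<equiv> (if even i then y else \<ominus>\<^bsub>M\<^esub> y)"

lemma addhom_alt:
  "h \<in> addhom M N \<Longrightarrow> abelian_group M \<Longrightarrow> abelian_group N \<Longrightarrow> y \<in> carrier M \<Longrightarrow> h (alt M i y) = alt N i (h y)"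
  using addhom_neg[of h M N y] by simp

text \<open>The part of the structure of a simplicial module on which its chain complex depends.\<close>

locale face_module =
  fixes A :: "('a, 'z) ring_scheme" and M :: "('a, 'm) smodule"
  assumes obj_module: "module A (obj M n)"
    and face_lin: "i \<le> Suc n \<Longrightarrow> face M (Suc n) i \<in> lin_maps A (obj M (Suc n)) (obj M n)"
    and face_face: "i < j \<Longrightarrow> j \<le> Suc (Suc n) \<Longrightarrow> x \<in> carrier (obj M (Suc (Suc n))) \<Longrightarrow>
      face M (Suc n) i (face M (Suc (Suc n)) j x) = face M (Suc n) (j - 1) (face M (Suc (Suc n)) i x)"
begin

sublocale O: module A "obj M n" for n by (rule obj_module)

lemma face_closed: "i \<le> Suc n \<Longrightarrow> x \<in> carrier (obj M (Suc n)) \<Longrightarrow> face M (Suc n) i x \<in> carrier (obj M n)"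
  by (rule addhom_closed[OF lin_maps_addhom[OF face_lin]])

lemma boundary_eq: "boundary M (Suc n) x = finsum (obj M n) (\<lambda>i. alt (obj M n) i (face M (Suc n) i x)) {..Suc n}"
  unfolding boundary_def diff_Suc_1 ..

lemma terms_closed: "x \<in> carrier (obj M (Suc n)) \<Longrightarrow>
    (\<lambda>i. alt (obj M n) i (face M (Suc n) i x)) \<in> {..Suc n} \<rightarrow> carrier (obj M n)"
  using face_closed by (auto simp: Pi_def)

lemma boundary_lin: "boundary M (Suc n) \<in> lin_maps A (obj M (Suc n)) (obj M n)"
proof (rule lin_mapsI[OF addhomI])
  show "boundary M (Suc n) x \<in> carrier (obj M n)" if "x \<in> carrier (obj M (Suc n))" for x
    unfolding boundary_eq by (rule O.finsum_closed[OF terms_closed[OF that]])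
  show "boundary M (Suc n) (x \<oplus>\<^bsub>obj M (Suc n)\<^esub> y) = boundary M (Suc n) x \<oplus>\<^bsub>obj M n\<^esub> boundary M (Suc n) y"
    if x: "x \<in> carrier (obj M (Suc n))" and y: "y \<in> carrier (obj M (Suc n))" for x y
    unfolding boundary_eq O.finsum_addf[OF terms_closed[OF x] terms_closed[OF y], symmetric]
  proof (rule O.finsum_cong')
    fix i assume i: "i \<in> {..Suc n}"
    then show "alt (obj M n) i (face M (Suc n) i (x \<oplus>\<^bsub>obj M (Suc n)\<^esub> y)) =
        alt (obj M n) i (face M (Suc n) i x) \<oplus>\<^bsub>obj M n\<^esub> alt (obj M n) i (face M (Suc n) i y)"
      using addhom_add[OF lin_maps_addhom[OF face_lin] x y] face_closed x y by (simp add: O.minus_add)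
  qed (use terms_closed[OF x] terms_closed[OF y] O.a_closed in \<open>auto simp: Pi_def simp del: O.minus_add\<close>)
  show "boundary M (Suc n) (a \<odot>\<^bsub>obj M (Suc n)\<^esub> x) = a \<odot>\<^bsub>obj M n\<^esub> boundary M (Suc n) x"
    if a: "a \<in> carrier A" and x: "x \<in> carrier (obj M (Suc n))" for a x
    unfolding boundary_eq O.finsum_smult_ldistr[OF finite_atMost a terms_closed[OF x]]
  proof (rule O.finsum_cong')
    fix i assume i: "i \<in> {..Suc n}"
    then show "alt (obj M n) i (face M (Suc n) i (a \<odot>\<^bsub>obj M (Suc n)\<^esub> x)) = a \<odot>\<^bsub>obj M n\<^esub> alt (obj M n) i (face M (Suc n) i x)"
      using lin_maps_smult[OF face_lin a x] face_closed x a by (simp add: O.smult_r_minus)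
  qed (use terms_closed[OF x] O.smult_closed[OF a] in \<open>auto simp: Pi_def\<close>)
qed

text \<open>
  The double sum splits into the terms with \<open>i < j\<close> and those with \<open>j \<le> i\<close>; the face identity
  matches \<open>(i, j)\<close> of the first kind with \<open>(j - 1, i)\<close> of the second, with the opposite sign.
\<close>

lemma boundary_boundary:
  assumes x: "x \<in> carrier (obj M (Suc (Suc n)))"
  shows "boundary M (Suc n) (boundary M (Suc (Suc n)) x) = \<zero>\<^bsub>obj M n\<^esub>"
proof -
  let ?M = "obj M n" and ?N = "obj M (Suc n)"
  define w where "w i j = face M (Suc n) i (face M (Suc (Suc n)) j x)" for i j
  define f where "f = (\<lambda>(i, j). alt ?M i (alt ?M j (w i j)))"
  have w: "w i j \<in> carrier ?M" if "i \<le> Suc n" "j \<le> Suc (Suc n)" for i j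
    unfolding w_def using that by (intro face_closed x)
  have fc: "f (i, j) \<in> carrier ?M" if "i \<le> Suc n" "j \<le> Suc (Suc n)" for i j
    using w[OF that] by (simp add: f_def)
  let ?row = "\<lambda>i. Pair i ` {..Suc (Suc n)}"
  let ?lt = "{(i, j). i < j \<and> j \<le> Suc (Suc n)}" and ?ge = "{(i, j). j \<le> i \<and> i \<le> Suc n}"
  define \<sigma> where "\<sigma> = (\<lambda>(i :: nat, j :: nat). (j - 1, i))"
  have fin: "finite ?lt" by (rule finite_subset[of _ "{..Suc (Suc n)} \<times> {..Suc (Suc n)}"]) auto
  have \<sigma>: "?ge = \<sigma> ` ?lt"
  proof
    show "?ge \<subseteq> \<sigma> ` ?lt"
    proof clarify
      fix i j assume "j \<le> i" "i \<le> Suc n"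
      then have "(i, j) = \<sigma> (j, Suc i)" "(j, Suc i) \<in> ?lt" by (auto simp: \<sigma>_def)
      then show "(i, j) \<in> \<sigma> ` ?lt" by (rule image_eqI)
    qed
    show "\<sigma> ` ?lt \<subseteq> ?ge" by (auto simp: \<sigma>_def)
  qed
  have finge: "finite ?ge" unfolding \<sigma> by (rule finite_imageI[OF fin])
  have disj: "?lt \<inter> ?ge = {}" by auto
  have flt: "f \<in> ?lt \<rightarrow> carrier ?M" by (auto intro!: fc)
  have fge: "f \<in> ?ge \<rightarrow> carrier ?M" by (auto intro!: fc)
  have f\<sigma>: "(\<lambda>p. f (\<sigma> p)) \<in> ?lt \<rightarrow> carrier ?M" using fge unfolding \<sigma> by blast
  have inj: "inj_on \<sigma> ?lt" by (auto simp: \<sigma>_def inj_on_def)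
  have "boundary M (Suc n) (boundary M (Suc (Suc n)) x)
      = finsum ?M (\<lambda>i. finsum ?M (\<lambda>j. f (i, j)) {..Suc (Suc n)}) {..Suc n}"
    unfolding boundary_eq[of n]
  proof (rule O.finsum_cong')
    fix i assume i: "i \<in> {..Suc n}"
    then have h: "face M (Suc n) i \<in> addhom ?N ?M" using lin_maps_addhom[OF face_lin] by simp
    have "face M (Suc n) i (boundary M (Suc (Suc n)) x)
        = finsum ?M (\<lambda>j. face M (Suc n) i (alt ?N j (face M (Suc (Suc n)) j x))) {..Suc (Suc n)}"
      unfolding boundary_eq[of "Suc n"]
      by (rule addhom_finsum[OF h O.abelian_group_axioms O.abelian_group_axioms finite_atMost terms_closed[OF x]])
    also have "\<dots> = finsum ?M (\<lambda>j. alt ?M j (w i j)) {..Suc (Suc n)}"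
      by (rule O.finsum_cong')
        (use i w in \<open>auto simp: Pi_def w_def addhom_alt[OF h O.abelian_group_axioms O.abelian_group_axioms] face_closed x\<close>)
    finally have e: "face M (Suc n) i (boundary M (Suc (Suc n)) x) = finsum ?M (\<lambda>j. alt ?M j (w i j)) {..Suc (Suc n)}" .
    have "(\<lambda>z. alt ?M i z) \<in> addhom ?M ?M" by (rule addhomI) (auto simp: O.minus_add)
    from addhom_finsum[OF this O.abelian_group_axioms O.abelian_group_axioms finite_atMost, of "\<lambda>j. alt ?M j (w i j)" "Suc (Suc n)"]
    show "alt ?M i (face M (Suc n) i (boundary M (Suc (Suc n)) x)) = finsum ?M (\<lambda>j. f (i, j)) {..Suc (Suc n)}"
      unfolding e f_def using i w by (auto simp: Pi_def)
  qed (auto intro!: O.finsum_closed fc)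
  also have "\<dots> = finsum ?M (\<lambda>i. finsum ?M f (?row i)) {..Suc n}"
  proof (rule O.finsum_cong')
    show "finsum ?M (\<lambda>j. f (i, j)) {..Suc (Suc n)} = finsum ?M f (?row i)" if "i \<in> {..Suc n}" for i
      by (rule O.finsum_reindex[symmetric]) (use that fc in \<open>auto simp: inj_on_def\<close>)
  qed (use fc in \<open>auto intro!: O.finsum_closed\<close>)
  also have "\<dots> = finsum ?M f (\<Union> (?row ` {..Suc n}))"
    by (rule O.add.finprod_UN_disjoint[symmetric]) (use fc in \<open>auto simp: disjoint_family_on_def pairwise_def disjnt_def\<close>)
  also have "\<Union> (?row ` {..Suc n}) = ?lt \<union> ?ge" by (auto simp: image_iff)
  also have "finsum ?M f (?lt \<union> ?ge) = finsum ?M f ?lt \<oplus>\<^bsub>?M\<^esub> finsum ?M f ?ge"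
    by (rule O.finsum_Un_disjoint[OF fin finge disj flt fge])
  also have "finsum ?M f ?ge = finsum ?M (\<lambda>p. f (\<sigma> p)) ?lt"
    unfolding \<sigma> by (rule O.finsum_reindex[OF fge[unfolded \<sigma>] inj])
  also have "finsum ?M f ?lt \<oplus>\<^bsub>?M\<^esub> finsum ?M (\<lambda>p. f (\<sigma> p)) ?lt = finsum ?M (\<lambda>p. f p \<oplus>\<^bsub>?M\<^esub> f (\<sigma> p)) ?lt"
    by (rule O.finsum_addf[OF flt f\<sigma>, symmetric])
  also have "\<dots> = \<zero>\<^bsub>?M\<^esub>"
  proof (rule O.finsum_zero_eqI)
    fix p assume "p \<in> ?lt"
    then obtain i j where p: "p = (i, Suc j)" "i \<le> j" "j \<le> Suc n" by (cases p; cases "snd p") auto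
    have "w i (Suc j) = w j i" using face_face[of i "Suc j" n x] p x by (simp add: w_def)
    then show "f p \<oplus>\<^bsub>?M\<^esub> f (\<sigma> p) = \<zero>\<^bsub>?M\<^esub>"
      using w[of j i] p by (auto simp: f_def \<sigma>_def O.r_neg O.l_neg)
  qed
  finally show ?thesis .
qed

end

lemma boundary_natural:
  assumes "face_module A M" "face_module A N"
    and h: "h n \<in> lin_maps A (obj M n) (obj N n)"
    and nat: "\<And>i. i \<le> Suc n \<Longrightarrow> h n (face M (Suc n) i x) = face N (Suc n) i (h (Suc n) x)"
    and x: "x \<in> carrier (obj M (Suc n))" "h (Suc n) x \<in> carrier (obj N (Suc n))"
  shows "h n (boundary M (Suc n) x) = boundary N (Suc n) (h (Suc n) x)"
proof -
  interpret M: face_module A M by fact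
  interpret N: face_module A N by fact
  note hh = lin_maps_addhom[OF h]
  have "h n (boundary M (Suc n) x) = finsum (obj N n) (\<lambda>i. h n (alt (obj M n) i (face M (Suc n) i x))) {..Suc n}"
    unfolding M.boundary_eq
    by (rule addhom_finsum[OF hh M.O.abelian_group_axioms N.O.abelian_group_axioms finite_atMost M.terms_closed[OF x(1)]])
  also have "\<dots> = boundary N (Suc n) (h (Suc n) x)"
    unfolding N.boundary_eq
    by (rule N.O.finsum_cong')
      (use N.terms_closed[OF x(2)] in \<open>auto simp: addhom_alt[OF hh M.O.abelian_group_axioms N.O.abelian_group_axioms] M.face_closed x nat\<close>)
  finally show ?thesis .
qed

section \<open>The complexes of a resolution\<close>

lemma (in abelian_group) finsum_atMost_2:
  assumes "f 0 \<in> carrier G" "f 1 \<in> carrier G" "f 2 \<in> carrier G"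
  shows "finsum G f {..2::nat} = f 0 \<oplus> (f 1 \<oplus> f 2)"
proof -
  have "{..2::nat} = {0, 1, 2}" by auto
  then show ?thesis using assms by (simp add: finsum_insert finsum_empty)
qed

lemma (in log_factorization) I_hom_eq:
  assumes f: "f \<in> addhom (RB F) L" and g: "g \<in> addhom (RB F) L" and L: "abelian_group L" and z: "z \<in> Iset"
    and eq: "\<And>b r. b \<in> carrier B \<Longrightarrow> r \<in> carrier R \<Longrightarrow> f (gI b r) = g (gI b r)"
  shows "f z = g z"
  using z
proof (induction rule: I_induct)
  case zero
  show ?case by (simp only: addhom_zero[OF f RB.abelian_group_axioms L] addhom_zero[OF g RB.abelian_group_axioms L])
next
  case (gen r b)
  then show ?case using eq by blast
next
  case (diff y z)
  then have yz: "y \<in> carrier (RB F)" "z \<in> carrier (RB F)" by auto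
  show ?case
    by (simp only: addhom_diff[OF f RB.abelian_group_axioms L yz] addhom_diff[OF g RB.abelian_group_axioms L yz] diff)
qed

lemma (in log_factorization) I_mult: "a \<in> Iset \<Longrightarrow> b \<in> Iset \<Longrightarrow> a \<otimes>\<^bsub>RB F\<^esub> b \<in> Iset"
  by simp

lemma (in log_factorization) RB_is_cring: "cring (RB F)" by (rule RB.is_cring)

lemma (in log_factorization) dI_const: "c \<in> carrier C \<Longrightarrow> b \<in> carrier B \<Longrightarrow> dI b (e c) = \<zero>\<^bsub>DB\<^esub>"
  by (simp only: dI_def gI_const D1_class_zero)

lemma (in log_factorization) D1_class_I_closed: "i \<in> Iset \<Longrightarrow> D1_class F i \<zero>\<^bsub>BT_mod F\<^esub> \<in> carrier DB"
  using addhom_closed[OF D1_class_I_hom] by simp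

lemma (in log_morphism) D1_map_class_I:
  "i \<in> S.Iset \<Longrightarrow> D1_map F' k (D1_class F i \<zero>\<^bsub>BT_mod F\<^esub>) = D1_class F' (RB_map F' k i) \<zero>\<^bsub>BT_mod F'\<^esub>"
  using D1_map_class[of i "\<zero>\<^bsub>BT_mod F\<^esub>"] addhom_zero[OF BT_map_hom S.BTm.M.abelian_group_axioms T.BTm.M.abelian_group_axioms]
  by simp

locale resolution =
  fixes A :: "('c, 'q) prelog" and B :: "('b, 'n) prelog" and \<phi> and S :: "('r, 'p) sprelog" and \<eta> \<epsilon>
  assumes A: "prelog_ring A" and B: "prelog_ring B" and res: "log_resolution A B \<phi> S \<eta> \<epsilon>"
begin

abbreviation "F \<equiv> degreewise A B S \<eta> \<epsilon>"
abbreviation "DC \<equiv> D1_over_B A B S \<eta> \<epsilon>"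
abbreviation "LC \<equiv> log_cotangent A B S \<eta> \<epsilon>"
abbreviation "DB n \<equiv> restrict_scalars (RB_tensor (F n) \<one>\<^bsub>ring_of (obj S n)\<^esub>) (D1_mod (F n))"
abbreviation "dI n \<equiv> log_factorization.dI (F n)"
abbreviation "dT n \<equiv> log_factorization.dT (F n)"
abbreviation "gI n \<equiv> log_factorization.gI (F n)"
abbreviation "g n \<equiv> log_factorization.D1_to_L (F n)"

lemma F_simps [simp]: "source (F n) = A" "middle (F n) = obj S n" "target (F n) = B" "incl (F n) = \<eta> n" "proj (F n) = \<epsilon> n"
  by (simp_all add: degreewise_def)

lemma S: "simplicial_prelog_ring S" and eta: "simplicial_prelog_hom (const_sprelog A) S \<eta>"
  and eps: "simplicial_prelog_hom S (const_sprelog B) \<epsilon>"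
  using res by (simp_all add: log_resolution_def)

lemma degree: "log_factorization (F n)"
  using A B S eta eps
  by (simp add: log_factorization_def simplicial_prelog_ring_def simplicial_prelog_hom_def const_sprelog_def)

text \<open>
  Naturality of \<open>\<eta>\<close> and \<open>\<epsilon>\<close>.  No face or degeneracy map appears on the constant sides \<open>(C,Q)\<close> and
  \<open>(B,N)\<close>.
\<close>

lemma eta_face:
  assumes "i \<le> Suc n"
  shows "c \<in> carrier (ring_of A) \<Longrightarrow> fst (face S (Suc n) i) (fst (\<eta> (Suc n)) c) = fst (\<eta> n) c"
    "q \<in> carrier (monoid_of A) \<Longrightarrow> snd (face S (Suc n) i) (snd (\<eta> (Suc n)) q) = snd (\<eta> n) q"
  using eta assms
  by (force simp: simplicial_prelog_hom_def simplicial_map_def ring_sset_def monoid_sset_def const_sprelog_def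
      dest: spec[of _ "Suc n"])+

lemma eta_degen:
  assumes "i \<le> n"
  shows "c \<in> carrier (ring_of A) \<Longrightarrow> fst (degen S n i) (fst (\<eta> n) c) = fst (\<eta> (Suc n)) c"
    "q \<in> carrier (monoid_of A) \<Longrightarrow> snd (degen S n i) (snd (\<eta> n) q) = snd (\<eta> (Suc n)) q"
  using eta assms
  by (auto simp: simplicial_prelog_hom_def simplicial_map_def ring_sset_def monoid_sset_def const_sprelog_def)

lemma eps_face:
  assumes "i \<le> Suc n"
  shows "r \<in> carrier (ring_of (obj S (Suc n))) \<Longrightarrow> fst (\<epsilon> n) (fst (face S (Suc n) i) r) = fst (\<epsilon> (Suc n)) r"
    "p \<in> carrier (monoid_of (obj S (Suc n))) \<Longrightarrow> snd (\<epsilon> n) (snd (face S (Suc n) i) p) = snd (\<epsilon> (Suc n)) p"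
  using eps assms
  by (force simp: simplicial_prelog_hom_def simplicial_map_def ring_sset_def monoid_sset_def const_sprelog_def
      dest: spec[of _ "Suc n"])+

lemma eps_degen:
  assumes "i \<le> n"
  shows "r \<in> carrier (ring_of (obj S n)) \<Longrightarrow> fst (\<epsilon> (Suc n)) (fst (degen S n i) r) = fst (\<epsilon> n) r"
    "p \<in> carrier (monoid_of (obj S n)) \<Longrightarrow> snd (\<epsilon> (Suc n)) (snd (degen S n i) p) = snd (\<epsilon> n) p"
  using eps assms
  by (auto simp: simplicial_prelog_hom_def simplicial_map_def ring_sset_def monoid_sset_def const_sprelog_def)

lemma face_hom: "i \<le> Suc n \<Longrightarrow> face S (Suc n) i \<in> prelog_hom (obj S (Suc n)) (obj S n)"
  using S by (force simp: simplicial_prelog_ring_def dest: spec[of _ "Suc n"])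

lemma degen_hom: "i \<le> n \<Longrightarrow> degen S n i \<in> prelog_hom (obj S n) (obj S (Suc n))"
  using S by (simp add: simplicial_prelog_ring_def)

lemma face_morphism: "i \<le> Suc n \<Longrightarrow> log_morphism (F (Suc n)) (F n) (face S (Suc n) i)"
  by (intro log_morphism.intro log_morphism_axioms.intro degree) (simp_all add: face_hom eta_face eps_face)

lemma degen_morphism: "i \<le> n \<Longrightarrow> log_morphism (F n) (F (Suc n)) (degen S n i)"
  by (intro log_morphism.intro log_morphism_axioms.intro degree) (simp_all add: degen_hom eta_degen eps_degen)

lemma simplicial: "simplicial_set (ring_sset S)" "simplicial_set (monoid_sset S)"
  using S by (simp_all add: simplicial_prelog_ring_def)

lemma face_face_S:
  assumes "i < j" "j \<le> Suc (Suc n)"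
  shows "r \<in> carrier (ring_of (obj S (Suc (Suc n)))) \<Longrightarrow>
      fst (face S (Suc n) i) (fst (face S (Suc (Suc n)) j) r) = fst (face S (Suc n) (j - 1)) (fst (face S (Suc (Suc n)) i) r)"
    "p \<in> carrier (monoid_of (obj S (Suc (Suc n)))) \<Longrightarrow>
      snd (face S (Suc n) i) (snd (face S (Suc (Suc n)) j) p) = snd (face S (Suc n) (j - 1)) (snd (face S (Suc (Suc n)) i) p)"
proof -
  have face_face: "face V (Suc n) i (face V (Suc (Suc n)) j x) = face V (Suc n) (j - 1) (face V (Suc (Suc n)) i x)"
    if "simplicial_set V" "x \<in> obj V (Suc (Suc n))" for V :: "'x sset" and x
  proof -
    have "\<forall>n\<ge>2. \<forall>j\<le>n. \<forall>i<j. \<forall>x\<in>obj V n.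
        face V (n - 1) i (face V n j x) = face V (n - 1) (j - 1) (face V n i x)"
      using that(1) by (simp add: simplicial_set_def)
    from this[rule_format, of "Suc (Suc n)" j i x] show ?thesis using assms that(2) by simp
  qed
  show "r \<in> carrier (ring_of (obj S (Suc (Suc n)))) \<Longrightarrow>
      fst (face S (Suc n) i) (fst (face S (Suc (Suc n)) j) r) = fst (face S (Suc n) (j - 1)) (fst (face S (Suc (Suc n)) i) r)"
    using face_face[OF simplicial(1), of r] by (simp add: ring_sset_def)
  show "p \<in> carrier (monoid_of (obj S (Suc (Suc n)))) \<Longrightarrow>
      snd (face S (Suc n) i) (snd (face S (Suc (Suc n)) j) p) = snd (face S (Suc n) (j - 1)) (snd (face S (Suc (Suc n)) i) p)"
    using face_face[OF simplicial(2), of p] by (simp add: monoid_sset_def)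
qed

lemma obj_DC: "obj DC n = DB n" by (simp add: D1_over_B_def D1_def)
lemma face_DC: "face DC (Suc n) i = D1_map (F n) (face S (Suc n) i)" by (simp add: D1_over_B_def D1_def)
lemma obj_LC: "obj LC n = L_mod (F n)" by (simp add: log_cotangent_def)
lemma face_LC: "face LC (Suc n) i = L_map (F n) (face S (Suc n) i)" by (simp add: log_cotangent_def)

lemmas DB_module = log_factorization.DB_module[OF degree, simplified F_simps]
lemmas DB_hom_eq = log_factorization.DB_hom_eq[OF degree, simplified F_simps]
lemmas g_lin = log_factorization.D1_to_L_lin[OF degree, simplified F_simps]
lemmas g_surj = log_factorization.D1_to_L_surj[OF degree, simplified F_simps]
lemmas L_module = log_factorization.L_module[OF degree, simplified F_simps]

lemmas face_D_lin = log_morphism.D1_map_lin[OF face_morphism, simplified F_simps]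
lemmas face_L_lin = log_morphism.L_map_lin[OF face_morphism, simplified F_simps]
lemmas face_dI = log_morphism.D1_map_dI[OF face_morphism, simplified F_simps]
lemmas face_dT = log_morphism.D1_map_dT[OF face_morphism, simplified F_simps]
lemmas face_natural = log_morphism.D1_to_L_natural[OF face_morphism, simplified F_simps]

lemma face_S_closed:
  "i \<le> Suc n \<Longrightarrow> r \<in> carrier (ring_of (obj S (Suc n))) \<Longrightarrow> fst (face S (Suc n) i) r \<in> carrier (ring_of (obj S n))"
  "i \<le> Suc n \<Longrightarrow> p \<in> carrier (monoid_of (obj S (Suc n))) \<Longrightarrow> snd (face S (Suc n) i) p \<in> carrier (monoid_of (obj S n))"
  using face_hom[of i n] by (auto simp: prelog_hom_def ring_hom_def monoid_hom_def hom_def split: prod.splits)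

lemma degen_S_closed:
  "i \<le> n \<Longrightarrow> r \<in> carrier (ring_of (obj S n)) \<Longrightarrow> fst (degen S n i) r \<in> carrier (ring_of (obj S (Suc n)))"
  using degen_hom[of i n] by (auto simp: prelog_hom_def ring_hom_def split: prod.splits)

lemma face_module_D: "face_module (ring_of B) DC"
proof (rule face_module.intro)
  show "module (ring_of B) (obj DC n)" for n unfolding obj_DC by (rule DB_module)
  show "face DC (Suc n) i \<in> lin_maps (ring_of B) (obj DC (Suc n)) (obj DC n)" if "i \<le> Suc n" for i n
    unfolding obj_DC face_DC by (rule face_D_lin[OF that])
  fix i j n x assume ij: "i < j" "j \<le> Suc (Suc n)" and x: "x \<in> carrier (obj DC (Suc (Suc n)))"
  have le: "i \<le> Suc (Suc n)" "i \<le> Suc n" "j - 1 \<le> Suc n" using ij by auto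
  note h = lin_maps_addhom[OF face_D_lin]
  show "face DC (Suc n) i (face DC (Suc (Suc n)) j x) = face DC (Suc n) (j - 1) (face DC (Suc (Suc n)) i x)"
    unfolding face_DC
  proof (rule DB_hom_eq[OF addhom_comp[OF h[OF ij(2)] h[OF le(2)]] addhom_comp[OF h[OF le(1)] h[OF le(3)]] module_abelian[OF DB_module]])
    show "x \<in> carrier (DB (Suc (Suc n)))" using x by (simp only: obj_DC)
  qed (simp_all only: face_dI face_dT face_S_closed face_face_S[OF ij] ij(2) le)
qed

text \<open>
  For \<open>D\<^sup>1\<close> the face identities hold on generators; they pass to the cotangent complex because the
  comparison map is surjective and commutes with the faces.
\<close>

lemma face_module_L: "face_module (ring_of B) LC"
proof (rule face_module.intro)
  show "module (ring_of B) (obj LC n)" for n unfolding obj_LC by (rule L_module)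
  show "face LC (Suc n) i \<in> lin_maps (ring_of B) (obj LC (Suc n)) (obj LC n)" if "i \<le> Suc n" for i n
    unfolding obj_LC face_LC by (rule face_L_lin[OF that])
  fix i j n x assume ij: "i < j" "j \<le> Suc (Suc n)" and x: "x \<in> carrier (obj LC (Suc (Suc n)))"
  have le: "i \<le> Suc (Suc n)" "i \<le> Suc n" "j - 1 \<le> Suc n" using ij by auto
  have "x \<in> g (Suc (Suc n)) ` carrier (DB (Suc (Suc n)))" using x by (simp only: obj_LC g_surj)
  then obtain y where y: "y \<in> carrier (DB (Suc (Suc n)))" "x = g (Suc (Suc n)) y" by blast
  have eq: "face LC (Suc n) a (face LC (Suc (Suc n)) b x) = g n (face DC (Suc n) a (face DC (Suc (Suc n)) b y))"
    if "a \<le> Suc n" "b \<le> Suc (Suc n)" for a b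
    unfolding face_LC face_DC y(2) face_natural[OF that(2) y(1), symmetric]
    by (rule face_natural[OF that(1) addhom_closed[OF lin_maps_addhom[OF face_D_lin[OF that(2)]] y(1)], symmetric])
  show "face LC (Suc n) i (face LC (Suc (Suc n)) j x) = face LC (Suc n) (j - 1) (face LC (Suc (Suc n)) i x)"
    unfolding eq[OF le(2) ij(2)] eq[OF le(3) le(1)]
    using face_module.face_face[OF face_module_D ij, of y] y(1) by (simp only: obj_DC)
qed

lemmas dI_const = log_factorization.dI_const[OF degree, simplified F_simps]
lemmas dT_eQ = log_factorization.dT_eQ[OF degree, simplified F_simps]
lemmas D1_induct [consumes 1, case_names zero I T diff] = log_factorization.D1_induct[OF degree, simplified F_simps]

lemma eta_0_surj:
  "r \<in> carrier (ring_of (obj S 0)) \<Longrightarrow> \<exists>c\<in>carrier (ring_of A). r = fst (\<eta> 0) c"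
  "p \<in> carrier (monoid_of (obj S 0)) \<Longrightarrow> \<exists>q\<in>carrier (monoid_of A). p = snd (\<eta> 0) q"
  using res by (auto simp: log_resolution_def bij_betw_def image_iff)

text \<open>
  In degree \<open>0\<close> every element of \<open>R\<close> and \<open>P\<close> comes from \<open>C\<close> and \<open>Q\<close>, and on those the generators
  of \<open>D\<^sup>1\<close> vanish.
\<close>

lemma D_zero: "carrier (DB 0) = {\<zero>\<^bsub>DB 0\<^esub>}"
proof -
  interpret D0: module "ring_of B" "DB 0" by (rule DB_module)
  have "x = \<zero>\<^bsub>DB 0\<^esub>" if "x \<in> carrier (DB 0)" for x
    using that
  proof (induction rule: D1_induct)
    case (I b r)
    then obtain c where c: "c \<in> carrier (ring_of A)" "r = fst (\<eta> 0) c" using eta_0_surj(1) by blast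
    show ?case unfolding c(2) by (rule dI_const[OF c(1) I(1)])
  next
    case (T b p)
    then obtain q where q: "q \<in> carrier (monoid_of A)" "p = snd (\<eta> 0) q" using eta_0_surj(2) by blast
    show ?case unfolding q(2) by (rule dT_eQ[OF T(1) q(1)])
  next
    case (diff x y)
    show ?case unfolding diff(3,4) using D0.r_neg[OF D0.zero_closed] unfolding D0.minus_eq .
  qed simp
  then show ?thesis using D0.zero_closed by blast
qed

abbreviation "IS n \<equiv> {z \<in> carrier (RB (F n)). RB_proj (F n) z = \<zero>\<^bsub>ring_of B\<^esub>}"
abbreviation "RBd n i \<equiv> RB_map (F n) (face S (Suc n) i)"
abbreviation "RBs n i \<equiv> RB_map (F (Suc n)) (degen S n i)"

lemmas I_hom_eq = log_factorization.I_hom_eq[OF degree, simplified F_simps]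
lemmas I_mult = log_factorization.I_mult[OF degree, simplified F_simps]
lemmas D1_class_I_closed = log_factorization.D1_class_I_closed[OF degree, simplified F_simps]
lemmas D1_class_zero = log_factorization.D1_class_zero[OF degree, simplified F_simps]
lemmas D1_to_L_product = log_factorization.D1_to_L_product[OF degree, simplified F_simps]
lemmas RBd_hom = log_morphism.RB_map_hom[OF face_morphism, simplified F_simps]
lemmas RBs_hom = log_morphism.RB_map_hom[OF degen_morphism, simplified F_simps]
lemmas RBd_gI = log_morphism.RB_map_gI[OF face_morphism, simplified F_simps]
lemmas RBs_gI = log_morphism.RB_map_gI[OF degen_morphism, simplified F_simps]
lemmas RBd_mult = log_morphism.RB_map_mult[OF face_morphism, simplified F_simps]

lemmas RB_cring = log_factorization.RB_is_cring[OF degree, simplified F_simps]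

lemma RBs_closed: "i \<le> n \<Longrightarrow> z \<in> IS n \<Longrightarrow> RBs n i z \<in> IS (Suc n)"
  using log_morphism.RB_map_proj[OF degen_morphism, of i n z] addhom_closed[OF RBs_hom, of i n z] by simp

lemma face_degen_1:
  assumes r: "r \<in> carrier (ring_of (obj S 1))"
  shows "i = j \<or> i = Suc j \<Longrightarrow> j \<le> 1 \<Longrightarrow> fst (face S 2 i) (fst (degen S 1 j) r) = r"
    and "fst (face S 2 2) (fst (degen S 1 0) r) = fst (degen S 0 0) (fst (face S 1 1) r)"
    and "fst (face S 2 0) (fst (degen S 1 1) r) = fst (degen S 0 0) (fst (face S 1 0) r)"
proof -
  have "\<forall>n. \<forall>j\<le>n. \<forall>i\<le>n + 1. \<forall>x\<in>obj (ring_sset S) n.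
        face (ring_sset S) (n + 1) i (degen (ring_sset S) n j x) =
          (if i < j then degen (ring_sset S) (n - 1) (j - 1) (face (ring_sset S) n i x)
           else if i \<le> j + 1 then x
           else degen (ring_sset S) (n - 1) j (face (ring_sset S) n (i - 1) x))"
    using simplicial(1) by (simp add: simplicial_set_def)
  from this[rule_format, of _ 1 _ r]
  have *: "fst (face S 2 i) (fst (degen S 1 j) r) =
      (if i < j then fst (degen S 0 (j - 1)) (fst (face S 1 i) r) else if i \<le> j + 1 then r
       else fst (degen S 0 j) (fst (face S 1 (i - 1)) r))" if "j \<le> 1" "i \<le> 2" for i j
    using that r by (simp add: ring_sset_def numeral_2_eq_2)
  show "i = j \<or> i = Suc j \<Longrightarrow> j \<le> 1 \<Longrightarrow> fst (face S 2 i) (fst (degen S 1 j) r) = r" using *[of j i] by auto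
  show "fst (face S 2 2) (fst (degen S 1 0) r) = fst (degen S 0 0) (fst (face S 1 1) r)" using *[of 0 2] by simp
  show "fst (face S 2 0) (fst (degen S 1 1) r) = fst (degen S 0 0) (fst (face S 1 0) r)" using *[of 1 0] by simp
qed

lemma RB_face_degen_id:
  assumes ij: "i = j \<or> i = Suc j" "j \<le> 1" and z: "z \<in> IS 1"
  shows "RBd 1 i (RBs 1 j z) = z"
proof (rule I_hom_eq[of "\<lambda>z. RBd 1 i (RBs 1 j z)" 1 "RB (F 1)" "\<lambda>z. z", OF addhom_comp[OF RBs_hom[OF ij(2)] RBd_hom] _ _ z])
  have i: "i \<le> Suc 1" using ij by auto
  then show "i \<le> Suc 1" .
  show "(\<lambda>z. z) \<in> addhom (RB (F 1)) (RB (F 1))"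
    using ring.ring_simprules(1)[OF cring.axioms(1)[OF RB_cring]] by (intro addhomI) simp_all
  show "abelian_group (RB (F 1))" by (rule cring.axioms(1)[OF RB_cring, THEN ring.axioms(1)])
  fix b r assume b: "b \<in> carrier (ring_of B)" and r: "r \<in> carrier (ring_of (obj S 1))"
  show "RBd 1 i (RBs 1 j (gI 1 b r)) = gI 1 b r"
    unfolding RBs_gI[OF ij(2) r b] RBd_gI[OF i degen_S_closed[OF ij(2) r] b]
    using face_degen_1(1)[OF r ij] by (simp add: numeral_2_eq_2)
qed

text \<open>
  Here \<open>d\<^sub>2 s\<^sub>0\<close> and \<open>d\<^sub>0 s\<^sub>1\<close> factor through degree \<open>0\<close>, where \<open>R\<close> is \<open>C\<close>, and \<open>gI\<close> vanishes on elements
  that come from \<open>C\<close>.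
\<close>

lemma RB_face_degen_zero:
  assumes ij: "i = 2 \<and> j = 0 \<or> i = 0 \<and> j = 1" and z: "z \<in> IS 1"
  shows "RBd 1 i (RBs 1 j z) = \<zero>\<^bsub>RB (F 1)\<^esub>"
proof -
  have i: "i \<le> Suc 1" and j: "j \<le> 1" using ij by auto
  have ab: "abelian_group (RB (F 1))" by (rule cring.axioms(1)[OF RB_cring, THEN ring.axioms(1)])
  show ?thesis
  proof (rule I_hom_eq[of "\<lambda>z. RBd 1 i (RBs 1 j z)" 1 "RB (F 1)" "\<lambda>z. \<zero>\<^bsub>RB (F 1)\<^esub>",
        OF addhom_comp[OF RBs_hom[OF j] RBd_hom[OF i]] addhom_const_zero[OF ab] ab z])
    fix b r assume b: "b \<in> carrier (ring_of B)" and r: "r \<in> carrier (ring_of (obj S 1))"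
    obtain k where k: "k \<le> Suc 0" "fst (face S 2 i) (fst (degen S 1 j) r) = fst (degen S 0 0) (fst (face S 1 k) r)"
      using ij face_degen_1(2,3)[OF r] by auto
    have "fst (face S 1 k) r \<in> carrier (ring_of (obj S 0))" using face_S_closed(1)[of k 0 r] k(1) r by simp
    then obtain c where c: "c \<in> carrier (ring_of A)" "fst (face S 1 k) r = fst (\<eta> 0) c" using eta_0_surj(1) by blast
    have e: "fst (face S 2 i) (fst (degen S 1 j) r) = fst (\<eta> 1) c"
      unfolding k(2) c(2) using eta_degen(1)[OF _ c(1), of 0 0] by simp
    have "RBd 1 i (RBs 1 j (gI 1 b r)) = gI 1 b (fst (\<eta> 1) c)"
      unfolding RBs_gI[OF j r b] RBd_gI[OF i degen_S_closed[OF j r] b] using e by (simp add: numeral_2_eq_2)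
    then show "RBd 1 i (RBs 1 j (gI 1 b r)) = \<zero>\<^bsub>RB (F 1)\<^esub>"
      using log_factorization.gI_const[OF degree, of c 1 b] c(1) b by simp
  qed
qed

lemmas face_class = log_morphism.D1_map_class_I[OF face_morphism, simplified F_simps]

text \<open>
  The faces of the product \<open>s\<^sub>0 a \<cdot> s\<^sub>1 b\<close> in degree \<open>2\<close> are \<open>d\<^sub>1 = a b\<close> and \<open>d\<^sub>0 = d\<^sub>2 = 0\<close>.  So, up to sign, every
  product in degree \<open>1\<close> is the boundary of a product in degree \<open>2\<close>.
\<close>

lemma product_boundary:
  assumes a: "a \<in> IS 1" and b: "b \<in> IS 1"
  shows "\<exists>y\<in>carrier (DB 2). g 2 y = \<zero>\<^bsub>L_mod (F 2)\<^esub> \<and>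
    boundary DC 2 y = \<ominus>\<^bsub>DB 1\<^esub> D1_class (F 1) (a \<otimes>\<^bsub>RB (F 1)\<^esub> b) \<zero>\<^bsub>BT_mod (F 1)\<^esub>"
proof -
  interpret D: face_module "ring_of B" DC by (rule face_module_D)
  interpret D1: module "ring_of B" "DB 1" by (rule DB_module)
  have two: "(2::nat) = Suc 1" by simp
  let ?a = "RBs 1 0 a" and ?b = "RBs 1 1 b"
  let ?y = "?a \<otimes>\<^bsub>RB (F 2)\<^esub> ?b"
  let ?Y = "D1_class (F 2) ?y \<zero>\<^bsub>BT_mod (F 2)\<^esub>"
  have ab: "?a \<in> IS 2" "?b \<in> IS 2" unfolding two using a b by (auto intro!: RBs_closed[of _ 1, simplified])
  have y: "?y \<in> IS 2" by (rule I_mult[OF ab])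
  have Y: "?Y \<in> carrier (DB 2)" by (rule D1_class_I_closed[OF y])
  have gY: "g 2 ?Y = \<zero>\<^bsub>L_mod (F 2)\<^esub>" by (rule D1_to_L_product[OF ab])
  have RBd: "RBd 1 i ?y = RBd 1 i ?a \<otimes>\<^bsub>RB (F 1)\<^esub> RBd 1 i ?b" if "i \<le> 2" for i
    using RBd_mult[of i 1 ?a ?b] that ab by (simp add: numeral_2_eq_2)
  have abc: "a \<in> carrier (RB (F 1))" "b \<in> carrier (RB (F 1))" using a b by auto
  let ?P = "D1_class (F 1) (a \<otimes>\<^bsub>RB (F 1)\<^esub> b) \<zero>\<^bsub>BT_mod (F 1)\<^esub>"
  have P: "?P \<in> carrier (DB 1)" by (rule D1_class_I_closed[OF I_mult[OF a b]])
  interpret R1: cring "RB (F 1)" by (rule RB_cring)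
  have d: "face DC 2 i ?Y = D1_class (F 1) (RBd 1 i ?y) \<zero>\<^bsub>BT_mod (F 1)\<^esub>" if "i \<le> 2" for i
    using face_class[of i 1 ?y] y that unfolding two face_DC by simp
  have d0: "face DC 2 0 ?Y = \<zero>\<^bsub>DB 1\<^esub>"
    using d[of 0] RBd[of 0] RB_face_degen_zero[OF _ b, of 0 1] RB_face_degen_id[OF _ _ a, of 0 0] R1.r_null[OF abc(1)] R1.l_null[OF abc(2)] D1_class_zero[of 1] by simp
  have d1: "face DC 2 1 ?Y = ?P"
    using d[of 1] RBd[of 1] RB_face_degen_id[OF _ _ a, of 1 0] RB_face_degen_id[OF _ _ b, of 1 1] by simp
  have d2: "face DC 2 2 ?Y = \<zero>\<^bsub>DB 1\<^esub>"
    using d[of 2] RBd[of 2] RB_face_degen_zero[OF _ a, of 2 0] RB_face_degen_id[OF _ _ b, of 2 1] R1.r_null[OF abc(1)] R1.l_null[OF abc(2)] D1_class_zero[of 1] by simp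
  have "boundary DC 2 ?Y = \<ominus>\<^bsub>DB 1\<^esub> ?P"
  proof -
    let ?f = "\<lambda>i. alt (DB 1) i (face DC 2 i ?Y)"
    have f: "?f 0 = \<zero>\<^bsub>DB 1\<^esub>" "?f 1 = \<ominus>\<^bsub>DB 1\<^esub> ?P" "?f 2 = \<zero>\<^bsub>DB 1\<^esub>"
      using d0 d1 d2 by simp_all
    have "boundary DC 2 ?Y = finsum (DB 1) ?f {..2}"
    proof -
      have one: "(2::nat) - 1 = 1" by simp
      show ?thesis unfolding boundary_def one obj_DC ..
    qed
    also have "\<dots> = ?f 0 \<oplus>\<^bsub>DB 1\<^esub> (?f 1 \<oplus>\<^bsub>DB 1\<^esub> ?f 2)"
      by (rule D1.finsum_atMost_2) (simp_all only: f D1.zero_closed D1.a_inv_closed[OF P])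
    also have "\<dots> = \<ominus>\<^bsub>DB 1\<^esub> ?P"
      by (simp only: f D1.l_zero D1.r_zero D1.zero_closed D1.a_inv_closed[OF P])
    finally show ?thesis .
  qed
  then show ?thesis using Y gY by blast
qed

text \<open>
  The boundaries of elements of the kernel in degree \<open>2\<close> form a submodule which, by
  \<open>product_boundary\<close>, contains all products; so it contains the kernel in degree \<open>1\<close>.
\<close>

lemma kernel_1:
  assumes x: "x \<in> carrier (DB 1)" "g 1 x = \<zero>\<^bsub>L_mod (F 1)\<^esub>"
  shows "\<exists>y\<in>carrier (DB 2). g 2 y = \<zero>\<^bsub>L_mod (F 2)\<^esub> \<and> boundary DC 2 y = x"
proof -
  let ?K = "{y \<in> carrier (DB 2). g 2 y \<in> {\<zero>\<^bsub>L_mod (F 2)\<^esub>}}"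
  let ?W = "boundary DC 2 ` ?K"
  have lin: "boundary DC 2 \<in> lin_maps (ring_of B) (DB 2) (DB 1)"
    using face_module.boundary_lin[OF face_module_D, of 1] unfolding obj_DC by (simp add: numeral_2_eq_2)
  have W: "submodule ?W (ring_of B) (DB 1)"
    by (rule submodule_image[OF DB_module DB_module lin
          submodule_vimage[OF DB_module L_module g_lin submodule_zero_module[OF L_module]]])
  have "x \<in> ?W"
  proof (rule log_factorization.D1_to_L_kernel[OF degree, of _ 1, simplified F_simps, OF W _ x])
    interpret D1: module "ring_of B" "DB 1" by (rule DB_module)
    fix a b assume ab: "a \<in> IS 1" "b \<in> IS 1"
    let ?P = "D1_class (F 1) (a \<otimes>\<^bsub>RB (F 1)\<^esub> b) \<zero>\<^bsub>BT_mod (F 1)\<^esub>"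
    obtain y where y: "y \<in> ?K" "boundary DC 2 y = \<ominus>\<^bsub>DB 1\<^esub> ?P" using product_boundary[OF ab] by blast
    have P: "?P \<in> carrier (DB 1)" by (rule D1_class_I_closed[OF I_mult[OF ab]])
    have m: "\<ominus>\<^bsub>DB 1\<^esub> ?P \<in> ?W" using y by (metis (no_types, lifting) image_eqI)
    have "?P = \<zero>\<^bsub>DB 1\<^esub> \<ominus>\<^bsub>DB 1\<^esub> (\<ominus>\<^bsub>DB 1\<^esub> ?P)" using P by (simp only: D1.minus_eq D1.minus_minus D1.l_zero)
    also have "\<dots> \<in> ?W" by (rule submodule_diff[OF W submodule_zero[OF W] m])
    finally show "?P \<in> ?W" .
  qed
  then show ?thesis by blast
qed

lemma chain_surjection: "chain_surjection (ring_of B) DC LC g"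
proof (rule chain_surjection.intro)
  interpret D: face_module "ring_of B" DC by (rule face_module_D)
  interpret L: face_module "ring_of B" LC by (rule face_module_L)
  show "module (ring_of B) (obj DC n)" "module (ring_of B) (obj LC n)" for n by (rule D.obj_module L.obj_module)+
  show "boundary DC (Suc n) \<in> lin_maps (ring_of B) (obj DC (Suc n)) (obj DC n)" for n by (rule D.boundary_lin)
  show "boundary LC (Suc n) \<in> lin_maps (ring_of B) (obj LC (Suc n)) (obj LC n)" for n by (rule L.boundary_lin)
  show "boundary DC (Suc n) (boundary DC (Suc (Suc n)) x) = \<zero>\<^bsub>obj DC n\<^esub>" if "x \<in> carrier (obj DC (Suc (Suc n)))" for n x
    using that by (rule D.boundary_boundary)
  show gl: "g n \<in> lin_maps (ring_of B) (obj DC n) (obj LC n)" for n unfolding obj_DC obj_LC by (rule g_lin)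
  show "g n ` carrier (obj DC n) = carrier (obj LC n)" for n unfolding obj_DC obj_LC by (rule g_surj)
  show "g n (boundary DC (Suc n) x) = boundary LC (Suc n) (g (Suc n) x)" if x: "x \<in> carrier (obj DC (Suc n))" for n x
  proof (rule boundary_natural[OF face_module_D face_module_L gl _ x addhom_closed[OF lin_maps_addhom[OF gl] x]])
    show "g n (face DC (Suc n) i x) = face LC (Suc n) i (g (Suc n) x)" if "i \<le> Suc n" for i
      using face_natural[OF that, of x] x unfolding obj_DC face_DC face_LC .
  qed
  show "carrier (obj DC 0) = {\<zero>\<^bsub>obj DC 0\<^esub>}" unfolding obj_DC by (rule D_zero)
  show "\<exists>y\<in>carrier (obj DC 2). g 2 y = \<zero>\<^bsub>obj LC 2\<^esub> \<and> boundary DC 2 y = x"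
    if "x \<in> carrier (obj DC 1)" "g 1 x = \<zero>\<^bsub>obj LC 1\<^esub>" for x
    using that unfolding obj_DC obj_LC by (rule kernel_1)
qed

end

theorem theorem2p4:
  fixes A :: "('c, 'q) prelog"
    and B :: "('b, 'n) prelog"
    and \<phi> :: "('c, 'q, 'b, 'n) prelog_map"
    and S :: "('r, 'p) sprelog"
    and \<eta> :: "nat \<Rightarrow> ('c, 'q, 'r, 'p) prelog_map"
    and \<epsilon> :: "nat \<Rightarrow> ('r, 'p, 'b, 'n) prelog_map"
  assumes "prelog_ring A"
    and "prelog_ring B"
    and "\<phi> \<in> prelog_hom A B"
    and "fst \<phi> ` carrier (ring_of A) = carrier (ring_of B)"
    and "snd \<phi> ` carrier (monoid_of A) = carrier (monoid_of B)"
    and "log_resolution A B \<phi> S \<eta> \<epsilon>"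
  shows "\<exists>(E :: nat \<Rightarrow> int \<Rightarrow> int \<Rightarrow> ('b, ('r, 'p, 'b, 'n) D1_elem set) module) d.
    first_quadrant_spectral_sequence (ring_of B) E d \<and>
    converges_to (ring_of B) E (homology (D1_over_B A B S \<eta> \<epsilon>)) \<and>
    (\<forall>p. zero_module (E 2 p 0)) \<and>
    (\<forall>p :: nat. module_iso (ring_of B) (E 2 (int p) 1) (homology (log_cotangent A B S \<eta> \<epsilon>) (p + 1)))"
proof -
  have "resolution A B \<phi> S \<eta> \<epsilon>" by (rule resolution.intro[OF assms(1,2,6)])
  from chain_surjection.spectral_sequence[OF resolution.chain_surjection[OF this]] show ?thesis .
qed

end
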